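(* Fix integers $m\geq3$ and $1\leq\ell\leq m-1$, and suppose $a\in\mathbb R^{m-1}$. Then all but finitely many eigenvalues of $H_{\ell,P}$ are real and positive. Consequently $\Re\left(d_{\ell,j}(a)\right)=0$ for all $1\leq j\leq\frac{m+2}{2}$.
   Context: For $a=(a_1,\dots,a_{m-1})$ let $P(z)=a_1z^{m-1}+\cdots+a_{m-1}z$. $H_{\ell,P}$ denotes the eigenvalue problem $-u''(z)+[(-1)^{\ell}(iz)^m-P(iz)]u(z)=\lambda u(z)$, $z\in\mathbb C$, with the boundary condition that $u(z)\to0$ exponentially as $z\to\infty$ along each of the rays $\arg z=-\frac{\pi}{2}\pm\frac{(\ell+1)\pi}{m+2}$; $\lambda\in\mathbb C$ is an eigenvalue if a nonconstant such $u$ exists. Multi-index notation: $\alpha\in(\mathbb N\cup\{0\})^{m-1}$, $\beta=(1,\dots,m-1)$, $|\alpha|=\sum\alpha_i$, $\alpha!=\prod\alpha_i!$, $a^\alpha=\prod a_i^{\alpha_i}$, $\alpha\cdot\beta=\sum i\alpha_i$; ${x\choose k}$ is the generalized binomial coefficient. For $1\leq k\leq j\leq\frac{m+2}{2}$, $b_{j,k}(a)={\frac12\choose k}\sum_{|\alpha|=k,\,\alpha\cdot\beta=j}\frac{k!}{\alpha!}a^\alpha$. $K_{m,j,k}=-\frac2m$ if $j=k=1$; $K_{m,j,k}=-\frac{2k-1}{m+2-2j}B\left(k-\frac{j-1}{m},\frac12+\frac{j-1}{m}\right)$ if $1\leq k\leq j\leq\frac{m+1}{2}$, $j\neq1$ ($B$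 the beta function); $K_{m,j,k}=\frac2m\left(\ln2-\frac11-\frac13-\cdots-\frac1{2k-3}\right)$ if $m$ is even and $1\leq k\leq j=\frac{m+2}{2}$ (empty sum for $k=1$). $\eta_{m,\ell}(a)=(-1)^{\frac{\ell-1}{2}}\frac{4\pi i}{m}\sum_{k=1}^{\frac{m+2}{2}}b_{\frac{m+2}{2},k}(a)$ if $m$ is even and $\ell$ odd, and $0$ otherwise. For $1\leq j\leq\frac{m+1}{2}$, $d_{\ell,j}(a)=-4i\sum_{k=1}^j(-1)^{(\ell+1)k}K_{m,j,k}b_{j,k}(a)\sin\left(\frac{(j-1)\ell\pi}{m}\right)\cos\left(\frac{(j-1)\pi}{m}\right)$; for $j=\frac{m+2}{2}$ ($m$ even), $d_{\ell,j}(a)=\eta_{m,\ell}(a)$. *)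

theory Defs
  imports "HOL-Complex_Analysis.Complex_Analysis"
begin

definition polyP :: "nat \<Rightarrow> (nat \<Rightarrow> real) \<Rightarrow> complex \<Rightarrow> complex" where
  "polyP m a z = (\<Sum>i=1..m-1. complex_of_real (a i) * z ^ (m - i))"

definition decays_on_ray :: "(complex \<Rightarrow> complex) \<Rightarrow> real \<Rightarrow> bool" where
  "decays_on_ray u \<theta> \<longleftrightarrow>
     (\<exists>c>0. \<exists>C. \<forall>r\<ge>0. norm (u (complex_of_real r * cis \<theta>)) \<le> C * exp (- c * r))"

definition is_eigenvalue :: "nat \<Rightarrow> nat \<Rightarrow> (nat \<Rightarrow> real) \<Rightarrow> complex \<Rightarrow> bool" where
  "is_eigenvalue m l a lam \<longleftrightarrow>
     (\<exists>u. u holomorphic_on UNIV \<and> \<not> (\<exists>c. \<forall>z. u z = c) \<and>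
        (\<forall>z. - deriv (deriv u) z
              + ((-1) ^ l * (\<i> * z) ^ m - polyP m a (\<i> * z)) * u z = lam * u z) \<and>
        decays_on_ray u (- pi / 2 + (real l + 1) * pi / (real m + 2)) \<and>
        decays_on_ray u (- pi / 2 - (real l + 1) * pi / (real m + 2)))"

definition multi_idx :: "nat \<Rightarrow> nat \<Rightarrow> nat \<Rightarrow> (nat \<Rightarrow> nat) set" where
  "multi_idx m j k = {\<alpha>. \<alpha> \<in> PiE {1..m-1} (\<lambda>_. {..k}) \<and>
      (\<Sum>i=1..m-1. \<alpha> i) = k \<and> (\<Sum>i=1..m-1. i * \<alpha> i) = j}"

definition b_coef :: "nat \<Rightarrow> (nat \<Rightarrow> real) \<Rightarrow> nat \<Rightarrow> nat \<Rightarrow> real" where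
  "b_coef m a j k = ((1/2::real) gchoose k) *
     (\<Sum>\<alpha>\<in>multi_idx m j k.
        fact k / (\<Prod>i=1..m-1. fact (\<alpha> i)) * (\<Prod>i=1..m-1. a i ^ \<alpha> i))"

definition K_coef :: "nat \<Rightarrow> nat \<Rightarrow> nat \<Rightarrow> real" where
  "K_coef m j k =
    (if j = 1 \<and> k = 1 then - 2 / real m
     else if 1 \<le> k \<and> k \<le> j \<and> 2 * j \<le> m + 1 \<and> j \<noteq> 1 then
       - (2 * real k - 1) / (real m + 2 - 2 * real j) *
         Beta (real k - (real j - 1) / real m) (1/2 + (real j - 1) / real m)
     else if even m \<and> 1 \<le> k \<and> k \<le> j \<and> 2 * j = m + 2 then
       2 / real m * (ln 2 - (\<Sum>i=1..k-1. 1 / (2 * real i - 1)))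
     else 0)"

definition eta :: "nat \<Rightarrow> nat \<Rightarrow> (nat \<Rightarrow> real) \<Rightarrow> complex" where
  "eta m l a =
    (if even m \<and> odd l then
       (-1) ^ ((l - 1) div 2) * (4 * pi * \<i> / real m) *
         (\<Sum>k=1..(m+2) div 2. complex_of_real (b_coef m a ((m+2) div 2) k))
     else 0)"

definition d_coef :: "nat \<Rightarrow> nat \<Rightarrow> (nat \<Rightarrow> real) \<Rightarrow> nat \<Rightarrow> complex" where
  "d_coef m l a j =
    (if 1 \<le> j \<and> 2 * j \<le> m + 1 then
       - 4 * \<i> * (\<Sum>k=1..j. (-1) ^ ((l + 1) * k) * complex_of_real (K_coef m j k)
             * complex_of_real (b_coef m a j k)
             * complex_of_real (sin ((real j - 1) * real l * pi / real m))
             * complex_of_real (cos ((real j - 1) * pi / real m)))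
     else if even m \<and> 2 * j = m + 2 then eta m l a
     else 0)"

end

theory Submission
  imports Defs "HOL-Real_Asymp.Real_Asymp"
begin

text \<open>After the rotation \<open>z = cis (- pi/2 - t) * y\<close> the equation becomes \<open>V'' = (p + \<lambda>) V\<close> with \<open>p\<close> monic of degree \<open>m\<close>,
  and the eigenvalues become the zeros of \<open>D = W 0 (l + 1)\<close>, where \<open>W j k\<close> is the Wronskian of the
  solutions \<open>F j\<close>, \<open>F k\<close> that are subdominant in the Stokes sectors around the rays \<open>arg y = j \<tau>, k \<tau>\<close>, \<open>\<tau> = 2 pi / (m + 2)\<close>.
  A WKB approximation that is uniform in \<open>\<lambda>\<close> gives \<open>ln \<bar>F j\<bar>\<close> at the origin to leading order \<open>\<bar>\<lambda>\<bar>\<^bsup>1/2 + 1/m\<^esup>\<close>. Through the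
  three-term relations between Wronskians, induction on \<open>l\<close> yields
  \<open>ln \<bar>W i (i + l + 1)\<bar> \<sim> 2 K sin (l pi / m) cos (\<rho> (\<theta> - pi)) \<bar>\<lambda>\<bar>\<^bsup>\<rho>\<^esup>\<close>, \<open>\<rho> = 1/2 + 1/m\<close>, away from one ray.
  So all but finitely many zeros of \<open>D\<close> lie close to this ray, which corresponds to the positive real axis.
  Near it the Plucker relation forces \<open>W 0 l / W 0 (l + 2)\<close> to equal a fixed constant at every zero of \<open>D\<close>, whereas the modulus of
  this quotient is strictly monotone in \<open>\<theta>\<close>. Since the real coefficients make the spectrum invariant under conjugation,
  a large eigenvalue and its conjugate would give the same modulus, so they coincide.\<close>

section \<open>Entire solutions of linear equations of second order\<close>

text \<open>The delicate point is uniformity in \<open>\<lambda>\<close>. In the diagonalising frame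
  the coupling is of size \<open>1 / x\<close>, which is not integrable, so it is never integrated
  by itself: a quadratic form trades it against the damping \<open>2 * Re w\<close>, and only the
  integrable cost, the square of \<open>norm b\<close> over \<open>Re w\<close>, survives. No
  integral equation is solved; the subdominant solution arises by linear algebra as the kernel of a
  limit functional. The approximation breaks down when \<open>\<lambda>\<close> points along the
  negative axis, since a turning point may then lie on the path; in that direction \<open>F\<close>
  has only an upper bound, gained from a Wronskian relation. The induction over Wronskians is
  two-sided for this reason: in each direction the relation is taken whose divisor and leading term
  are under control. Leading-order moduli alone cannot detect that a zero is exactly real; for this
  the asymptotics of a logarithm of the quotient are differentiated in the angle, which analyticity
  permits. The claim about \<open>d_coef\<close> is settled by its formula: for real
  \<open>a\<close> each factor except \<open>\<i>\<close> is real.\<close>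

fun ode_coeff :: "complex poly \<Rightarrow> complex \<Rightarrow> complex \<Rightarrow> nat \<Rightarrow> complex" where
  "ode_coeff q a b 0 = a"
| "ode_coeff q a b (Suc 0) = b"
| "ode_coeff q a b (Suc (Suc n)) =
     (\<Sum>j\<le>n. coeff q j * ode_coeff q a b (n - j)) / of_nat ((n + 1) * (n + 2))"

text \<open>Each recursion step multiplies the weighted coefficient by at most
  \<open>A / ((n + 1) * (n + 2))\<close>, which is at most 1 once the index reaches
  \<open>N\<close>; hence at most \<open>N\<close> factors \<open>A\<close> accumulate. The
  polynomial enters only through \<open>A\<close>, which makes the bound uniform in the spectral
  parameter.\<close>

lemma ode_coeff_bound:
  assumes "r > 0" and A: "\<And>n. (\<Sum>j\<le>n. norm (coeff q j) * r ^ j) * r\<^sup>2 \<le> A"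
    and "1 \<le> A" and N: "A \<le> real N" and T: "norm a \<le> T" "norm b * r \<le> T"
  shows "norm (ode_coeff q a b n) * r ^ n \<le> T * A ^ N"
proof -
  have T0: "0 \<le> T" using T(1) norm_ge_zero order_trans by blast
  have "norm (ode_coeff q a b n) * r ^ n \<le> T * A ^ (min n N)"
  proof (induction n rule: less_induct)
    case (less n)
    consider "n = 0" | "n = 1" | k where "n = Suc (Suc k)"
      by (metis One_nat_def not0_implies_Suc)
    then show ?case
    proof cases
      case 2
      then have "T * 1 \<le> T * A ^ min n N"
        by (intro mult_left_mono one_le_power \<open>1 \<le> A\<close> T0)
      then show ?thesis using 2 T by simp
    next
      case 3
      define G where "G = T * A ^ min k N"
      have G0: "G \<ge> 0" using T0 \<open>1 \<le> A\<close> by (simp add: G_def)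
      have step: "norm (coeff q j * ode_coeff q a b (k - j)) * r ^ n \<le> norm (coeff q j) * r ^ j * r\<^sup>2 * G"
        if "j \<le> k" for j
      proof -
        have "norm (ode_coeff q a b (k - j)) * r ^ (k - j) \<le> T * A ^ min (k - j) N"
          using less 3 by simp
        also have "\<dots> \<le> G"
          unfolding G_def using \<open>1 \<le> A\<close> by (intro mult_left_mono power_increasing T0) auto
        finally have "norm (coeff q j) * r ^ j * r\<^sup>2 * (norm (ode_coeff q a b (k - j)) * r ^ (k - j))
            \<le> norm (coeff q j) * r ^ j * r\<^sup>2 * G"
          using \<open>r > 0\<close> by (intro mult_left_mono) auto
        moreover have "r ^ n = r ^ j * r\<^sup>2 * r ^ (k - j)"
          using 3 that by (simp add: power_add [symmetric] power2_eq_square)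
        ultimately show ?thesis
          by (simp add: norm_mult mult_ac)
      qed
      define D where "D = real ((k + 1) * (k + 2))"
      have D: "D > 0" unfolding D_def by (simp only: of_nat_0_less_iff)  simp
      have "norm (\<Sum>j\<le>k. coeff q j * ode_coeff q a b (k - j)) * r ^ n
          \<le> (\<Sum>j\<le>k. norm (coeff q j * ode_coeff q a b (k - j))) * r ^ n"
        using \<open>r > 0\<close> by (intro mult_right_mono norm_sum) auto
      also have "\<dots> = (\<Sum>j\<le>k. norm (coeff q j * ode_coeff q a b (k - j)) * r ^ n)"
        by (simp add: sum_distrib_right)
      also have "\<dots> \<le> (\<Sum>j\<le>k. norm (coeff q j) * r ^ j * r\<^sup>2 * G)"
        by (intro sum_mono step) auto
      also have "\<dots> = (\<Sum>j\<le>k. norm (coeff q j) * r ^ j) * r\<^sup>2 * G"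
        unfolding mult.assoc by (subst sum_distrib_right) (simp add: mult.assoc)
      also have "\<dots> \<le> A * G"
        by (intro mult_right_mono A G0)
      finally have *: "norm (\<Sum>j\<le>k. coeff q j * ode_coeff q a b (k - j)) * r ^ n \<le> A * G" .
      have "norm (ode_coeff q a b n) = norm (\<Sum>j\<le>k. coeff q j * ode_coeff q a b (k - j)) / D"
        using 3 by (simp add: norm_divide D_def norm_mult del: of_nat_add of_nat_mult of_nat_Suc)
      then have "norm (ode_coeff q a b n) * r ^ n =
        norm (\<Sum>j\<le>k. coeff q j * ode_coeff q a b (k - j)) * r ^ n / D" by simp
      also have "\<dots> \<le> A * G / D"
        using * D by (intro divide_right_mono) auto
      also have "\<dots> \<le> T * A ^ min n N"
      proof (cases "k < N")
        case True
        have "1 \<le> (k + 1) * (k + 2)" by simp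
        then have "D \<ge> 1" unfolding D_def by (metis of_nat_1 of_nat_le_iff)
        have "A * G / D \<le> A * G / 1"
          using \<open>D \<ge> 1\<close> \<open>1 \<le> A\<close> G0 by (intro divide_left_mono mult_nonneg_nonneg) auto
        also have "\<dots> = T * A ^ Suc k" using True by (simp add: G_def)
        also have "\<dots> \<le> T * A ^ min n N"
          using True 3 \<open>1 \<le> A\<close> by (intro mult_left_mono power_increasing T0) auto
        finally show ?thesis .
      next
        case False
        have "A \<le> real k" using False N by simp
        also have "real k \<le> D" unfolding D_def of_nat_le_iff by simp
        finally have "A * G / D \<le> G"
          using D G0 by (simp add: divide_le_eq mult_right_mono mult.commute)
        then show ?thesis using False 3 by (simp add: G_def min_def split: if_splits)
      qed
      finally show ?thesis .
    qed (use T in auto)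
  qed
  also have "\<dots> \<le> T * A ^ N"
    using \<open>1 \<le> A\<close> by (intro mult_left_mono power_increasing T0) auto
  finally show ?thesis .
qed

lemma ode_coeff_geometric:
  assumes "r > 0"
  shows "\<exists>M\<ge>0. \<forall>lam n. norm lam \<le> L \<longrightarrow> norm (ode_coeff (p + [:lam:]) a b n) \<le> M / r ^ n"
proof -
  \<comment> \<open>The parameter changes only the constant coefficient, so putting \<open>L\<close>
    there yields one \<open>A\<close> for the whole disc.\<close>
  define A where "A = max 1 (((\<Sum>j\<le>degree p. norm (coeff p j) * r ^ j) + L) * r\<^sup>2)"
  define N where "N = nat \<lceil>A\<rceil>"
  define T where "T = max (norm a) (norm b * r)"
  have "norm (ode_coeff (p + [:lam:]) a b n) \<le> T * A ^ N / r ^ n" if lam: "norm lam \<le> L" for lam n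
  proof -
    have "norm (ode_coeff (p + [:lam:]) a b n) * r ^ n \<le> T * A ^ N"
    proof (rule ode_coeff_bound)
      fix n
      have "(\<Sum>j\<le>n. norm (coeff (p + [:lam:]) j) * r ^ j)
          \<le> (\<Sum>j\<le>n. norm (coeff p j) * r ^ j + (if j = 0 then L else 0))"
      proof (intro sum_mono)
        fix j
        have "norm (coeff (p + [:lam:]) j) \<le> norm (coeff p j) + (if j = 0 then L else 0)"
          using lam norm_triangle_ineq[of "coeff p j" lam] by (cases j) (auto)
        then show "norm (coeff (p + [:lam:]) j) * r ^ j \<le> norm (coeff p j) * r ^ j + (if j = 0 then L else 0)"
          using \<open>r > 0\<close> by (cases j) (auto simp: algebra_simps)
      qed
      also have "\<dots> = (\<Sum>j\<le>n. norm (coeff p j) * r ^ j) + L"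
        by (simp add: sum.distrib)
      also have "(\<Sum>j\<le>n. norm (coeff p j) * r ^ j) \<le> (\<Sum>j\<le>degree p. norm (coeff p j) * r ^ j)"
      proof -
        have "(\<Sum>j\<le>n. norm (coeff p j) * r ^ j) \<le> (\<Sum>j\<le>max n (degree p). norm (coeff p j) * r ^ j)"
          using \<open>r > 0\<close> by (intro sum_mono2) auto
        also have "\<dots> = (\<Sum>j\<le>degree p. norm (coeff p j) * r ^ j)"
          by (rule sum.mono_neutral_right) (auto simp: coeff_eq_0)
        finally show ?thesis .
      qed
      finally show "(\<Sum>j\<le>n. norm (coeff (p + [:lam:]) j) * r ^ j) * r\<^sup>2 \<le> A"
        unfolding A_def using \<open>r > 0\<close> by (intro max.coboundedI2 mult_right_mono) auto
    qed (auto simp: A_def N_def T_def assms)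
    then show ?thesis using assms by (simp add: field_simps)
  qed
  moreover have "T * A ^ N \<ge> 0" by (auto simp: T_def A_def le_max_iff_disj)
  ultimately show ?thesis by blast
qed

definition ode_sol :: "complex poly \<Rightarrow> complex \<Rightarrow> complex \<Rightarrow> complex \<Rightarrow> complex" where
  "ode_sol q a b z = (\<Sum>n. ode_coeff q a b n * z ^ n)"

definition ode_sol' :: "complex poly \<Rightarrow> complex \<Rightarrow> complex \<Rightarrow> complex \<Rightarrow> complex" where
  "ode_sol' q a b z = (\<Sum>n. diffs (ode_coeff q a b) n * z ^ n)"

text \<open>Majorants independent of \<open>lam\<close> are what the M-test needs to pass holomorphy
  in \<open>lam\<close> from the coefficients to the sums.\<close>

lemma ode_terms_bound:
  fixes z :: complex
  shows "\<exists>B B'. summable B \<and> summable B' \<and> (\<forall>lam n. norm lam \<le> L \<longrightarrow>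
     norm (ode_coeff (p + [:lam:]) a b n * z ^ n) \<le> B n \<and>
     norm (diffs (ode_coeff (p + [:lam:]) a b) n * z ^ n) \<le> B' n)"
proof -
  \<comment> \<open>A radius at least four times \<open>norm z\<close> leaves the ratio
    \<open>1/4\<close>; the factor \<open>Suc n \<le> 2 ^ n\<close> of the differentiated series
    turns it into \<open>1/2\<close>.\<close>
  define r where "r = 4 * (norm z + 1)"
  have r: "r > 0" by (simp add: r_def add_nonneg_pos)
  obtain M where M: "M \<ge> 0" "\<And>lam n. norm lam \<le> L \<Longrightarrow> norm (ode_coeff (p + [:lam:]) a b n) \<le> M / r ^ n"
    using ode_coeff_geometric[OF r] by blast
  have zr: "norm z \<le> r / 4" by (simp add: r_def)
  have "norm (ode_coeff (p + [:lam:]) a b n * z ^ n) \<le> M * (1/4) ^ n" if "norm lam \<le> L" for lam n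
  proof -
    have "norm (ode_coeff (p + [:lam:]) a b n * z ^ n) \<le> M / r ^ n * (r / 4) ^ n"
      unfolding norm_mult norm_power using M r
      by (intro mult_mono power_mono M zr) (auto simp: that)
    also have "\<dots> = M * (1/4)^n" using r by (simp add: power_divide)
    finally show ?thesis .
  qed
  moreover have "norm (diffs (ode_coeff (p + [:lam:]) a b) n * z ^ n) \<le> M / r * (1/2) ^ n" if "norm lam \<le> L" for lam n
  proof -
    have "norm (ode_coeff (p + [:lam:]) a b (Suc n)) * norm (z ^ n) \<le> M / r ^ Suc n * (r / 4) ^ n"
      unfolding norm_power using M r
      by (intro mult_mono power_mono M zr) (auto simp: that)
    also have "\<dots> = M / r * (1/4)^n" using r by (simp add: power_divide)
    finally have "norm (diffs (ode_coeff (p + [:lam:]) a b) n * z ^ n) \<le> real (Suc n) * (M / r * (1/4)^n)"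
      unfolding diffs_def norm_mult norm_of_nat by (simp only: mult.assoc mult_left_mono of_nat_0_le_iff)
    also have "\<dots> \<le> 2 ^ n * (M / r * (1/4)^n)"
    proof (intro mult_right_mono)
      have "n < 2 ^ n" by simp
      then have "Suc n \<le> 2 ^ n" by (rule Suc_leI)
      then show "real (Suc n) \<le> 2 ^ n"
        by (metis of_nat_le_iff of_nat_numeral of_nat_power)
    qed (use M r in auto)
    also have "\<dots> = M / r * (1/2)^n"
    proof -
      have "2 ^ n * (1/4 :: real) ^ n = (1/2) ^ n" by (simp flip: power_mult_distrib)
      then show ?thesis by (simp add: mult_ac)
    qed
    finally show ?thesis .
  qed
  moreover have "summable (\<lambda>n. M * (1/4)^n)" "summable (\<lambda>n. M / r * (1/2)^n)"
    by (intro summable_mult summable_geometric; simp)+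
  ultimately show ?thesis by blast
qed

lemma summable_ode_coeff: "summable (\<lambda>n. norm (ode_coeff q a b n * z ^ n))"
proof -
  obtain B where "summable B" "\<And>n. norm (ode_coeff (q + [:0:]) a b n * z ^ n) \<le> B n"
    using ode_terms_bound[of 0 q a b z] by auto
  then show ?thesis
    by (auto intro!: summable_comparison_test'[of B 0])
qed

lemma ode_sol_DERIV: "(ode_sol q a b has_field_derivative ode_sol' q a b z) (at z)"
  unfolding ode_sol_def ode_sol'_def
  by (rule termdiffs_strong_converges_everywhere) (rule summable_norm_cancel, rule summable_ode_coeff)

lemma ode_sol'_DERIV: "(ode_sol' q a b has_field_derivative poly q z * ode_sol q a b z) (at z)"
proof -
  have "(ode_sol' q a b has_field_derivative (\<Sum>n. diffs (diffs (ode_coeff q a b)) n * z ^ n)) (at z)"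
    unfolding ode_sol'_def
  proof (rule termdiffs_strong_converges_everywhere)
    fix y
    obtain B where "summable B" "\<And>n. norm (diffs (ode_coeff (q + [:0:]) a b) n * y ^ n) \<le> B n"
      using ode_terms_bound[of 0 q a b y] by auto
    then show "summable (\<lambda>n. diffs (ode_coeff q a b) n * y ^ n)"
      by (auto intro!: summable_comparison_test'[of B 0])
  qed
  moreover have "diffs (diffs (ode_coeff q a b)) n * z ^ n =
     (\<Sum>j\<le>n. (coeff q j * z ^ j) * (ode_coeff q a b (n - j) * z ^ (n - j)))" for n
  proof -
    have "(\<Sum>j\<le>n. (coeff q j * z ^ j) * (ode_coeff q a b (n - j) * z ^ (n - j))) =
       (\<Sum>j\<le>n. (coeff q j * ode_coeff q a b (n - j)) * z ^ n)"
      by (intro sum.cong) (auto simp: mult_ac simp flip: power_add)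
    moreover have "of_nat (n + 1) * (of_nat (n + 2) :: complex) \<noteq> 0"
      by (simp only: of_nat_mult [symmetric] of_nat_eq_0_iff) simp
    then have "diffs (diffs (ode_coeff q a b)) n = (\<Sum>j\<le>n. coeff q j * ode_coeff q a b (n - j))"
      unfolding diffs_def ode_coeff.simps of_nat_mult by (simp add: mult.assoc [symmetric] del: of_nat_Suc of_nat_add)
    ultimately show ?thesis by (simp add: sum_distrib_right)
  qed
  moreover have "poly q z * ode_sol q a b z =
      (\<Sum>n. \<Sum>j\<le>n. (coeff q j * z ^ j) * (ode_coeff q a b (n - j) * z ^ (n - j)))"
  proof -
    have fin: "coeff q j * z ^ j = 0" if "j \<notin> {..degree q}" for j
      using that by (simp add: coeff_eq_0)
    have "poly q z = (\<Sum>n. coeff q n * z ^ n)"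
      unfolding poly_altdef by (rule suminf_finite [symmetric]) (use fin in auto)
    moreover have "summable (\<lambda>n. norm (coeff q n * z ^ n))"
      by (rule summable_finite[of "{..degree q}"]) (use fin in auto)
    ultimately show ?thesis
      unfolding ode_sol_def by (simp only:) (rule Cauchy_product [OF _ summable_ode_coeff])
  qed
  ultimately show ?thesis by simp
qed

lemma ode_sol_0 [simp]: "ode_sol q a b 0 = a" and ode_sol'_0 [simp]: "ode_sol' q a b 0 = b"
  unfolding ode_sol_def ode_sol'_def by (simp_all only: powser_zero) (simp_all add: diffs_def)

section \<open>Holomorphic dependence on the spectral parameter\<close>

lemma holomorphic_suminf:
  fixes g :: "nat \<Rightarrow> complex \<Rightarrow> complex"
  assumes hol: "\<And>n. g n holomorphic_on UNIV"
    and bd: "\<And>L. \<exists>B. summable B \<and> (\<forall>x n. norm x \<le> L \<longrightarrow> norm (g n x) \<le> B n)"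
  shows "(\<lambda>x. \<Sum>n. g n x) holomorphic_on UNIV"
proof (rule holomorphic_uniform_sequence[where f = "\<lambda>n x. \<Sum>i<n. g i x"])
  fix x :: complex
  obtain B where B: "summable B" "\<And>y n. norm y \<le> norm x + 1 \<Longrightarrow> norm (g n y) \<le> B n"
    using bd[of "norm x + 1"] by blast
  have "uniform_limit (cball x 1) (\<lambda>n x. \<Sum>i<n. g i x) (\<lambda>x. \<Sum>n. g n x) sequentially"
  proof (rule Weierstrass_m_test)
    fix n y assume "y \<in> cball x 1"
    then have "norm (y - x) \<le> 1" by (simp add: dist_norm norm_minus_commute)
    then have "norm y \<le> norm x + 1"
      by (meson diff_left_mono norm_triangle_ineq2 order_trans diff_le_eq add.commute add_le_cancel_left norm_triangle_sub)
    then show "norm (g n y) \<le> B n" by (rule B)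
  qed (rule B)
  then show "\<exists>d>0. cball x d \<subseteq> UNIV \<and> uniform_limit (cball x d) (\<lambda>n x. \<Sum>i<n. g i x) (\<lambda>x. \<Sum>n. g n x) sequentially"
    by (intro exI[of _ 1]) auto
qed (auto intro!: holomorphic_intros hol)

lemma ode_coeff_holomorphic: "(\<lambda>lam. ode_coeff (p + [:lam:]) a b n) holomorphic_on UNIV"
proof (induction n rule: less_induct)
  case (less n)
  consider "n = 0" | "n = 1" | k where "n = Suc (Suc k)"
    by (metis One_nat_def not0_implies_Suc)
  then show ?case
  proof cases
    case 3
    have c: "(\<lambda>lam. coeff (p + [:lam:]) j) holomorphic_on UNIV" for j
      by (cases j) (auto intro!: holomorphic_intros)
    show ?thesis
      unfolding 3 ode_coeff.simps by (intro holomorphic_intros c less) (auto simp: 3)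
  qed auto
qed

lemma ode_sol_holomorphic_param: "(\<lambda>lam. ode_sol (p + [:lam:]) a b z) holomorphic_on UNIV"
  unfolding ode_sol_def
proof (rule holomorphic_suminf)
  show "\<exists>B. summable B \<and> (\<forall>x n. norm x \<le> L \<longrightarrow> norm (ode_coeff (p + [:x:]) a b n * z ^ n) \<le> B n)" for L
    using ode_terms_bound[of L p a b z] by blast
qed (intro holomorphic_intros ode_coeff_holomorphic)

lemma ode_sol'_holomorphic_param: "(\<lambda>lam. ode_sol' (p + [:lam:]) a b z) holomorphic_on UNIV"
  unfolding ode_sol'_def
proof (rule holomorphic_suminf)
  show "\<exists>B. summable B \<and> (\<forall>x n. norm x \<le> L \<longrightarrow> norm (diffs (ode_coeff (p + [:x:]) a b) n * z ^ n) \<le> B n)" for L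
    using ode_terms_bound[of L p a b z] by blast
next
  show "(\<lambda>x. diffs (ode_coeff (p + [:x:]) a b) n * z ^ n) holomorphic_on UNIV" for n
    unfolding diffs_def by (intro holomorphic_intros ode_coeff_holomorphic)
qed

section \<open>The subdominant solution in a cone\<close>

lemma nonincreasing_within:
  fixes h :: "real \<Rightarrow> real"
  assumes "a \<le> b" and der: "\<And>x. x \<in> {a..b} \<Longrightarrow> (h has_real_derivative h' x) (at x within {a..b})"
    and neg: "\<And>x. x \<in> {a..b} \<Longrightarrow> h' x \<le> 0"
  shows "h b \<le> h a"
proof (cases "a = b")
  case False
  then have "a < b" using assms by simp
  show ?thesis
  proof (rule DERIV_nonpos_imp_decreasing_open[of a b h])
    show "\<exists>y. DERIV h x :> y \<and> y \<le> 0" if "a < x" "x < b" for x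
      using der[of x] neg[of x] that by (auto simp: at_within_Icc_at)
    show "continuous_on {a..b} h"
      using der by (meson DERIV_continuous continuous_on_eq_continuous_within)
  qed (use \<open>a < b\<close> in auto)
qed simp

lemma gronwall_within:
  fixes V G :: "real \<Rightarrow> real"
  assumes "a \<le> b"
    and V: "\<And>x. x \<in> {a..b} \<Longrightarrow> (V has_real_derivative V' x) (at x within {a..b})"
    and G: "\<And>x. x \<in> {a..b} \<Longrightarrow> (G has_real_derivative g x) (at x within {a..b})"
    and le: "\<And>x. x \<in> {a..b} \<Longrightarrow> V' x \<le> g x * V x"
  shows "V b \<le> V a * exp (G b - G a)"
proof -
  have "V b * exp (- G b) \<le> V a * exp (- G a)"
  proof (rule nonincreasing_within[OF \<open>a \<le> b\<close>])
    fix x assume x: "x \<in> {a..b}"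
    show "((\<lambda>x. V x * exp (- G x)) has_real_derivative (V' x - g x * V x) * exp (- G x)) (at x within {a..b})"
      by (rule derivative_eq_intros V[OF x] G[OF x] refl)+ (simp add: algebra_simps)
    show "(V' x - g x * V x) * exp (- G x) \<le> 0"
      using le[OF x] by (simp add: mult_le_0_iff)
  qed
  then have "V b * exp (- G b) * exp (G b) \<le> V a * exp (- G a) * exp (G b)"
    by (intro mult_right_mono) auto
  then show ?thesis
    by (simp add: mult.assoc exp_minus exp_diff field_simps)
qed

lemma norm_sq_has_derivative:
  fixes f :: "real \<Rightarrow> complex"
  assumes "(f has_vector_derivative f') (at t within S)"
  shows "((\<lambda>t. (norm (f t))\<^sup>2) has_real_derivative 2 * Re (cnj (f t) * f')) (at t within S)"
proof -
  have d: "((\<lambda>t. Re (f t)) has_real_derivative Re f') (at t within S)"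
    "((\<lambda>t. Im (f t)) has_real_derivative Im f') (at t within S)"
    unfolding has_real_derivative_iff_has_vector_derivative
    by (rule bounded_linear.has_vector_derivative[OF bounded_linear_Re assms]
        bounded_linear.has_vector_derivative[OF bounded_linear_Im assms])+
  have "((\<lambda>t. (Re (f t))\<^sup>2 + (Im (f t))\<^sup>2) has_real_derivative
     2 * Re (cnj (f t) * f')) (at t within S)"
    by (rule DERIV_cong[OF DERIV_add[OF DERIV_power[OF d(1), of 2] DERIV_power[OF d(2), of 2]]]) simp
  then show ?thesis by (simp add: cmod_power2)
qed

text \<open>Completing a square with weight \<open>sqrt (Re w)\<close>: the coupling is split so
  that one part is exactly what a damping of rate \<open>4 * Re w\<close> absorbs.\<close>

lemma cross_term_bound:
  fixes s d b w :: complex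
  assumes "Re w > 0"
  shows "4 * (norm b * norm s * norm d) \<le> (norm b)\<^sup>2 / Re w * (norm d)\<^sup>2 + 4 * Re w * (norm s)\<^sup>2"
proof -
  define r where "r = sqrt (Re w)"
  have r: "r > 0" "Re w = r\<^sup>2" using assms by (auto simp: r_def)
  have "0 \<le> (norm b * norm d / r - 2 * r * norm s)\<^sup>2" by simp
  also have "\<dots> = (norm b)\<^sup>2 / r\<^sup>2 * (norm d)\<^sup>2 + 4 * r\<^sup>2 * (norm s)\<^sup>2 - 4 * (norm b * norm s * norm d)"
    using r by (simp add: power2_diff power_mult_distrib power_divide)
  finally show ?thesis using r by simp
qed

lemma Re_mult_le_norm: "Re (x * y) \<le> norm x * norm y" and Re_mult_ge_norm: "- (norm x * norm y) \<le> Re (x * y)"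
  using complex_Re_le_cmod[of "x * y"] abs_Re_le_cmod[of "x * y"] by (auto simp: norm_mult)

lemma cnj_mult_self: "Re (cnj x * (w * x)) = Re w * (norm x)\<^sup>2"
  unfolding cmod_power2 by (simp add: algebra_simps power2_eq_square)

text \<open>Here \<open>s\<close> is the neutral and \<open>d\<close> the damped component. The
  damping of \<open>d\<close> swallows its share of the coupling \<open>b\<close>; what remains is
  quadratic in \<open>b\<close> and can be integrated up to infinity. The perturbation
  \<open>k\<close> costs a term of first order.\<close>

lemma growth_form_bound:
  fixes s d b w k :: complex
  assumes "Re w > 0"
  shows "2 * Re (cnj s * (b * d + k * (s + d))) + 2 * Re (cnj d * (- 2 * w * d + b * s - k * (s + d)))
    \<le> ((norm b)\<^sup>2 / Re w + 2 * norm k) * ((norm s)\<^sup>2 + (norm d)\<^sup>2)"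
proof -
  have 1: "Re (cnj s * (b * d)) \<le> norm b * norm s * norm d" "Re (cnj d * (b * s)) \<le> norm b * norm s * norm d"
    using Re_mult_le_norm[of "cnj s" "b * d"] Re_mult_le_norm[of "cnj d" "b * s"]
    by (simp_all add: norm_mult mult_ac)
  \<comment> \<open>The two terms with \<open>k\<close> combine into a product of
    \<open>s + d\<close> and the conjugate of \<open>s - d\<close>, to which the parallelogram law
    applies.\<close>
  have "Re (k * (s + d) * cnj (s - d)) \<le> norm k * norm (s + d) * norm (s - d)"
    using Re_mult_le_norm[of "k * (s + d)" "cnj (s - d)"] by (simp only: norm_mult complex_mod_cnj)
  then have "2 * Re (k * (s + d) * cnj (s - d)) \<le> norm k * (2 * norm (s + d) * norm (s - d))"
    by linarith
  also have "\<dots> \<le> norm k * ((norm (s + d))\<^sup>2 + (norm (s - d))\<^sup>2)"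
    using sum_squares_bound[of "norm (s + d)" "norm (s - d)"] by (intro mult_left_mono) auto
  also have "(norm (s + d))\<^sup>2 + (norm (s - d))\<^sup>2 = 2 * ((norm s)\<^sup>2 + (norm d)\<^sup>2)"
    unfolding cmod_power2 by (simp add: power2_eq_square algebra_simps)
  finally have 2: "2 * Re (k * (s + d) * cnj (s - d)) \<le> 2 * norm k * ((norm s)\<^sup>2 + (norm d)\<^sup>2)"
    by (simp only: mult_ac)
  have "2 * Re (cnj s * (b * d + k * (s + d))) + 2 * Re (cnj d * (- 2 * w * d + b * s - k * (s + d)))
    = 2 * Re (cnj s * (b * d)) + 2 * Re (cnj d * (b * s)) - 4 * Re (cnj d * (w * d))
      + 2 * Re (k * (s + d) * cnj (s - d))"
    by (simp add: algebra_simps)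
  also have "\<dots> \<le> 4 * (norm b * norm d * norm s) - 4 * Re w * (norm d)\<^sup>2
      + 2 * norm k * ((norm s)\<^sup>2 + (norm d)\<^sup>2)"
    using 1 2 cnj_mult_self[of d w] by (simp only: mult_ac)
  also have "\<dots> \<le> (norm b)\<^sup>2 / Re w * (norm s)\<^sup>2 + 2 * norm k * ((norm s)\<^sup>2 + (norm d)\<^sup>2)"
    using cross_term_bound[OF assms, of b d s] by simp
  also have "\<dots> \<le> (norm b)\<^sup>2 / Re w * ((norm s)\<^sup>2 + (norm d)\<^sup>2) + 2 * norm k * ((norm s)\<^sup>2 + (norm d)\<^sup>2)"
    using assms by (intro add_right_mono mult_left_mono) auto
  finally show ?thesis by (simp add: algebra_simps)
qed

text \<open>Now \<open>s\<close> is amplified at rate \<open>2 * w\<close> and \<open>d\<close> is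
  neutral. Read backwards from infinity, \<open>s\<close> is damped, so the sum of squares is
  controlled by its value at the far end; the difference of squares is tracked in order to keep
  \<open>d\<close> bounded from below.\<close>

lemma decay_form_bounds:
  fixes s d b w :: complex
  assumes "Re w > 0"
  shows "- ((norm b)\<^sup>2 / Re w * ((norm s)\<^sup>2 + (norm d)\<^sup>2))
      \<le> 2 * Re (cnj s * (2 * w * s + b * d)) + 2 * Re (cnj d * (b * s))"
    and "2 * Re (cnj d * (b * s)) - 2 * Re (cnj s * (2 * w * s + b * d))
      \<le> (norm b)\<^sup>2 / Re w * ((norm s)\<^sup>2 + (norm d)\<^sup>2)"
proof -
  have 1: "\<bar>Re (cnj s * (b * d))\<bar> \<le> norm b * norm s * norm d" "\<bar>Re (cnj d * (b * s))\<bar> \<le> norm b * norm s * norm d"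
    using abs_Re_le_cmod[of "cnj s * (b * d)"] abs_Re_le_cmod[of "cnj d * (b * s)"]
    by (simp_all add: norm_mult mult_ac)
  have 2: "Re (cnj s * (2 * w * s + b * d)) = 2 * Re w * (norm s)\<^sup>2 + Re (cnj s * (b * d))"
    using cnj_mult_self[of s w] by (simp add: algebra_simps)
  have "0 \<le> (norm b)\<^sup>2 / Re w * (norm s)\<^sup>2" using assms by simp
  note 3 = cross_term_bound[OF assms, of b s d] 1 this
  show "- ((norm b)\<^sup>2 / Re w * ((norm s)\<^sup>2 + (norm d)\<^sup>2))
      \<le> 2 * Re (cnj s * (2 * w * s + b * d)) + 2 * Re (cnj d * (b * s))"
    using 3 unfolding 2 by (simp add: algebra_simps abs_le_iff)
  show "2 * Re (cnj d * (b * s)) - 2 * Re (cnj s * (2 * w * s + b * d))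
      \<le> (norm b)\<^sup>2 / Re w * ((norm s)\<^sup>2 + (norm d)\<^sup>2)"
    using 3 unfolding 2 by (simp add: algebra_simps abs_le_iff)
qed

text \<open>With \<open>P = w * R\<close> the combinations \<open>s\<close> and \<open>d\<close> are
  the components of \<open>(u, u1)\<close> along the two WKB solutions. For \<open>e = -1\<close>
  they are scaled by the decaying factor, so that the growing WKB solution becomes stationary;
  \<open>e = 1\<close> does the reverse.\<close>

lemma wkb_frame_derivs:
  fixes u u1 P R :: "real \<Rightarrow> complex"
  assumes "(u has_vector_derivative u1 t) (at t within A)"
    and "(u1 has_vector_derivative (w\<^sup>2 + L) * u t) (at t within A)"
    and "(P has_vector_derivative (b + e * w) * P t) (at t within A)"
    and "(R has_vector_derivative (e * w - b) * R t) (at t within A)"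
    and "P t = w * R t" "w \<noteq> 0"
  defines "s \<equiv> \<lambda>t. P t * u t + R t * u1 t" and "d \<equiv> \<lambda>t. P t * u t - R t * u1 t"
  defines "k \<equiv> L / (2 * w)"
  shows "(s has_vector_derivative b * d t + (1 + e) * w * s t + k * (s t + d t)) (at t within A)"
    and "(d has_vector_derivative b * s t + (e - 1) * w * d t - k * (s t + d t)) (at t within A)"
proof -
  note der = has_vector_derivative_add has_vector_derivative_diff has_vector_derivative_mult assms(1-4)
  have k: "k * (2 * (w * R t * u t)) = L * R t * u t"
  proof -
    have kk: "k * (2 * w) = L" using assms(6) by (simp add: k_def)
    show ?thesis unfolding kk [symmetric] by (simp add: mult_ac)
  qed
  show "(s has_vector_derivative b * d t + (1 + e) * w * s t + k * (s t + d t)) (at t within A)"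
  proof (rule has_vector_derivative_eq_rhs)
    show "(s has_vector_derivative (P t * u1 t + (b + e * w) * P t * u t) +
       (R t * ((w\<^sup>2 + L) * u t) + (e * w - b) * R t * u1 t)) (at t within A)"
      unfolding s_def by (rule der)+
    have "s t + d t = 2 * (w * R t * u t)"
      by (simp add: s_def d_def assms(5))
    then have K: "k * (s t + d t) = L * R t * u t"
      by (simp only: k)
    show "(P t * u1 t + (b + e * w) * P t * u t) +
       (R t * ((w\<^sup>2 + L) * u t) + (e * w - b) * R t * u1 t) = b * d t + (1 + e) * w * s t + k * (s t + d t)"
      unfolding K unfolding s_def d_def assms(5) by (simp add: algebra_simps power2_eq_square)
  qed
  show "(d has_vector_derivative b * s t + (e - 1) * w * d t - k * (s t + d t)) (at t within A)"
  proof (rule has_vector_derivative_eq_rhs)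
    show "(d has_vector_derivative (P t * u1 t + (b + e * w) * P t * u t) -
       (R t * ((w\<^sup>2 + L) * u t) + (e * w - b) * R t * u1 t)) (at t within A)"
      unfolding d_def by (rule der)+
    have "s t + d t = 2 * (w * R t * u t)"
      by (simp add: s_def d_def assms(5))
    then have K: "k * (s t + d t) = L * R t * u t"
      by (simp only: k)
    show "(P t * u1 t + (b + e * w) * P t * u t) -
       (R t * ((w\<^sup>2 + L) * u t) + (e * w - b) * R t * u1 t) = b * s t + (e - 1) * w * d t - k * (s t + d t)"
      unfolding K unfolding s_def d_def assms(5) by (simp add: algebra_simps power2_eq_square)
  qed
qed

lemma wkb_growth:
  fixes u u1 P R w b :: "real \<Rightarrow> complex" and G g :: "real \<Rightarrow> real"
  assumes "a \<le> c"
    and u: "\<And>t. t \<in> {a..c} \<Longrightarrow> (u has_vector_derivative u1 t) (at t within {a..c})"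
    and u1: "\<And>t. t \<in> {a..c} \<Longrightarrow> (u1 has_vector_derivative ((w t)\<^sup>2 + L) * u t) (at t within {a..c})"
    and P: "\<And>t. t \<in> {a..c} \<Longrightarrow> (P has_vector_derivative (b t - w t) * P t) (at t within {a..c})"
    and R: "\<And>t. t \<in> {a..c} \<Longrightarrow> (R has_vector_derivative (- w t - b t) * R t) (at t within {a..c})"
    and PR: "\<And>t. t \<in> {a..c} \<Longrightarrow> P t = w t * R t"
    and w: "\<And>t. t \<in> {a..c} \<Longrightarrow> Re (w t) > 0"
    and G: "\<And>t. t \<in> {a..c} \<Longrightarrow> (G has_real_derivative g t) (at t within {a..c})"
    and g: "\<And>t. t \<in> {a..c} \<Longrightarrow> (norm (b t))\<^sup>2 / Re (w t) + norm L / norm (w t) \<le> g t"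
  defines "V \<equiv> \<lambda>t. (norm (P t * u t + R t * u1 t))\<^sup>2 + (norm (P t * u t - R t * u1 t))\<^sup>2"
  shows "V c \<le> V a * exp (G c - G a)"
proof (rule gronwall_within[OF \<open>a \<le> c\<close> _ G])
  fix t assume t: "t \<in> {a..c}"
  define s d where "s = (\<lambda>t. P t * u t + R t * u1 t)" "d = (\<lambda>t. P t * u t - R t * u1 t)"
  define k where "k = L / (2 * w t)"
  have w0: "w t \<noteq> 0" using w[OF t] by auto
  have ds: "(s has_vector_derivative b t * d t + k * (s t + d t)) (at t within {a..c})"
    and dd: "(d has_vector_derivative - 2 * w t * d t + b t * s t - k * (s t + d t)) (at t within {a..c})"
    using wkb_frame_derivs[where u = u and ?u1.0 = u1 and t = t and A = "{a..c}" and w = "w t" and L = L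
        and P = P and b = "b t" and e = "-1" and R = R] u[OF t] u1[OF t] P[OF t] R[OF t] PR[OF t] w0
    by (simp_all add: s_d_def k_def algebra_simps)
  show "(V has_real_derivative 2 * Re (cnj (s t) * (b t * d t + k * (s t + d t)))
     + 2 * Re (cnj (d t) * (- 2 * w t * d t + b t * s t - k * (s t + d t)))) (at t within {a..c})"
    using norm_sq_has_derivative[OF ds] norm_sq_has_derivative[OF dd]
    unfolding V_def s_d_def by (rule DERIV_add)
  have "2 * norm k = norm L / norm (w t)"
    by (simp add: k_def norm_divide norm_mult)
  then have "(norm (b t))\<^sup>2 / Re (w t) + 2 * norm k \<le> g t"
    using g[OF t] by simp
  then have "((norm (b t))\<^sup>2 / Re (w t) + 2 * norm k) * V t \<le> g t * V t"
    by (rule mult_right_mono) (simp add: V_def)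
  moreover have "V t = (norm (s t))\<^sup>2 + (norm (d t))\<^sup>2" by (simp add: V_def s_d_def)
  ultimately show "2 * Re (cnj (s t) * (b t * d t + k * (s t + d t)))
     + 2 * Re (cnj (d t) * (- 2 * w t * d t + b t * s t - k * (s t + d t))) \<le> g t * V t"
    using growth_form_bound[OF w[OF t], of "s t" "b t" "d t" k] by simp
qed

text \<open>Gronwall for \<open>V\<close> gives only an upper bound at the left end. The difference
  \<open>U\<close> changes by at most the integrated rate times the maximum of \<open>V\<close>; it
  therefore cannot drop much, and this forces \<open>d\<close> to dominate \<open>s\<close>.\<close>

lemma wkb_decay:
  fixes u u1 P R w b :: "real \<Rightarrow> complex" and G g :: "real \<Rightarrow> real"
  assumes "a \<le> c"
    and u: "\<And>t. t \<in> {a..c} \<Longrightarrow> (u has_vector_derivative u1 t) (at t within {a..c})"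
    and u1: "\<And>t. t \<in> {a..c} \<Longrightarrow> (u1 has_vector_derivative (w t)\<^sup>2 * u t) (at t within {a..c})"
    and P: "\<And>t. t \<in> {a..c} \<Longrightarrow> (P has_vector_derivative (b t + w t) * P t) (at t within {a..c})"
    and R: "\<And>t. t \<in> {a..c} \<Longrightarrow> (R has_vector_derivative (w t - b t) * R t) (at t within {a..c})"
    and PR: "\<And>t. t \<in> {a..c} \<Longrightarrow> P t = w t * R t"
    and w: "\<And>t. t \<in> {a..c} \<Longrightarrow> Re (w t) > 0"
    and G: "\<And>t. t \<in> {a..c} \<Longrightarrow> (G has_real_derivative g t) (at t within {a..c})"
    and g: "\<And>t. t \<in> {a..c} \<Longrightarrow> (norm (b t))\<^sup>2 / Re (w t) \<le> g t"
  defines "s \<equiv> \<lambda>t. P t * u t + R t * u1 t" and "d \<equiv> \<lambda>t. P t * u t - R t * u1 t"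
  defines "V \<equiv> \<lambda>t. (norm (s t))\<^sup>2 + (norm (d t))\<^sup>2"
  defines "U \<equiv> \<lambda>t. (norm (d t))\<^sup>2 - (norm (s t))\<^sup>2"
  shows "V a \<le> V c * exp (G c - G a)"
    and "U c - (G c - G a) * exp (G c - G a) * V c \<le> U a"
proof -
  define s' d' where "s' = (\<lambda>t. 2 * w t * s t + b t * d t)" "d' = (\<lambda>t. b t * s t)"
  have ds: "(s has_vector_derivative s' t) (at t within {a..c})"
    and dd: "(d has_vector_derivative d' t) (at t within {a..c})" if t: "t \<in> {a..c}" for t
  proof -
    have w0: "w t \<noteq> 0" using w[OF t] by auto
    show "(s has_vector_derivative s' t) (at t within {a..c})"
      "(d has_vector_derivative d' t) (at t within {a..c})"
      using wkb_frame_derivs[where u = u and ?u1.0 = u1 and t = t and A = "{a..c}" and w = "w t" and L = 0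
        and P = P and b = "b t" and e = 1 and R = R] u[OF t] u1[OF t] P[OF t] R[OF t] PR[OF t] w0
      by (simp_all add: s_def d_def s'_d'_def algebra_simps)
  qed
  have gpos: "0 \<le> g t" if "t \<in> {a..c}" for t
  proof -
    have "0 \<le> (norm (b t))\<^sup>2 / Re (w t)" using w[OF that] by simp
    then show ?thesis using g[OF that] by simp
  qed
  have Vpos: "0 \<le> V t" for t by (simp add: V_def)
  have gV: "(norm (b t))\<^sup>2 / Re (w t) * V t \<le> g t * V t" if "t \<in> {a..c}" for t
    by (rule mult_right_mono[OF g[OF that] Vpos])
  have V_le: "V t \<le> V c * exp (G c - G t)" if t: "t \<in> {a..c}" for t
  proof -
    \<comment> \<open>The backward estimate is Gronwall for \<open>- V\<close> with the rate
      \<open>- g\<close>.\<close>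
    have "- V c \<le> - V t * exp (- G c - (- G t))"
    proof (rule gronwall_within[where V = "\<lambda>t. - V t" and G = "\<lambda>t. - G t" and g = "\<lambda>t. - g t"])
      show "t \<le> c" using t by simp
      fix x assume "x \<in> {t..c}"
      then have x: "x \<in> {a..c}" and sub: "{t..c} \<subseteq> {a..c}" using t by auto
      show "((\<lambda>t. - V t) has_real_derivative - (2 * Re (cnj (s x) * s' x) + 2 * Re (cnj (d x) * d' x))) (at x within {t..c})"
        unfolding V_def
        by (intro derivative_intros DERIV_subset[OF norm_sq_has_derivative[OF ds[OF x]] sub]
            DERIV_subset[OF norm_sq_has_derivative[OF dd[OF x]] sub])
      show "((\<lambda>t. - G t) has_real_derivative - g x) (at x within {t..c})"
        by (intro derivative_intros DERIV_subset[OF G[OF x] sub])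
      have "- (g x * V x) \<le> 2 * Re (cnj (s x) * s' x) + 2 * Re (cnj (d x) * d' x)"
        using decay_form_bounds(1)[OF w[OF x], of "b x" "s x" "d x"] gV[OF x]
        unfolding s'_d'_def V_def by linarith
      then show "- (2 * Re (cnj (s x) * s' x) + 2 * Re (cnj (d x) * d' x)) \<le> - g x * - V x"
        unfolding minus_mult_minus by linarith
    qed
    then have "V t * exp (G t - G c) \<le> V c" by simp
    then have "V t * exp (G t - G c) * exp (G c - G t) \<le> V c * exp (G c - G t)"
      by (rule mult_right_mono) simp
    then show ?thesis by (simp add: mult.assoc flip: exp_add)
  qed
  show "V a \<le> V c * exp (G c - G a)" using V_le[of a] \<open>a \<le> c\<close> by simp
  define M where "M = V c * exp (G c - G a)"
  have V_M: "V t \<le> M" if t: "t \<in> {a..c}" for t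
  proof -
    have "- G t \<le> - G a"
    proof (rule nonincreasing_within[where h = "\<lambda>t. - G t" and h' = "\<lambda>t. - g t"])
      fix x assume "x \<in> {a..t}"
      then have x: "x \<in> {a..c}" and sub: "{a..t} \<subseteq> {a..c}" using t by auto
      show "((\<lambda>t. - G t) has_real_derivative - g x) (at x within {a..t})"
        by (intro derivative_intros DERIV_subset[OF G[OF x] sub])
      show "- g x \<le> 0" using gpos[OF x] by simp
    qed (use t in auto)
    then have "V c * exp (G c - G t) \<le> M" unfolding M_def by (intro mult_left_mono Vpos) simp
    then show ?thesis using V_le[OF t] by simp
  qed
  have "U c - G c * M \<le> U a - G a * M"
  proof (rule nonincreasing_within[OF \<open>a \<le> c\<close>])
    fix x assume x: "x \<in> {a..c}"
    show "((\<lambda>t. U t - G t * M) has_real_derivative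
      (2 * Re (cnj (d x) * d' x) - 2 * Re (cnj (s x) * s' x)) - g x * M) (at x within {a..c})"
      unfolding U_def
      by (intro DERIV_diff DERIV_cmult_right norm_sq_has_derivative dd[OF x] ds[OF x] G[OF x])
    have "2 * Re (cnj (d x) * d' x) - 2 * Re (cnj (s x) * s' x) \<le> (norm (b x))\<^sup>2 / Re (w x) * V x"
      using decay_form_bounds(2)[OF w[OF x], of "d x" "b x" "s x"] by (simp only: s'_d'_def V_def)
    also have "\<dots> \<le> g x * M"
      using gV[OF x] mult_left_mono[OF V_M[OF x] gpos[OF x]] by simp
    finally show "(2 * Re (cnj (d x) * d' x) - 2 * Re (cnj (s x) * s' x)) - g x * M \<le> 0" by simp
  qed
  then show "U c - (G c - G a) * exp (G c - G a) * V c \<le> U a"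
    by (simp add: M_def algebra_simps)
qed

text \<open>The component of \<open>f\<close> in the fixed direction \<open>D\<close> is a real
  function with derivative at most \<open>norm D * g\<close>, so the mean value inequality reduces
  to monotonicity.\<close>

lemma path_bound:
  fixes f :: "real \<Rightarrow> complex" and G g :: "real \<Rightarrow> real"
  assumes "a \<le> b"
    and f: "\<And>x. x \<in> {a..b} \<Longrightarrow> (f has_vector_derivative f' x) (at x within {a..b})"
    and G: "\<And>x. x \<in> {a..b} \<Longrightarrow> (G has_real_derivative g x) (at x within {a..b})"
    and le: "\<And>x. x \<in> {a..b} \<Longrightarrow> norm (f' x) \<le> g x"
  shows "norm (f b - f a) \<le> G b - G a"
proof -
  define D where "D = f b - f a"
  have 1: "Re (cnj e * f b) - norm e * G b \<le> Re (cnj e * f a) - norm e * G a" for e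
  proof (rule nonincreasing_within[OF \<open>a \<le> b\<close>])
    fix x assume x: "x \<in> {a..b}"
    have "((\<lambda>t. cnj e * f t) has_vector_derivative cnj e * f' x) (at x within {a..b})"
      by (intro has_vector_derivative_mult_right f x)
    then have "((\<lambda>t. Re (cnj e * f t)) has_real_derivative Re (cnj e * f' x)) (at x within {a..b})"
      unfolding has_real_derivative_iff_has_vector_derivative
      by (rule bounded_linear.has_vector_derivative[OF bounded_linear_Re])
    then show "((\<lambda>t. Re (cnj e * f t) - norm e * G t) has_real_derivative Re (cnj e * f' x) - norm e * g x)
       (at x within {a..b})"
      by (intro DERIV_diff DERIV_cmult G x)
    have "Re (cnj e * f' x) \<le> norm e * norm (f' x)" using Re_mult_le_norm[of "cnj e" "f' x"] by simp
    also have "\<dots> \<le> norm e * g x" by (intro mult_left_mono le x) simp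
    finally show "Re (cnj e * f' x) - norm e * g x \<le> 0" by simp
  qed
  show ?thesis
  proof (cases "D = 0")
    case True
    then show ?thesis using 1[of 1] by (simp add: D_def)
  next
    case False
    have "norm D * norm D = Re (cnj D * D)"
      by (simp add: cmod_power2 power2_eq_square [symmetric])
    also have "\<dots> \<le> norm D * (G b - G a)"
      using 1[of D] by (simp add: D_def algebra_simps)
    finally show ?thesis using False by (simp add: D_def)
  qed
qed

lemma filterlim_add_const_at_top: "filterlim (\<lambda>t. a + t) at_top at_top" for a :: real
  using filterlim_tendsto_add_at_top[of "\<lambda>_. a" a at_top "\<lambda>t. t"] by (simp add: filterlim_ident)

lemma continuous_compact_bounded_above:
  fixes g :: "'a::topological_space \<Rightarrow> real"
  assumes "compact K" "continuous_on K g"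
  shows "\<exists>M. \<forall>x\<in>K. g x \<le> M"
  using continuous_attains_sup[OF assms(1) _ assms(2)] by (cases "K = {}") auto

section \<open>Cones, and the setting of the WKB approximation\<close>

definition cone :: "real \<Rightarrow> real \<Rightarrow> complex set" where
  "cone X T = {z. X < Re z \<and> \<bar>Im z\<bar> < T * Re z}"

lemma cone_add: "z \<in> cone X T \<Longrightarrow> T > 0 \<Longrightarrow> t \<ge> 0 \<Longrightarrow> z + of_real t \<in> cone X T"
  by (auto simp: cone_def algebra_simps intro: order.strict_trans2)

lemma open_cone: "open (cone X T)"
proof -
  have "cone X T = {z. X < Re z} \<inter> {z. \<bar>Im z\<bar> < T * Re z}" by (auto simp: cone_def)
  then show ?thesis by (auto intro!: open_Int open_Collect_less continuous_intros)
qed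

lemma convex_cone: "convex (cone X T)"
proof (rule convexI)
  fix x y :: complex and u v :: real
  assume x: "x \<in> cone X T" and y: "y \<in> cone X T" and uv: "0 \<le> u" "0 \<le> v" "u + v = 1"
  have *: "u * a + v * b < u * c + v * d" if "a < c" "b < d" for a b c d :: real
  proof (cases "u = 0")
    case False
    then have "u * a < u * c" "v * b \<le> v * d" using that uv by (auto intro: mult_left_mono)
    then show ?thesis by simp
  qed (use that uv in auto)
  have "X = u * X + v * X" using uv by (simp flip: distrib_right)
  also have "\<dots> < u * Re x + v * Re y" using x y by (intro *) (auto simp: cone_def)
  finally have 1: "X < Re (u *\<^sub>R x + v *\<^sub>R y)" by simp
  have "\<bar>u * Im x + v * Im y\<bar> \<le> u * \<bar>Im x\<bar> + v * \<bar>Im y\<bar>"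
    using uv by (intro order.trans[OF abs_triangle_ineq]) (simp add: abs_mult)
  also have "\<dots> < u * (T * Re x) + v * (T * Re y)" using x y by (intro *) (auto simp: cone_def)
  finally show "u *\<^sub>R x + v *\<^sub>R y \<in> cone X T"
    using 1 by (simp add: cone_def algebra_simps)
qed

text \<open>The derivative is carried along as a function of its own, so that pairs can be combined
  linearly and rotated without \<open>deriv\<close>.\<close>

definition ode :: "complex poly \<Rightarrow> complex \<Rightarrow> (complex \<Rightarrow> complex) \<Rightarrow> (complex \<Rightarrow> complex) \<Rightarrow> bool" where
  "ode p lam u u1 \<longleftrightarrow> (\<forall>z. (u has_field_derivative u1 z) (at z) \<and>
      (u1 has_field_derivative (poly p z + lam) * u z) (at z))"

lemma ode_ode_sol: "ode p lam (ode_sol (p + [:lam:]) a b) (ode_sol' (p + [:lam:]) a b)"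
  unfolding ode_def using ode_sol_DERIV ode_sol'_DERIV[of "p + [:lam:]"] by simp

lemma ode_lincomb:
  assumes "ode p lam u u1" "ode p lam v v1"
  shows "ode p lam (\<lambda>z. a * u z + b * v z) (\<lambda>z. a * u1 z + b * v1 z)"
  using assms unfolding ode_def by (auto intro!: derivative_eq_intros simp: algebra_simps)

lemma wronskian_constant:
  assumes "ode p lam u u1" "ode p lam v v1"
  shows "u z * v1 z - u1 z * v z = u 0 * v1 0 - u1 0 * v 0"
proof -
  have "((\<lambda>z. u z * v1 z - u1 z * v z) has_field_derivative 0) (at z)" for z
    using assms unfolding ode_def
    by (auto intro!: derivative_eq_intros simp: algebra_simps)
  then obtain k where "\<And>z. u z * v1 z - u1 z * v z = k"
    using has_field_derivative_zero_constant[OF convex_UNIV, of "\<lambda>z. u z * v1 z - u1 z * v z"] by auto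
  then show ?thesis by metis
qed

text \<open>This collects what the approximation needs from the potential: no branch point of the
  root, a root whose argument stays away from the imaginary axis, and derivatives that each lose one
  power of \<open>norm z\<close>. Only bounds occur, so that existence for a concrete polynomial is
  a separate matter.\<close>

locale wkb_cone =
  fixes p :: "complex poly" and m :: nat and X T c C :: real and S :: "complex \<Rightarrow> complex"
  assumes m3: "m \<ge> 3" and X1: "X \<ge> 1" and T0: "T > 0" and c0: "c > 0" and C0: "C \<ge> 0"
    and nonpos: "z \<in> cone X T \<Longrightarrow> poly p z \<notin> \<real>\<^sub>\<le>\<^sub>0"
    and low: "z \<in> cone X T \<Longrightarrow> c * norm z ^ m \<le> norm (poly p z)"
    and Re_low: "z \<in> cone X T \<Longrightarrow> c * sqrt (norm (poly p z)) \<le> Re (csqrt (poly p z))"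
    and p1: "z \<in> cone X T \<Longrightarrow> norm (poly (pderiv p) z) * norm z \<le> C * norm (poly p z)"
    and p2: "z \<in> cone X T \<Longrightarrow> norm (poly (pderiv (pderiv p)) z) * (norm z)\<^sup>2 \<le> C * norm (poly p z)"
    and S: "z \<in> cone X T \<Longrightarrow> (S has_field_derivative csqrt (poly p z)) (at z)"
begin

abbreviation "D \<equiv> cone X T"

text \<open>\<open>\<phi>\<close> is the decaying WKB approximate solution, which satisfies \<open>\<phi>'' = (p + E) \<phi>\<close>, and \<open>V\<close> is the squared
  size of \<open>(u, u1)\<close> in the frame in which the equation is diagonal up to the error \<open>b\<close>.\<close>

definition "w z = csqrt (poly p z)"
definition "b z = poly (pderiv p) z / (4 * poly p z)"
definition "\<phi> z = exp (- S z) / csqrt (w z)"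
definition "\<phi>1 z = - (w z + b z) * \<phi> z"
definition "E z = 5 * (b z)\<^sup>2 - poly (pderiv (pderiv p)) z / (4 * poly p z)"
definition "V u u1 z = (norm (w z * \<phi> z * u z + \<phi> z * u1 z))\<^sup>2 + (norm (w z * \<phi> z * u z - \<phi> z * u1 z))\<^sup>2"
definition "\<omega> u u1 z = \<phi> z * u1 z - \<phi>1 z * u z"

lemma D_Re: "z \<in> D \<Longrightarrow> 1 \<le> Re z" "z \<in> D \<Longrightarrow> X < Re z"
  using X1 by (auto simp: cone_def)

lemma D_norm: "z \<in> D \<Longrightarrow> Re z \<le> norm z" "z \<in> D \<Longrightarrow> 1 \<le> norm z"
  using D_Re(1)[of z] complex_Re_le_cmod[of z] by auto

lemma p_nz: "z \<in> D \<Longrightarrow> poly p z \<noteq> 0"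
  using nonpos[of z] by auto

lemma w_sq: "(w z)\<^sup>2 = poly p z" and norm_w: "norm (w z) = sqrt (norm (poly p z))"
  by (simp_all add: w_def)

lemma Re_w: "z \<in> D \<Longrightarrow> 0 < Re (w z)"
  using Re_low[of z] p_nz[of z] c0 unfolding w_def
  by (metis mult_pos_pos real_sqrt_gt_zero zero_less_norm_iff order_less_le_trans)

lemma w_nz: "z \<in> D \<Longrightarrow> w z \<noteq> 0" using Re_w by fastforce

lemma phi_nz: "z \<in> D \<Longrightarrow> \<phi> z \<noteq> 0" using w_nz by (simp add: \<phi>_def)

lemma w_deriv: "z \<in> D \<Longrightarrow> (w has_field_derivative 2 * b z * w z) (at z)"
proof -
  assume z: "z \<in> D"
  have "((\<lambda>z. csqrt (poly p z)) has_field_derivative inverse (2 * csqrt (poly p z)) * poly (pderiv p) z) (at z)"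
    by (rule DERIV_chain2[OF has_field_derivative_csqrt poly_DERIV]) (rule nonpos[OF z])
  moreover have "inverse (2 * csqrt (poly p z)) * poly (pderiv p) z = 2 * b z * w z"
  proof -
    have pz: "poly p z = w z * w z" using w_sq[of z] by (simp add: power2_eq_square)
    show ?thesis unfolding w_def[symmetric] using w_nz[OF z] unfolding b_def pz by (simp add: field_simps)
  qed
  ultimately show ?thesis unfolding w_def[abs_def] by (simp only:)
qed

lemma b_deriv: "z \<in> D \<Longrightarrow> (b has_field_derivative (b z)\<^sup>2 - E z) (at z)"
proof -
  assume z: "z \<in> D"
  have "((\<lambda>z. poly (pderiv p) z / (4 * poly p z)) has_field_derivative
     (poly (pderiv (pderiv p)) z * (4 * poly p z) - poly (pderiv p) z * (4 * poly (pderiv p) z)) /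
       (4 * poly p z * (4 * poly p z))) (at z)"
    using p_nz[OF z] by (intro DERIV_divide poly_DERIV DERIV_cmult) auto
  moreover have "(poly (pderiv (pderiv p)) z * (4 * poly p z) - poly (pderiv p) z * (4 * poly (pderiv p) z)) /
       (4 * poly p z * (4 * poly p z)) = (b z)\<^sup>2 - E z"
    using p_nz[OF z] by (simp add: b_def E_def power_divide field_simps power2_eq_square)
  ultimately show ?thesis unfolding b_def[abs_def] by simp
qed

lemma phi_deriv: "z \<in> D \<Longrightarrow> (\<phi> has_field_derivative \<phi>1 z) (at z)"
proof -
  assume z: "z \<in> D"
  have v: "w z \<notin> \<real>\<^sub>\<le>\<^sub>0" using Re_w[OF z] by (auto simp: complex_nonpos_Reals_iff)
  have v2: "csqrt (w z) * csqrt (w z) = w z" by (simp flip: power2_eq_square)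
  have "((\<lambda>z. csqrt (w z)) has_field_derivative inverse (2 * csqrt (w z)) * (2 * b z * w z)) (at z)"
    by (rule DERIV_chain2[OF has_field_derivative_csqrt w_deriv]) (rule v, rule z)
  moreover have "inverse (2 * csqrt (w z)) * (2 * b z * w z) = b z * csqrt (w z)"
    using w_nz[OF z] by (subst (2) v2[symmetric]) (simp add: field_simps)
  ultimately have 1: "((\<lambda>z. csqrt (w z)) has_field_derivative b z * csqrt (w z)) (at z)" by (simp only:)
  have 2: "((\<lambda>z. exp (- S z)) has_field_derivative exp (- S z) * (- w z)) (at z)"
    unfolding w_def by (rule DERIV_chain2[OF DERIV_exp DERIV_minus[OF S[OF z]]])
  have "((\<lambda>z. exp (- S z) / csqrt (w z)) has_field_derivative
     (exp (- S z) * (- w z) * csqrt (w z) - exp (- S z) * (b z * csqrt (w z))) / (csqrt (w z) * csqrt (w z))) (at z)"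
    using w_nz[OF z] by (intro DERIV_divide 1 2) auto
  moreover have "(exp (- S z) * (- w z) * csqrt (w z) - exp (- S z) * (b z * csqrt (w z))) / (csqrt (w z) * csqrt (w z)) = \<phi>1 z"
    using w_nz[OF z] by (simp add: \<phi>1_def \<phi>_def field_simps)
  ultimately show ?thesis unfolding \<phi>_def[abs_def] by simp
qed

lemma phi1_deriv: "z \<in> D \<Longrightarrow> (\<phi>1 has_field_derivative (poly p z + E z) * \<phi> z) (at z)"
proof -
  assume z: "z \<in> D"
  have "((\<lambda>z. - (w z + b z) * \<phi> z) has_field_derivative
     - (w z + b z) * \<phi>1 z + - (2 * b z * w z + ((b z)\<^sup>2 - E z)) * \<phi> z) (at z)"
    using w_deriv[OF z] b_deriv[OF z] phi_deriv[OF z]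
    by (auto intro!: derivative_eq_intros simp: algebra_simps)
  moreover have "- (w z + b z) * \<phi>1 z + - (2 * b z * w z + ((b z)\<^sup>2 - E z)) * \<phi> z = (poly p z + E z) * \<phi> z"
    unfolding \<phi>1_def w_sq[symmetric] by (simp add: algebra_simps power2_eq_square)
  ultimately show ?thesis unfolding \<phi>1_def[abs_def] by simp
qed

text \<open>Neither the equation of \<open>u\<close> nor that of \<open>\<phi>\<close> has a
  first-order term, so only the difference \<open>lam - E\<close> of the potentials survives in the
  derivative of the Wronskian.\<close>

lemma omega_deriv:
  assumes "ode p lam u u1" "z \<in> D"
  shows "(\<omega> u u1 has_field_derivative (lam - E z) * (\<phi> z * u z)) (at z)"
proof -
  have "(u has_field_derivative u1 z) (at z)" "(u1 has_field_derivative (poly p z + lam) * u z) (at z)"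
    using assms(1) by (auto simp: ode_def)
  with phi_deriv[OF assms(2)] phi1_deriv[OF assms(2)]
  have "((\<lambda>z. \<phi> z * u1 z - \<phi>1 z * u z) has_field_derivative
     (\<phi> z * ((poly p z + lam) * u z) + \<phi>1 z * u1 z) - (\<phi>1 z * u1 z + (poly p z + E z) * \<phi> z * u z)) (at z)"
    by (auto intro!: derivative_eq_intros)
  then show ?thesis unfolding \<omega>_def[abs_def] by (simp add: algebra_simps)
qed

section \<open>Bounds along horizontal rays and the limit of the Wronskian with
  \<open>\<phi>\<close>\<close>

lemma b_bound: "z \<in> D \<Longrightarrow> norm (b z) \<le> C / (4 * Re z)"
proof -
  assume z: "z \<in> D"
  have "norm (b z) \<le> C / (4 * norm z)"
  proof -
    have "0 < norm z" using D_norm(2)[OF z] by linarith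
    then show ?thesis using p1[OF z] p_nz[OF z] by (simp add: b_def norm_divide norm_mult field_simps)
  qed
  also have "\<dots> \<le> C / (4 * Re z)"
    using D_norm[OF z] D_Re[OF z] C0 by (intro divide_left_mono) (auto intro!: mult_pos_pos)
  finally show ?thesis .
qed

lemma b_bound': assumes "z \<in> D" shows "norm (b z) \<le> C / 4"
proof -
  have "C / (4 * Re z) \<le> C / (4 * 1)"
    using D_Re(1)[OF assms] C0 by (intro divide_left_mono mult_left_mono) auto
  then show ?thesis using b_bound[OF assms] by simp
qed

definition "CE = 5 * (C/4)\<^sup>2 + C / 4"

lemma CE0: "CE \<ge> 0" using C0 by (simp add: CE_def)

lemma E_bound: "z \<in> D \<Longrightarrow> norm (E z) \<le> CE"
proof -
  assume z: "z \<in> D"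
  have 1: "norm (5 * (b z)\<^sup>2) \<le> 5 * (C/4)\<^sup>2"
    using b_bound'[OF z] by (simp add: norm_mult norm_power power_mono)
  have "norm (poly (pderiv (pderiv p)) z) * 1 \<le> norm (poly (pderiv (pderiv p)) z) * (norm z)\<^sup>2"
    using D_norm(2)[OF z] by (intro mult_left_mono) auto
  also note p2[OF z]
  finally have "norm (poly (pderiv (pderiv p)) z / (4 * poly p z)) \<le> C / 4"
    using p_nz[OF z] by (simp add: norm_divide norm_mult field_simps)
  then show ?thesis unfolding E_def CE_def using 1 by (intro order.trans[OF norm_triangle_ineq4] add_mono)
qed

text \<open>Here \<open>m \<ge> 3\<close> enters: the exponent \<open>3/2\<close> exceeds 1, so the
  rates have finite integrals along horizontal rays, with tails of order
  \<open>x powr (-1/2)\<close>.\<close>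

lemma inverse_norm_w: "z \<in> D \<Longrightarrow> 1 / norm (w z) \<le> 1 / sqrt c * Re z powr (-3/2)"
proof -
  assume z: "z \<in> D"
  have "Re z powr 3 = Re z ^ 3" using D_Re(1)[OF z] by (simp add: powr_numeral)
  also have "\<dots> \<le> norm z ^ 3" using D_norm[OF z] D_Re(1)[OF z] by (intro power_mono) auto
  also have "\<dots> \<le> norm z ^ m" using D_norm[OF z] m3 by (intro power_increasing) auto
  finally have "c * Re z powr 3 \<le> norm (poly p z)"
    using low[OF z] c0 by (meson mult_left_mono order.trans less_imp_le)
  then have "sqrt c * sqrt (Re z powr 3) \<le> norm (w z)"
    unfolding norm_w by (metis real_sqrt_le_iff real_sqrt_mult)
  moreover have "sqrt (Re z powr 3) = Re z powr (3/2)" by (simp add: powr_half_sqrt [symmetric] powr_powr)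
  moreover have "0 < sqrt c * Re z powr (3/2)" using c0 D_Re(1)[OF z] by simp
  ultimately have "1 / norm (w z) \<le> 1 / (sqrt c * Re z powr (3/2))"
    by (intro divide_left_mono) (auto intro!: mult_pos_pos)
  also have "\<dots> = 1 / sqrt c * Re z powr (-3/2)" by (simp add: powr_minus field_simps)
  finally show ?thesis .
qed

definition "C1 L = (C\<^sup>2 / (16 * c) + L) / sqrt c"

lemma growth_rate_bound:
  assumes "z \<in> D" "norm lam \<le> L"
  shows "(norm (b z))\<^sup>2 / Re (w z) + norm lam / norm (w z) \<le> C1 L * Re z powr (-3/2)"
proof -
  have w: "0 < norm (w z)" using w_nz[OF assms(1)] by simp
  have "(norm (b z))\<^sup>2 / Re (w z) \<le> (C/4)\<^sup>2 / (c * norm (w z))"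
    using Re_low[OF assms(1)] b_bound'[OF assms(1)] c0 w
    by (intro frac_le power_mono) (auto simp: w_def norm_w[unfolded w_def])
  also have "(C/4)\<^sup>2 / (c * norm (w z)) = C\<^sup>2 / (16 * c) * (1 / norm (w z))"
    by (simp add: power_divide)
  moreover have "norm lam / norm (w z) \<le> L * (1 / norm (w z))"
    using assms(2) w by (simp add: divide_right_mono)
  ultimately have "(norm (b z))\<^sup>2 / Re (w z) + norm lam / norm (w z) \<le> (C\<^sup>2 / (16 * c) + L) * (1 / norm (w z))"
    unfolding distrib_right by linarith
  also have "\<dots> \<le> (C\<^sup>2 / (16 * c) + L) * (1 / sqrt c * Re z powr (-3/2))"
    using c0 assms(2) norm_ge_zero[of lam] by (intro mult_left_mono inverse_norm_w assms(1) add_nonneg_nonneg) (auto simp del: norm_ge_zero)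
  finally show ?thesis by (simp add: C1_def)
qed

lemma horizontal_deriv:
  assumes "(F has_field_derivative F') (at (z + of_real t))"
  shows "((\<lambda>t. F (z + of_real t)) has_vector_derivative F') (at t within A)"
proof -
  have "((\<lambda>t. z + of_real t) has_vector_derivative 1) (at t within A)"
    by (auto intro!: derivative_eq_intros)
  from field_vector_diff_chain_within[OF this has_field_derivative_at_within[OF assms]]
  show ?thesis by (simp add: o_def)
qed

lemma powr_antideriv:
  assumes "x + t > 0"
  shows "((\<lambda>t. - (2 * K) * (x + t) powr (-1/2)) has_real_derivative K * (x + t) powr (-3/2)) (at t within A)"
  using assms by (auto intro!: derivative_eq_intros)

text \<open>Because \<open>Re z \<ge> 1\<close>, the total rate along the ray is at most
  \<open>2 * C1 L\<close> wherever the ray starts; no solution outgrows the growing WKB solution by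
  more than a constant factor.\<close>

lemma V_growth:
  assumes u: "ode p lam u u1" and z: "z \<in> D" and L: "norm lam \<le> L" and "0 \<le> t"
  shows "V u u1 (z + of_real t) \<le> V u u1 z * exp (2 * C1 L)"
proof -
  have C1: "0 \<le> C1 L" using c0 norm_ge_zero[of lam] L unfolding C1_def by (intro divide_nonneg_nonneg add_nonneg_nonneg) (auto simp del: norm_ge_zero)
  have zt: "z + of_real s \<in> D" if "s \<in> {0..t}" for s using cone_add[OF z T0] that by auto
  define G where "G = (\<lambda>t. - (2 * C1 L) * (Re z + t) powr (-1/2))"
  have "V u u1 (z + of_real t) \<le> V u u1 (z + of_real 0) * exp (G t - G 0)"
    unfolding V_def
  proof (rule wkb_growth[OF \<open>0 \<le> t\<close>, where u = "\<lambda>t. u (z + of_real t)" and ?u1.0 = "\<lambda>t. u1 (z + of_real t)"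
        and P = "\<lambda>t. w (z + of_real t) * \<phi> (z + of_real t)" and R = "\<lambda>t. \<phi> (z + of_real t)"
        and w = "\<lambda>t. w (z + of_real t)" and b = "\<lambda>t. b (z + of_real t)" and L = lam and G = G
        and g = "\<lambda>t. C1 L * (Re z + t) powr (-3/2)"])
    fix s assume s: "s \<in> {0..t}"
    note zs = zt[OF s]
    show "((\<lambda>t. u (z + of_real t)) has_vector_derivative u1 (z + of_real s)) (at s within {0..t})"
      using u by (intro horizontal_deriv) (auto simp: ode_def)
    show "((\<lambda>t. u1 (z + of_real t)) has_vector_derivative ((w (z + of_real s))\<^sup>2 + lam) * u (z + of_real s)) (at s within {0..t})"
      unfolding w_sq using u by (intro horizontal_deriv) (auto simp: ode_def)
    show "((\<lambda>t. \<phi> (z + of_real t)) has_vector_derivative (- w (z + of_real s) - b (z + of_real s)) * \<phi> (z + of_real s)) (at s within {0..t})"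
      by (intro horizontal_deriv DERIV_cong[OF phi_deriv[OF zs]]) (simp add: \<phi>1_def algebra_simps)
    show "((\<lambda>t. w (z + of_real t) * \<phi> (z + of_real t)) has_vector_derivative (b (z + of_real s) - w (z + of_real s)) * (w (z + of_real s) * \<phi> (z + of_real s))) (at s within {0..t})"
    proof (rule horizontal_deriv)
      show "((\<lambda>z. w z * \<phi> z) has_field_derivative (b (z + of_real s) - w (z + of_real s)) * (w (z + of_real s) * \<phi> (z + of_real s))) (at (z + of_real s))"
        by (rule DERIV_cong[OF DERIV_mult[OF w_deriv[OF zs] phi_deriv[OF zs]]]) (simp add: \<phi>1_def algebra_simps)
    qed
    show "0 < Re (w (z + of_real s))" by (rule Re_w[OF zs])
    show "(norm (b (z + of_real s)))\<^sup>2 / Re (w (z + of_real s)) + norm lam / norm (w (z + of_real s)) \<le> C1 L * (Re z + s) powr (-3/2)"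
      using growth_rate_bound[OF zs L] by simp
    show "(G has_real_derivative C1 L * (Re z + s) powr (-3/2)) (at s within {0..t})"
      unfolding G_def using D_Re(1)[OF zs] by (intro powr_antideriv) simp
  qed simp
  also have "\<dots> \<le> V u u1 z * exp (2 * C1 L)"
  proof -
    have "Re z powr (-1/2) \<le> Re z powr 0" using D_Re(1)[OF z] by (intro powr_mono) auto
    then have "Re z powr (-1/2) \<le> 1" using D_Re(1)[OF z] by simp
    then have "2 * C1 L * Re z powr (-1/2) \<le> 2 * C1 L" using C1 by (simp add: mult_left_le)
    moreover have "0 \<le> 2 * C1 L * (Re z + t) powr (-1/2)" using C1 by simp
    ultimately have "G t - G 0 \<le> 2 * C1 L" by (simp add: G_def)
    then show ?thesis by (intro mult_mono) (auto simp: V_def)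
  qed
  finally show ?thesis .
qed

lemma phi_u_bound: 
  assumes "z \<in> D"
  shows "norm (\<phi> z * u z) \<le> sqrt (V u u1 z) * (1 / norm (w z))"
proof -
  define s d where "s = w z * \<phi> z * u z + \<phi> z * u1 z" "d = w z * \<phi> z * u z - \<phi> z * u1 z"
  have "norm s \<le> sqrt (V u u1 z)" "norm d \<le> sqrt (V u u1 z)"
    by (rule real_le_rsqrt; simp add: V_def s_d_def)+
  moreover have "2 * (w z * \<phi> z * u z) = s + d" by (simp add: s_d_def)
  then have "2 * norm (w z * \<phi> z * u z) \<le> norm s + norm d"
    by (metis norm_mult norm_numeral norm_triangle_ineq)
  ultimately have "norm (w z) * norm (\<phi> z * u z) \<le> sqrt (V u u1 z)"
    by (simp add: norm_mult mult_ac)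
  then show ?thesis using w_nz[OF assms] by (simp add: field_simps)
qed

definition "C2 L = (L + CE) * exp (C1 L) / sqrt c"

lemma C2_nonneg: "L \<ge> 0 \<Longrightarrow> C2 L \<ge> 0" using CE0 c0 by (simp add: C2_def)

lemma omega_deriv_bound:
  assumes u: "ode p lam u u1" and z: "z \<in> D" and L: "norm lam \<le> L" and t: "0 \<le> t"
  shows "norm ((lam - E (z + of_real t)) * (\<phi> (z + of_real t) * u (z + of_real t)))
    \<le> C2 L * sqrt (V u u1 z) * (Re z + t) powr (-3/2)"
proof -
  let ?z = "z + of_real t"
  have zt: "?z \<in> D" by (rule cone_add[OF z T0 t])
  have "norm (\<phi> ?z * u ?z) \<le> sqrt (V u u1 ?z) * (1 / norm (w ?z))" by (rule phi_u_bound[OF zt])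
  also have "\<dots> \<le> sqrt (V u u1 z * exp (2 * C1 L)) * (1 / sqrt c * Re ?z powr (-3/2))"
    using V_growth[OF u z L t] inverse_norm_w[OF zt] by (intro mult_mono) (auto simp: V_def)
  also have "sqrt (V u u1 z * exp (2 * C1 L)) = sqrt (V u u1 z) * exp (C1 L)"
    by (simp add: real_sqrt_mult exp_double)
  finally have 1: "norm (\<phi> ?z * u ?z) \<le> sqrt (V u u1 z) * exp (C1 L) * (1 / sqrt c * (Re z + t) powr (-3/2))" by simp
  have "norm (lam - E ?z) \<le> L + CE" using L E_bound[OF zt] by (intro order.trans[OF norm_triangle_ineq4]) auto
  with 1 have "norm ((lam - E ?z) * (\<phi> ?z * u ?z)) \<le> (L + CE) * (sqrt (V u u1 z) * exp (C1 L) * (1 / sqrt c * (Re z + t) powr (-3/2)))"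
    unfolding norm_mult[of "lam - E ?z"] using order.trans[OF norm_ge_zero L] CE0 by (intro mult_mono) auto
  then show ?thesis by (simp add: C2_def mult_ac)
qed

lemma omega_cauchy:
  assumes u: "ode p lam u u1" and z: "z \<in> D" and L: "norm lam \<le> L" and t: "0 \<le> s" "s \<le> t"
  shows "norm (\<omega> u u1 (z + of_real t) - \<omega> u u1 (z + of_real s)) \<le> 2 * C2 L * sqrt (V u u1 z) * (Re z + s) powr (-1/2)"
proof -
  define K where "K = C2 L * sqrt (V u u1 z)"
  have L0: "0 \<le> L" using L norm_ge_zero[of lam] by linarith
  define G where "G = (\<lambda>t. - (2 * K) * (Re z + t) powr (-1/2))"
  have "norm (\<omega> u u1 (z + of_real t) - \<omega> u u1 (z + of_real s)) \<le> G t - G s"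
  proof (rule path_bound[OF t(2), where f = "\<lambda>t. \<omega> u u1 (z + of_real t)" and g = "\<lambda>t. K * (Re z + t) powr (-3/2)"])
    fix x assume x: "x \<in> {s..t}"
    then have zx: "z + of_real x \<in> D" using t cone_add[OF z T0] by auto
    show "((\<lambda>t. \<omega> u u1 (z + of_real t)) has_vector_derivative (lam - E (z + of_real x)) * (\<phi> (z + of_real x) * u (z + of_real x))) (at x within {s..t})"
      by (rule horizontal_deriv[OF omega_deriv[OF u zx]])
    show "(G has_real_derivative K * (Re z + x) powr (-3/2)) (at x within {s..t})"
      unfolding G_def using D_Re(1)[OF zx] by (intro powr_antideriv) simp
    show "norm ((lam - E (z + of_real x)) * (\<phi> (z + of_real x) * u (z + of_real x))) \<le> K * (Re z + x) powr (-3/2)"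
      unfolding K_def using x t by (intro omega_deriv_bound[OF u z L]) auto
  qed
  also have "\<dots> \<le> 2 * K * (Re z + s) powr (-1/2)"
    using C2_nonneg[OF L0] by (simp add: G_def K_def V_def)
  finally show ?thesis by (simp add: K_def mult_ac)
qed

definition "x0 = X + 1"

lemma x0_D: "of_real x0 \<in> D" using X1 T0 by (simp add: x0_def cone_def)

text \<open>The fixed starting point and the integer steps only serve to name a value;
  \<open>Om_limit\<close> shows that each horizontal ray in the cone leads to the same
  limit.\<close>

definition "Om u u1 = lim (\<lambda>n. \<omega> u u1 (of_real x0 + of_real (real n)))"

lemma powr_tendsto_0: "((\<lambda>t. K * (a + t) powr (-1/2)) \<longlongrightarrow> 0) at_top" for K a :: real
proof -
  have "filterlim (\<lambda>t. a + t) at_top at_top" by (rule filterlim_add_const_at_top)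
  then have "((\<lambda>t. (a + t) powr (-1/2)) \<longlongrightarrow> 0) at_top" by (intro tendsto_neg_powr) auto
  from tendsto_mult_right_zero[OF this] show ?thesis by simp
qed

lemma Om_converges:
  assumes u: "ode p lam u u1"
  shows "(\<lambda>n. \<omega> u u1 (of_real x0 + of_real (real n))) \<longlonglongrightarrow> Om u u1"
proof -
  define K where "K = 2 * C2 (norm lam) * sqrt (V u u1 (of_real x0))"
  have "Cauchy (\<lambda>n. \<omega> u u1 (of_real x0 + of_real (real n)))"
  proof (rule metric_CauchyI)
    fix e :: real assume "e > 0"
    have "(\<lambda>n. K * (x0 + real n) powr (-1/2)) \<longlonglongrightarrow> 0"
      by (rule filterlim_compose[OF powr_tendsto_0 filterlim_real_sequentially])
    then have "eventually (\<lambda>n. K * (x0 + real n) powr (-1/2) < e / 2) sequentially"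
      using \<open>e > 0\<close> by (intro order_tendstoD(2)[where y = 0]) auto
    then obtain N where N: "K * (x0 + real N) powr (-1/2) < e / 2" by (auto simp: eventually_at_top_linorder)
    have bd: "dist (\<omega> u u1 (of_real x0 + of_real (real n))) (\<omega> u u1 (of_real x0 + of_real (real N))) < e / 2" if "n \<ge> N" for n
      using omega_cauchy[OF u x0_D order.refl, of "real N" "real n"] that N by (simp add: dist_norm K_def)
    show "\<exists>M. \<forall>m\<ge>M. \<forall>n\<ge>M. dist (\<omega> u u1 (of_real x0 + of_real (real m))) (\<omega> u u1 (of_real x0 + of_real (real n))) < e"
      using dist_triangle_half_l[OF bd bd] by blast
  qed
  then show ?thesis unfolding Om_def by (simp add: Cauchy_convergent_iff convergent_LIMSEQ_iff)
qed

lemma Om_real: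
  assumes u: "ode p lam u u1" and L: "norm lam \<le> L" and t: "t \<ge> 0"
  shows "norm (\<omega> u u1 (of_real x0 + of_real t) - Om u u1) \<le> 2 * C2 L * sqrt (V u u1 (of_real x0)) * (x0 + t) powr (-1/2)"
proof -
  have "norm (Om u u1 - \<omega> u u1 (of_real x0 + of_real t)) \<le> 2 * C2 L * sqrt (V u u1 (of_real x0)) * (x0 + t) powr (-1/2)"
  proof (rule Lim_norm_ubound[where net = sequentially])
    show "(\<lambda>n. \<omega> u u1 (of_real x0 + of_real (real n)) - \<omega> u u1 (of_real x0 + of_real t)) \<longlonglongrightarrow> Om u u1 - \<omega> u u1 (of_real x0 + of_real t)"
      by (intro tendsto_intros Om_converges[OF u])
    have "eventually (\<lambda>n. t \<le> real n) sequentially"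
      using filterlim_real_sequentially by (auto simp: filterlim_at_top)
    then show "\<forall>\<^sub>F n in sequentially. norm (\<omega> u u1 (of_real x0 + of_real (real n)) - \<omega> u u1 (of_real x0 + of_real t)) \<le> 2 * C2 L * sqrt (V u u1 (of_real x0)) * (x0 + t) powr (-1/2)"
    proof eventually_elim
      case (elim n)
      then show ?case using omega_cauchy[OF u x0_D L t, of "real n"] by simp
    qed
  qed simp
  then show ?thesis by (simp add: norm_minus_commute)
qed

lemma V_continuous: 
  assumes u: "ode p lam u u1"
  shows "continuous_on D (V u u1)"
proof -
  have "continuous_on D w" "continuous_on D \<phi>"
    using w_deriv phi_deriv by (meson DERIV_isCont continuous_at_imp_continuous_on)+
  moreover have "continuous_on D u" "continuous_on D u1"
    using u unfolding ode_def by (meson DERIV_isCont continuous_at_imp_continuous_on)+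
  ultimately show ?thesis unfolding V_def[abs_def] by (intro continuous_intros)
qed

text \<open>The ray through \<open>z\<close> and the real axis are joined by vertical segments of
  fixed length \<open>\<bar>h\<bar>\<close>, on which the derivative of \<open>\<omega>\<close>
  tends to 0.\<close>

lemma Om_limit:
  assumes u: "ode p lam u u1" and z: "z \<in> D"
  shows "((\<lambda>t. \<omega> u u1 (z + of_real t)) \<longlongrightarrow> Om u u1) at_top"
proof -
  let ?L = "norm lam"
  have L0: "0 \<le> ?L" by simp
  define x h where "x = Re z" "h = Im z"
  have hx: "of_real x + of_real a * (\<i> * of_real h) \<in> D" if "a \<in> {0..1}" for a :: real
  proof -
    have "\<bar>a * h\<bar> \<le> \<bar>h\<bar>" using that by (auto simp: abs_mult intro: mult_left_le_one_le)
    then show ?thesis using z by (auto simp: cone_def x_h_def intro: order.strict_trans1)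
  qed
  have "continuous_on {0..1} (\<lambda>a::real. V u u1 (of_real x + of_real a * (\<i> * of_real h)))"
    by (intro continuous_on_compose2[OF V_continuous[OF u]] continuous_intros) (use hx in blast)
  then obtain M where M: "\<And>a. a \<in> {0..1} \<Longrightarrow> V u u1 (of_real x + of_real a * (\<i> * of_real h)) \<le> M"
    using continuous_compact_bounded_above[OF compact_Icc, of 0 "1::real" "\<lambda>a. V u u1 (of_real x + of_real a * (\<i> * of_real h))"] by blast
  define K where "K = C2 ?L * sqrt M"
  have seg: "norm (\<omega> u u1 (z + of_real t) - \<omega> u u1 (of_real (x + t))) \<le> K * (x + t) powr (-3/2) * \<bar>h\<bar>" if t: "t \<ge> 0" for t
  proof -
    define Q where "Q = closed_segment (of_real (x + t)) (z + of_real t)"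
    have Qz: "\<exists>a\<in>{0..1}. y = (of_real x + of_real a * (\<i> * of_real h)) + of_real t" if yQ: "y \<in> Q" for y
    proof -
      obtain a where a: "a \<in> {0..1}" "y = (1 - a) *\<^sub>R of_real (x + t) + a *\<^sub>R (z + of_real t)"
        using yQ unfolding Q_def by (auto simp: closed_segment_def simp del: of_real_add)
      have "y = (of_real x + of_real a * (\<i> * of_real h)) + of_real t"
        unfolding a(2) by (simp add: complex_eq_iff x_h_def algebra_simps)
      then show ?thesis using a by blast
    qed
    have "norm (\<omega> u u1 (z + of_real t) - \<omega> u u1 (of_real (x + t))) \<le> K * (x + t) powr (-3/2) * norm ((z + of_real t) - of_real (x + t))"
    proof (rule field_differentiable_bound[where S = Q])
      fix y assume "y \<in> Q"
      then obtain a where a: "a \<in> {0..1}" and y: "y = (of_real x + of_real a * (\<i> * of_real h)) + of_real t"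
        using Qz by blast
      have yD: "y \<in> D" unfolding y by (rule cone_add[OF hx[OF a] T0 t])
      show "(\<omega> u u1 has_field_derivative (lam - E y) * (\<phi> y * u y)) (at y within Q)"
        by (rule has_field_derivative_at_within[OF omega_deriv[OF u yD]])
      have "norm ((lam - E y) * (\<phi> y * u y)) \<le> C2 ?L * sqrt (V u u1 (of_real x + of_real a * (\<i> * of_real h))) * (x + t) powr (-3/2)"
        unfolding y using omega_deriv_bound[OF u hx[OF a] order.refl t] by simp
      also have "\<dots> \<le> K * (x + t) powr (-3/2)"
        unfolding K_def using M[OF a] C2_nonneg[OF L0] by (intro mult_right_mono mult_left_mono) auto
      finally show "norm ((lam - E y) * (\<phi> y * u y)) \<le> K * (x + t) powr (-3/2)" .
    qed (auto simp: Q_def)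
    moreover have "norm ((z + of_real t) - of_real (x + t)) = \<bar>h\<bar>"
    proof -
      have "(z + of_real t) - of_real (x + t) = \<i> * of_real h" by (simp add: complex_eq_iff x_h_def)
      then show ?thesis by (simp add: norm_mult)
    qed
    ultimately show ?thesis by simp
  qed
  have lim1: "((\<lambda>t. \<omega> u u1 (of_real (x + t))) \<longlongrightarrow> Om u u1) at_top"
  proof -
    have "((\<lambda>t. \<omega> u u1 (of_real x0 + of_real t) - Om u u1) \<longlongrightarrow> 0) at_top"
    proof (rule Lim_null_comparison[OF _ powr_tendsto_0])
      show "\<forall>\<^sub>F t in at_top. norm (\<omega> u u1 (of_real x0 + of_real t) - Om u u1) \<le> 2 * C2 ?L * sqrt (V u u1 (of_real x0)) * (x0 + t) powr (-1/2)"
        using eventually_ge_at_top[of 0] by eventually_elim (rule Om_real[OF u order.refl])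
    qed
    then have "((\<lambda>t. \<omega> u u1 (of_real x0 + of_real t)) \<longlongrightarrow> Om u u1) at_top"
      by (rule Lim_transform[OF tendsto_const, rotated, THEN tendsto_cong_limit]) simp_all
    moreover have "filterlim (\<lambda>t. (x - x0) + t) at_top at_top" by (rule filterlim_add_const_at_top)
    ultimately have "((\<lambda>t. \<omega> u u1 (of_real x0 + of_real ((x - x0) + t))) \<longlongrightarrow> Om u u1) at_top"
      by (rule filterlim_compose)
    then show ?thesis by (simp add: algebra_simps)
  qed
  have "((\<lambda>t. \<omega> u u1 (z + of_real t) - \<omega> u u1 (of_real (x + t))) \<longlongrightarrow> 0) at_top"
  proof (rule Lim_null_comparison)
    have "filterlim (\<lambda>t. x + t) at_top at_top" by (rule filterlim_add_const_at_top)
    then have "((\<lambda>t. (x + t) powr (-3/2)) \<longlongrightarrow> 0) at_top" by (intro tendsto_neg_powr) auto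
    then show "((\<lambda>t. K * (x + t) powr (-3/2) * \<bar>h\<bar>) \<longlongrightarrow> 0) at_top"
      by (intro tendsto_mult_left_zero tendsto_mult_right_zero)
    show "\<forall>\<^sub>F t in at_top. norm (\<omega> u u1 (z + of_real t) - \<omega> u u1 (of_real (x + t))) \<le> K * (x + t) powr (-3/2) * \<bar>h\<bar>"
      using eventually_ge_at_top[of 0] by eventually_elim (rule seg)
  qed
  from tendsto_add[OF this lim1] show ?thesis by simp
qed

lemma Om_bound:
  assumes u: "ode p lam u u1" and z: "z \<in> D"
  shows "norm (Om u u1 - \<omega> u u1 z) \<le> 2 * C2 (norm lam) * sqrt (V u u1 z) * Re z powr (-1/2)"
proof (rule Lim_norm_ubound[where net = at_top])
  show "((\<lambda>t. \<omega> u u1 (z + of_real t) - \<omega> u u1 z) \<longlongrightarrow> Om u u1 - \<omega> u u1 z) at_top"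
    by (intro tendsto_intros Om_limit[OF u z])
  show "\<forall>\<^sub>F t in at_top. norm (\<omega> u u1 (z + of_real t) - \<omega> u u1 z) \<le> 2 * C2 (norm lam) * sqrt (V u u1 z) * Re z powr (-1/2)"
    using eventually_ge_at_top[of 0]
  proof eventually_elim
    case (elim t)
    then show ?case using omega_cauchy[OF u z order.refl, of 0 t] by simp
  qed
qed simp

lemma Om_lincomb:
  assumes u: "ode p lam u u1" and v: "ode p lam v v1"
  shows "Om (\<lambda>z. a * u z + d * v z) (\<lambda>z. a * u1 z + d * v1 z) = a * Om u u1 + d * Om v v1"
proof -
  have "(\<lambda>n. a * \<omega> u u1 (of_real x0 + of_real (real n)) + d * \<omega> v v1 (of_real x0 + of_real (real n))) \<longlonglongrightarrow> a * Om u u1 + d * Om v v1"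
    by (intro tendsto_intros Om_converges[OF u] Om_converges[OF v])
  then have "(\<lambda>n. \<omega> (\<lambda>z. a * u z + d * v z) (\<lambda>z. a * u1 z + d * v1 z) (of_real x0 + of_real (real n))) \<longlonglongrightarrow> a * Om u u1 + d * Om v v1"
    by (simp add: \<omega>_def algebra_simps)
  then show ?thesis using Om_converges[OF ode_lincomb[OF u v]] LIMSEQ_unique by blast
qed

end

section \<open>The subdominant solution and its asymptotics in the cone\<close>

context wkb_cone
begin

definition "A lam = ode_sol (p + [:lam:]) 1 0"
definition "A1 lam = ode_sol' (p + [:lam:]) 1 0"
definition "B lam = ode_sol (p + [:lam:]) 0 1"
definition "B1 lam = ode_sol' (p + [:lam:]) 0 1"

lemma ode_AB: "ode p lam (A lam) (A1 lam)" "ode p lam (B lam) (B1 lam)"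
  unfolding A_def A1_def B_def B1_def by (rule ode_ode_sol)+

lemma wronskian_AB: "A lam z * B1 lam z - A1 lam z * B lam z = 1"
  by (subst wronskian_constant[OF ode_AB]) (simp add: A_def A1_def B_def B1_def)

text \<open>\<open>Om u u1\<close> measures the dominant component of \<open>u\<close> at infinity; \<open>f\<close> is the combination for which it vanishes.\<close>

definition "f lam z = Om (B lam) (B1 lam) * A lam z - Om (A lam) (A1 lam) * B lam z"
definition "f1 lam z = Om (B lam) (B1 lam) * A1 lam z - Om (A lam) (A1 lam) * B1 lam z"

lemma ode_f: "ode p lam (f lam) (f1 lam)"
  using ode_lincomb[OF ode_AB, of lam "Om (B lam) (B1 lam)" "- Om (A lam) (A1 lam)"]
  by (simp add: f_def[abs_def] f1_def[abs_def])

lemma f_0: "f lam 0 = Om (B lam) (B1 lam)" "f1 lam 0 = - Om (A lam) (A1 lam)"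
  by (simp_all add: f_def f1_def A_def A1_def B_def B1_def)

lemma Om_holomorphic:
  assumes u: "\<And>lam. ode p lam (u lam) (u1 lam)"
    and hol: "\<And>z. (\<lambda>lam. u lam z) holomorphic_on UNIV" "\<And>z. (\<lambda>lam. u1 lam z) holomorphic_on UNIV"
  shows "(\<lambda>lam. Om (u lam) (u1 lam)) holomorphic_on UNIV"
proof (rule holomorphic_uniform_sequence[where f = "\<lambda>n lam. \<omega> (u lam) (u1 lam) (of_real x0 + of_real (real n))"])
  show "(\<lambda>lam. \<omega> (u lam) (u1 lam) (of_real x0 + of_real (real n))) holomorphic_on UNIV" for n
    unfolding \<omega>_def by (intro holomorphic_intros hol)
  fix lam0 :: complex
  define L where "L = norm lam0 + 1"
  have "continuous_on UNIV (\<lambda>lam. V (u lam) (u1 lam) (of_real x0))"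
    unfolding V_def by (intro continuous_intros holomorphic_on_imp_continuous_on hol)
  then have "continuous_on (cball lam0 1) (\<lambda>lam. V (u lam) (u1 lam) (of_real x0))"
    by (rule continuous_on_subset) simp
  then obtain M where M: "\<And>lam. lam \<in> cball lam0 1 \<Longrightarrow> V (u lam) (u1 lam) (of_real x0) \<le> M"
    using continuous_compact_bounded_above[OF compact_cball] by blast
  have L: "norm lam \<le> L" if "lam \<in> cball lam0 1" for lam
    using that norm_triangle_ineq2[of lam lam0] by (simp add: L_def dist_norm norm_minus_commute)
  define K where "K = 2 * C2 L * sqrt M"
  have "uniform_limit (cball lam0 1) (\<lambda>n lam. \<omega> (u lam) (u1 lam) (of_real x0 + of_real (real n)))
     (\<lambda>lam. Om (u lam) (u1 lam)) sequentially"
  proof (rule uniform_limitI)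
    fix e :: real assume "e > 0"
    have "(\<lambda>n. K * (x0 + real n) powr (-1/2)) \<longlonglongrightarrow> 0"
      by (rule filterlim_compose[OF powr_tendsto_0 filterlim_real_sequentially])
    then have "eventually (\<lambda>n. K * (x0 + real n) powr (-1/2) < e) sequentially"
      using \<open>e > 0\<close> by (rule order_tendstoD(2))
    then show "\<forall>\<^sub>F n in sequentially. \<forall>lam\<in>cball lam0 1.
       dist (\<omega> (u lam) (u1 lam) (of_real x0 + of_real (real n))) (Om (u lam) (u1 lam)) < e"
    proof eventually_elim
      case (elim n)
      show ?case
      proof
        fix lam assume lam: "lam \<in> cball lam0 1"
        have "0 \<le> C2 L" by (rule C2_nonneg) (simp add: L_def)
        have "dist (\<omega> (u lam) (u1 lam) (of_real x0 + of_real (real n))) (Om (u lam) (u1 lam))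
           \<le> 2 * C2 L * sqrt (V (u lam) (u1 lam) (of_real x0)) * (x0 + real n) powr (-1/2)"
          unfolding dist_norm by (rule Om_real[OF u L[OF lam]]) simp
        also have "\<dots> \<le> K * (x0 + real n) powr (-1/2)"
          unfolding K_def using M[OF lam] \<open>0 \<le> C2 L\<close> by (intro mult_right_mono mult_left_mono) auto
        finally show "dist (\<omega> (u lam) (u1 lam) (of_real x0 + of_real (real n))) (Om (u lam) (u1 lam)) < e"
          using elim by simp
      qed
    qed
  qed
  then show "\<exists>d>0. cball lam0 d \<subseteq> UNIV \<and> uniform_limit (cball lam0 d)
     (\<lambda>n lam. \<omega> (u lam) (u1 lam) (of_real x0 + of_real (real n))) (\<lambda>lam. Om (u lam) (u1 lam)) sequentially"
    by (intro exI[of _ 1]) auto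
qed auto

lemma f_holomorphic: "(\<lambda>lam. f lam 0) holomorphic_on UNIV" "(\<lambda>lam. f1 lam 0) holomorphic_on UNIV"
  unfolding f_0
  by (intro holomorphic_on_minus Om_holomorphic ode_AB,
      (simp_all add: A_def A1_def B_def B1_def ode_ode_sol ode_sol_holomorphic_param ode_sol'_holomorphic_param))+

definition "C3 lam = 2 * C2 (norm lam) * sqrt 2"

text \<open>A duality replaces the analysis of \<open>f\<close>. For fixed \<open>z\<close>, the
  solution with \<open>u z = 0\<close> and \<open>u1 z = 1\<close> has
  \<open>\<omega> = \<phi> z\<close> at \<open>z\<close>, while by linearity its \<open>Om\<close>
  is precisely \<open>f lam z\<close>. So \<open>f - \<phi>\<close> is the distance of
  \<open>\<omega>\<close> from its limit, and \<open>V\<close> at \<open>z\<close> is explicit. The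
  data \<open>-1\<close> and \<open>0\<close> give \<open>f1\<close> in the same way.\<close>

lemma f_bounds:
  assumes z: "z \<in> D"
  shows "norm (f lam z - \<phi> z) \<le> C3 lam * norm (\<phi> z) * Re z powr (-1/2)"
    and "norm (f1 lam z - \<phi>1 z) \<le> C3 lam * norm (w z * \<phi> z) * Re z powr (-1/2)"
proof -
  define u where "u = (\<lambda>a d y. a * B lam y + d * A lam y)"
  define u1 where "u1 = (\<lambda>a d y. a * B1 lam y + d * A1 lam y)"
  have u: "ode p lam (u a d) (u1 a d)" for a d
    unfolding u_def u1_def by (rule ode_lincomb[OF ode_AB(2,1)])
  have Om: "Om (u a d) (u1 a d) = a * Om (B lam) (B1 lam) + d * Om (A lam) (A1 lam)" for a d
    unfolding u_def u1_def by (rule Om_lincomb[OF ode_AB(2,1)])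
  define a d where "a = A lam z" "d = - B lam z"
  have "u a d z = 0" "u1 a d z = 1"
    using wronskian_AB[of lam z] by (simp_all add: u_def u1_def a_d_def algebra_simps)
  then have "\<omega> (u a d) (u1 a d) z = \<phi> z" "V (u a d) (u1 a d) z = 2 * (norm (\<phi> z))\<^sup>2"
    by (simp_all add: \<omega>_def V_def)
  moreover have "Om (u a d) (u1 a d) = f lam z" by (simp add: Om a_d_def f_def algebra_simps)
  ultimately show "norm (f lam z - \<phi> z) \<le> C3 lam * norm (\<phi> z) * Re z powr (-1/2)"
    using Om_bound[OF u z, of a d] by (simp add: C3_def real_sqrt_mult)
  define a d where "a = A1 lam z" "d = - B1 lam z"
  have "u a d z = -1" "u1 a d z = 0"
    using wronskian_AB[of lam z] by (simp_all add: u_def u1_def a_d_def algebra_simps)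
  then have "\<omega> (u a d) (u1 a d) z = \<phi>1 z" "V (u a d) (u1 a d) z = 2 * (norm (w z * \<phi> z))\<^sup>2"
    by (simp_all add: \<omega>_def V_def)
  moreover have "Om (u a d) (u1 a d) = f1 lam z" by (simp add: Om a_d_def f1_def algebra_simps)
  ultimately show "norm (f1 lam z - \<phi>1 z) \<le> C3 lam * norm (w z * \<phi> z) * Re z powr (-1/2)"
    using Om_bound[OF u z, of a d] by (simp add: C3_def real_sqrt_mult)
qed

lemma tendsto_along:
  assumes "filterlim (\<lambda>t. Re (g t)) at_top F" "eventually (\<lambda>t. g t \<in> D) F"
  shows "((\<lambda>t. f lam (g t) / \<phi> (g t)) \<longlongrightarrow> 1) F"
    and "((\<lambda>t. f1 lam (g t) / (w (g t) * \<phi> (g t))) \<longlongrightarrow> -1) F"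
proof -
  have lim: "((\<lambda>t. K * Re (g t) powr (-1/2)) \<longlongrightarrow> 0) F" for K
    using filterlim_compose[OF powr_tendsto_0[of K 0] assms(1)] by simp
  have "((\<lambda>t. f lam (g t) / \<phi> (g t) - 1) \<longlongrightarrow> 0) F"
  proof (rule Lim_null_comparison[OF _ lim])
    show "\<forall>\<^sub>F t in F. norm (f lam (g t) / \<phi> (g t) - 1) \<le> C3 lam * Re (g t) powr (-1/2)"
      using assms(2)
    proof eventually_elim
      case (elim t)
      have "f lam (g t) / \<phi> (g t) - 1 = (f lam (g t) - \<phi> (g t)) / \<phi> (g t)"
        using phi_nz[OF elim] by (simp add: field_simps)
      then show ?case
        using f_bounds(1)[OF elim, of lam] phi_nz[OF elim] by (simp add: norm_divide field_simps)
    qed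
  qed
  then show "((\<lambda>t. f lam (g t) / \<phi> (g t)) \<longlongrightarrow> 1) F" by (rule LIM_zero_cancel)
  have "((\<lambda>t. f1 lam (g t) / (w (g t) * \<phi> (g t)) - (-1)) \<longlongrightarrow> 0) F"
  proof (rule Lim_null_comparison[OF _ lim])
    show "\<forall>\<^sub>F t in F. norm (f1 lam (g t) / (w (g t) * \<phi> (g t)) - (-1)) \<le> (C3 lam + C / 4 * (1 / sqrt c)) * Re (g t) powr (-1/2)"
      using assms(2)
    proof eventually_elim
      case (elim t)
      define z where "z = g t"
      have z: "z \<in> D" using elim by (simp add: z_def)
      have nz: "w z \<noteq> 0" "\<phi> z \<noteq> 0" using w_nz[OF z] phi_nz[OF z] by auto
      have "f1 lam z / (w z * \<phi> z) - (-1) = (f1 lam z - \<phi>1 z) / (w z * \<phi> z) - b z / w z"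
        using nz by (simp add: \<phi>1_def field_simps)
      also have "norm \<dots> \<le> norm ((f1 lam z - \<phi>1 z) / (w z * \<phi> z)) + norm (b z / w z)"
        by (rule norm_triangle_ineq4)
      also have "\<dots> \<le> C3 lam * Re z powr (-1/2) + C / 4 * (1 / sqrt c * Re z powr (-1/2))"
      proof (intro add_mono)
        show "norm ((f1 lam z - \<phi>1 z) / (w z * \<phi> z)) \<le> C3 lam * Re z powr (-1/2)"
          using f_bounds(2)[OF z, of lam] nz by (simp add: norm_divide field_simps norm_mult)
        have "norm (b z / w z) = norm (b z) * (1 / norm (w z))" by (simp add: norm_divide)
        also have "\<dots> \<le> C / 4 * (1 / sqrt c * Re z powr (-3/2))"
          using b_bound'[OF z] inverse_norm_w[OF z] C0 by (intro mult_mono) auto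
        also have "\<dots> \<le> C / 4 * (1 / sqrt c * Re z powr (-1/2))"
          using D_Re(1)[OF z] C0 c0 by (intro mult_left_mono powr_mono) auto
        finally show "norm (b z / w z) \<le> C / 4 * (1 / sqrt c * Re z powr (-1/2))" .
      qed
      finally show ?case by (simp add: z_def algebra_simps)
    qed
  qed
  then show "((\<lambda>t. f1 lam (g t) / (w (g t) * \<phi> (g t))) \<longlongrightarrow> -1) F" by (rule LIM_zero_cancel)
qed

lemma real_in_D: "t > X \<Longrightarrow> of_real t \<in> D"
  using X1 T0 by (simp add: cone_def)

lemma w_at_top: "filterlim (\<lambda>t. norm (w (of_real t))) at_top at_top"
proof (rule filterlim_at_top_mono)
  have "filterlim (\<lambda>t::real. t powr (3/2)) at_top at_top" by real_asymp
  then show "filterlim (\<lambda>t::real. sqrt c * t powr (3/2)) at_top at_top"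
    using c0 by (intro filterlim_tendsto_pos_mult_at_top[OF tendsto_const]) auto
  show "\<forall>\<^sub>F t in at_top. sqrt c * t powr (3/2) \<le> norm (w (of_real t))"
    using eventually_gt_at_top[of X]
  proof eventually_elim
    case (elim t)
    then have "1 / norm (w (of_real t)) \<le> 1 / sqrt c * t powr (-3/2)"
      using inverse_norm_w[OF real_in_D] by simp
    moreover have "0 < norm (w (of_real t))" using w_nz[OF real_in_D[OF elim]] by simp
    ultimately show ?case using c0 elim X1 by (simp add: powr_minus field_simps)
  qed
qed

text \<open>The logarithmic derivative \<open>b - w\<close> has real part at most -1 beyond some
  \<open>a\<close>, because \<open>Re w \<ge> c * norm w\<close> grows while \<open>b\<close> stays
  below \<open>C / 4\<close>; this gives exponential decay.\<close>

lemma wphi_tendsto_0: "((\<lambda>t. norm (w (of_real t) * \<phi> (of_real t))) \<longlongrightarrow> 0) at_top"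
proof -
  have "eventually (\<lambda>t. (C / 4 + 1) / c \<le> norm (w (of_real t))) at_top"
    using w_at_top by (auto simp: filterlim_at_top)
  then have "eventually (\<lambda>t. t > X \<and> (C / 4 + 1) / c \<le> norm (w (of_real t))) at_top"
    using eventually_gt_at_top[of X] by eventually_elim auto
  then obtain a where a: "\<And>t. t \<ge> a \<Longrightarrow> t > X \<and> (C / 4 + 1) / c \<le> norm (w (of_real t))"
    by (auto simp: eventually_at_top_linorder)
  define q where "q = (\<lambda>t::real. (norm (w (of_real t) * \<phi> (of_real t)))\<^sup>2)"
  have bd: "q t \<le> q a * exp (- t - (- a))" if "t \<ge> a" for t
  proof (rule gronwall_within[OF that, where g = "\<lambda>_. -1" and G = "\<lambda>t. -t"])
    fix s assume "s \<in> {a..t}"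
    then have s: "s \<ge> a" by simp
    then have sD: "of_real s \<in> D" using a real_in_D by auto
    have "((\<lambda>z. w z * \<phi> z) has_field_derivative (b (of_real s) - w (of_real s)) * (w (of_real s) * \<phi> (of_real s))) (at (of_real s))"
      by (rule DERIV_cong[OF DERIV_mult[OF w_deriv[OF sD] phi_deriv[OF sD]]]) (simp add: \<phi>1_def algebra_simps)
    then have "((\<lambda>t. w (of_real t) * \<phi> (of_real t)) has_vector_derivative (b (of_real s) - w (of_real s)) * (w (of_real s) * \<phi> (of_real s))) (at s within {a..t})"
      using horizontal_deriv[of _ _ 0] by simp
    from norm_sq_has_derivative[OF this]
    show "(q has_real_derivative 2 * (Re (b (of_real s) - w (of_real s)) * q s)) (at s within {a..t})"
      unfolding q_def cnj_mult_self .
    have "C / 4 + 1 \<le> c * norm (w (of_real s))" using a[OF s] c0 by (simp add: field_simps)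
    then have "Re (b (of_real s) - w (of_real s)) \<le> -1"
      using Re_low[OF sD] b_bound'[OF sD] complex_Re_le_cmod[of "b (of_real s)"] by (simp add: w_def norm_w[unfolded w_def])
    then have "Re (b (of_real s) - w (of_real s)) * q s \<le> -1 * q s" by (intro mult_right_mono) (auto simp: q_def)
    moreover have "0 \<le> q s" by (simp add: q_def)
    ultimately show "2 * (Re (b (of_real s) - w (of_real s)) * q s) \<le> -1 * q s" by linarith
  qed (auto intro!: derivative_eq_intros)
  have "((\<lambda>t. q a * exp (- t - (- a))) \<longlongrightarrow> 0) at_top"
  proof -
    have "((\<lambda>t::real. exp (- t)) \<longlongrightarrow> 0) at_top"
      by (rule filterlim_compose[OF exp_at_bot filterlim_uminus_at_bot_at_top])
    from tendsto_mult_right_zero[OF this, of "q a * exp a"] show ?thesis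
      by (simp add: exp_diff exp_minus field_simps exp_add)
  qed
  moreover have "\<forall>\<^sub>F t in at_top. norm (q t) \<le> q a * exp (- t - (- a))"
    using eventually_ge_at_top[of a] by eventually_elim (use bd in \<open>simp add: q_def\<close>)
  ultimately have "(q \<longlongrightarrow> 0) at_top" by (rule Lim_null_comparison[rotated])
  from tendsto_real_sqrt[OF this] show ?thesis by (simp add: q_def)
qed

lemma f_tendsto_0: "((\<lambda>t. f lam (of_real t)) \<longlongrightarrow> 0) at_top" "((\<lambda>t. f1 lam (of_real t)) \<longlongrightarrow> 0) at_top"
proof -
  have ev: "eventually (\<lambda>t. of_real t \<in> D) at_top"
    using eventually_gt_at_top[of X] by eventually_elim (rule real_in_D)
  have wphi: "((\<lambda>t. w (of_real t) * \<phi> (of_real t)) \<longlongrightarrow> 0) at_top"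
    by (rule tendsto_norm_zero_cancel[OF wphi_tendsto_0])
  have "((\<lambda>t. inverse (norm (w (of_real t)))) \<longlongrightarrow> 0) at_top"
    by (rule filterlim_compose[OF tendsto_inverse_0_at_top w_at_top]) (rule filterlim_ident)
  then have "((\<lambda>t. norm (inverse (w (of_real t)))) \<longlongrightarrow> 0) at_top" by (simp add: norm_inverse)
  then have "((\<lambda>t. inverse (w (of_real t))) \<longlongrightarrow> 0) at_top" by (rule tendsto_norm_zero_cancel)
  from tendsto_mult[OF this wphi] have "((\<lambda>t. inverse (w (of_real t)) * (w (of_real t) * \<phi> (of_real t))) \<longlongrightarrow> 0) at_top" by simp
  then have phi: "((\<lambda>t. \<phi> (of_real t)) \<longlongrightarrow> 0) at_top"
    by (rule Lim_transform_eventually) (use ev in eventually_elim, use w_nz in auto)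
  have id: "filterlim (\<lambda>t. Re (of_real t)) at_top at_top" by (simp add: filterlim_ident)
  from tendsto_mult[OF tendsto_along(1)[OF id ev] phi]
  have "((\<lambda>t. f lam (of_real t) / \<phi> (of_real t) * \<phi> (of_real t)) \<longlongrightarrow> 0) at_top" by simp
  then show "((\<lambda>t. f lam (of_real t)) \<longlongrightarrow> 0) at_top"
    by (rule Lim_transform_eventually) (use ev in eventually_elim, use phi_nz in auto)
  from tendsto_mult[OF tendsto_along(2)[OF id ev] wphi]
  have "((\<lambda>t. f1 lam (of_real t) / (w (of_real t) * \<phi> (of_real t)) * (w (of_real t) * \<phi> (of_real t))) \<longlongrightarrow> 0) at_top" by simp
  then show "((\<lambda>t. f1 lam (of_real t)) \<longlongrightarrow> 0) at_top"
    by (rule Lim_transform_eventually) (use ev in eventually_elim, use phi_nz w_nz in auto)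
qed

end

section \<open>The action integral\<close>

lemma Arg_le_if_slope:
  assumes "Re z > 0" "\<bar>Im z\<bar> \<le> tan \<beta> * Re z" "0 \<le> \<beta>" "\<beta> < pi / 2"
  shows "\<bar>Arg z\<bar> \<le> \<beta>"
proof -
  have "Arg z = arctan (Im z / Re z)" using assms(1) by (rule arg_conv_arctan)
  moreover have "Im z / Re z \<le> tan \<beta>" "- tan \<beta> \<le> Im z / Re z" using assms by (auto simp: field_simps abs_le_iff)
  then have "arctan (Im z / Re z) \<le> arctan (tan \<beta>)" "arctan (- tan \<beta>) \<le> arctan (Im z / Re z)"
    by (intro arctan_monotone'; simp)+
  ultimately show ?thesis using assms by (simp add: arctan_tan arctan_minus abs_le_iff)
qed

lemma Re_power_ge_cos:
  assumes "\<bar>Arg z\<bar> \<le> \<beta>" "real n * \<beta> \<le> pi"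
  shows "cos (real n * \<beta>) * norm z ^ n \<le> Re (z ^ n)"
proof -
  have "z ^ n = (of_real (norm z) * cis (Arg z)) ^ n" by (simp add: rcis_cmod_Arg flip: rcis_def)
  also have "\<dots> = of_real (norm z ^ n) * cis (real n * Arg z)"
    by (simp add: power_mult_distrib Complex.DeMoivre)
  finally have *: "Re (z ^ n) = norm z ^ n * cos (real n * Arg z)" by simp
  have "cos (real n * \<beta>) \<le> cos \<bar>real n * Arg z\<bar>"
    using assms by (intro cos_monotone_0_pi_le) (auto simp: abs_mult mult_left_mono)
  then show ?thesis unfolding *
    by (subst mult.commute) (simp add: mult_left_mono)
qed

lemma Re_powr_half_ge:
  assumes "\<bar>Arg z\<bar> \<le> \<beta>" "s * \<beta> \<le> pi" "z \<noteq> 0" "s \<ge> 0"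
  shows "norm z powr s * cos (s * \<beta>) \<le> Re (z powr of_real s)"
proof -
  have "z powr of_real s = exp (of_real s * Ln z)" using assms by (simp add: powr_def)
  also have "Re \<dots> = exp (s * ln (norm z)) * cos (s * Arg z)"
    using assms by (simp add: Re_exp Arg_eq_Im_Ln)
  also have "exp (s * ln (norm z)) = norm z powr s" using assms by (simp add: powr_def)
  finally have "Re (z powr of_real s) = norm z powr s * cos (s * Arg z)" .
  moreover have "cos (s * \<beta>) \<le> cos \<bar>s * Arg z\<bar>"
    using assms by (intro cos_monotone_0_pi_le) (auto simp: abs_mult mult_left_mono)
  ultimately show ?thesis by (simp add: mult_left_mono)
qed

lemma Re_csqrt_pos:
  assumes "z \<notin> \<real>\<^sub>\<le>\<^sub>0"
  shows "0 < Re (csqrt z)"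
proof -
  have "norm z + Re z \<noteq> 0"
  proof
    assume *: "norm z + Re z = 0"
    then have "(norm z)\<^sup>2 = (Re z)\<^sup>2" by (simp add: add_eq_0_iff2)
    then have "Im z = 0" by (simp add: cmod_power2)
    moreover have "Re z \<le> 0" using * norm_ge_zero[of z] by linarith
    ultimately show False using assms by (simp add: complex_nonpos_Reals_iff)
  qed
  moreover have "norm z + Re z \<ge> 0" using abs_Re_le_cmod[of z] by linarith
  ultimately show ?thesis by simp
qed

text \<open>Adding \<open>x \<ge> 0\<close> keeps the imaginary part, so the roots of
  \<open>lam\<close> and of \<open>x + lam\<close> lie on the same side of the real axis. Their
  quotient then has positive real part and is a principal root.\<close>

lemma csqrt_times_csqrt_pos:
  fixes lam :: complex and x :: real
  assumes "x \<ge> 0" "lam \<notin> \<real>\<^sub>\<le>\<^sub>0"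
  shows "csqrt lam * csqrt (1 + of_real x / lam) = csqrt (of_real x + lam)"
proof -
  define a q where "a = csqrt lam" "q = csqrt (of_real x + lam)"
  have lam0: "lam \<noteq> 0" using assms by auto
  have nq: "of_real x + lam \<notin> \<real>\<^sub>\<le>\<^sub>0"
    using assms by (auto simp: complex_nonpos_Reals_iff)
  have a: "Re a > 0" and q: "Re q > 0"
    unfolding a_q_def using assms(2) nq by (intro Re_csqrt_pos; simp)+
  have sq: "a\<^sup>2 = lam" "q\<^sup>2 = of_real x + lam" unfolding a_q_def by (rule power2_csqrt)+
  have Im: "Im a * Im q \<ge> 0"
  proof -
    have "2 * Re a * Im a = Im lam" 
      using arg_cong[OF sq(1), of Im] by (simp add: power2_eq_square algebra_simps)
    moreover have "2 * Re q * Im q = Im lam" 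
      using arg_cong[OF sq(2), of Im] by (simp add: power2_eq_square algebra_simps)
    ultimately have "0 \<le> (2 * Re a * Im a) * (2 * Re q * Im q)" by simp
    then have "0 \<le> (4 * (Re a * Re q)) * (Im a * Im q)" by (simp only: mult_ac)
    moreover have "0 < 4 * (Re a * Re q)" using a q by simp
    ultimately show ?thesis using mult_pos_neg[of "4 * (Re a * Re q)" "Im a * Im q"] by linarith
  qed
  have "Re (q / a) > 0"
  proof -
    have "Re a * Re q > 0" using a q by simp
    then show ?thesis using Im a by (auto simp: Re_divide power2_eq_square intro!: divide_pos_pos add_pos_nonneg simp: mult.commute)
  qed
  moreover have "(q / a)\<^sup>2 = 1 + of_real x / lam"
    using lam0 by (simp add: power_divide a_q_def field_simps)
  ultimately have "csqrt (1 + of_real x / lam) = q / a" by (intro csqrt_unique) auto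
  then show ?thesis using a by (auto simp: a_q_def simp del: csqrt.simps)
qed

text \<open>The action of the pure monomial potential: \<open>primG\<close> is a primitive of \<open>sqrt (1 + z^m)\<close>
  and \<open>actK m\<close> is its regularised value at infinity.\<close>

definition star_dom :: "nat \<Rightarrow> complex set" where
  "star_dom m = {z. 1 + z ^ m \<notin> \<real>\<^sub>\<le>\<^sub>0}"

lemma open_star_dom: "open (star_dom m)"
proof -
  have "star_dom m = (\<lambda>z. 1 + z ^ m) -` (- \<real>\<^sub>\<le>\<^sub>0)" by (auto simp: star_dom_def)
  then show ?thesis by (auto intro!: continuous_open_vimage continuous_intros)
qed

text \<open>The excluded points are those whose power is real and at most -1. This set is closed
  under stretching away from 0, hence segments from 0 to the other points avoid it, and a primitive
  exists without constructing an integral.\<close>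

lemma starlike_star_dom:
  assumes "m \<ge> 1"
  shows "starlike (star_dom m)"
proof -
  have "closed_segment 0 z \<subseteq> star_dom m" if z: "z \<in> star_dom m" for z
  proof
    fix y assume "y \<in> closed_segment 0 z"
    then obtain t where t: "0 \<le> t" "t \<le> 1" "y = of_real t * z"
      by (auto simp: closed_segment_def scaleR_conv_of_real)
    show "y \<in> star_dom m"
    proof (rule ccontr)
      assume "y \<notin> star_dom m"
      then have "1 + of_real (t ^ m) * z ^ m \<in> \<real>\<^sub>\<le>\<^sub>0" by (simp add: star_dom_def t(3) power_mult_distrib)
      then have re: "1 + t ^ m * Re (z ^ m) \<le> 0" and im: "t ^ m * Im (z ^ m) = 0"
        by (auto simp: complex_nonpos_Reals_iff Im_power_real)
      have "t \<noteq> 0" using re assms by (auto simp: power_0_left split: if_splits)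
      then have tm: "0 < t ^ m" "t ^ m \<le> 1" using t by (auto simp: power_le_one)
      have "Im (z ^ m) = 0" using im \<open>t \<noteq> 0\<close> by simp
      moreover have "Re (z ^ m) \<le> -1"
      proof (rule ccontr)
        assume "\<not> Re (z ^ m) \<le> -1"
        then have "t ^ m * Re (z ^ m) > - 1 \<or> t ^ m * Re (z^m) \<ge> 0"
        proof (cases "Re (z ^ m) \<ge> 0")
          case False
          have "t ^ m * (-1) < t ^ m * Re (z ^ m)" using tm \<open>\<not> Re (z ^ m) \<le> -1\<close> by (intro mult_strict_left_mono) auto
          then show ?thesis using tm by simp
        qed (use tm in auto)
        then show False using re by auto
      qed
      ultimately have "1 + z ^ m \<in> \<real>\<^sub>\<le>\<^sub>0" by (auto simp: complex_nonpos_Reals_iff)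
      then show False using z by (simp add: star_dom_def)
    qed
  qed
  moreover have "0 \<in> star_dom m" using assms by (auto simp: star_dom_def power_0_left complex_nonpos_Reals_iff)
  ultimately show ?thesis unfolding starlike_def by blast
qed

definition primG :: "nat \<Rightarrow> complex \<Rightarrow> complex" where
  "primG m = (SOME g. g 0 = 0 \<and> (\<forall>z\<in>star_dom m. (g has_field_derivative csqrt (1 + z ^ m)) (at z)))"

lemma primG:
  assumes "m \<ge> 1"
  shows "primG m 0 = 0" "z \<in> star_dom m \<Longrightarrow> (primG m has_field_derivative csqrt (1 + z ^ m)) (at z)"
proof -
  have fd: "(\<lambda>z. csqrt (1 + z ^ m)) field_differentiable at z" if "z \<in> star_dom m" for z
  proof -
    have "(\<lambda>z. csqrt (1 + z ^ m)) holomorphic_on star_dom m"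
      by (intro holomorphic_intros) (auto simp: star_dom_def)
    then show ?thesis using that open_star_dom holomorphic_on_imp_differentiable_at by blast
  qed
  then have "continuous_on (star_dom m) (\<lambda>z. csqrt (1 + z ^ m))"
    by (simp add: continuous_at_imp_continuous_on field_differentiable_imp_continuous_at)
  from holomorphic_starlike_primitive[OF this starlike_star_dom[OF assms] open_star_dom finite.emptyI] fd
  obtain g where g: "\<forall>z\<in>star_dom m. (g has_field_derivative csqrt (1 + z ^ m)) (at z)" by auto
  have "\<exists>g. g 0 = 0 \<and> (\<forall>z\<in>star_dom m. (g has_field_derivative csqrt (1 + z ^ m)) (at z))"
    by (rule exI[of _ "\<lambda>z. g z - g 0"]) (use g in \<open>auto intro!: derivative_eq_intros\<close>)
  then have "primG m 0 = 0 \<and> (\<forall>z\<in>star_dom m. (primG m has_field_derivative csqrt (1 + z ^ m)) (at z))"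
    unfolding primG_def by (rule someI_ex)
  then show "primG m 0 = 0" "z \<in> star_dom m \<Longrightarrow> (primG m has_field_derivative csqrt (1 + z ^ m)) (at z)" by auto
qed

definition actr :: "nat \<Rightarrow> real \<Rightarrow> real" where
  "actr m x = Re (primG m (of_real x)) - x powr (real m / 2 + 1) / (real m / 2 + 1)"

definition actK :: "nat \<Rightarrow> real" where "actK m = Lim at_top (actr m)"

lemma real_star_dom: "x \<ge> 0 \<Longrightarrow> of_real x \<in> star_dom m"
proof -
  assume "x \<ge> 0"
  then have "0 < 1 + x ^ m" by (simp add: add_pos_nonneg)
  moreover have "1 + of_real x ^ m = complex_of_real (1 + x ^ m)" by simp
  ultimately show ?thesis unfolding star_dom_def mem_Collect_eq by (simp only: nonpos_Reals_of_real_iff)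
qed

lemma primG_real_deriv:
  assumes "m \<ge> 1" "x \<ge> 0"
  shows "((\<lambda>x. primG m (of_real x)) has_vector_derivative of_real (sqrt (1 + x ^ m))) (at x within A)"
proof -
  have "csqrt (1 + of_real x ^ m) = of_real (sqrt (1 + x ^ m))"
    using assms csqrt_of_real_nonneg[of "1 + x ^ m"] by simp
  then have "(primG m has_field_derivative of_real (sqrt (1 + x ^ m))) (at (of_real x))"
    using primG(2)[OF assms(1) real_star_dom[OF assms(2)]] by simp
  then have "(primG m has_field_derivative of_real (sqrt (1 + x ^ m))) (at (of_real x) within range of_real)"
    by (rule has_field_derivative_at_within)
  moreover have "(of_real has_vector_derivative (1::complex)) (at x within A)"
    by (auto intro!: derivative_eq_intros)
  ultimately show ?thesis
    using field_vector_diff_chain_within[of "of_real :: real \<Rightarrow> complex" 1 x A "primG m"]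
      primG(2)[OF assms(1) real_star_dom[OF assms(2)]] \<open>csqrt _ = _\<close>
    by (simp add: o_def has_field_derivative_at_within)
qed

lemma primG_real:
  assumes "m \<ge> 1" "x \<ge> 0"
  shows "Im (primG m (of_real x)) = 0"
proof -
  have "norm (of_real (Im (primG m (of_real x))) - of_real (Im (primG m (of_real 0))) :: complex) \<le> 0 - 0"
  proof (rule path_bound[OF assms(2), where f = "\<lambda>x. of_real (Im (primG m (of_real x)))" and G = "\<lambda>_. 0" and g = "\<lambda>_. 0" and f' = "\<lambda>_. 0"])
    fix y assume "y \<in> {0..x}"
    then have "((\<lambda>x. Im (primG m (of_real x))) has_vector_derivative Im (of_real (sqrt (1 + y ^ m)))) (at y within {0..x})"
      by (intro bounded_linear.has_vector_derivative[OF bounded_linear_Im primG_real_deriv] assms) auto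
    from bounded_linear.has_vector_derivative[OF bounded_linear_of_real this]
    show "((\<lambda>x. complex_of_real (Im (primG m (of_real x)))) has_vector_derivative 0) (at y within {0..x})" by simp
  qed auto
  then show ?thesis using primG(1)[OF assms(1)] by simp
qed

lemma actr_deriv:
  assumes "m \<ge> 1" "x > 0"
  shows "(actr m has_real_derivative sqrt (1 + x ^ m) - x powr (real m / 2)) (at x within A)"
proof -
  have "((\<lambda>x. Re (primG m (of_real x))) has_vector_derivative Re (of_real (sqrt (1 + x ^ m)))) (at x within A)"
    using assms by (intro bounded_linear.has_vector_derivative[OF bounded_linear_Re primG_real_deriv]) auto
  then have 1: "((\<lambda>x. Re (primG m (of_real x))) has_real_derivative sqrt (1 + x ^ m)) (at x within A)"
    by (simp add: has_real_derivative_iff_has_vector_derivative)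
  have "((\<lambda>x. x powr (real m / 2 + 1)) has_real_derivative (real m / 2 + 1) * x powr (real m / 2)) (at x within A)"
    using has_real_derivative_powr[OF assms(2), of "real m / 2 + 1"] by (simp add: has_field_derivative_at_within)
  from DERIV_cdivide[OF this, of "real m / 2 + 1"]
  have 2: "((\<lambda>x. x powr (real m / 2 + 1) / (real m / 2 + 1)) has_real_derivative x powr (real m / 2)) (at x within A)"
    by (simp add: add_nonneg_pos)
  show ?thesis unfolding actr_def[abs_def] by (rule DERIV_diff[OF 1 2])
qed

text \<open>In terms of \<open>h = x powr (m / 2)\<close> the derivative is
  \<open>sqrt (1 + h * h) - h\<close>, which lies between 0 and \<open>1 / h\<close>.\<close>

lemma actr_deriv_bounds:
  assumes "m \<ge> 3" "x > 0"
  shows "0 < sqrt (1 + x ^ m) - x powr (real m / 2)"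
    and "x \<ge> 1 \<Longrightarrow> sqrt (1 + x ^ m) - x powr (real m / 2) \<le> x powr (-3/2)"
proof -
  define h where "h = x powr (real m / 2)"
  have h0: "h > 0" using assms by (simp add: h_def)
  have h2: "h\<^sup>2 = x ^ m" using assms by (simp add: h_def powr_power powr_realpow)
  have "h < sqrt (1 + h\<^sup>2)" by (rule real_less_rsqrt) simp
  then show "0 < sqrt (1 + x ^ m) - x powr (real m / 2)" unfolding h2[symmetric] h_def[symmetric] by simp
  assume x: "x \<ge> 1"
  have "sqrt (1 + h\<^sup>2) \<le> h + 1 / h"
    using h0 by (intro real_le_lsqrt) (auto simp: power2_eq_square field_simps)
  moreover have "1 / h = x powr (- (real m / 2))" by (simp add: h_def powr_minus_divide)
  moreover have "\<dots> \<le> x powr (-3/2)" using x assms by (intro powr_mono) auto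
  ultimately show "sqrt (1 + x ^ m) - x powr (real m / 2) \<le> x powr (-3/2)" unfolding h2[symmetric] h_def[symmetric] by simp
qed

lemma actr_mono:
  assumes "m \<ge> 3" "0 < x" "x \<le> y"
  shows "actr m x \<le> actr m y"
proof -
  have "- actr m y \<le> - actr m x"
  proof (rule nonincreasing_within[OF assms(3), where h = "\<lambda>t. - actr m t" and h' = "\<lambda>x. - (sqrt (1 + x ^ m) - x powr (real m / 2))"])
    fix t assume t: "t \<in> {x..y}"
    show "((\<lambda>t. - actr m t) has_real_derivative - (sqrt (1 + t ^ m) - t powr (real m / 2))) (at t within {x..y})"
      using t assms by (intro DERIV_minus actr_deriv) auto
    show "- (sqrt (1 + t ^ m) - t powr (real m / 2)) \<le> 0"
      using actr_deriv_bounds(1)[of m t] t assms by simp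
  qed
  then show ?thesis by simp
qed

text \<open>An increasing bounded function has a limit. Thus \<open>actK m\<close> is the integral
  of \<open>sqrt (1 + x ^ m) - x powr (m / 2)\<close> over the positive axis, and a positive
  integrand makes it positive.\<close>

lemma actK:
  assumes "m \<ge> 3"
  shows "(actr m \<longlongrightarrow> actK m) at_top" "actK m > 0"
proof -
  have bdd: "actr m x \<le> actr m 1 + 2" if "x \<ge> 1" for x
  proof -
    have "actr m x - (- 2 * (0 + x) powr (-1/2)) \<le> actr m 1 - (- 2 * (0 + 1) powr (-1/2))"
    proof (rule nonincreasing_within[OF that, where h = "\<lambda>x. actr m x - (- 2 * (0 + x) powr (-1/2))"
          and h' = "\<lambda>x. (sqrt (1 + x ^ m) - x powr (real m / 2)) - x powr (-3/2)"])
      fix t assume t: "t \<in> {1..x}"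
      show "((\<lambda>x. actr m x - (- 2 * (0 + x) powr (-1/2))) has_real_derivative
        (sqrt (1 + t ^ m) - t powr (real m / 2)) - t powr (-3/2)) (at t within {1..x})"
        using t assms by (intro DERIV_diff actr_deriv) (auto intro!: derivative_eq_intros)
      show "(sqrt (1 + t ^ m) - t powr (real m / 2)) - t powr (-3/2) \<le> 0"
        using actr_deriv_bounds(2)[OF assms, of t] t by simp
    qed
    then show ?thesis by (simp add: algebra_simps) (smt (verit) powr_ge_zero)
  qed
  define s where "s = Sup (actr m ` {1..})"
  have bddA: "bdd_above (actr m ` {1..})" using bdd by (intro bdd_aboveI2) auto
  have lim: "(actr m \<longlongrightarrow> s) at_top"
  proof (rule order_tendstoI)
    fix a assume "a < s"
    then obtain x where x: "x \<ge> 1" "a < actr m x"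
      unfolding s_def using less_cSup_iff[OF _ bddA, of a] by auto
    show "\<forall>\<^sub>F x in at_top. a < actr m x"
      using eventually_ge_at_top[of x]
    proof eventually_elim
      case (elim y)
      then show ?case using actr_mono[OF assms _ elim] x by auto
    qed
  next
    fix a assume "s < a"
    show "\<forall>\<^sub>F x in at_top. actr m x < a"
      using eventually_ge_at_top[of 1]
    proof eventually_elim
      case (elim y)
      then have "actr m y \<le> s" unfolding s_def by (intro cSup_upper bddA) auto
      then show ?case using \<open>s < a\<close> by simp
    qed
  qed
  then have sK: "actK m = s" unfolding actK_def by (intro tendsto_Lim) auto
  then show "(actr m \<longlongrightarrow> actK m) at_top" using lim by simp
  have cont0: "actr m 0 = 0" using primG(1)[of m] assms by (simp add: actr_def)
  have contf: "continuous (at 0 within {0..}) (actr m)"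
  proof -
    have "continuous (at 0 within {0..}) (\<lambda>x. primG m (of_real x))"
      using primG_real_deriv[of m 0 "{0..}"] assms by (intro has_vector_derivative_continuous) auto
    moreover have "continuous (at 0 within {0..}) (\<lambda>x::real. x powr (real m / 2 + 1))"
      unfolding continuous_within
      by (rule tendsto_eq_intros refl | (rule eventually_at_filter[THEN iffD2], force))+ (auto simp: eventually_at_filter)
    ultimately show ?thesis unfolding actr_def[abs_def] by (auto intro!: continuous_intros simp: add_nonneg_eq_0_iff)
  qed
  have half: "actr m (1/2) < actr m 1"
  proof (rule DERIV_pos_imp_increasing[where f = "actr m" and a = "1/2" and b = 1])
    fix x :: real assume x: "1/2 \<le> x" "x \<le> 1"
    then show "\<exists>y. (actr m has_real_derivative y) (at x) \<and> 0 < y"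
      using actr_deriv[of m x UNIV] actr_deriv_bounds(1)[of m x] assms by auto
  qed simp
  \<comment> \<open>Monotonicity is available only for positive arguments, so the value 0 at the
    origin is brought in by a limit from the right.\<close>
  have "0 \<le> actr m (1/2)"
  proof (rule tendsto_upperbound[where f = "actr m" and F = "at 0 within {0<..<1/2}"])
    show "(actr m \<longlongrightarrow> 0) (at 0 within {0<..<1/2})"
      using contf unfolding continuous_within cont0 by (rule tendsto_within_subset) auto
    show "\<forall>\<^sub>F x in at 0 within {0<..<1/2}. actr m x \<le> actr m (1/2)"
      by (auto simp: eventually_at_filter intro!: always_eventually actr_mono assms)
    show "at (0::real) within {0<..<1/2} \<noteq> bot" by (simp add: at_within_eq_bot_iff)
  qed
  moreover have "actr m 1 \<le> s" unfolding s_def by (intro cSup_upper bddA) auto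
  ultimately show "actK m > 0" using half sK by simp
qed

text \<open>The difference \<open>csqrt (1 + z ^ m) - z powr (m / 2)\<close> is one over the sum of
  the two roots. For arguments below \<open>pi / m\<close> the second root has positive real part,
  so the difference is of size \<open>x powr (-3/2)\<close>. The chord from \<open>x\<close> to
  \<open>x * cis \<psi>\<close> has length at most \<open>2 * x\<close>; turning the ray therefore
  does not change the limit.\<close>

lemma primG_direction:
  assumes m: "m \<ge> 3" and psi: "\<bar>\<psi>\<bar> < pi / real m"
  defines "s \<equiv> real m / 2 + 1"
  shows "((\<lambda>x. primG m (of_real x * cis \<psi>) - (of_real x * cis \<psi>) powr of_real s / of_real s)
    \<longlongrightarrow> of_real (actK m)) at_top"
proof -
  define \<beta> where "\<beta> = \<bar>\<psi>\<bar>"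
  define e where "e = cis \<psi>"
  have b: "0 \<le> \<beta>" "real m / 2 * \<beta> < pi / 2" using psi m by (auto simp: \<beta>_def field_simps)
  have b3: "real m / 2 * \<beta> \<le> pi" using b(2) pi_gt_zero by linarith
  have b2: "\<beta> < pi / 2"
  proof -
    have "pi / real m \<le> pi / 2" using m by (intro divide_left_mono) auto
    then show ?thesis using psi unfolding \<beta>_def by linarith
  qed
  have s0: "s > 0" by (simp add: s_def add_nonneg_pos)
  define c1 c2 where "c1 = cos \<beta>" "c2 = cos (real m / 2 * \<beta>)"
  have "0 < cos (real m / 2 * \<beta>)" by (rule cos_gt_zero_pi[OF _ b(2)]) (use b m in \<open>auto intro: less_le_trans[of _ 0]\<close>)
  moreover have "0 < cos \<beta>" by (rule cos_gt_zero_pi) (use b b2 in auto)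
  ultimately have c: "c1 > 0" "c2 > 0" by (simp_all add: c1_c2_def)
  define F where "F = (\<lambda>z. primG m z - z powr of_real s / of_real s)"
  have Re_e: "Re e = c1" by (simp add: e_def c1_c2_def \<beta>_def abs_if)
  have Im_e: "\<bar>Im e\<bar> = sin \<beta>"
    using b b2 sin_ge_zero[of \<beta>] by (auto simp: e_def \<beta>_def abs_if)
  have sinb: "sin \<beta> \<ge> 0" using b b2 by (intro sin_ge_zero) auto
  have diff: "norm (F (of_real x * e) - F (of_real x)) \<le> 2 * x / ((x * c1) powr (3/2) * c2)" if x: "x > 0" "x * c1 \<ge> 1" for x
  proof -
    define Q where "Q = closed_segment (of_real x) (of_real x * e)"
    have "norm (F (of_real x * e) - F (of_real x)) \<le> 1 / ((x * c1) powr (3/2) * c2) * norm (of_real x * e - of_real x)"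
    proof (rule field_differentiable_bound[where S = Q])
      fix z assume "z \<in> Q"
      then obtain t where t: "0 \<le> t" "t \<le> 1" and z: "z = (1 - t) *\<^sub>R of_real x + t *\<^sub>R (of_real x * e)"
        by (auto simp: Q_def closed_segment_def)
      have Re_z: "Re z = x * ((1 - t) + t * c1)" and Im_z: "Im z = x * (t * Im e)"
        by (simp_all add: z Re_e algebra_simps)
      have "c1 \<le> (1 - t) + t * c1"
      proof -
        have "c1 * (1 - t) \<le> 1 * (1 - t)" using t by (intro mult_right_mono) (auto simp: c1_c2_def)
        then show ?thesis by (simp add: algebra_simps)
      qed
      then have "x * c1 \<le> Re z" unfolding Re_z using x by (intro mult_left_mono) auto
      then have Re1: "Re z > 0" "Re z \<ge> 1" using x by auto
      have nz: "norm z \<ge> x * c1" using \<open>x * c1 \<le> Re z\<close> complex_Re_le_cmod order.trans by blast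
      have "\<bar>Im z\<bar> = x * (t * sin \<beta>)" using x t Im_e by (simp add: Im_z abs_mult)
      also have "t * sin \<beta> = tan \<beta> * (t * c1)" using c by (simp add: tan_def c1_c2_def)
      also have "x * (tan \<beta> * (t * c1)) \<le> x * (tan \<beta> * ((1 - t) + t * c1))"
        using x t sinb c by (intro mult_left_mono) (auto simp: tan_def c1_c2_def)
      finally have "\<bar>Im z\<bar> \<le> tan \<beta> * Re z" by (simp add: Re_z mult_ac)
      then have Arg: "\<bar>Arg z\<bar> \<le> \<beta>" using Re1 b b2 by (intro Arg_le_if_slope) auto
      have z0: "z \<noteq> 0" using Re1 by auto
      define \<zeta> where "\<zeta> = z powr of_real (real m / 2)"
      have "\<zeta>\<^sup>2 = z powr (of_real (real m / 2) + of_real (real m / 2))"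
        unfolding power2_eq_square \<zeta>_def by (simp only: powr_add)
      also have "of_real (real m / 2) + of_real (real m / 2) = (of_nat m :: complex)" by simp
      finally have zeta2: "\<zeta>\<^sup>2 = z ^ m" using z0 by (simp add: powr_nat')
      have "(x * c1) powr (3/2) \<le> (x * c1) powr (real m / 2)" using x m by (intro powr_mono) auto
      also have "\<dots> \<le> norm z powr (real m / 2)" using nz x c by (intro powr_mono2) auto
      finally have "(x * c1) powr (3/2) * c2 \<le> norm z powr (real m / 2) * c2" using c by (intro mult_right_mono) auto
      also have "\<dots> \<le> Re \<zeta>" unfolding \<zeta>_def c1_c2_def by (rule Re_powr_half_ge[OF Arg b3 z0]) simp
      finally have Re_zeta: "(x * c1) powr (3/2) * c2 \<le> Re \<zeta>" .
      have pos: "0 < (x * c1) powr (3/2) * c2" using x c by simp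
      have st: "z \<in> star_dom m"
      proof -
        have "Re \<zeta> > 0" using Re_zeta pos by linarith
        have "1 + \<zeta>\<^sup>2 \<notin> \<real>\<^sub>\<le>\<^sub>0"
        proof
          assume "1 + \<zeta>\<^sup>2 \<in> \<real>\<^sub>\<le>\<^sub>0"
          then have "Re (1 + \<zeta>\<^sup>2) \<le> 0" "Im (1 + \<zeta>\<^sup>2) = 0" by (auto simp: complex_nonpos_Reals_iff)
          then have "1 + (Re \<zeta>)\<^sup>2 \<le> (Im \<zeta>)\<^sup>2" "Re \<zeta> * Im \<zeta> = 0" by (auto simp: power2_eq_square algebra_simps)
          then show False using \<open>Re \<zeta> > 0\<close> by (auto simp: add_nonneg_eq_0_iff) (metis add_pos_nonneg not_le zero_le_power2 zero_less_one power_zero_numeral)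
        qed
        then show ?thesis by (simp add: star_dom_def zeta2)
      qed
      have "(primG m has_field_derivative csqrt (1 + z ^ m)) (at z)" using primG(2)[OF _ st] m by simp
      moreover have "((\<lambda>z. z powr of_real s / of_real s) has_field_derivative \<zeta>) (at z)"
      proof -
        have "z \<notin> \<real>\<^sub>\<le>\<^sub>0" using Re1 by (auto simp: complex_nonpos_Reals_iff)
        then have "((\<lambda>z. z powr of_real s / of_real s) has_field_derivative (of_real s * z powr (of_real s - 1)) / of_real s) (at z)"
          by (intro DERIV_cdivide has_field_derivative_powr)
        moreover have "of_real s - 1 = (of_real (real m / 2) :: complex)" by (simp add: s_def)
        ultimately show ?thesis using s0 by (simp add: \<zeta>_def)
      qed
      ultimately have "(F has_field_derivative csqrt (1 + z ^ m) - \<zeta>) (at z)"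
        unfolding F_def by (rule DERIV_diff)
      then show "(F has_field_derivative csqrt (1 + z ^ m) - \<zeta>) (at z within Q)" by (rule has_field_derivative_at_within)
      have "(csqrt (1 + z ^ m) - \<zeta>) * (csqrt (1 + z ^ m) + \<zeta>) = 1"
      proof -
        have "(csqrt (1 + z ^ m) - \<zeta>) * (csqrt (1 + z ^ m) + \<zeta>) = (csqrt (1 + z ^ m))\<^sup>2 - \<zeta>\<^sup>2"
          by (simp add: power2_eq_square algebra_simps)
        then show ?thesis by (simp only: power2_csqrt zeta2) simp
      qed
      then have "norm (csqrt (1 + z ^ m) - \<zeta>) * norm (csqrt (1 + z ^ m) + \<zeta>) = 1"
        by (metis norm_mult norm_one)
      moreover have "(x * c1) powr (3/2) * c2 \<le> norm (csqrt (1 + z ^ m) + \<zeta>)"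
      proof -
        have "0 \<le> Re (csqrt (1 + z ^ m))" using csqrt_principal[of "1 + z ^ m"] by (auto simp del: csqrt.simps)
        then have "(x * c1) powr (3/2) * c2 \<le> Re (csqrt (1 + z ^ m) + \<zeta>)" using Re_zeta by (simp del: csqrt.simps)
        then show ?thesis using complex_Re_le_cmod order.trans by blast
      qed
      ultimately show "norm (csqrt (1 + z ^ m) - \<zeta>) \<le> 1 / ((x * c1) powr (3/2) * c2)"
        using pos by (metis mult_left_mono norm_ge_zero pos_le_divide_eq)
    qed (auto simp: Q_def)
    also have "norm (of_real x * e - of_real x) \<le> 2 * x"
      using norm_triangle_ineq4[of "of_real x * e" "of_real x"] x by (simp add: norm_mult e_def)
    finally show ?thesis using x c by (simp add: mult_left_mono divide_right_mono)
  qed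
  have "((\<lambda>x. F (of_real x * e) - F (of_real x)) \<longlongrightarrow> 0) at_top"
  proof (rule Lim_null_comparison)
    show "\<forall>\<^sub>F x in at_top. norm (F (of_real x * e) - F (of_real x)) \<le> 2 * x / ((x * c1) powr (3/2) * c2)"
      using eventually_ge_at_top[of "1 / c1"] eventually_gt_at_top[of 0]
    proof eventually_elim
      case (elim x)
      then show ?case using c by (intro diff) (auto simp: field_simps)
    qed
    show "((\<lambda>x. 2 * x / ((x * c1) powr (3/2) * c2)) \<longlongrightarrow> 0) at_top" using c by real_asymp
  qed
  moreover have "((\<lambda>x. F (of_real x)) \<longlongrightarrow> of_real (actK m)) at_top"
  proof (rule Lim_transform_eventually)
    show "((\<lambda>x. of_real (actr m x) :: complex) \<longlongrightarrow> of_real (actK m)) at_top"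
      by (intro tendsto_of_real actK m)
    show "\<forall>\<^sub>F x in at_top. of_real (actr m x) = F (of_real x)"
      using eventually_gt_at_top[of 0]
    proof eventually_elim
      case (elim x)
      have "primG m (of_real x) = of_real (Re (primG m (of_real x)))"
        using primG_real[of m x] elim m by (simp add: complex_eq_iff)
      moreover have "of_real x powr of_real s = (of_real (x powr s) :: complex)"
        using elim by (simp add: powr_of_real)
      ultimately show ?case by (simp add: F_def actr_def s_def)
    qed
  qed
  ultimately have "((\<lambda>x. (F (of_real x * e) - F (of_real x)) + F (of_real x)) \<longlongrightarrow> 0 + of_real (actK m)) at_top"
    by (rule tendsto_add)
  then show ?thesis by (simp add: F_def e_def)
qed

section \<open>The action as a function of the spectral parameter\<close>

definition rho :: "nat \<Rightarrow> real" where "rho m = 1 / 2 + 1 / real m"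

text \<open>This is the integral of \<open>csqrt (t ^ m + lam)\<close> over \<open>t\<close> from 0
  to \<open>y\<close>, after scaling \<open>t\<close> by the \<open>m\<close>-th root of
  \<open>lam\<close>; the powers of \<open>lam\<close> are the principal ones.\<close>

definition actT :: "nat \<Rightarrow> complex \<Rightarrow> real \<Rightarrow> complex" where
  "actT m lam y = exp (of_real (rho m) * Ln lam) * primG m (of_real y * exp (- Ln lam / of_nat m))"

lemma actT_0: "m \<ge> 1 \<Longrightarrow> actT m lam 0 = 0"
  by (simp add: actT_def primG)

lemma actT_deriv:
  assumes m: "m \<ge> 1" and lam: "lam \<notin> \<real>\<^sub>\<le>\<^sub>0" and y: "y \<ge> 0"
  shows "(actT m lam has_vector_derivative csqrt (of_real (y ^ m) + lam)) (at y within A)"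
proof -
  define \<mu> where "\<mu> = exp (- Ln lam / of_nat m)"
  have lam0: "lam \<noteq> 0" using lam by auto
  have "\<mu> ^ m = exp (of_nat m * (- Ln lam / of_nat m))" unfolding \<mu>_def by (rule exp_of_nat_mult [symmetric])
  also have "\<dots> = 1 / lam" using m lam0 by (simp add: exp_minus field_simps)
  finally have mu_m: "(of_real y * \<mu>) ^ m = of_real (y ^ m) / lam" by (simp add: power_mult_distrib)
  have st: "of_real y * \<mu> \<in> star_dom m"
  proof -
    have "1 + of_real (y ^ m) / lam \<notin> \<real>\<^sub>\<le>\<^sub>0"
    proof
      assume "1 + of_real (y ^ m) / lam \<in> \<real>\<^sub>\<le>\<^sub>0"
      then obtain t where t: "t \<le> 0" "1 + of_real (y ^ m) / lam = of_real t" by (auto elim!: nonpos_Reals_cases)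
      then have "of_real (y ^ m) = of_real (t - 1) * lam" using lam0 by (simp add: field_simps)
      then have "lam = of_real (y ^ m / (t - 1))" using t(1) by (simp add: field_simps)
      moreover have "y ^ m / (t - 1) \<le> 0" using y t(1) by (intro divide_nonneg_nonpos) auto
      ultimately show False using lam nonpos_Reals_of_real_iff[of "y ^ m / (t - 1)"] by metis
    qed
    then show ?thesis by (simp add: star_dom_def mu_m)
  qed
  have "(primG m has_field_derivative csqrt (1 + (of_real y * \<mu>) ^ m)) (at (of_real y * \<mu>))" by (rule primG(2)[OF m st])
  then have "(primG m has_field_derivative csqrt (1 + of_real (y ^ m) / lam)) (at (of_real y * \<mu>) within (\<lambda>y. of_real y * \<mu>) ` A)"
    unfolding mu_m by (rule has_field_derivative_at_within)
  moreover have "((\<lambda>y. of_real y * \<mu>) has_vector_derivative \<mu>) (at y within A)"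
    by (auto intro!: derivative_eq_intros)
  ultimately have "((\<lambda>y. primG m (of_real y * \<mu>)) has_vector_derivative \<mu> * csqrt (1 + of_real (y ^ m) / lam)) (at y within A)"
    using field_vector_diff_chain_within[of "\<lambda>y. of_real y * \<mu>" \<mu> y A "primG m"] by (simp add: o_def)
  then have "(actT m lam has_vector_derivative exp (of_real (rho m) * Ln lam) * (\<mu> * csqrt (1 + of_real (y ^ m) / lam))) (at y within A)"
    unfolding actT_def[abs_def] \<mu>_def by (rule has_vector_derivative_mult_right)
  moreover have "exp (of_real (rho m) * Ln lam) * \<mu> = csqrt lam"
  proof -
    have "of_real (rho m) * Ln lam + - Ln lam / of_nat m = Ln lam / 2"
      using m by (simp add: rho_def field_simps)
    then show ?thesis unfolding \<mu>_def csqrt_exp_Ln[OF lam0] exp_add [symmetric] by (simp only:)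
  qed
  ultimately show ?thesis
    using csqrt_times_csqrt_pos[of "y ^ m" lam] y lam by (simp add: mult.assoc [symmetric] del: csqrt.simps)
qed

text \<open>Since \<open>lam\<close> avoids the negative axis, the argument of
  \<open>exp (- Ln lam / m)\<close> is below \<open>pi / m\<close> in modulus, and the limit along
  rays applies. The regularising terms match because \<open>m * rho m = m / 2 + 1\<close>.\<close>

lemma actT_limit:
  assumes m: "m \<ge> 3" and lam: "lam \<notin> \<real>\<^sub>\<le>\<^sub>0"
  defines "s \<equiv> real m / 2 + 1"
  shows "((\<lambda>N. actT m lam N - of_real (N powr s / s)) \<longlongrightarrow> of_real (actK m) * exp (of_real (rho m) * Ln lam)) at_top"
proof -
  define \<mu> where "\<mu> = exp (- Ln lam / of_nat m)"
  define \<psi> where "\<psi> = - Arg lam / real m"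
  have lam0: "lam \<noteq> 0" using lam by auto
  have "\<bar>Arg lam\<bar> < pi"
  proof -
    have "Arg lam \<noteq> pi" using lam lam0 by (auto simp: Arg_eq_pi complex_nonpos_Reals_iff)
    then show ?thesis using mpi_less_Arg[of lam] Arg_le_pi[of lam] by auto
  qed
  then have psi: "\<bar>\<psi>\<bar> < pi / real m" using m by (simp add: \<psi>_def abs_mult divide_strict_right_mono)
  have Im_mu: "Im (- Ln lam / of_nat m) = \<psi>" using lam0 m by (simp add: \<psi>_def Arg_eq_Im_Ln Im_divide_of_nat)
  have mu: "\<mu> = of_real (norm \<mu>) * cis \<psi>" 
    unfolding \<mu>_def exp_eq_polar[of "- Ln lam / of_nat m"] Im_mu by (simp add: norm_mult)
  have nmu: "norm \<mu> > 0" by (simp add: \<mu>_def)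
  have "filterlim (\<lambda>N. N * norm \<mu>) at_top at_top"
    using nmu by (intro filterlim_at_top_mult_tendsto_pos[OF tendsto_const]) (auto simp: filterlim_ident)
  from tendsto_mult[OF tendsto_const filterlim_compose[OF primG_direction[OF m psi] this], of "exp (of_real (rho m) * Ln lam)"]
  have "((\<lambda>N. exp (of_real (rho m) * Ln lam) * (primG m (of_real (N * norm \<mu>) * cis \<psi>) - (of_real (N * norm \<mu>) * cis \<psi>) powr of_real s / of_real s))
     \<longlongrightarrow> exp (of_real (rho m) * Ln lam) * of_real (actK m)) at_top" by (simp add: s_def)
  then have "((\<lambda>N. exp (of_real (rho m) * Ln lam) * (primG m (of_real N * \<mu>) - (of_real N * \<mu>) powr of_real s / of_real s))
     \<longlongrightarrow> exp (of_real (rho m) * Ln lam) * of_real (actK m)) at_top"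
    by (subst mu, subst mu) (simp add: mult.assoc)
  then have "((\<lambda>N. actT m lam N - of_real (N powr s / s)) \<longlongrightarrow> exp (of_real (rho m) * Ln lam) * of_real (actK m)) at_top"
  proof (rule Lim_transform_eventually)
    show "\<forall>\<^sub>F N in at_top. exp (of_real (rho m) * Ln lam) * (primG m (of_real N * \<mu>) - (of_real N * \<mu>) powr of_real s / of_real s)
       = actT m lam N - of_real (N powr s / s)"
      using eventually_gt_at_top[of 0]
    proof eventually_elim
      case (elim N)
      \<comment> \<open>The argument of \<open>of_real N * \<mu>\<close> is \<open>\<psi>\<close>,
        of modulus below \<open>pi\<close>, so the principal logarithm of the product is the
        expected sum.\<close>
      have "Ln (exp (of_real (ln N) - Ln lam / of_nat m)) = of_real (ln N) - Ln lam / of_nat m"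
      proof (rule Ln_exp)
        have "pi / real m \<le> pi / 1" using m by (intro divide_left_mono) auto
        then have "\<bar>\<psi>\<bar> < pi" using psi by simp
        moreover have "Im (of_real (ln N) - Ln lam / of_nat m) = \<psi>" using Im_mu by simp
        ultimately show "- pi < Im (of_real (ln N) - Ln lam / of_nat m)" "Im (of_real (ln N) - Ln lam / of_nat m) \<le> pi" by auto
      qed
      moreover have "exp (of_real (ln N) - Ln lam / of_nat m) = of_real N * \<mu>"
      proof -
        have "exp (of_real (ln N) - Ln lam / of_nat m) = exp (of_real (ln N)) * \<mu>"
          unfolding \<mu>_def by (simp flip: exp_add)
        moreover have "exp (of_real (ln N)) = (of_real N :: complex)" using elim exp_of_real[of "ln N"] by simp
        ultimately show ?thesis by simp
      qed
      ultimately have "Ln (of_real N * \<mu>) = of_real (ln N) - Ln lam / of_nat m" by simp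
      then have "(of_real N * \<mu>) powr of_real s = exp (of_real s * (of_real (ln N) - Ln lam / of_nat m))"
        using elim nmu by (auto simp: powr_def)
      then have "exp (of_real (rho m) * Ln lam) * (of_real N * \<mu>) powr of_real s = exp (of_real (rho m) * Ln lam + of_real s * (of_real (ln N) - Ln lam / of_nat m))"
        by (simp add: exp_add)
      also have "of_real (rho m) * Ln lam + of_real s * (of_real (ln N) - Ln lam / of_nat m) = of_real (s * ln N)"
        using m by (simp add: rho_def s_def field_simps)
      also have "exp (of_real (s * ln N)) = (of_real (N powr s) :: complex)"
        using elim by (simp add: powr_def exp_of_real [symmetric])
      finally show ?case by (simp add: actT_def \<mu>_def algebra_simps)
    qed
  qed
  then show ?thesis by (simp add: mult.commute)
qed

section \<open>Sectors given by a lower bound on the real part\<close>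

lemma sector_csqrt:
  assumes "- k * norm z \<le> Re z" "k < 1"
  shows "sqrt ((1 - k) / 2) * sqrt (norm z) \<le> Re (csqrt z)"
proof -
  have "(1 - k) / 2 * norm z \<le> (norm z + Re z) / 2" using assms by (simp add: algebra_simps)
  then show ?thesis by (simp add: real_sqrt_mult [symmetric])
qed

lemma sector_nonpos: "- k * norm z \<le> Re z \<Longrightarrow> k < 1 \<Longrightarrow> z \<noteq> 0 \<Longrightarrow> z \<notin> \<real>\<^sub>\<le>\<^sub>0"
proof
  assume *: "- k * norm z \<le> Re z" "k < 1" "z \<noteq> 0" "z \<in> \<real>\<^sub>\<le>\<^sub>0"
  then have "norm z = - Re z" by (auto simp: complex_nonpos_Reals_iff cmod_eq_Re)
  moreover have "k * norm z < 1 * norm z" using * by (intro mult_strict_right_mono) auto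
  ultimately show False using * by simp
qed

text \<open>A perturbation of relative size \<open>(1 - k) / 4\<close> halves the distance from
  \<open>k\<close> to 1 and no more, so the negative axis is still avoided.\<close>

lemma sector_perturb:
  assumes "- k * norm z \<le> Re z" "0 \<le> k" "k < 1" "norm e \<le> (1 - k) / 4 * norm z"
  shows "- ((1 + k) / 2) * norm (z + e) \<le> Re (z + e)" "3 / 4 * norm z \<le> norm (z + e)"
proof -
  have n: "norm z - (1 - k) / 4 * norm z \<le> norm (z + e)"
    using norm_triangle_ineq2[of z "- e"] assms(4) by simp
  have kz: "0 \<le> k * norm z" using assms by simp
  have "(1 - k) / 4 * norm z = norm z / 4 - k * norm z / 4" by (simp add: field_simps)
  then show "3 / 4 * norm z \<le> norm (z + e)" using n kz by linarith
  have "- Re (z + e) \<le> k * norm z + (1 - k) / 4 * norm z"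
    using assms abs_Re_le_cmod[of e] by simp
  also have "\<dots> = (k + (1 - k) / 4) * norm z" by (simp add: algebra_simps)
  also have "\<dots> \<le> ((1 + k) / 2 * (1 - (1 - k) / 4)) * norm z"
  proof (intro mult_right_mono)
    have "0 \<le> (1 - k) * (1 - k)" by simp
    then show "k + (1 - k) / 4 \<le> (1 + k) / 2 * (1 - (1 - k) / 4)" using assms by (simp add: field_simps)
  qed simp
  also have "\<dots> = (1 + k) / 2 * (norm z - (1 - k) / 4 * norm z)" by (simp add: algebra_simps)
  also have "\<dots> \<le> (1 + k) / 2 * norm (z + e)" using n assms by (intro mult_left_mono) auto
  finally show "- ((1 + k) / 2) * norm (z + e) \<le> Re (z + e)" by simp
qed

text \<open>A nonnegative real summand turns \<open>l\<close> towards the positive axis. The angle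
  between the two summands stays away from \<open>pi\<close>, which excludes cancellation.\<close>

lemma sector_add:
  assumes "- k * norm l \<le> Re l" "0 \<le> k" "k < 1" "x \<ge> 0"
  shows "- k * norm (of_real x + l) \<le> Re (of_real x + l)"
    and "sqrt ((1 - k) / 2) * (x + norm l) \<le> norm (of_real x + l)"
proof -
  show "- k * norm (of_real x + l) \<le> Re (of_real x + l)"
  proof (cases "Re (of_real x + l) \<ge> 0")
    case True
    then show ?thesis using assms by (simp add: order.trans[of _ 0])
  next
    case False
    then have neg: "x + Re l < 0" by simp
    have "- Re l \<le> k * norm l" using assms by simp
    then have "(- Re l)\<^sup>2 \<le> (k * norm l)\<^sup>2" using neg assms by (intro power_mono) auto
    then have 1: "(1 - k\<^sup>2) * (Re l)\<^sup>2 \<le> k\<^sup>2 * (Im l)\<^sup>2" by (simp add: power_mult_distrib cmod_power2 algebra_simps)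
    have "(x + Re l)\<^sup>2 \<le> (Re l)\<^sup>2" using abs_le_square_iff[of "x + Re l" "Re l"] neg assms by auto
    then have "(1 - k\<^sup>2) * (x + Re l)\<^sup>2 \<le> (1 - k\<^sup>2) * (Re l)\<^sup>2"
      using assms by (intro mult_left_mono) (auto simp: power_le_one power2_commute[of "- x"])
    with 1 have "(x + Re l)\<^sup>2 \<le> (k * norm (of_real x + l))\<^sup>2"
      by (simp add: power_mult_distrib cmod_power2 algebra_simps)
    then have "\<bar>x + Re l\<bar> \<le> \<bar>k * norm (of_real x + l)\<bar>"
      by (simp only: abs_le_square_iff)
    then have "- (x + Re l) \<le> k * norm (of_real x + l)"
      using assms by (simp add: abs_mult)
    then show ?thesis by simp
  qed
  have "((1 - k) / 2) * (x + norm l)\<^sup>2 \<le> (norm (of_real x + l))\<^sup>2"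
  proof -
    have "(x + norm l)\<^sup>2 \<le> 2 * (x\<^sup>2 + (norm l)\<^sup>2)" using sum_squares_bound[of x "norm l"] by (simp add: power2_sum)
    then have "((1 - k) / 2) * (x + norm l)\<^sup>2 \<le> ((1 - k) / 2) * (2 * (x\<^sup>2 + (norm l)\<^sup>2))"
      using assms by (intro mult_left_mono) auto
    also have "\<dots> = x\<^sup>2 + (norm l)\<^sup>2 - k * (x\<^sup>2 + (norm l)\<^sup>2)" by (simp add: field_simps)
    also have "\<dots> \<le> x\<^sup>2 + (norm l)\<^sup>2 - k * (2 * x * norm l)"
      using sum_squares_bound[of x "norm l"] assms by (intro diff_left_mono mult_left_mono) auto
    also have "\<dots> \<le> x\<^sup>2 + (norm l)\<^sup>2 + 2 * x * Re l"
    proof -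
      have "2 * x * (- k * norm l) \<le> 2 * x * Re l" using assms by (intro mult_left_mono) auto
      then show ?thesis by (simp add: algebra_simps)
    qed
    also have "\<dots> = (norm (of_real x + l))\<^sup>2" by (simp add: cmod_power2 power2_sum)
    finally show ?thesis .
  qed
  then have "sqrt (((1 - k) / 2) * (x + norm l)\<^sup>2) \<le> sqrt ((norm (of_real x + l))\<^sup>2)" by (rule real_sqrt_le_mono)
  then show "sqrt ((1 - k) / 2) * (x + norm l) \<le> norm (of_real x + l)"
    using assms unfolding real_sqrt_mult real_sqrt_abs by simp
qed

lemma poly_growth_bound:
  assumes "degree q \<le> n"
  shows "\<exists>C\<ge>0. \<forall>z::complex. norm (poly q z) \<le> C * (1 + norm z) ^ n"
proof (intro exI conjI allI)
  fix z :: complex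
  have "norm (poly q z) \<le> (\<Sum>i\<le>degree q. norm (coeff q i * z ^ i))"
    unfolding poly_altdef by (rule norm_sum)
  also have "\<dots> \<le> (\<Sum>i\<le>degree q. norm (coeff q i) * (1 + norm z) ^ n)"
  proof (intro sum_mono)
    fix i assume "i \<in> {..degree q}"
    then have "norm z ^ i \<le> (1 + norm z) ^ i" "(1 + norm z) ^ i \<le> (1 + norm z) ^ n"
      using assms by (auto intro!: power_mono power_increasing)
    then show "norm (coeff q i * z ^ i) \<le> norm (coeff q i) * (1 + norm z) ^ n"
      unfolding norm_mult norm_power by (intro mult_left_mono) auto
  qed
  finally show "norm (poly q z) \<le> (\<Sum>i\<le>degree q. norm (coeff q i)) * (1 + norm z) ^ n"
    by (simp add: sum_distrib_right)
qed (auto intro: sum_nonneg)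

section \<open>Asymptotics for large spectral parameter\<close>

lemma frac_le_cross: "0 < a \<Longrightarrow> 0 < b \<Longrightarrow> x * b \<le> y * a \<Longrightarrow> x / a \<le> y / b" for a b x y :: real
  by (simp add: field_simps)

text \<open>The cone estimates hold far out, with constants that depend on \<open>lam\<close>. Here
  the whole half-line from 0 is used: for large \<open>lam\<close> away from the negative axis
  \<open>p + lam\<close> has no zero on it and is comparable with \<open>y ^ m + norm lam\<close>.
  The condition \<open>poly p 0 = 0\<close> makes the frame at 0 depend on \<open>lam\<close>
  alone.\<close>

locale wkb_sector = wkb_cone +
  fixes k c2 L0 C0 :: real
  assumes p0: "poly p 0 = 0" and c20: "0 < c2" and L01: "1 \<le> L0" and C00: "0 \<le> C0"
    and diff_bound: "0 \<le> y \<Longrightarrow> norm (poly p (of_real y) - of_real (y ^ m)) \<le> C0 * (1 + y) ^ (m - 1)"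
    and deriv_bound: "0 \<le> y \<Longrightarrow> norm (poly (pderiv p) (of_real y)) \<le> C0 * (1 + y) ^ (m - 1)"
    and q_low: "L0 \<le> norm lam \<Longrightarrow> - k * norm lam \<le> Re lam \<Longrightarrow> 0 \<le> y \<Longrightarrow>
      c2 * (y ^ m + norm lam) \<le> norm (poly p (of_real y) + lam)"
    and q_nonpos: "L0 \<le> norm lam \<Longrightarrow> - k * norm lam \<le> Re lam \<Longrightarrow> 0 \<le> y \<Longrightarrow>
      poly p (of_real y) + lam \<notin> \<real>\<^sub>\<le>\<^sub>0"
    and q_Re: "L0 \<le> norm lam \<Longrightarrow> - k * norm lam \<le> Re lam \<Longrightarrow> 0 \<le> y \<Longrightarrow>
      c2 * sqrt (y ^ m + norm lam) \<le> Re (csqrt (poly p (of_real y) + lam))"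
    and m_Re: "L0 \<le> norm lam \<Longrightarrow> - k * norm lam \<le> Re lam \<Longrightarrow> 0 \<le> y \<Longrightarrow>
      c2 * sqrt (y ^ m + norm lam) \<le> Re (csqrt (of_real (y ^ m) + lam))"
begin

definition "Lam = {lam. L0 \<le> norm lam \<and> - k * norm lam \<le> Re lam}"

lemma LamD: "lam \<in> Lam \<Longrightarrow> L0 \<le> norm lam" "lam \<in> Lam \<Longrightarrow> - k * norm lam \<le> Re lam"
  by (auto simp: Lam_def)

lemma Lam_norm: "lam \<in> Lam \<Longrightarrow> 1 \<le> norm lam" using L01 by (auto simp: Lam_def)

lemma Lam_nonpos: "lam \<in> Lam \<Longrightarrow> lam \<notin> \<real>\<^sub>\<le>\<^sub>0"
  using q_nonpos[of lam 0] p0 by (auto simp: Lam_def)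

definition "wl lam y = csqrt (poly p (of_real y) + lam)"
definition "bl lam y = poly (pderiv p) (of_real y) / (4 * (poly p (of_real y) + lam))"
definition "vl lam y = csqrt (wl lam y)"
definition "Sl lam y = integral {0..y} (wl lam)"

lemma wl_sq: "(wl lam y)\<^sup>2 = poly p (of_real y) + lam" by (simp add: wl_def)
lemma vl_sq: "(vl lam y)\<^sup>2 = wl lam y" by (simp add: vl_def)

lemma Re_wl: "lam \<in> Lam \<Longrightarrow> 0 \<le> y \<Longrightarrow> c2 * sqrt (y ^ m + norm lam) \<le> Re (wl lam y)"
  unfolding wl_def by (rule q_Re) (auto simp: Lam_def)

lemma Re_wl_pos: "lam \<in> Lam \<Longrightarrow> 0 \<le> y \<Longrightarrow> 0 < Re (wl lam y)"
  unfolding wl_def by (intro Re_csqrt_pos q_nonpos LamD)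

lemma wl_nz: "lam \<in> Lam \<Longrightarrow> 0 \<le> y \<Longrightarrow> wl lam y \<noteq> 0" "lam \<in> Lam \<Longrightarrow> 0 \<le> y \<Longrightarrow> vl lam y \<noteq> 0"
  using Re_wl_pos[of lam y] by (auto simp: vl_def)

lemma wl_deriv:
  assumes "lam \<in> Lam" "0 \<le> y"
  shows "(wl lam has_vector_derivative 2 * bl lam y * wl lam y) (at y within Q)"
proof -
  have np: "poly p (of_real y) + lam \<notin> \<real>\<^sub>\<le>\<^sub>0" using assms by (intro q_nonpos LamD)
  have "((\<lambda>z. csqrt (poly p z + lam)) has_field_derivative
     inverse (2 * csqrt (poly p (of_real y) + lam)) * (poly (pderiv p) (of_real y) + 0)) (at (of_real y))"
    by (rule DERIV_chain2[OF has_field_derivative_csqrt DERIV_add[OF poly_DERIV DERIV_const]]) (rule np)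
  then have "((\<lambda>z. csqrt (poly p z + lam)) has_field_derivative 2 * bl lam y * wl lam y) (at (0 + of_real y))"
  proof -
    have q: "poly p (of_real y) + lam = wl lam y * wl lam y" using wl_sq[of lam y] by (simp add: power2_eq_square)
    have "inverse (2 * csqrt (poly p (of_real y) + lam)) * (poly (pderiv p) (of_real y) + 0) = 2 * bl lam y * wl lam y"
      unfolding wl_def[symmetric] using wl_nz(1)[OF assms] unfolding bl_def q by (simp add: field_simps)
    moreover assume "((\<lambda>z. csqrt (poly p z + lam)) has_field_derivative
      inverse (2 * csqrt (poly p (of_real y) + lam)) * (poly (pderiv p) (of_real y) + 0)) (at (of_real y))"
    ultimately show ?thesis by (simp only: add_0)
  qed
  from horizontal_deriv[OF this] show ?thesis by (simp add: wl_def[abs_def])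
qed

lemma vl_deriv:
  assumes "lam \<in> Lam" "0 \<le> y"
  shows "(vl lam has_vector_derivative bl lam y * vl lam y) (at y within Q)"
proof -
  have "wl lam y \<notin> \<real>\<^sub>\<le>\<^sub>0" using Re_wl_pos[OF assms] by (auto simp: complex_nonpos_Reals_iff)
  then have "(csqrt has_field_derivative inverse (2 * csqrt (wl lam y))) (at (wl lam y) within wl lam ` Q)"
    by (rule has_field_derivative_at_within[OF has_field_derivative_csqrt])
  from field_vector_diff_chain_within[OF wl_deriv[OF assms] this]
  have "(vl lam has_vector_derivative 2 * bl lam y * wl lam y * inverse (2 * vl lam y)) (at y within Q)"
    by (simp add: vl_def[abs_def] o_def del: csqrt.simps)
  moreover have "2 * bl lam y * wl lam y * inverse (2 * vl lam y) = bl lam y * vl lam y"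
    unfolding vl_sq[symmetric] using wl_nz(2)[OF assms] by (simp add: field_simps power2_eq_square)
  ultimately show ?thesis by (simp only:)
qed

lemma Sl_deriv:
  assumes "lam \<in> Lam" "y \<in> {0..N}"
  shows "(Sl lam has_vector_derivative wl lam y) (at y within {0..N})"
  unfolding Sl_def[abs_def]
proof (rule integral_has_vector_derivative)
  show "continuous_on {0..N} (wl lam)"
    unfolding continuous_on_eq_continuous_within
    by (intro ballI has_vector_derivative_continuous[OF wl_deriv[OF assms(1)]]) auto
qed (rule assms)

lemma Sl_0 [simp]: "Sl lam 0 = 0" by (simp add: Sl_def)

text \<open>The growing WKB approximation for the full potential \<open>p + lam\<close>, with the
  action counted from 0.\<close>

definition "Rl lam y = exp (Sl lam y) * inverse (vl lam y)"
definition "Pl lam y = wl lam y * Rl lam y"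

lemma Rl_deriv:
  assumes "lam \<in> Lam" "y \<in> {0..N}"
  shows "(Rl lam has_vector_derivative (wl lam y - bl lam y) * Rl lam y) (at y within {0..N})"
proof -
  have y: "0 \<le> y" using assms by simp
  have 1: "((\<lambda>y. exp (Sl lam y)) has_vector_derivative wl lam y * exp (Sl lam y)) (at y within {0..N})"
    using field_vector_diff_chain_within[OF Sl_deriv[OF assms] has_field_derivative_at_within[OF DERIV_exp]]
    by (simp add: o_def)
  have "(inverse has_field_derivative - (inverse (vl lam y) ^ Suc (Suc 0))) (at (vl lam y) within vl lam ` {0..N})"
    by (rule DERIV_inverse[OF wl_nz(2)[OF assms(1) y]])
  from field_vector_diff_chain_within[OF vl_deriv[OF assms(1) y] this]
  have "((\<lambda>y. inverse (vl lam y)) has_vector_derivative bl lam y * vl lam y * - (inverse (vl lam y) ^ Suc (Suc 0))) (at y within {0..N})"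
    by (simp add: o_def)
  moreover have "bl lam y * vl lam y * - (inverse (vl lam y) ^ Suc (Suc 0)) = - bl lam y * inverse (vl lam y)"
    using wl_nz(2)[OF assms(1) y] by (simp add: field_simps)
  ultimately have 2: "((\<lambda>y. inverse (vl lam y)) has_vector_derivative - bl lam y * inverse (vl lam y)) (at y within {0..N})"
    by (simp only:)
  from has_vector_derivative_mult[OF 1 2] show ?thesis
    unfolding Rl_def[abs_def] by (rule has_vector_derivative_eq_rhs) (simp add: algebra_simps)
qed

lemma Pl_deriv:
  assumes "lam \<in> Lam" "y \<in> {0..N}"
  shows "(Pl lam has_vector_derivative (bl lam y + wl lam y) * Pl lam y) (at y within {0..N})"
proof -
  have y: "0 \<le> y" using assms by simp
  from has_vector_derivative_mult[OF wl_deriv[OF assms(1) y] Rl_deriv[OF assms]] show ?thesis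
    unfolding Pl_def[abs_def] by (rule has_vector_derivative_eq_rhs) (simp add: algebra_simps)
qed

lemma binom_bound:
  assumes "lam \<in> Lam" "0 \<le> y"
  shows "(1 + y) ^ m \<le> 2 ^ m * (y ^ m + norm lam)"
proof -
  have "(1 + y) ^ m \<le> (2 * max 1 y) ^ m" using assms by (intro power_mono) auto
  also have "\<dots> = 2 ^ m * (max 1 y) ^ m" by (simp add: power_mult_distrib)
  also have "(max 1 y) ^ m \<le> y ^ m + norm lam"
    using Lam_norm[OF assms(1)] assms(2) by (auto simp: max_def intro: add_increasing)
  finally show ?thesis by simp
qed

text \<open>The weight \<open>1 / (1 + y)^2\<close> has integral 1 over the half-line, so
  \<open>eps lam\<close> is the total rate. The summand 1 keeps \<open>KK\<close> positive.\<close>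

definition "KK = (C0 * 2 ^ m / (4 * c2))\<^sup>2 / c2 + 1"
definition "eps lam = KK / sqrt (norm lam)"

lemma KK_pos: "KK > 0" using c20 by (auto simp: KK_def intro!: add_nonneg_pos divide_nonneg_pos)

text \<open>The coupling decays like \<open>1 / (1 + y)\<close> uniformly in \<open>lam\<close>, as
  \<open>(1 + y) ^ m\<close> is at most a multiple of \<open>y ^ m + norm lam\<close>; the gain
  \<open>1 / sqrt (norm lam)\<close> comes from \<open>Re wl\<close>.\<close>

lemma rate_bound:
  assumes lam: "lam \<in> Lam" and y: "0 \<le> y"
  shows "(norm (bl lam y))\<^sup>2 / Re (wl lam y) \<le> eps lam * (1 / (1 + y)\<^sup>2)"
proof -
  define Y where "Y = y ^ m + norm lam"
  define B where "B = C0 * 2 ^ m / (4 * c2)"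
  have Y1: "Y \<ge> 1" using Lam_norm[OF lam] y by (simp add: Y_def add_increasing)
  have Yl: "norm lam \<le> Y" using y by (simp add: Y_def)
  have Sm: "(1 + y) ^ (m - 1) * (1 + y) = (1 + y) ^ m" using m3     by (subst power_minus_mult) auto
  have B0: "B \<ge> 0" using C00 c20 by (simp add: B_def)
  have "norm (bl lam y) \<le> C0 * (1 + y) ^ (m - 1) / (4 * (c2 * Y))"
    unfolding bl_def norm_divide norm_mult norm_numeral Y_def
    using deriv_bound[OF y] q_low[OF LamD[OF lam] y] Y1 c20 C00 y
    by (intro frac_le mult_left_mono) (auto simp: Y_def)
  also have "\<dots> \<le> B / (1 + y)"
  proof -
    have "C0 * ((1 + y) ^ (m - 1) * (1 + y)) \<le> C0 * (2 ^ m * Y)"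
      unfolding Sm Y_def using binom_bound[OF lam y] C00 by (intro mult_left_mono) auto
    then have "C0 * (1 + y) ^ (m - 1) * (1 + y) \<le> B * (4 * (c2 * Y))" using c20 by (simp add: B_def mult_ac)
    then show ?thesis using Y1 c20 y by (intro frac_le_cross) auto
  qed
  finally have "(norm (bl lam y))\<^sup>2 \<le> (B / (1 + y))\<^sup>2" by (intro power_mono) auto
  moreover have "c2 * sqrt (norm lam) \<le> Re (wl lam y)"
  proof -
    have "c2 * sqrt (norm lam) \<le> c2 * sqrt Y" using Yl c20 by (intro mult_left_mono) auto
    also have "\<dots> \<le> Re (wl lam y)" unfolding Y_def by (rule Re_wl[OF lam y])
    finally show ?thesis .
  qed
  moreover have "0 < norm lam" using Lam_norm[OF lam] by linarith
  then have "0 < sqrt (norm lam)" by simp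
  ultimately have "(norm (bl lam y))\<^sup>2 / Re (wl lam y) \<le> (B / (1 + y))\<^sup>2 / (c2 * sqrt (norm lam))"
    using c20 by (intro frac_le) auto
  also have "\<dots> = (B\<^sup>2 / c2) / sqrt (norm lam) * (1 / (1 + y)\<^sup>2)" by (simp add: power_divide)
  also have "\<dots> \<le> eps lam * (1 / (1 + y)\<^sup>2)"
    unfolding eps_def KK_def B_def[symmetric] using Lam_norm[OF lam]
    by (intro mult_right_mono divide_right_mono) auto
  finally show ?thesis .
qed

definition "sf lam t = Pl lam t * f lam (of_real t) + Rl lam t * f1 lam (of_real t)"
definition "df lam t = Pl lam t * f lam (of_real t) - Rl lam t * f1 lam (of_real t)"
definition "Vf lam t = (norm (sf lam t))\<^sup>2 + (norm (df lam t))\<^sup>2"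
definition "Uf lam t = (norm (df lam t))\<^sup>2 - (norm (sf lam t))\<^sup>2"

lemma frame_estimate:
  assumes lam: "lam \<in> Lam" and N: "0 \<le> N"
  shows "Vf lam 0 \<le> Vf lam N * exp (eps lam)"
    and "Uf lam N - eps lam * exp (eps lam) * Vf lam N \<le> Uf lam 0"
proof -
  define G where "G = (\<lambda>y. - eps lam / (1 + y))"
  have "0 < norm lam" using Lam_norm[OF lam] by linarith
  then have e0: "eps lam > 0" using KK_pos by (simp add: eps_def)
  have G: "0 \<le> G N - G 0" "G N - G 0 \<le> eps lam"
    using e0 N by (auto simp: G_def field_simps)
  have u: "((\<lambda>t. f lam (of_real t)) has_vector_derivative f1 lam (of_real t)) (at t within {0..N})"
    "((\<lambda>t. f1 lam (of_real t)) has_vector_derivative (wl lam t)\<^sup>2 * f lam (of_real t)) (at t within {0..N})" for t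
    using ode_f[of lam] horizontal_deriv[of "f lam" "f1 lam (of_real t)" 0 t "{0..N}"]
      horizontal_deriv[of "f1 lam" "(poly p (of_real t) + lam) * f lam (of_real t)" 0 t "{0..N}"]
    unfolding wl_sq ode_def by simp_all
  have Gd: "(G has_real_derivative eps lam * (1 / (1 + t)\<^sup>2)) (at t within {0..N})" if "t \<in> {0..N}" for t
    unfolding G_def using that by (auto intro!: derivative_eq_intros simp: power2_eq_square)
  have "Vf lam 0 \<le> Vf lam N * exp (G N - G 0)"
    unfolding Vf_def sf_def df_def
    by (rule wkb_decay(1)[OF N u Pl_deriv[OF lam] Rl_deriv[OF lam], where g = "\<lambda>t. eps lam * (1 / (1 + t)\<^sup>2)"])
      (use Re_wl_pos[OF lam] rate_bound[OF lam] Gd in \<open>auto simp: Pl_def\<close>)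
  also have "\<dots> \<le> Vf lam N * exp (eps lam)" using G by (intro mult_left_mono) (auto simp: Vf_def)
  finally show "Vf lam 0 \<le> Vf lam N * exp (eps lam)" .
  have "Uf lam N - (G N - G 0) * exp (G N - G 0) * Vf lam N \<le> Uf lam 0"
    unfolding Vf_def Uf_def sf_def df_def
    by (rule wkb_decay(2)[OF N u Pl_deriv[OF lam] Rl_deriv[OF lam], where g = "\<lambda>t. eps lam * (1 / (1 + t)\<^sup>2)"])
      (use Re_wl_pos[OF lam] rate_bound[OF lam] Gd in \<open>auto simp: Pl_def\<close>)
  moreover have "(G N - G 0) * exp (G N - G 0) * Vf lam N \<le> eps lam * exp (eps lam) * Vf lam N"
    using G e0 by (intro mult_right_mono mult_mono) (auto simp: Vf_def)
  ultimately show "Uf lam N - eps lam * exp (eps lam) * Vf lam N \<le> Uf lam 0" by linarith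
qed

text \<open>Fourth roots of \<open>p + lam\<close> and \<open>p\<close> are compared by multiplying
  with the conjugate factor twice, once for \<open>wl\<close> and \<open>w\<close>, once more for
  their roots.\<close>

lemma vl_ratio:
  assumes lam: "lam \<in> Lam"
  shows "((\<lambda>t. vl lam t / csqrt (w (of_real t))) \<longlongrightarrow> 1) at_top"
proof -
  have inv: "((\<lambda>t. inverse (norm (w (of_real t)))) \<longlongrightarrow> 0) at_top"
    by (rule filterlim_compose[OF tendsto_inverse_0_at_top w_at_top]) (rule filterlim_ident)
  have "((\<lambda>t. vl lam t / csqrt (w (of_real t)) - 1) \<longlongrightarrow> 0) at_top"
  proof (rule Lim_null_comparison)
    show "((\<lambda>t. 2 * norm lam / c * inverse (norm (w (of_real t)))) \<longlongrightarrow> 0) at_top"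
      by (rule tendsto_mult_right_zero[OF inv])
    have "\<forall>\<^sub>F t in at_top. 1 \<le> norm (w (of_real t))"
      using w_at_top by (auto simp: filterlim_at_top)
    then show "\<forall>\<^sub>F t in at_top. norm (vl lam t / csqrt (w (of_real t)) - 1) \<le> 2 * norm lam / c * inverse (norm (w (of_real t)))"
      using eventually_gt_at_top[of X]
    proof eventually_elim
      case (elim t)
      have tD: "of_real t \<in> D" by (rule real_in_D[OF elim(2)])
      have t0: "0 \<le> t" using elim X1 by simp
      define a q where "a = csqrt (w (of_real t))" "q = vl lam t"
      have aw: "a\<^sup>2 = w (of_real t)" and qw: "q\<^sup>2 = wl lam t" by (simp_all add: a_q_def vl_sq)
      have na: "(norm a)\<^sup>2 = norm (w (of_real t))" unfolding aw[symmetric] by (simp add: norm_power)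
      have na1: "1 \<le> norm a" using elim(1) unfolding na[symmetric] by (intro power2_le_imp_le[of 1 "norm a"]) auto
      have Rea: "norm a / 2 \<le> Re a"
      proof -
        have "sqrt ((1 - 0) / 2) * sqrt (norm (w (of_real t))) \<le> Re a"
          unfolding a_q_def using Re_w[OF tD] by (intro sector_csqrt) auto
        moreover have "sqrt (norm (w (of_real t))) = norm a" using na by (metis norm_ge_zero real_sqrt_unique)
        ultimately have "sqrt (1 / 2) * norm a \<le> Re a" by simp
        moreover have "1 / 2 \<le> sqrt (1 / 2 :: real)" by (rule real_le_rsqrt) (simp add: power2_eq_square)
        then have "1 / 2 * norm a \<le> sqrt (1 / 2) * norm a" by (rule mult_right_mono) simp
        ultimately show ?thesis by linarith
      qed
      have Req: "0 \<le> Re q" unfolding a_q_def vl_def using csqrt_principal[of "wl lam t"] by (auto simp del: csqrt.simps)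
      have sum1: "norm a / 2 \<le> norm (q + a)" using Rea Req complex_Re_le_cmod[of "q + a"] by simp
      have "(wl lam t - w (of_real t)) * (wl lam t + w (of_real t)) = lam"
        using wl_sq[of lam t] w_sq[of "of_real t"] by (simp add: algebra_simps power2_eq_square)
      then have e1: "norm (wl lam t - w (of_real t)) * norm (wl lam t + w (of_real t)) = norm lam" by (metis norm_mult)
      have "c * norm (w (of_real t)) \<le> Re (w (of_real t))" using Re_low[OF tD] by (simp add: w_def norm_w[unfolded w_def])
      also have "\<dots> \<le> norm (wl lam t + w (of_real t))"
        using Re_wl_pos[OF lam t0] complex_Re_le_cmod[of "wl lam t + w (of_real t)"] by simp
      finally have *: "norm (wl lam t - w (of_real t)) * (c * norm (w (of_real t))) \<le> norm lam"
        unfolding e1[symmetric] by (intro mult_left_mono) auto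
      then have d1: "norm (wl lam t - w (of_real t)) \<le> norm lam / c * inverse (norm (w (of_real t)))"
      proof -
        have "0 < c * norm (w (of_real t))" using c0 elim(1) by (intro mult_pos_pos) linarith+
        with * have "norm (wl lam t - w (of_real t)) \<le> norm lam / (c * norm (w (of_real t)))"
          by (simp only: pos_le_divide_eq)
        then show ?thesis by (simp add: divide_inverse)
      qed
      have "(q - a) * (q + a) = wl lam t - w (of_real t)" unfolding aw[symmetric] qw[symmetric] by (simp add: algebra_simps power2_eq_square)
      then have "norm (q - a) * norm (q + a) = norm (wl lam t - w (of_real t))" by (metis norm_mult)
      moreover have "norm (q - a) * (norm a / 2) \<le> norm (q - a) * norm (q + a)" using sum1 by (intro mult_left_mono) auto
      ultimately have "norm (q - a) * norm a \<le> 2 * (norm lam / c * inverse (norm (w (of_real t))))" using d1 by linarith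
      moreover have "norm (q - a) * 1 \<le> norm (q - a) * norm a" using na1 by (intro mult_left_mono) auto
      moreover have "norm (q / a - 1) \<le> norm (q - a)"
      proof -
        have "a \<noteq> 0" using na1 by auto
        then have "norm (q / a - 1) = norm (q - a) / norm a" by (simp add: norm_divide [symmetric] diff_divide_distrib)
        also have "\<dots> \<le> norm (q - a) / 1" using na1 by (intro divide_left_mono) auto
        finally show ?thesis by simp
      qed
      ultimately have "norm (q / a - 1) \<le> 2 * (norm lam / c * inverse (norm (w (of_real t))))" by linarith
      then show ?case unfolding a_q_def by simp
    qed
  qed
  then show ?thesis by (rule LIM_zero_cancel)
qed

text \<open>Two normalisations meet at infinity: \<open>f\<close> behaves like
  \<open>\<phi>\<close>, which is built from \<open>S\<close>, while the frame is built from
  \<open>Sl\<close>. After division by \<open>exp (Sl - S)\<close> the two summands tend to 1 and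
  -1, whence 0 for the sum and 2 for the difference.\<close>

lemma frame_limit:
  assumes lam: "lam \<in> Lam"
  shows "((\<lambda>t. sf lam t / exp (Sl lam t - S (of_real t))) \<longlongrightarrow> 0) at_top"
    and "((\<lambda>t. df lam t / exp (Sl lam t - S (of_real t))) \<longlongrightarrow> 2) at_top"
proof -
  define r where "r = (\<lambda>t. vl lam t / csqrt (w (of_real t)))"
  have r: "(r \<longlongrightarrow> 1) at_top" unfolding r_def by (rule vl_ratio[OF lam])
  have id: "filterlim (\<lambda>t. Re (of_real t)) at_top at_top" by (simp add: filterlim_ident)
  have ev: "eventually (\<lambda>t. of_real t \<in> D) at_top"
    using eventually_gt_at_top[of X] by eventually_elim (rule real_in_D)
  define x where "x = (\<lambda>t. r t * (f lam (of_real t) / \<phi> (of_real t)))"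
  define y where "y = (\<lambda>t. (1 / r t) * (f1 lam (of_real t) / (w (of_real t) * \<phi> (of_real t))))"
  have x: "(x \<longlongrightarrow> 1) at_top" using tendsto_mult[OF r tendsto_along(1)[OF id ev]] by (simp add: x_def)
  have y: "(y \<longlongrightarrow> -1) at_top"
    using tendsto_mult[OF tendsto_divide[OF tendsto_const[of 1] r] tendsto_along(2)[OF id ev, of lam]] by (simp add: y_def)
  have eq: "eventually (\<lambda>t. Pl lam t * f lam (of_real t) / exp (Sl lam t - S (of_real t)) = x t
     \<and> Rl lam t * f1 lam (of_real t) / exp (Sl lam t - S (of_real t)) = y t) at_top"
    using eventually_gt_at_top[of X]
  proof eventually_elim
    case (elim t)
    have tD: "of_real t \<in> D" by (rule real_in_D[OF elim])
    have t0: "0 \<le> t" using elim X1 by simp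
    define v a where "v = csqrt (w (of_real t))" "a = vl lam t"
    have v: "w (of_real t) = v * v" "v \<noteq> 0" using w_nz[OF tD] by (auto simp: v_a_def simp flip: power2_eq_square)
    have a: "wl lam t = a * a" "a \<noteq> 0" using wl_nz[OF lam t0] vl_sq[of lam t] by (auto simp: v_a_def power2_eq_square)
    show ?case
      using v(2) a(2) unfolding Pl_def Rl_def x_def y_def r_def \<phi>_def v_a_def[symmetric] a(1)
      unfolding v(1) by (simp add: exp_diff exp_minus field_simps)
  qed
  show "((\<lambda>t. sf lam t / exp (Sl lam t - S (of_real t))) \<longlongrightarrow> 0) at_top"
    by (rule Lim_transform_eventually[OF tendsto_add[OF x y, simplified]])
      (use eq in \<open>eventually_elim, auto simp: sf_def add_divide_distrib\<close>)
  show "((\<lambda>t. df lam t / exp (Sl lam t - S (of_real t))) \<longlongrightarrow> 2) at_top"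
    by (rule Lim_transform_eventually[OF tendsto_diff[OF x y, simplified]])
      (use eq in \<open>eventually_elim, auto simp: df_def diff_divide_distrib\<close>)
qed

end

lemma max_powr_le:
  fixes a b t :: real
  assumes "a > 0" "b > 0" "0 \<le> t" "t \<le> 1"
  shows "a powr t * b powr (1 - t) \<le> a + b"
proof -
  have "a powr t * b powr (1 - t) \<le> max a b powr t * max a b powr (1 - t)"
    using assms by (intro mult_mono powr_mono2) auto
  also have "\<dots> = max a b" using assms by (simp add: powr_add [symmetric])
  finally show ?thesis using assms by auto
qed

lemma csqrt_diff_bound:
  assumes "a > 0" "a \<le> Re (csqrt x + csqrt y)" 
  shows "norm (csqrt x - csqrt y) \<le> norm (x - y) / a"
proof -
  have "(csqrt x - csqrt y) * (csqrt x + csqrt y) = (csqrt x)\<^sup>2 - (csqrt y)\<^sup>2"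
    by (simp add: algebra_simps power2_eq_square)
  then have "norm (csqrt x - csqrt y) * norm (csqrt x + csqrt y) = norm (x - y)"
    by (metis norm_mult power2_csqrt)
  moreover have "a \<le> norm (csqrt x + csqrt y)" using assms complex_Re_le_cmod order.trans by blast
  then have "norm (csqrt x - csqrt y) * a \<le> norm (csqrt x - csqrt y) * norm (csqrt x + csqrt y)"
    by (intro mult_left_mono) auto
  ultimately show ?thesis using assms by (simp add: pos_le_divide_eq)
qed

section \<open>Comparison of the action with that of the monomial\<close>

context wkb_sector
begin

lemma action_start:
  assumes lam: "lam \<in> Lam" and N: "0 \<le> N"
  shows "norm (Sl lam N - actT m lam N) \<le> C0 * (1 + N) ^ (m - 1) / c2 * N"
proof -
  define K where "K = C0 * (1 + N) ^ (m - 1) / c2"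
  have "norm ((Sl lam N - actT m lam N) - (Sl lam 0 - actT m lam 0)) \<le> K * N - K * 0"
  proof (rule path_bound[OF N, where f = "\<lambda>y. Sl lam y - actT m lam y" and g = "\<lambda>_. K"])
    fix y assume y: "y \<in> {0..N}"
    then have y0: "0 \<le> y" by simp
    show "((\<lambda>y. Sl lam y - actT m lam y) has_vector_derivative wl lam y - csqrt (of_real (y ^ m) + lam)) (at y within {0..N})"
      using m3 by (intro has_vector_derivative_diff Sl_deriv[OF lam y] actT_deriv[OF _ Lam_nonpos[OF lam] y0]) auto
    show "((\<lambda>y. K * y) has_real_derivative K) (at y within {0..N})" by (auto intro!: derivative_eq_intros)
    have "1 \<le> sqrt (y ^ m + norm lam)" using Lam_norm[OF lam] y0 by (simp add: add_increasing)
    then have "c2 * 1 \<le> c2 * sqrt (y ^ m + norm lam)" using c20 by (intro mult_left_mono) auto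
    then have "c2 \<le> Re (csqrt (poly p (of_real y) + lam) + csqrt (of_real (y ^ m) + lam))"
      using q_Re[OF LamD[OF lam] y0] m_Re[OF LamD[OF lam] y0] c20 unfolding plus_complex.sel by linarith
    from csqrt_diff_bound[OF c20 this]
    have "norm (wl lam y - csqrt (of_real (y ^ m) + lam)) \<le> norm (poly p (of_real y) - of_real (y ^ m)) / c2"
      by (simp add: wl_def)
    also have "\<dots> \<le> C0 * (1 + y) ^ (m - 1) / c2" using diff_bound[OF y0] c20 by (intro divide_right_mono) auto
    also have "\<dots> \<le> K" unfolding K_def using y c20 C00 by (intro divide_right_mono mult_left_mono power_mono) auto
    finally show "norm (wl lam y - csqrt (of_real (y ^ m) + lam)) \<le> K" .
  qed
  then show ?thesis using m3 by (simp add: actT_0 K_def)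
qed

text \<open>This exponent is below \<open>rho m\<close>, so an error of this order is negligible. It
  is the one for which bounding \<open>y ^ m + norm lam\<close> from below by a product of powers
  leaves exactly the integrable weight \<open>y powr (-3/2)\<close>.\<close>

definition "aexp = 1 / 2 + 1 / (2 * real m)"
definition "C8 = (1 / c2 + 1) / c2\<^sup>2 * (C0 * 2 ^ (m - 1))"

lemma C8_nonneg: "0 \<le> C8" using C00 c20 by (simp add: C8_def)

text \<open>Each difference of roots is \<open>lam\<close> over a sum:
  \<open>wq - wp = lam / (wq + wp)\<close> and \<open>w0 - h = lam / (w0 + h)\<close>. Subtracting
  them leaves \<open>lam\<close> times the differences \<open>w0 - wq\<close> and
  \<open>h - wp\<close> of roots with equal parameter, which are small because \<open>p\<close>
  differs from its leading monomial by terms of degree at most \<open>m - 1\<close>.\<close>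

lemma action_rate:
  assumes lam: "lam \<in> Lam" and y: "X < y"
  shows "norm ((wl lam y - w (of_real y)) - (csqrt (of_real (y ^ m) + lam) - of_real (y powr (real m / 2))))
    \<le> C8 * norm lam powr aexp * y powr (-3/2)"
proof -
  have y1: "1 \<le> y" using y X1 by simp
  then have y0: "0 \<le> y" by simp
  have yD: "of_real y \<in> D" by (rule real_in_D[OF y])
  define h where "h = y powr (real m / 2)"
  have h0: "h > 0" using y1 by (simp add: h_def)
  have h2: "h\<^sup>2 = y ^ m" using y1 by (simp add: h_def powr_power powr_realpow)
  define Y where "Y = y ^ m + norm lam"
  have L1: "1 \<le> norm lam" by (rule Lam_norm[OF lam])
  have Y0: "Y > 0" using y1 L1 by (simp add: Y_def add_pos_nonneg)
  define wq wp w0 where "wq = wl lam y" "wp = w (of_real y)" "w0 = csqrt (of_real (y ^ m) + lam)"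
  note defs = wq_wp_w0_def
  have Rq: "c2 * sqrt Y \<le> Re wq" unfolding defs Y_def by (rule Re_wl[OF lam y0])
  have R0: "c2 * sqrt Y \<le> Re w0" unfolding defs Y_def by (rule m_Re[OF LamD[OF lam] y0])
  have Rp: "0 < Re wp" unfolding defs by (rule Re_w[OF yD])
  have sY: "0 < c2 * sqrt Y" using c20 Y0 by simp
  have hY: "h \<le> sqrt Y" unfolding h2[symmetric] Y_def by (rule real_le_rsqrt) simp
  define M where "M = C0 * 2 ^ (m - 1) * y ^ (m - 1)"
  have dM: "norm (poly p (of_real y) - of_real (y ^ m)) \<le> M"
  proof -
    have "(1 + y) ^ (m - 1) \<le> (2 * y) ^ (m - 1)" using y1 by (intro power_mono) auto
    then have "C0 * (1 + y) ^ (m - 1) \<le> C0 * (2 * y) ^ (m - 1)" using C00 by (intro mult_left_mono)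
    then show ?thesis using diff_bound[OF y0] by (simp add: M_def power_mult_distrib)
  qed
  have M0: "0 \<le> M" using C00 y0 by (simp add: M_def)
  have sq: "wq\<^sup>2 = poly p (of_real y) + lam" "wp\<^sup>2 = poly p (of_real y)" "w0\<^sup>2 = of_real (y ^ m) + lam"
    unfolding defs by (simp_all add: wl_sq w_sq)
  have hc2: "(of_real h)\<^sup>2 = (of_real (y ^ m) :: complex)" by (simp flip: h2)

  define P where "P = (wq + wp) * (w0 + of_real h)"
  have den: "c2\<^sup>2 * Y \<le> norm P"
  proof -
    have "c2 * sqrt Y \<le> norm (wq + wp)" using Rq Rp complex_Re_le_cmod[of "wq + wp"] by simp
    moreover have "c2 * sqrt Y \<le> norm (w0 + of_real h)" using R0 h0 complex_Re_le_cmod[of "w0 + of_real h"] by simp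
    ultimately have "(c2 * sqrt Y) * (c2 * sqrt Y) \<le> norm P" unfolding P_def norm_mult using sY by (intro mult_mono) auto
    moreover have "(c2 * sqrt Y) * (c2 * sqrt Y) = c2\<^sup>2 * (sqrt Y * sqrt Y)" by (simp only: power2_eq_square mult_ac)
    ultimately show ?thesis using Y0 by simp
  qed
  have P0: "norm P > 0" using den Y0 c20 by (smt (verit) mult_pos_pos zero_less_power)
  have e1: "(wq - wp) * (wq + wp) = lam" "(w0 - of_real h) * (w0 + of_real h) = lam"
    using sq hc2 by (simp_all add: algebra_simps power2_eq_square)
  have "((wq - wp) - (w0 - of_real h)) * P = lam * (w0 + of_real h) - lam * (wq + wp)"
  proof -
    have "((wq - wp) - (w0 - of_real h)) * P = ((wq - wp) * (wq + wp)) * (w0 + of_real h)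
       - ((w0 - of_real h) * (w0 + of_real h)) * (wq + wp)"
      unfolding P_def left_diff_distrib[of "wq - wp"] by (simp only: mult_ac)
    then show ?thesis unfolding e1 .
  qed
  also have "\<dots> = lam * ((w0 - wq) + (of_real h - wp))" by (simp add: algebra_simps)
  finally have "norm ((wq - wp) - (w0 - of_real h)) * norm P = norm lam * norm ((w0 - wq) + (of_real h - wp))"
    by (metis norm_mult)
  also have "\<dots> \<le> norm lam * (M / (c2 * h) + M / h)"
  proof (intro mult_left_mono order.trans[OF norm_triangle_ineq] add_mono)
    have "(w0 - wq) * (w0 + wq) = of_real (y ^ m) - poly p (of_real y)" using sq by (simp add: algebra_simps power2_eq_square)
    then have "norm (w0 - wq) * norm (w0 + wq) \<le> M" using dM by (metis norm_minus_commute norm_mult)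
    moreover have "c2 * h \<le> norm (w0 + wq)"
    proof -
      have "c2 * h \<le> c2 * sqrt Y" using hY c20 by (intro mult_left_mono) auto
      then show ?thesis using R0 Rq sY complex_Re_le_cmod[of "w0 + wq"] by simp
    qed
    then have "norm (w0 - wq) * (c2 * h) \<le> norm (w0 - wq) * norm (w0 + wq)" by (intro mult_left_mono) auto
    ultimately show "norm (w0 - wq) \<le> M / (c2 * h)" using c20 h0 by (simp add: pos_le_divide_eq)
    have "(of_real h - wp) * (of_real h + wp) = of_real (y ^ m) - poly p (of_real y)" using sq hc2 by (simp add: algebra_simps power2_eq_square)
    then have "norm (of_real h - wp) * norm (of_real h + wp) \<le> M" using dM by (metis norm_minus_commute norm_mult)
    moreover have "h \<le> norm (of_real h + wp)" using Rp complex_Re_le_cmod[of "of_real h + wp"] by simp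
    then have "norm (of_real h - wp) * h \<le> norm (of_real h - wp) * norm (of_real h + wp)" by (intro mult_left_mono) auto
    ultimately show "norm (of_real h - wp) \<le> M / h" using h0 by (simp add: pos_le_divide_eq)
  qed auto
  finally have n: "norm ((wq - wp) - (w0 - of_real h)) * norm P \<le> norm lam * (M / (c2 * h) + M / h)" .
  have "norm ((wq - wp) - (w0 - of_real h)) * (c2\<^sup>2 * Y) \<le> norm ((wq - wp) - (w0 - of_real h)) * norm P"
    using den by (intro mult_left_mono) auto
  with n have "norm ((wq - wp) - (w0 - of_real h)) \<le> norm lam * (M / (c2 * h) + M / h) / (c2\<^sup>2 * Y)"
    using c20 Y0 by (simp add: pos_le_divide_eq)
  also have "\<dots> = (1 / c2 + 1) / c2\<^sup>2 * (C0 * 2 ^ (m - 1)) * (norm lam * (y ^ (m - 1) / h) / Y)"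
    using c20 h0 Y0 by (simp add: M_def field_simps)
  also have "\<dots> \<le> C8 * (norm lam powr aexp * y powr (-3/2))"
    unfolding C8_def
  proof (intro mult_left_mono)
    show "norm lam * (y ^ (m - 1) / h) / Y \<le> norm lam powr aexp * y powr (-3/2)"
  proof -
    have m0: "real m > 0" using m3 by simp
    have "(y ^ m) powr aexp * norm lam powr (1 - aexp) \<le> Y"
      unfolding Y_def using y1 L1 m3 by (intro max_powr_le) (auto simp: aexp_def field_simps)
    moreover have "(y ^ m) powr aexp = y powr (real m / 2 + 1 / 2)"
    proof -
      have "real m * aexp = real m / 2 + 1 / 2" using m0 by (simp add: aexp_def distrib_left)
      then show ?thesis using y1 by (simp add: powr_realpow[symmetric] powr_powr)
    qed
    ultimately have Yb: "y powr (real m / 2 + 1 / 2) * norm lam powr (1 - aexp) \<le> Y" by simp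
    have "y ^ (m - 1) / h = y powr (real m / 2 - 1)"
    proof -
      have "y ^ (m - 1) = y powr (real m - 1)" using y1 m3 powr_realpow[of y "m - 1"] by simp
      then show ?thesis using y1 by (simp add: h_def powr_diff [symmetric] field_simps)
    qed
    then have "norm lam * (y ^ (m - 1) / h) / Y \<le> norm lam * y powr (real m / 2 - 1) / (y powr (real m / 2 + 1 / 2) * norm lam powr (1 - aexp))"
      using Yb y1 L1 by (intro frac_le) (auto intro!: mult_pos_pos)
    also have "\<dots> = (norm lam powr 1 / norm lam powr (1 - aexp)) * (y powr (real m / 2 - 1) / y powr (real m / 2 + 1 / 2))"
      using L1 by (simp add: mult_ac)
    also have "\<dots> = norm lam powr aexp * y powr (-3/2)"
      unfolding powr_diff [symmetric] by simp
    finally show ?thesis .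
  qed
  qed (use C00 c20 in auto)
  finally show ?thesis
    by (simp add: defs h_def mult.assoc)
qed

text \<open>The function \<open>Df\<close> compares the regularised actions of \<open>p\<close> and
  of the monomial. It is bounded at \<open>x0\<close>, from where on it changes by an integrable
  rate; the regularised action of the monomial has a known limit.\<close>

lemma action_asymp:
  shows "\<exists>K. \<forall>lam\<in>Lam. eventually (\<lambda>N. norm (Sl lam N - S (of_real N) - of_real (actK m) * exp (of_real (rho m) * Ln lam))
     \<le> K * norm lam powr aexp) at_top"
proof -
  define s where "s = real m / 2 + 1"
  have s0: "s > 0" by (simp add: s_def add_nonneg_pos)
  define C6 where "C6 = C0 * (1 + x0) ^ (m - 1) / c2 * x0 + norm (S (of_real x0)) + x0 powr s / s"
  define K where "K = C6 + 2 * C8 + 1"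
  have x0X: "x0 > X" by (simp add: x0_def)
  then have x01: "x0 \<ge> 1" using X1 by simp
  have C6: "C6 \<ge> 0" using C00 c20 x01 s0 by (simp add: C6_def)
  have "eventually (\<lambda>N. norm (Sl lam N - S (of_real N) - of_real (actK m) * exp (of_real (rho m) * Ln lam))
     \<le> K * norm lam powr aexp) at_top" if lam: "lam \<in> Lam" for lam
  proof -
    define Df where "Df = (\<lambda>y. Sl lam y - S (of_real y) - (actT m lam y - of_real (y powr s / s)))"
    have start: "norm (Df x0) \<le> C6"
    proof -
      have "Df x0 = (Sl lam x0 - actT m lam x0) - S (of_real x0) + of_real (x0 powr s / s)" by (simp add: Df_def)
      also have "norm \<dots> \<le> norm (Sl lam x0 - actT m lam x0) + norm (S (of_real x0)) + norm (of_real (x0 powr s / s) :: complex)"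
        by (intro norm_triangle_le add_mono norm_triangle_ineq4 order.refl)
      also have "\<dots> \<le> C6" unfolding C6_def
        using action_start[OF lam, of x0] x01 s0 by (intro add_mono) (auto simp: norm_divide)
      finally show ?thesis .
    qed
    have grow: "norm (Df N - Df x0) \<le> 2 * C8 * norm lam powr aexp" if N: "N \<ge> x0" for N
    proof -
      define Kp where "Kp = C8 * norm lam powr aexp"
      have Kp0: "Kp \<ge> 0" using C8_nonneg by (simp add: Kp_def)
      have "norm (Df N - Df x0) \<le> (- (2 * Kp) * (0 + N) powr (-1/2)) - (- (2 * Kp) * (0 + x0) powr (-1/2))"
      proof (rule path_bound[OF N, where f = Df and G = "\<lambda>y. - (2 * Kp) * (0 + y) powr (-1/2)" and g = "\<lambda>y. Kp * (0 + y) powr (-3/2)"])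
        fix y assume y: "y \<in> {x0..N}"
        then have yX: "X < y" "0 \<le> y" "0 < y" using x0X x01 by auto
        show "((\<lambda>y. - (2 * Kp) * (0 + y) powr (-1/2)) has_real_derivative Kp * (0 + y) powr (-3/2)) (at y within {x0..N})"
          using yX by (intro powr_antideriv) simp
        have 1: "(Sl lam has_vector_derivative wl lam y) (at y within {x0..N})"
          by (rule has_vector_derivative_within_subset[OF Sl_deriv[OF lam, of y N]]) (use y x01 in auto)
        have 2: "((\<lambda>y. S (of_real y)) has_vector_derivative w (of_real y)) (at y within {x0..N})"
          using horizontal_deriv[of S "w (of_real y)" 0 y] S[OF real_in_D[OF yX(1)]] by (simp add: w_def)
        have 3: "(actT m lam has_vector_derivative csqrt (of_real (y ^ m) + lam)) (at y within {x0..N})"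
          using m3 by (intro actT_deriv Lam_nonpos lam yX) auto
        have "((\<lambda>y. y powr s) has_real_derivative s * y powr (s - 1)) (at y within {x0..N})"
          using has_real_derivative_powr[OF yX(3), of s] by (rule has_field_derivative_at_within)
        from DERIV_cdivide[OF this, of s]
        have "((\<lambda>y. y powr s / s) has_real_derivative y powr (real m / 2)) (at y within {x0..N})"
          using s0 by (simp add: s_def)
        then have 4: "((\<lambda>y. of_real (y powr s / s) :: complex) has_vector_derivative of_real (y powr (real m / 2))) (at y within {x0..N})"
          unfolding has_real_derivative_iff_has_vector_derivative
          by (rule bounded_linear.has_vector_derivative[OF bounded_linear_of_real])
        show "(Df has_vector_derivative (wl lam y - w (of_real y)) - (csqrt (of_real (y ^ m) + lam) - of_real (y powr (real m / 2)))) (at y within {x0..N})"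
          unfolding Df_def by (intro has_vector_derivative_diff 1 2 3 4)
        show "norm ((wl lam y - w (of_real y)) - (csqrt (of_real (y ^ m) + lam) - of_real (y powr (real m / 2)))) \<le> Kp * (0 + y) powr (-3/2)"
          using action_rate[OF lam yX(1)] by (simp add: Kp_def)
      qed
      also have "\<dots> \<le> 2 * Kp * x0 powr (-1/2)" using Kp0 by simp
      also have "\<dots> \<le> 2 * Kp * x0 powr 0" using Kp0 x01 by (intro mult_left_mono powr_mono) auto
      finally show ?thesis using x01 by (simp add: Kp_def)
    qed
    have "((\<lambda>N. (actT m lam N - of_real (N powr s / s)) - of_real (actK m) * exp (of_real (rho m) * Ln lam)) \<longlongrightarrow> 0) at_top"
      using actT_limit[OF m3 Lam_nonpos[OF lam]] unfolding s_def by (rule LIM_zero)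
    then have "eventually (\<lambda>N. norm ((actT m lam N - of_real (N powr s / s)) - of_real (actK m) * exp (of_real (rho m) * Ln lam)) < 1) at_top"
      by (intro order_tendstoD(2)[OF tendsto_norm_zero]) auto
    then show ?thesis using eventually_ge_at_top[of x0]
    proof eventually_elim
      case (elim N)
      have L1: "1 \<le> norm lam powr aexp" using Lam_norm[OF lam] by (intro ge_one_powr_ge_zero) (auto simp: aexp_def)
      let ?T = "actT m lam N - of_real (N powr s / s)"
      let ?K = "of_real (actK m) * exp (of_real (rho m) * Ln lam)"
      have "Sl lam N - S (of_real N) - ?K = (Df N - Df x0) + Df x0 + (?T - ?K)" by (simp add: Df_def)
      also have "norm \<dots> \<le> 2 * C8 * norm lam powr aexp + C6 + 1"
        using elim(1) by (intro norm_triangle_le add_mono grow[OF elim(2)] start) auto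
      also have "\<dots> \<le> K * norm lam powr aexp"
        using mult_left_mono[OF L1, of "C6 + 1"] C6 by (simp add: K_def algebra_simps)
      finally show ?case .
    qed
  qed
  then show ?thesis by blast
qed

section \<open>The subdominant solution at the origin for large parameter\<close>

lemma frame_at_0:
  assumes lam: "lam \<in> Lam"
  defines "q \<equiv> csqrt (csqrt lam)"
  shows "sf lam 0 = q * f lam 0 + f1 lam 0 / q" "df lam 0 = q * f lam 0 - f1 lam 0 / q" "q \<noteq> 0" "q\<^sup>2 = csqrt lam"
proof -
  have wl0: "wl lam 0 = csqrt lam" by (simp add: wl_def p0)
  have vl0: "vl lam 0 = q" by (simp add: vl_def wl0 q_def)
  show q: "q \<noteq> 0" using wl_nz(2)[OF lam, of 0] vl0 by simp
  show qq: "q\<^sup>2 = csqrt lam" by (simp add: q_def)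
  have "Pl lam 0 = q" unfolding Pl_def Rl_def wl0 vl0 qq[symmetric] using q by (simp add: power2_eq_square)
  moreover have "Rl lam 0 = 1 / q" by (simp add: Rl_def vl0 inverse_eq_divide)
  ultimately show "sf lam 0 = q * f lam 0 + f1 lam 0 / q" "df lam 0 = q * f lam 0 - f1 lam 0 / q"
    by (simp_all add: sf_def df_def)
qed

end

text \<open>Both \<open>V\<close> and \<open>U\<close> equal \<open>4 * T * T\<close> up to a
  relative error of order \<open>e\<close>, and half of their difference is the square of
  \<open>norm s\<close>; so \<open>s\<close> is small against \<open>d\<close>. The bound
  \<open>1 / 16\<close> keeps \<open>4 - 10 * e\<close> above 3.\<close>

lemma frame_ratio_estimates:
  fixes s d :: complex and V U e T VN Unn :: real
  assumes V: "V = (norm s)\<^sup>2 + (norm d)\<^sup>2" and U: "U = (norm d)\<^sup>2 - (norm s)\<^sup>2"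
    and e: "0 < e" "e \<le> 1 / 16" and T: "0 < T"
    and VN: "VN \<le> T\<^sup>2 * (4 + e)" "0 \<le> VN" and Unn: "T\<^sup>2 * (4 - e) \<le> Unn"
    and VV: "V \<le> VN * exp e" and UU: "Unn - e * exp e * VN \<le> U"
  shows "d \<noteq> 0" "T \<le> norm d" "norm d \<le> 3 * T" "norm (s / d) \<le> 2 * sqrt e"
proof -
  have ex: "exp e \<le> 1 + 2 * e" using exp_bound_lemma[of e] e by simp
  have T2: "0 < T\<^sup>2" using T by simp
  have e2: "e * e \<le> e / 16" using e mult_left_mono[of e "1/16" e] by simp
  have "V \<le> VN * (1 + 2 * e)" using VV mult_left_mono[OF ex VN(2)] by linarith
  also have "\<dots> \<le> T\<^sup>2 * (4 + e) * (1 + 2 * e)" using VN e by (intro mult_right_mono) auto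
  also have "\<dots> = T\<^sup>2 * ((4 + e) * (1 + 2 * e))" by simp
  also have "\<dots> \<le> T\<^sup>2 * (4 + 10 * e)" using e2 e T2 by (intro mult_left_mono) (auto simp: algebra_simps)
  finally have V4: "V \<le> T\<^sup>2 * (4 + 10 * e)" .
  have "e * exp e * VN \<le> e * (1 + 2 * e) * (T\<^sup>2 * (4 + e))"
    using ex e VN by (intro mult_mono) auto
  also have "\<dots> = T\<^sup>2 * (e * ((1 + 2 * e) * (4 + e)))" by simp
  also have "\<dots> \<le> T\<^sup>2 * (e * 9)"
  proof -
    have "(1 + 2 * e) * (4 + e) = 4 + 9 * e + 2 * (e * e)" by (simp add: algebra_simps)
    then have "(1 + 2 * e) * (4 + e) \<le> 9" using e2 e by linarith
    then show ?thesis using e T2 by (intro mult_left_mono) auto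
  qed
  finally have "T\<^sup>2 * (4 - e) - T\<^sup>2 * (e * 9) \<le> U" using Unn UU by linarith
  then have U4: "T\<^sup>2 * (4 - 10 * e) \<le> U" by (simp add: algebra_simps)
  have s2: "(norm s)\<^sup>2 \<le> T\<^sup>2 * (10 * e)" using V4 U4 by (simp add: V U algebra_simps)
  have "T\<^sup>2 * 3 \<le> T\<^sup>2 * (4 - 10 * e)" using e by (intro mult_left_mono) auto
  then have d2: "T\<^sup>2 * 3 \<le> (norm d)\<^sup>2" using U4 zero_le_power2[of "norm s"] unfolding U by linarith
  then have "T\<^sup>2 \<le> (norm d)\<^sup>2" using T2 by linarith
  then show Td: "T \<le> norm d" by (intro power2_le_imp_le[of T "norm d"]) auto
  then show d0: "d \<noteq> 0" using T by auto
  have "T\<^sup>2 * (4 + 10 * e) \<le> T\<^sup>2 * 9" using e by (intro mult_left_mono) auto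
  then have "(norm d)\<^sup>2 \<le> 9 * T\<^sup>2" using V4 zero_le_power2[of "norm s"] unfolding V by linarith
  then have "(norm d)\<^sup>2 \<le> (3 * T)\<^sup>2" by (simp add: power_mult_distrib)
  then show "norm d \<le> 3 * T" using T by (intro power2_le_imp_le[of "norm d" "3 * T"]) auto
  have "T\<^sup>2 * (10 * e) \<le> T\<^sup>2 * (12 * e)" using e by (intro mult_left_mono) auto
  moreover have "T\<^sup>2 * (12 * e) = (T\<^sup>2 * 3) * (4 * e)" by simp
  ultimately have "(norm s)\<^sup>2 \<le> (T\<^sup>2 * 3) * (4 * e)" using s2 by linarith
  also have "\<dots> \<le> (norm d)\<^sup>2 * (4 * e)" using d2 e by (intro mult_right_mono) auto
  also have "\<dots> = (norm d * (2 * sqrt e))\<^sup>2" using e by (simp add: power_mult_distrib)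
  finally have "norm s \<le> norm d * (2 * sqrt e)" using e by (intro power2_le_imp_le[of "norm s"]) auto
  then show "norm (s / d) \<le> 2 * sqrt e" using d0 by (simp add: norm_divide divide_le_eq mult.commute)
qed

context wkb_sector
begin

text \<open>Inverting the frame at 0 gives \<open>f = d * (1 + x) / (2 * q)\<close> and
  \<open>f1 = d * (x - 1) * q / 2\<close> with \<open>x = s / d\<close> small. The growth sits in
  \<open>T\<close>, the modulus of \<open>exp (Sl - S)\<close>; logarithms of constants fit into 4,
  and \<open>q\<close> contributes a quarter of \<open>ln (norm lam)\<close>.\<close>

lemma f_large_single:
  assumes lam: "lam \<in> Lam" and eps: "eps lam \<le> 1 / 16"
    and K: "eventually (\<lambda>N. norm (Sl lam N - S (of_real N) - of_real (actK m) * exp (of_real (rho m) * Ln lam)) \<le> M) at_top"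
  shows "f lam 0 \<noteq> 0"
    and "\<bar>ln (norm (f lam 0)) - actK m * Re (exp (of_real (rho m) * Ln lam))\<bar> \<le> M + 4 + ln (norm lam)"
    and "norm (f1 lam 0 / (f lam 0 * csqrt lam) + 1) \<le> 8 * sqrt (eps lam)"
proof -
  define e where "e = eps lam"
  have L1: "1 \<le> norm lam" by (rule Lam_norm[OF lam])
  have "0 < norm lam" using L1 by linarith
  then have e0: "0 < e" using KK_pos by (simp add: e_def eps_def)
  define \<theta> where "\<theta> = (\<lambda>N. exp (Sl lam N - S (of_real N)))"
  have nth: "norm (\<theta> N) > 0" for N by (simp add: \<theta>_def)
  have l1: "((\<lambda>N. norm (sf lam N / \<theta> N)) \<longlongrightarrow> 0) at_top" "((\<lambda>N. norm (df lam N / \<theta> N)) \<longlongrightarrow> 2) at_top"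
    using tendsto_norm[OF frame_limit(1)[OF lam]] tendsto_norm[OF frame_limit(2)[OF lam]] by (simp_all add: \<theta>_def)
  have "((\<lambda>N. (norm (sf lam N / \<theta> N))\<^sup>2 + (norm (df lam N / \<theta> N))\<^sup>2) \<longlongrightarrow> 0\<^sup>2 + 2\<^sup>2) at_top"
    by (intro tendsto_intros l1)
  then have ev1: "eventually (\<lambda>N. (norm (sf lam N / \<theta> N))\<^sup>2 + (norm (df lam N / \<theta> N))\<^sup>2 < 4 + e) at_top"
    by (rule order_tendstoD(2)) (use e0 in simp)
  have "((\<lambda>N. (norm (df lam N / \<theta> N))\<^sup>2 - (norm (sf lam N / \<theta> N))\<^sup>2) \<longlongrightarrow> 2\<^sup>2 - 0\<^sup>2) at_top"
    by (intro tendsto_intros l1)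
  then have ev2: "eventually (\<lambda>N. 4 - e < (norm (df lam N / \<theta> N))\<^sup>2 - (norm (sf lam N / \<theta> N))\<^sup>2) at_top"
    by (rule order_tendstoD(1)) (use e0 in simp)
  have "eventually (\<lambda>N. N \<ge> 0 \<and> Vf lam N \<le> (norm (\<theta> N))\<^sup>2 * (4 + e) \<and> (norm (\<theta> N))\<^sup>2 * (4 - e) \<le> Uf lam N
    \<and> norm (Sl lam N - S (of_real N) - of_real (actK m) * exp (of_real (rho m) * Ln lam)) \<le> M) at_top"
    using ev1 ev2 K eventually_ge_at_top[of 0]
  proof eventually_elim
    case (elim N)
    have T2: "0 < (norm (\<theta> N))\<^sup>2" by (rule zero_less_power[OF nth])
    have "Vf lam N / (norm (\<theta> N))\<^sup>2 < 4 + e" "4 - e < Uf lam N / (norm (\<theta> N))\<^sup>2"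
      using elim(1,2) by (simp_all add: Vf_def Uf_def norm_divide power_divide add_divide_distrib diff_divide_distrib)
    then have "Vf lam N < (4 + e) * (norm (\<theta> N))\<^sup>2" "(4 - e) * (norm (\<theta> N))\<^sup>2 < Uf lam N"
      unfolding pos_divide_less_eq[OF T2] pos_less_divide_eq[OF T2] by simp_all
    then show ?case using elim(3,4) by (simp add: mult.commute)
  qed
  then obtain N where N: "N \<ge> 0" "Vf lam N \<le> (norm (\<theta> N))\<^sup>2 * (4 + e)" "(norm (\<theta> N))\<^sup>2 * (4 - e) \<le> Uf lam N"
    "norm (Sl lam N - S (of_real N) - of_real (actK m) * exp (of_real (rho m) * Ln lam)) \<le> M"
    using eventually_happens trivial_limit_at_top_linorder by blast
  define T where "T = norm (\<theta> N)"
  define s d where "s = sf lam 0" "d = df lam 0"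
  have V: "Vf lam 0 = (norm s)\<^sup>2 + (norm d)\<^sup>2" and U: "Uf lam 0 = (norm d)\<^sup>2 - (norm s)\<^sup>2"
    by (simp_all add: Vf_def Uf_def s_d_def)
  have T0: "0 < T" unfolding T_def by (rule nth)
  have VN0: "0 \<le> Vf lam N" by (simp add: Vf_def)
  note est = frame_ratio_estimates[OF V U e0 eps[folded e_def] T0 N(2)[folded T_def] VN0 N(3)[folded T_def]
      frame_estimate(1)[OF lam N(1), folded e_def] frame_estimate(2)[OF lam N(1), folded e_def]]
  define q where "q = csqrt (csqrt lam)"
  note fr = frame_at_0[OF lam, folded q_def s_d_def]
  define x where "x = s / d"
  have se: "sqrt e \<le> 1 / 4" using eps real_sqrt_le_mono[of e "1/16"] by (simp add: e_def real_sqrt_divide)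
  have x: "norm x \<le> 2 * sqrt e" "norm x \<le> 1 / 2" using est(4) se by (simp_all add: x_def)
  have x1: "1 / 2 \<le> norm (1 + x)" "norm (1 + x) \<le> 3 / 2"
    using norm_triangle_ineq2[of 1 "- x"] norm_triangle_ineq[of 1 x] x(2) by auto
  have f: "f lam 0 = d * (1 + x) / (2 * q)" 
    using est(1) fr(3) unfolding x_def fr(1,2) by (simp add: field_simps)
  have f1: "f1 lam 0 = d * (x - 1) * q / 2"
    using est(1) fr(3) unfolding x_def fr(1,2) by (simp add: field_simps)
  have x10: "1 + x \<noteq> 0" using x1 by auto
  show f0: "f lam 0 \<noteq> 0" using est(1) fr(3) x10 by (simp add: f)
  have "(x - 1) / (1 + x) * (f lam 0 * csqrt lam) = ((x - 1) / (1 + x) * (1 + x)) * (d / 2 * (q * (q / q)))"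
    unfolding f fr(4)[symmetric] by (simp add: power2_eq_square)
  also have "\<dots> = f1 lam 0" unfolding f1 using x10 fr(3) by simp
  finally have "f1 lam 0 / (f lam 0 * csqrt lam) = (x - 1) / (1 + x)"
    using f0 fr(3,4) by (metis nonzero_mult_div_cancel_right mult_eq_0_iff zero_eq_power2)
  then have "f1 lam 0 / (f lam 0 * csqrt lam) + 1 = (x - 1) / (1 + x) + 1" by simp
  also have "\<dots> = 2 * x / (1 + x)" using x10 by (simp add: field_simps)
  also have "norm \<dots> = 2 * norm x / norm (1 + x)" by (simp add: norm_divide norm_mult)
  also have "\<dots> \<le> 2 * (2 * sqrt e) / (1 / 2)" using x x1 e0 by (intro frac_le mult_left_mono) auto
  finally show "norm (f1 lam 0 / (f lam 0 * csqrt lam) + 1) \<le> 8 * sqrt (eps lam)" by (simp add: e_def)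
  have nq: "norm q = norm lam powr (1 / 4)"
    by (simp add: q_def powr_half_sqrt [symmetric] powr_powr)
  have "ln (norm (f lam 0)) = ln (norm d) + ln (norm (1 + x)) - ln 2 - ln (norm q)"
    unfolding f norm_divide norm_mult using est(1) fr(3) x10 by (simp add: ln_div ln_mult)
  moreover have "ln (norm q) = ln (norm lam) / 4" using L1 unfolding nq by (simp add: ln_powr)
  moreover have "0 \<le> ln (norm lam)" using L1 by simp
  moreover have "ln T \<le> ln (norm d)" "ln (norm d) \<le> ln 3 + ln T"
  proof -
    have nd: "0 < norm d" using est(1) by simp
    show "ln T \<le> ln (norm d)" by (rule iffD2[OF ln_le_cancel_iff[OF T0 nd] est(2)])
    have "ln (norm d) \<le> ln (3 * T)" using T0 by (intro iffD2[OF ln_le_cancel_iff[OF nd] est(3)]) simp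
    then show "ln (norm d) \<le> ln 3 + ln T" using T0 by (simp add: ln_mult)
  qed
  moreover have "ln (1 / 2) \<le> ln (norm (1 + x))" "ln (norm (1 + x)) \<le> ln (3 / 2)"
    using x1 x10 by (subst ln_le_cancel_iff; simp)+
  moreover have "ln (1 / 2 :: real) = - ln 2" "ln (3 / 2 :: real) = ln 3 - ln 2" by (simp_all add: ln_div)
  moreover have "ln (2::real) \<le> 1" "ln (3::real) \<le> 2" "0 \<le> ln (2 :: real)"
    using ln_le_minus_one[of "2::real"] ln_le_minus_one[of "3::real"] by simp_all
  moreover have "\<bar>ln T - actK m * Re (exp (of_real (rho m) * Ln lam))\<bar> \<le> M"
  proof -
    have "ln T = Re (Sl lam N - S (of_real N))" by (simp add: T_def \<theta>_def)
    then have "ln T - actK m * Re (exp (of_real (rho m) * Ln lam)) =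
      Re (Sl lam N - S (of_real N) - of_real (actK m) * exp (of_real (rho m) * Ln lam))" by simp
    then show ?thesis using N(4) abs_Re_le_cmod order.trans by metis
  qed
  ultimately show "\<bar>ln (norm (f lam 0)) - actK m * Re (exp (of_real (rho m) * Ln lam))\<bar> \<le> M + 4 + ln (norm lam)"
    unfolding abs_le_iff by linarith
qed

lemma f_large:
  "\<exists>K L1. \<forall>lam. L1 \<le> norm lam \<longrightarrow> - k * norm lam \<le> Re lam \<longrightarrow> f lam 0 \<noteq> 0
    \<and> \<bar>ln (norm (f lam 0)) - actK m * Re (exp (of_real (rho m) * Ln lam))\<bar> \<le> K * norm lam powr aexp + 4 + ln (norm lam)
    \<and> norm (f1 lam 0 / (f lam 0 * csqrt lam) + 1) \<le> K * norm lam powr (-1/4)"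
proof -
  obtain K where K: "\<And>lam. lam \<in> Lam \<Longrightarrow> eventually (\<lambda>N. norm (Sl lam N - S (of_real N) - of_real (actK m) * exp (of_real (rho m) * Ln lam))
     \<le> K * norm lam powr aexp) at_top" using action_asymp by blast
  define L1 where "L1 = max L0 ((16 * KK)\<^sup>2)"
  define K' where "K' = max K (8 * sqrt KK)"
  show ?thesis
  proof (rule exI[of _ K'], rule exI[of _ L1], intro allI impI)
    fix lam assume *: "L1 \<le> norm lam" "- k * norm lam \<le> Re lam"
    then have lam: "lam \<in> Lam" by (auto simp: Lam_def L1_def)
    have n1: "1 \<le> norm lam" by (rule Lam_norm[OF lam])
    have "16 * KK \<le> sqrt (norm lam)" using * by (intro real_le_rsqrt) (simp add: L1_def)
    moreover have "0 < norm lam" using n1 by linarith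
    then have "0 < sqrt (norm lam)" by simp
    ultimately have eps: "eps lam \<le> 1 / 16" by (simp add: eps_def divide_le_eq)
    note fl = f_large_single[OF lam eps K[OF lam]]
    have "8 * sqrt (eps lam) = 8 * sqrt KK * norm lam powr (-1/4)"
    proof -
      have "sqrt (sqrt (norm lam)) = norm lam powr (1/4)" by (simp add: powr_half_sqrt [symmetric] powr_powr)
      then show ?thesis by (simp add: eps_def real_sqrt_divide powr_minus_divide)
    qed
    also have "\<dots> \<le> K' * norm lam powr (-1/4)" by (intro mult_right_mono) (auto simp: K'_def)
    finally have "norm (f1 lam 0 / (f lam 0 * csqrt lam) + 1) \<le> K' * norm lam powr (-1/4)" using fl(3) by linarith
    moreover have "K * norm lam powr aexp \<le> K' * norm lam powr aexp" by (intro mult_right_mono) (auto simp: K'_def)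
    ultimately show "f lam 0 \<noteq> 0
    \<and> \<bar>ln (norm (f lam 0)) - actK m * Re (exp (of_real (rho m) * Ln lam))\<bar> \<le> K' * norm lam powr aexp + 4 + ln (norm lam)
    \<and> norm (f1 lam 0 / (f lam 0 * csqrt lam) + 1) \<le> K' * norm lam powr (-1/4)"
      using fl(1,2) by linarith
  qed
qed

end

section \<open>Monic polynomials satisfy the hypotheses\<close>

lemma monic_diff_degree:
  fixes p :: "complex poly"
  assumes "lead_coeff p = 1" "degree p = m" "m \<ge> 1"
  shows "degree (p - monom 1 m) \<le> m - 1"
proof (rule degree_le, intro allI impI)
  fix i assume "m - 1 < i"
  then have "i = m \<or> i > degree p" using assms by auto
  then show "coeff (p - monom 1 m) i = 0" using assms by (auto simp: coeff_eq_0)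
qed

lemma wkb_sector_exists:
  assumes cone: "wkb_cone p m X T c C S" and p: "lead_coeff p = 1" "degree p = m" "poly p 0 = 0"
    and k: "0 \<le> k" "k < 1"
  shows "\<exists>c2 L0 C0. wkb_sector p m X T c C S k c2 L0 C0"
proof -
  interpret wkb_cone p m X T c C S by (rule cone)
  obtain Ca where Ca: "Ca \<ge> 0" "\<And>z. norm (poly (p - monom 1 m) z) \<le> Ca * (1 + norm z) ^ (m - 1)"
    using poly_growth_bound[OF monic_diff_degree[OF p(1,2)]] m3 by auto
  have "degree (pderiv p) \<le> m - 1" using p by (simp add: degree_pderiv)
  then obtain Cb where Cb: "Cb \<ge> 0" "\<And>z. norm (poly (pderiv p) z) \<le> Cb * (1 + norm z) ^ (m - 1)"
    using poly_growth_bound by blast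
  define C0 where "C0 = max Ca Cb"
  have C0: "C0 \<ge> 0" using Ca by (simp add: C0_def)
  have diff: "norm (poly p (of_real y) - of_real (y ^ m)) \<le> C0 * (1 + y) ^ (m - 1)" if "0 \<le> y" for y
  proof -
    have "norm (poly p (of_real y) - of_real (y ^ m)) \<le> Ca * (1 + y) ^ (m - 1)"
      using Ca(2)[of "of_real y"] that by (simp add: poly_monom)
    also have "\<dots> \<le> C0 * (1 + y) ^ (m - 1)" using that by (intro mult_right_mono) (auto simp: C0_def)
    finally show ?thesis .
  qed
  have der: "norm (poly (pderiv p) (of_real y)) \<le> C0 * (1 + y) ^ (m - 1)" if "0 \<le> y" for y
  proof -
    have "norm (poly (pderiv p) (of_real y)) \<le> Cb * (1 + y) ^ (m - 1)"
      using Cb(2)[of "of_real y"] that by simp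
    also have "\<dots> \<le> C0 * (1 + y) ^ (m - 1)" using that by (intro mult_right_mono) (auto simp: C0_def)
    finally show ?thesis .
  qed
  define k' where "k' = (1 + k) / 2"
  define ck where "ck = sqrt ((1 - k) / 2)"
  \<comment> \<open>This is the size allowed to the lower-order terms: \<open>(C0 + 1) * e\<close>
    is the tolerance \<open>(1 - k) / 4\<close> of a sector perturbation times the constant
    \<open>ck\<close> lost in the sum. For \<open>y\<close> beyond \<open>y0\<close> the power of
    \<open>y\<close> provides it, for smaller \<open>y\<close> the size \<open>L0\<close> of the
    parameter.\<close>
  define e where "e = (1 - k) / 4 * ck / (C0 + 1)"
  have k': "0 \<le> k'" "k' < 1" and ck: "0 < ck" "ck \<le> 1" using k by (auto simp: k'_def ck_def)
  have e0: "e > 0" using C0 k ck by (simp add: e_def)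
  define y0 where "y0 = 2 ^ m / e"
  have y00: "y0 \<ge> 0" using e0 by (simp add: y0_def)
  define L0 where "L0 = max 1 ((1 + y0) ^ (m - 1) / e)"
  define c2 where "c2 = sqrt ((1 - k') / 2) * (3 / 4 * ck)"
  have c20: "0 < c2" using k' ck by (simp add: c2_def)
  have key: "(1 + y) ^ (m - 1) \<le> e * (y ^ m + norm lam)" if "L0 \<le> norm lam" "0 \<le> y" for y and lam :: complex
  proof (cases "y \<le> y0")
    case True
    have "(1 + y) ^ (m - 1) \<le> (1 + y0) ^ (m - 1)" using True that by (intro power_mono) auto
    also have "\<dots> \<le> e * norm lam" using that(1) e0 by (simp add: L0_def divide_le_eq mult.commute)
    also have "\<dots> \<le> e * (y ^ m + norm lam)" using e0 that by (intro mult_left_mono) auto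
    finally show ?thesis .
  next
    case False
    have "(1 + y) ^ m \<le> (2 * max 1 y) ^ m" using that by (intro power_mono) auto
    also have "\<dots> = 2 ^ m * (max 1 y) ^ m" by (simp add: power_mult_distrib)
    also have "(max 1 y) ^ m \<le> y ^ m + norm lam"
    proof -
      have "1 \<le> norm lam" using that(1) by (simp add: L0_def)
      then show ?thesis using that(2) by (auto simp: max_def intro: add_increasing)
    qed
    finally have "(1 + y) ^ m \<le> 2 ^ m * (y ^ m + norm lam)" by simp
    moreover have "(1 + y) ^ m = (1 + y) ^ (m - 1) * (1 + y)" using m3 by (subst power_minus_mult) auto
    ultimately have "(1 + y) ^ (m - 1) * (1 + y) \<le> 2 ^ m * (y ^ m + norm lam)" by simp
    moreover have "(1 + y) ^ (m - 1) * (2 ^ m / e) \<le> (1 + y) ^ (m - 1) * (1 + y)"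
      using False that by (intro mult_left_mono) (auto simp: y0_def)
    ultimately have "(1 + y) ^ (m - 1) * 2 ^ m / e \<le> 2 ^ m * (y ^ m + norm lam)" by simp
    then have "(1 + y) ^ (m - 1) * 2 ^ m \<le> 2 ^ m * (y ^ m + norm lam) * e" unfolding pos_divide_le_eq[OF e0] .
    then show ?thesis by (simp add: mult_ac)
  qed
  have facts: "c2 * (y ^ m + norm lam) \<le> norm (poly p (of_real y) + lam)
     \<and> poly p (of_real y) + lam \<notin> \<real>\<^sub>\<le>\<^sub>0
     \<and> c2 * sqrt (y ^ m + norm lam) \<le> Re (csqrt (poly p (of_real y) + lam))
     \<and> c2 * sqrt (y ^ m + norm lam) \<le> Re (csqrt (of_real (y ^ m) + lam))"
    if lam: "L0 \<le> norm lam" "- k * norm lam \<le> Re lam" and y: "0 \<le> y" for y lam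
  proof -
    define Y z \<eta> where "Y = y ^ m + norm lam" "z = of_real (y ^ m) + lam" "\<eta> = poly p (of_real y) - of_real (y ^ m)"
    have Y1: "1 \<le> Y" using lam y by (simp add: Y_z_\<eta>_def L0_def add_increasing)
    have z1: "- k * norm z \<le> Re z" "ck * Y \<le> norm z"
      using sector_add[OF lam(2) k, of "y ^ m"] y by (simp_all add: Y_z_\<eta>_def ck_def)
    have "norm \<eta> \<le> C0 * (1 + y) ^ (m - 1)" using diff[OF y] by (simp add: Y_z_\<eta>_def)
    also have "\<dots> \<le> (C0 + 1) * (1 + y) ^ (m - 1)" using y by (intro mult_right_mono) auto
    also have "\<dots> \<le> (C0 + 1) * (e * Y)" unfolding Y_z_\<eta>_def using key[OF lam(1) y] C0 by (intro mult_left_mono) auto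
    also have "\<dots> = (1 - k) / 4 * (ck * Y)"
    proof -
      have "C0 + 1 \<noteq> 0" using C0 by simp
      then have "(C0 + 1) * (x / (C0 + 1) * Y) = x * Y" for x by simp
      then show ?thesis unfolding e_def by (simp only: mult.assoc)
    qed
    also have "\<dots> \<le> (1 - k) / 4 * norm z" using k by (intro mult_left_mono z1) auto
    finally have eta: "norm \<eta> \<le> (1 - k) / 4 * norm z" .
    note pert = sector_perturb[OF z1(1) k eta, folded k'_def]
    have qe: "z + \<eta> = poly p (of_real y) + lam" by (simp add: Y_z_\<eta>_def)
    have low: "3 / 4 * ck * Y \<le> norm (z + \<eta>)" using pert(2) z1(2) by simp
    have s1: "sqrt ((1 - k') / 2) \<le> 1" using k' by simp
    have "c2 * Y \<le> 1 * (3 / 4 * ck) * Y" unfolding c2_def using s1 ck Y1 by (intro mult_right_mono) auto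
    then have 1: "c2 * Y \<le> norm (z + \<eta>)" using low by simp
    have "0 < c2 * Y" using c20 Y1 by (intro mult_pos_pos) linarith+
    then have "norm (z + \<eta>) \<noteq> 0" using 1 by linarith
    then have nz: "z + \<eta> \<noteq> 0" by simp
    have 2: "z + \<eta> \<notin> \<real>\<^sub>\<le>\<^sub>0" by (rule sector_nonpos[OF pert(1) k'(2) nz])
    have c34: "(3 / 4 * ck) \<le> sqrt (3 / 4 * ck)" using ck by (intro real_le_rsqrt) (simp add: power2_eq_square mult_le_one mult_left_le)
    have sY: "c2 * sqrt Y \<le> sqrt ((1 - k') / 2) * sqrt W" if "3 / 4 * ck * Y \<le> W" for W
    proof -
      have "3 / 4 * ck * sqrt Y \<le> sqrt (3 / 4 * ck) * sqrt Y" using c34 Y1 by (intro mult_right_mono) auto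
      also have "\<dots> = sqrt (3 / 4 * ck * Y)" by (simp only: real_sqrt_mult)
      also have "\<dots> \<le> sqrt W" using that by simp
      finally have "sqrt ((1 - k') / 2) * (3 / 4 * ck * sqrt Y) \<le> sqrt ((1 - k') / 2) * sqrt W"
        using k' by (intro mult_left_mono) auto
      then show ?thesis by (simp add: c2_def mult.assoc)
    qed
    have 3: "c2 * sqrt Y \<le> Re (csqrt (z + \<eta>))"
      using sY[OF low] sector_csqrt[OF pert(1) k'(2)] by linarith
    have "k * norm z \<le> k' * norm z" using k by (intro mult_right_mono) (auto simp: k'_def)
    then have "sqrt ((1 - k') / 2) * sqrt (norm z) \<le> Re (csqrt z)" using z1(1) by (intro sector_csqrt k') simp
    moreover have "0 \<le> ck * Y" using ck Y1 by simp
    then have "3 / 4 * ck * Y \<le> norm z" using z1(2) by linarith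
    ultimately have 4: "c2 * sqrt Y \<le> Re (csqrt z)" using sY by fastforce
    show ?thesis using 1 2 3 4 unfolding qe unfolding Y_z_\<eta>_def by blast
  qed
  have "wkb_sector p m X T c C S k c2 L0 C0"
  proof (unfold_locales)
    show "poly p 0 = 0" "0 < c2" "0 \<le> C0" by fact+
    show "1 \<le> L0" by (simp add: L0_def)
  qed (use diff der facts in auto)
  then show ?thesis by blast
qed

text \<open>On a cone of half-angle below \<open>pi / m\<close> the power \<open>z ^ m\<close> keeps
  away from the negative axis, and far out \<open>p\<close> is a small relative perturbation of it.
  Convexity of the cone supplies the primitive \<open>S\<close>.\<close>

lemma wkb_cone_exists:
  fixes p :: "complex poly"
  assumes p: "lead_coeff p = 1" "degree p = m" and m: "m \<ge> 3" and beta: "0 < \<beta>" "real m * \<beta> < pi"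
  shows "\<exists>X c C S. wkb_cone p m X (tan \<beta>) c C S"
proof -
  have b2: "\<beta> < pi / 2"
  proof -
    have "2 * \<beta> \<le> real m * \<beta>" using m beta by (intro mult_right_mono) auto
    then show ?thesis using beta by linarith
  qed
  then have T: "tan \<beta> > 0" using beta by (intro tan_gt_zero)
  define k where "k = max 0 (- cos (real m * \<beta>))"
  have "cos pi < cos (real m * \<beta>)" using beta m by (intro cos_monotone_0_pi) auto
  then have k: "0 \<le> k" "k < 1" by (auto simp: k_def)
  define k' where "k' = (1 + k) / 2"
  have k': "k' < 1" using k by (simp add: k'_def)
  obtain Ca where Ca: "Ca \<ge> 0" "\<And>z. norm (poly (p - monom 1 m) z) \<le> Ca * (1 + norm z) ^ (m - 1)"
    using poly_growth_bound[OF monic_diff_degree[OF p(1,2)]] m by auto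
  have "degree (pderiv p) \<le> m - 1" "degree (pderiv (pderiv p)) \<le> m - 2"
    using p by (simp_all add: degree_pderiv)
  then obtain Cb Cc where Cb: "Cb \<ge> 0" "\<And>z. norm (poly (pderiv p) z) \<le> Cb * (1 + norm z) ^ (m - 1)"
    and Cc: "Cc \<ge> 0" "\<And>z. norm (poly (pderiv (pderiv p)) z) \<le> Cc * (1 + norm z) ^ (m - 2)"
    using poly_growth_bound by meson
  have two: "(1 + norm z) ^ j \<le> 2 ^ m * norm z ^ j" if "1 \<le> norm z" "j \<le> m" for z :: complex and j
  proof -
    have "(1 + norm z) ^ j \<le> (2 * norm z) ^ j" using that by (intro power_mono) auto
    also have "\<dots> = 2 ^ j * norm z ^ j" by (simp add: power_mult_distrib)
    also have "\<dots> \<le> 2 ^ m * norm z ^ j" using that by (intro mult_right_mono power_increasing) auto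
    finally show ?thesis .
  qed
  define X where "X = max 1 (4 * Ca * 2 ^ m / (1 - k))"
  define c where "c = min (3 / 4) (sqrt ((1 - k') / 2))"
  define C where "C = max Cb Cc * 2 ^ m * (4 / 3)"
  let ?D = "cone X (tan \<beta>)"
  have main: "poly p z \<notin> \<real>\<^sub>\<le>\<^sub>0 \<and> 3 / 4 * norm z ^ m \<le> norm (poly p z) \<and>
      sqrt ((1 - k') / 2) * sqrt (norm (poly p z)) \<le> Re (csqrt (poly p z)) \<and> 1 \<le> norm z" if z: "z \<in> ?D" for z
  proof -
    have Re: "Re z > X" "Re z > 0" using z by (auto simp: cone_def X_def)
    then have n: "norm z > X" "norm z \<ge> 1" using complex_Re_le_cmod[of z] by (auto simp: X_def)
    have Arg: "\<bar>Arg z\<bar> \<le> \<beta>" using z Re beta b2 by (intro Arg_le_if_slope) (auto simp: cone_def)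
    have "- k * norm (z ^ m) \<le> cos (real m * \<beta>) * norm z ^ m"
      unfolding norm_power by (intro mult_right_mono) (auto simp: k_def)
    also have "\<dots> \<le> Re (z ^ m)" using Arg beta by (intro Re_power_ge_cos) auto
    finally have 1: "- k * norm (z ^ m) \<le> Re (z ^ m)" .
    have nz: "norm z ^ m = norm z ^ (m - 1) * norm z" using m by (subst power_minus_mult) auto
    have "norm (poly p z - z ^ m) \<le> Ca * (2 ^ m * norm z ^ (m - 1))"
      using Ca(2)[of z] mult_left_mono[OF two[OF n(2), of "m - 1"] Ca(1)] by (simp add: poly_monom)
    also have "\<dots> = (Ca * 2 ^ m) * norm z ^ (m - 1)" by simp
    also have "\<dots> \<le> ((1 - k) / 4 * norm z) * norm z ^ (m - 1)"
    proof (intro mult_right_mono)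
      have k10: "1 - k > 0" using k by simp
      have "4 * Ca * 2 ^ m / (1 - k) \<le> norm z" using n(1) by (simp add: X_def)
      then have "4 * Ca * 2 ^ m \<le> norm z * (1 - k)" unfolding pos_divide_le_eq[OF k10] .
      moreover have "4 * Ca * 2 ^ m = 4 * (Ca * 2 ^ m)" "norm z * (1 - k) = 4 * ((1 - k) / 4 * norm z)" by simp_all
      ultimately show "Ca * 2 ^ m \<le> (1 - k) / 4 * norm z" by linarith
    qed simp
    also have "\<dots> = (1 - k) / 4 * norm (z ^ m)" by (simp add: norm_power nz)
    finally have eta: "norm (poly p z - z ^ m) \<le> (1 - k) / 4 * norm (z ^ m)" .
    note pert = sector_perturb[OF 1 k eta, folded k'_def, simplified]
    have low: "3 / 4 * norm z ^ m \<le> norm (poly p z)" using pert(2) by (simp add: norm_power)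
    have "0 < norm z" using n by linarith
    then have "0 < 3 / 4 * norm z ^ m" by simp
    then have "norm (poly p z) \<noteq> 0" using low by linarith
    then have "poly p z \<noteq> 0" by simp
    with pert(1) k' have "poly p z \<notin> \<real>\<^sub>\<le>\<^sub>0" by (intro sector_nonpos[of k']) auto
    moreover have "sqrt ((1 - k') / 2) * sqrt (norm (poly p z)) \<le> Re (csqrt (poly p z))"
      using pert(1) k' by (intro sector_csqrt) auto
    ultimately show ?thesis using low n by blast
  qed
  have "(\<lambda>z. csqrt (poly p z)) holomorphic_on ?D"
    by (intro holomorphic_intros) (use main in auto)
  then obtain S where S: "\<And>z. z \<in> ?D \<Longrightarrow> (S has_field_derivative csqrt (poly p z)) (at z within ?D)"
    using holomorphic_convex_primitive'[OF convex_cone open_cone] by blast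
  have "wkb_cone p m X (tan \<beta>) c C S"
  proof
    show "3 \<le> m" "0 < tan \<beta>" by fact+
    show "1 \<le> X" "0 \<le> C" using Cb(1) by (auto simp: X_def C_def le_max_iff_disj)
    show "0 < c" using k' by (simp add: c_def)
  next
    fix z assume z: "z \<in> ?D"
    note mz = main[OF z]
    show "poly p z \<notin> \<real>\<^sub>\<le>\<^sub>0" using mz by blast
    have "c * norm z ^ m \<le> 3 / 4 * norm z ^ m" by (intro mult_right_mono) (auto simp: c_def)
    then show "c * norm z ^ m \<le> norm (poly p z)" using mz by linarith
    have "c * sqrt (norm (poly p z)) \<le> sqrt ((1 - k') / 2) * sqrt (norm (poly p z))"
      by (intro mult_right_mono) (auto simp: c_def)
    then show "c * sqrt (norm (poly p z)) \<le> Re (csqrt (poly p z))" using mz by linarith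
    have fin: "B * (2 ^ m * norm z ^ m) \<le> C * norm (poly p z)" if "B = Cb \<or> B = Cc" for B
    proof -
      have "B * (2 ^ m * norm z ^ m) \<le> max Cb Cc * (2 ^ m * (4 / 3 * norm (poly p z)))"
        using that mz Cb(1) Cc(1) by (intro mult_mono mult_left_mono) (auto simp: le_max_iff_disj)
      then show ?thesis by (simp add: C_def)
    qed
    have "norm (poly (pderiv p) z) * norm z \<le> Cb * (2 ^ m * norm z ^ (m - 1)) * norm z"
      using Cb(2)[of z] mult_left_mono[OF two[of z "m - 1"] Cb(1)] mz by (intro mult_right_mono) auto
    also have "\<dots> = Cb * (2 ^ m * (norm z ^ (m - 1) * norm z))" by simp
    also have "norm z ^ (m - 1) * norm z = norm z ^ m" using m by (subst power_minus_mult) auto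
    finally show "norm (poly (pderiv p) z) * norm z \<le> C * norm (poly p z)" using fin[of Cb] by simp
    have "norm (poly (pderiv (pderiv p)) z) * (norm z)\<^sup>2 \<le> Cc * (2 ^ m * norm z ^ (m - 2)) * (norm z)\<^sup>2"
      using Cc(2)[of z] mult_left_mono[OF two[of z "m - 2"] Cc(1)] mz by (intro mult_right_mono) auto
    also have "\<dots> = Cc * (2 ^ m * (norm z ^ (m - 2) * (norm z)\<^sup>2))" by simp
    also have "norm z ^ (m - 2) * (norm z)\<^sup>2 = norm z ^ m"
    proof -
      have "m - 2 + 2 = m" using m by simp
      then show ?thesis by (metis power_add)
    qed
    finally show "norm (poly (pderiv (pderiv p)) z) * (norm z)\<^sup>2 \<le> C * norm (poly p z)" using fin[of Cc] by simp
    show "(S has_field_derivative csqrt (poly p z)) (at z)"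
      using S[OF z] at_within_open[OF z open_cone] by simp
  qed
  then show ?thesis by blast
qed

text \<open>\<open>grows m g t h\<close>: the function \<open>ln \<bar>g\<bar>\<close> is asymptotic to \<open>h r^\<rho>\<close>, locally uniformly in the
  direction \<open>t\<close>; \<open>below\<close> is the corresponding upper bound.\<close>

definition dirf :: "real \<Rightarrow> (real \<times> real) filter" where
  "dirf t = at_top \<times>\<^sub>F nhds t"

definition pol :: "real \<times> real \<Rightarrow> complex" where
  "pol x = of_real (fst x) * cis (snd x)"

definition below :: "nat \<Rightarrow> (complex \<Rightarrow> complex) \<Rightarrow> real \<Rightarrow> real \<Rightarrow> bool" where
  "below m g t h \<longleftrightarrow> (\<forall>e>0. \<forall>\<^sub>F x in dirf t. norm (g (pol x)) \<le> exp ((h + e) * fst x powr rho m))"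

definition grows :: "nat \<Rightarrow> (complex \<Rightarrow> complex) \<Rightarrow> real \<Rightarrow> real \<Rightarrow> bool" where
  "grows m g t h \<longleftrightarrow> below m g t h \<and>
     (\<forall>e>0. \<forall>\<^sub>F x in dirf t. exp ((h - e) * fst x powr rho m) \<le> norm (g (pol x)))"

lemma eventually_dirf_fst: "eventually P at_top \<Longrightarrow> eventually (\<lambda>x. P (fst x)) (dirf t)"
  unfolding dirf_def by (rule eventually_compose_filterlim[OF _ filterlim_fst])

lemma eventually_dirf_snd: "eventually P (nhds t) \<Longrightarrow> eventually (\<lambda>x. P (snd x)) (dirf t)"
  unfolding dirf_def by (rule eventually_compose_filterlim[OF _ filterlim_snd])

text \<open>The interface to the remaining proof, in which the WKB functions are hidden in
  \<open>\<Phi>\<close>. The rays with \<open>\<bar>a\<bar> = pi / (m + 2)\<close> bound the Stokes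
  sector and are shared with its neighbours; that \<open>\<Phi>\<close> does not depend on
  \<open>lam\<close> is what makes adjacent Wronskians constant.\<close>

definition subdominant :: "complex poly \<Rightarrow> nat \<Rightarrow> (complex \<Rightarrow> complex \<Rightarrow> complex) \<Rightarrow> (complex \<Rightarrow> complex \<Rightarrow> complex)
    \<Rightarrow> (complex \<Rightarrow> complex) \<Rightarrow> bool" where
  "subdominant p m f f1 \<Phi> \<longleftrightarrow>
     (\<forall>lam. ode p lam (f lam) (f1 lam))
   \<and> (\<lambda>lam. f lam 0) holomorphic_on UNIV \<and> (\<lambda>lam. f1 lam 0) holomorphic_on UNIV
   \<and> (\<forall>lam. ((\<lambda>t. f lam (of_real t)) \<longlongrightarrow> 0) at_top \<and> ((\<lambda>t. f1 lam (of_real t)) \<longlongrightarrow> 0) at_top)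
   \<and> (\<forall>lam a. \<bar>a\<bar> = pi / (real m + 2) \<longrightarrow>
        ((\<lambda>t. f lam (of_real t * cis a) / \<Phi> (of_real t * cis a)) \<longlongrightarrow> 1) at_top \<and>
        ((\<lambda>t. f1 lam (of_real t * cis a) / (csqrt (poly p (of_real t * cis a)) * \<Phi> (of_real t * cis a))) \<longlongrightarrow> -1) at_top \<and>
        eventually (\<lambda>t. \<Phi> (of_real t * cis a) \<noteq> 0) at_top)
   \<and> (\<forall>t. \<bar>t\<bar> < pi \<longrightarrow> grows m (\<lambda>lam. f lam 0) t (actK m * cos (rho m * t)))
   \<and> (\<forall>t. \<bar>t\<bar> < pi \<longrightarrow> ((\<lambda>x. f1 (pol x) 0 / (f (pol x) 0 * csqrt (pol x))) \<longlongrightarrow> -1) (dirf t))"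

lemma powr_log_o:
  fixes a b e K :: real
  assumes ab: "0 < a" "a < b" "e > 0"
  shows "\<forall>\<^sub>F r in at_top. K * r powr a + 4 + ln r \<le> e * r powr b"
proof -
  have "((\<lambda>r. (K * r powr a + 4 + ln r) / r powr b) \<longlongrightarrow> 0) at_top" using ab by real_asymp
  then have "\<forall>\<^sub>F r in at_top. (K * r powr a + 4 + ln r) / r powr b < e" using ab by (intro order_tendstoD)
  then show ?thesis using eventually_gt_at_top[of 0]
    by eventually_elim (simp add: field_simps)
qed

lemma direction_sector:
  assumes "\<bar>t\<bar> < pi"
  shows "\<exists>k. 0 \<le> k \<and> k < 1 \<and> (\<forall>\<^sub>F x in dirf t. fst x > 0 \<and> \<bar>snd x\<bar> < pi \<and> - k * norm (pol x) \<le> Re (pol x))"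
proof -
  define t1 where "t1 = (\<bar>t\<bar> + pi) / 2"
  have t1: "\<bar>t\<bar> < t1" "t1 < pi" "0 \<le> t1" using assms by (auto simp: t1_def)
  define k where "k = max 0 (- cos t1)"
  have "cos pi < cos t1" using t1 by (intro cos_monotone_0_pi) auto
  then have k: "0 \<le> k" "k < 1" by (auto simp: k_def)
  have "eventually (\<lambda>s. \<bar>s\<bar> < t1) (nhds t)"
    using t1 by (intro order_tendstoD(2)[where y = "\<bar>t\<bar>"] tendsto_rabs filterlim_ident)
  from eventually_dirf_snd[OF this] eventually_dirf_fst[OF eventually_gt_at_top[of 0], of t]
  have "\<forall>\<^sub>F x in dirf t. fst x > 0 \<and> \<bar>snd x\<bar> < pi \<and> - k * norm (pol x) \<le> Re (pol x)"
  proof eventually_elim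
    case (elim x)
    have "cos t1 \<le> cos \<bar>snd x\<bar>" using elim t1 by (intro cos_monotone_0_pi_le) auto
    then have "- k \<le> cos (snd x)" by (simp add: k_def)
    then have "- k * fst x \<le> cos (snd x) * fst x" using elim by (intro mult_right_mono) auto
    then show ?case using elim t1 by (simp add: pol_def norm_mult mult.commute)
  qed
  then show ?thesis using k by blast
qed

lemma Ln_pol: "fst x > 0 \<Longrightarrow> \<bar>snd x\<bar> < pi \<Longrightarrow> Ln (pol x) = of_real (ln (fst x)) + \<i> * of_real (snd x)"
proof -
  assume x: "fst x > 0" "\<bar>snd x\<bar> < pi"
  have "exp (of_real (ln (fst x))) = (of_real (fst x) :: complex)" using x by (simp add: exp_of_real)
  then have "pol x = exp (of_real (ln (fst x)) + \<i> * of_real (snd x))"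
    by (simp add: pol_def exp_add cis_conv_exp)
  moreover have "Ln (exp (of_real (ln (fst x)) + \<i> * of_real (snd x))) = of_real (ln (fst x)) + \<i> * of_real (snd x)"
    using x by (intro Ln_exp) auto
  ultimately show ?thesis by simp
qed

theorem subdominant_exists:
  fixes p :: "complex poly"
  assumes p: "lead_coeff p = 1" "degree p = m" "poly p 0 = 0" and m: "m \<ge> 3"
  shows "\<exists>f f1 \<Phi>. subdominant p m f f1 \<Phi>"
proof -
  \<comment> \<open>The cone has to contain the rays at \<open>pi / (m + 2)\<close> and yet stay
    below \<open>pi / m\<close>, so its half-angle is taken halfway between.\<close>
  define \<alpha> \<beta> where "\<alpha> = pi / (real m + 2)" "\<beta> = (pi / (real m + 2) + pi / real m) / 2"
  have ab: "0 < \<alpha>" "\<alpha> < \<beta>" "0 < \<beta>" "\<beta> < pi / real m" "pi / real m < pi / 2"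
  proof -
    have "pi / (real m + 2) < pi / real m" "pi / real m < pi / 2" "0 < pi / (real m + 2)"
      using m by (intro divide_strict_left_mono divide_pos_pos; simp)+
    moreover have "a < (a + g) / 2 \<and> 0 < (a + g) / 2 \<and> (a + g) / 2 < g" if "a < g" "0 < a" for a g :: real
      using that by auto
    ultimately show "0 < \<alpha>" "\<alpha> < \<beta>" "0 < \<beta>" "\<beta> < pi / real m" "pi / real m < pi / 2"
      unfolding \<alpha>_\<beta>_def by blast+
  qed
  then have "real m * \<beta> < pi" using m by (simp add: field_simps)
  then obtain X c C S where cone: "wkb_cone p m X (tan \<beta>) c C S"
    using wkb_cone_exists[OF p(1,2) m ab(3)] by blast
  have b2: "\<beta> < pi / 2" using ab(4,5) by (rule less_trans)
  have a2: "\<alpha> < pi / 2" using ab(2) b2 by (rule less_trans)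
  have a3: "- (pi / 2) < \<alpha>" using ab(1) pi_gt_zero by linarith
  interpret wkb_cone p m X "tan \<beta>" c C S by (rule cone)
  have ray: "filterlim (\<lambda>t. Re (of_real t * cis a)) at_top at_top" "eventually (\<lambda>t. of_real t * cis a \<in> D) at_top"
    if a: "\<bar>a\<bar> = \<alpha>" for a
  proof -
    have ca: "cos a = cos \<alpha>" using a by (auto simp: abs_if split: if_splits)
    have c0: "cos a > 0" unfolding ca by (rule cos_gt_zero_pi[OF a3 a2])
    have "0 \<le> sin \<alpha>" using ab(1) a2 by (intro sin_ge_zero) auto
    then have sa: "\<bar>sin a\<bar> = sin \<alpha>" using a by (auto simp: abs_if split: if_splits)
    have "sin \<alpha> = tan \<alpha> * cos a" using c0 by (simp add: tan_def ca)
    also have "\<dots> < tan \<beta> * cos a" by (rule mult_strict_right_mono[OF tan_monotone[OF a3 ab(2) b2] c0])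
    finally have sb: "\<bar>sin a\<bar> < tan \<beta> * cos a" by (simp add: sa)
    show lim: "filterlim (\<lambda>t. Re (of_real t * cis a)) at_top at_top"
      using filterlim_at_top_mult_tendsto_pos[OF tendsto_const c0 filterlim_ident] by simp
    then have "eventually (\<lambda>t. X < Re (of_real t * cis a)) at_top" by (auto simp: filterlim_at_top_dense)
    then show "eventually (\<lambda>t. of_real t * cis a \<in> D) at_top"
      using eventually_gt_at_top[of 0]
    proof eventually_elim
      case (elim t)
      have "t * \<bar>sin a\<bar> < t * (tan \<beta> * cos a)" using sb elim by (intro mult_strict_left_mono)
      then show ?case using elim by (simp add: cone_def abs_mult mult_ac)
    qed
  qed
  have large: "\<exists>K. (\<forall>\<^sub>F x in dirf t. fst x > 0 \<and> \<bar>snd x\<bar> < pi \<and> f (pol x) 0 \<noteq> 0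
      \<and> \<bar>ln (norm (f (pol x) 0)) - actK m * cos (rho m * snd x) * fst x powr rho m\<bar> \<le> K * fst x powr (1 / 2 + 1 / (2 * real m)) + 4 + ln (fst x)
      \<and> norm (f1 (pol x) 0 / (f (pol x) 0 * csqrt (pol x)) + 1) \<le> K * fst x powr (-1/4))" if t: "\<bar>t\<bar> < pi" for t
  proof -
    obtain k where k: "0 \<le> k" "k < 1" and ev: "\<forall>\<^sub>F x in dirf t. fst x > 0 \<and> \<bar>snd x\<bar> < pi \<and> - k * norm (pol x) \<le> Re (pol x)"
      using direction_sector[OF t] by blast
    obtain c2 L0 C0 where "wkb_sector p m X (tan \<beta>) c C S k c2 L0 C0"
      using wkb_sector_exists[OF cone p k] by blast
    then interpret sec: wkb_sector p m X "tan \<beta>" c C S k c2 L0 C0 .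
    obtain K L1 where K: "\<And>lam. L1 \<le> norm lam \<Longrightarrow> - k * norm lam \<le> Re lam \<Longrightarrow> f lam 0 \<noteq> 0
    \<and> \<bar>ln (norm (f lam 0)) - actK m * Re (exp (of_real (rho m) * Ln lam))\<bar> \<le> K * norm lam powr (1 / 2 + 1 / (2 * real m)) + 4 + ln (norm lam)
    \<and> norm (f1 lam 0 / (f lam 0 * csqrt lam) + 1) \<le> K * norm lam powr (-1/4)"
      using sec.f_large unfolding sec.aexp_def by blast
    have "\<forall>\<^sub>F x in dirf t. L1 \<le> fst x" by (rule eventually_dirf_fst[OF eventually_ge_at_top])
    with ev have "\<forall>\<^sub>F x in dirf t. fst x > 0 \<and> \<bar>snd x\<bar> < pi \<and> f (pol x) 0 \<noteq> 0
      \<and> \<bar>ln (norm (f (pol x) 0)) - actK m * cos (rho m * snd x) * fst x powr rho m\<bar> \<le> K * fst x powr (1 / 2 + 1 / (2 * real m)) + 4 + ln (fst x)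
      \<and> norm (f1 (pol x) 0 / (f (pol x) 0 * csqrt (pol x)) + 1) \<le> K * fst x powr (-1/4)"
    proof eventually_elim
      case (elim x)
      have n: "norm (pol x) = fst x" using elim by (simp add: pol_def norm_mult)
      have "Re (exp (of_real (rho m) * Ln (pol x))) = fst x powr rho m * cos (rho m * snd x)"
        using elim by (simp add: Ln_pol Re_exp powr_def)
      then show ?case using K[of "pol x"] elim unfolding n by (simp add: mult_ac)
    qed
    then show ?thesis by blast
  qed
  have gr: "grows m (\<lambda>lam. f lam 0) t (actK m * cos (rho m * t))" if t: "\<bar>t\<bar> < pi" for t
  proof -
    obtain K where K: "\<forall>\<^sub>F x in dirf t. fst x > 0 \<and> \<bar>snd x\<bar> < pi \<and> f (pol x) 0 \<noteq> 0
      \<and> \<bar>ln (norm (f (pol x) 0)) - actK m * cos (rho m * snd x) * fst x powr rho m\<bar> \<le> K * fst x powr (1 / 2 + 1 / (2 * real m)) + 4 + ln (fst x)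
      \<and> norm (f1 (pol x) 0 / (f (pol x) 0 * csqrt (pol x)) + 1) \<le> K * fst x powr (-1/4)"
      using large[OF t] by blast
    have "\<forall>\<^sub>F x in dirf t. \<bar>ln (norm (f (pol x) 0)) - actK m * cos (rho m * t) * fst x powr rho m\<bar> \<le> e * fst x powr rho m \<and> f (pol x) 0 \<noteq> 0"
      if e: "e > 0" for e
    proof -
      \<comment> \<open>Half of \<open>e\<close> absorbs the error terms, the other half the
        variation of the exponent between the directions \<open>snd x\<close> and
        \<open>t\<close>.\<close>
      have "\<forall>\<^sub>F r in at_top. K * r powr (1 / 2 + 1 / (2 * real m)) + 4 + ln r \<le> (e / 2) * r powr rho m"
        using m e by (intro powr_log_o) (auto simp: rho_def field_simps)
      note ev1 = eventually_dirf_fst[OF this, of t]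
      have "((\<lambda>s. actK m * cos (rho m * s)) \<longlongrightarrow> actK m * cos (rho m * t)) (nhds t)"
        by (intro tendsto_intros filterlim_ident)
      then have "\<forall>\<^sub>F s in nhds t. dist (actK m * cos (rho m * s)) (actK m * cos (rho m * t)) < e / 2"
        using e by (intro tendstoD) auto
      note ev2 = eventually_dirf_snd[OF this]
      show ?thesis using K ev1 ev2
      proof eventually_elim
        case (elim x)
        have "\<bar>actK m * cos (rho m * snd x) * fst x powr rho m - actK m * cos (rho m * t) * fst x powr rho m\<bar>
          = \<bar>actK m * cos (rho m * snd x) - actK m * cos (rho m * t)\<bar> * fst x powr rho m"
          by (simp add: abs_mult flip: left_diff_distrib)
        also have "\<dots> \<le> e / 2 * fst x powr rho m" using elim by (intro mult_right_mono) (auto simp: dist_real_def)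
        finally have 3: "\<bar>actK m * cos (rho m * snd x) * fst x powr rho m - actK m * cos (rho m * t) * fst x powr rho m\<bar> \<le> e / 2 * fst x powr rho m" .
        have "e / 2 * fst x powr rho m + e / 2 * fst x powr rho m = e * fst x powr rho m" by simp
        then show ?case using elim 3 by linarith
      qed
    qed
    note ev = this
    show ?thesis unfolding grows_def below_def
    proof (intro conjI allI impI)
      fix e :: real assume e: "e > 0"
      show "\<forall>\<^sub>F x in dirf t. norm (f (pol x) 0) \<le> exp ((actK m * cos (rho m * t) + e) * fst x powr rho m)"
        using ev[OF e]
      proof eventually_elim
        case (elim x)
        then have "ln (norm (f (pol x) 0)) \<le> (actK m * cos (rho m * t) + e) * fst x powr rho m" by (simp add: algebra_simps abs_le_iff)
        then have "exp (ln (norm (f (pol x) 0))) \<le> exp ((actK m * cos (rho m * t) + e) * fst x powr rho m)" by simp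
        then show ?case using elim by simp
      qed
      show "\<forall>\<^sub>F x in dirf t. exp ((actK m * cos (rho m * t) - e) * fst x powr rho m) \<le> norm (f (pol x) 0)"
        using ev[OF e]
      proof eventually_elim
        case (elim x)
        then have "(actK m * cos (rho m * t) - e) * fst x powr rho m \<le> ln (norm (f (pol x) 0))" by (simp add: algebra_simps abs_le_iff)
        then have "exp ((actK m * cos (rho m * t) - e) * fst x powr rho m) \<le> exp (ln (norm (f (pol x) 0)))" by simp
        then show ?case using elim by simp
      qed
    qed
  qed
  have ratio: "((\<lambda>x. f1 (pol x) 0 / (f (pol x) 0 * csqrt (pol x))) \<longlongrightarrow> -1) (dirf t)" if t: "\<bar>t\<bar> < pi" for t
  proof -
    obtain K where K: "\<forall>\<^sub>F x in dirf t. norm (f1 (pol x) 0 / (f (pol x) 0 * csqrt (pol x)) + 1) \<le> K * fst x powr (-1/4)"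
    proof -
      obtain K where "\<forall>\<^sub>F x in dirf t. fst x > 0 \<and> \<bar>snd x\<bar> < pi \<and> f (pol x) 0 \<noteq> 0
        \<and> \<bar>ln (norm (f (pol x) 0)) - actK m * cos (rho m * snd x) * fst x powr rho m\<bar> \<le> K * fst x powr (1 / 2 + 1 / (2 * real m)) + 4 + ln (fst x)
        \<and> norm (f1 (pol x) 0 / (f (pol x) 0 * csqrt (pol x)) + 1) \<le> K * fst x powr (-1/4)"
        using large[OF t] by blast
      then have "\<forall>\<^sub>F x in dirf t. norm (f1 (pol x) 0 / (f (pol x) 0 * csqrt (pol x)) + 1) \<le> K * fst x powr (-1/4)"
        by eventually_elim blast
      then show thesis by (rule that)
    qed
    have "((\<lambda>r. K * r powr (-1/4)) \<longlongrightarrow> 0) at_top" by real_asymp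
    then have "((\<lambda>x. K * fst x powr (-1/4)) \<longlongrightarrow> 0) (dirf t)"
      unfolding dirf_def by (rule filterlim_compose[OF _ filterlim_fst])
    then have "((\<lambda>x. f1 (pol x) 0 / (f (pol x) 0 * csqrt (pol x)) - (-1)) \<longlongrightarrow> 0) (dirf t)"
      by (rule Lim_null_comparison[rotated]) (use K in simp)
    then show ?thesis by (rule LIM_zero_cancel)
  qed
  have "subdominant p m f f1 \<phi>"
    unfolding subdominant_def
  proof (intro conjI allI impI)
    fix lam a assume "\<bar>a\<bar> = pi / (real m + 2)"
    then have a: "\<bar>a\<bar> = \<alpha>" by (simp add: \<alpha>_\<beta>_def)
    show "((\<lambda>t. f lam (of_real t * cis a) / \<phi> (of_real t * cis a)) \<longlongrightarrow> 1) at_top"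
      by (rule tendsto_along(1)[OF ray[OF a]])
    show "((\<lambda>t. f1 lam (of_real t * cis a) / (csqrt (poly p (of_real t * cis a)) * \<phi> (of_real t * cis a))) \<longlongrightarrow> -1) at_top"
      using tendsto_along(2)[OF ray[OF a]] unfolding w_def .
    show "eventually (\<lambda>t. \<phi> (of_real t * cis a) \<noteq> 0) at_top"
      using ray(2)[OF a] by eventually_elim (rule phi_nz)
  qed (use ode_f f_holomorphic f_tendsto_0 gr ratio in auto)
  then show ?thesis by blast
qed

section \<open>Exponential growth along directions\<close>

lemma dirf_pos: "\<forall>\<^sub>F x in dirf t. fst x > R"
  by (rule eventually_dirf_fst[OF eventually_gt_at_top])

lemma dirf_neq_bot: "dirf t \<noteq> bot"
  unfolding dirf_def by (simp add: prod_filter_eq_bot)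

lemma dirf_powr_large:
  assumes "m \<ge> 1" "e > 0"
  shows "\<forall>\<^sub>F x in dirf t. B \<le> e * fst x powr rho m"
proof -
  have "rho m > 0" by (simp add: rho_def add_pos_nonneg)
  then have "filterlim (\<lambda>r. e * r powr rho m) at_top at_top" using assms by real_asymp
  then have "\<forall>\<^sub>F r in at_top. B \<le> e * r powr rho m" by (simp add: filterlim_at_top)
  then show ?thesis by (rule eventually_dirf_fst)
qed

lemma growsD:
  assumes "grows m g t h" "e > 0"
  shows "\<forall>\<^sub>F x in dirf t. exp ((h - e) * fst x powr rho m) \<le> norm (g (pol x))"
    "\<forall>\<^sub>F x in dirf t. norm (g (pol x)) \<le> exp ((h + e) * fst x powr rho m)"
  using assms unfolding grows_def below_def by auto

lemma grows_imp_below: "grows m g t h \<Longrightarrow> below m g t h"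
  by (simp add: grows_def)

lemma grows_nonzero: "grows m g t h \<Longrightarrow> \<forall>\<^sub>F x in dirf t. g (pol x) \<noteq> 0"
  using growsD(1)[of m g t h 1] by (auto elim!: eventually_mono)

lemma below_cong: "below m g t h \<Longrightarrow> (\<forall>\<^sub>F x in dirf t. g (pol x) = g' (pol x)) \<Longrightarrow> below m g' t h"
  unfolding below_def
proof (intro allI impI)
  fix e :: real assume *: "\<forall>e>0. \<forall>\<^sub>F x in dirf t. cmod (g (pol x)) \<le> exp ((h + e) * fst x powr rho m)"
    "\<forall>\<^sub>F x in dirf t. g (pol x) = g' (pol x)" and "e > 0"
  then have "\<forall>\<^sub>F x in dirf t. cmod (g (pol x)) \<le> exp ((h + e) * fst x powr rho m)" by blast
  then show "\<forall>\<^sub>F x in dirf t. cmod (g' (pol x)) \<le> exp ((h + e) * fst x powr rho m)"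
    using *(2) by eventually_elim simp
qed

lemma grows_cong: "grows m g t h \<Longrightarrow> (\<forall>\<^sub>F x in dirf t. g (pol x) = g' (pol x)) \<Longrightarrow> grows m g' t h"
  unfolding grows_def
proof (intro conjI allI impI)
  assume *: "below m g t h \<and> (\<forall>e>0. \<forall>\<^sub>F x in dirf t. exp ((h - e) * fst x powr rho m) \<le> cmod (g (pol x)))"
    "\<forall>\<^sub>F x in dirf t. g (pol x) = g' (pol x)"
  show "below m g' t h" using * by (blast intro: below_cong)
  fix e :: real assume "e > 0"
  then have "\<forall>\<^sub>F x in dirf t. exp ((h - e) * fst x powr rho m) \<le> cmod (g (pol x))" using * by blast
  then show "\<forall>\<^sub>F x in dirf t. exp ((h - e) * fst x powr rho m) \<le> cmod (g' (pol x))"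
    using *(2) by eventually_elim simp
qed

lemma below_mult:
  assumes "below m f t a" "below m g t b"
  shows "below m (\<lambda>z. f z * g z) t (a + b)"
  unfolding below_def
proof (intro allI impI)
  fix e :: real assume "e > 0"
  then have "\<forall>\<^sub>F x in dirf t. norm (f (pol x)) \<le> exp ((a + e / 2) * fst x powr rho m)"
    "\<forall>\<^sub>F x in dirf t. norm (g (pol x)) \<le> exp ((b + e / 2) * fst x powr rho m)"
    using assms unfolding below_def by auto
  then show "\<forall>\<^sub>F x in dirf t. norm (f (pol x) * g (pol x)) \<le> exp ((a + b + e) * fst x powr rho m)"
  proof eventually_elim
    case (elim x)
    then have "norm (f (pol x) * g (pol x)) \<le> exp ((a + e / 2) * fst x powr rho m) * exp ((b + e / 2) * fst x powr rho m)"
      unfolding norm_mult by (intro mult_mono) auto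
    also have "\<dots> = exp ((a + e / 2) * fst x powr rho m + (b + e / 2) * fst x powr rho m)" by (simp only: exp_add)
    also have "(a + e / 2) * fst x powr rho m + (b + e / 2) * fst x powr rho m = (a + b + e) * fst x powr rho m"
      by (simp flip: distrib_right)
    finally show ?case .
  qed
qed

lemma grows_mult:
  assumes "grows m f t a" "grows m g t b"
  shows "grows m (\<lambda>z. f z * g z) t (a + b)"
  unfolding grows_def
proof (intro conjI allI impI)
  show "below m (\<lambda>z. f z * g z) t (a + b)" using assms by (intro below_mult grows_imp_below)
  fix e :: real assume "e > 0"
  then have "\<forall>\<^sub>F x in dirf t. exp ((a - e / 2) * fst x powr rho m) \<le> norm (f (pol x))"
    "\<forall>\<^sub>F x in dirf t. exp ((b - e / 2) * fst x powr rho m) \<le> norm (g (pol x))"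
    using assms unfolding grows_def by auto
  then show "\<forall>\<^sub>F x in dirf t. exp ((a + b - e) * fst x powr rho m) \<le> norm (f (pol x) * g (pol x))"
  proof eventually_elim
    case (elim x)
    have "(a + b - e) * fst x powr rho m = (a - e / 2) * fst x powr rho m + (b - e / 2) * fst x powr rho m"
      by (simp flip: distrib_right)
    then have "exp ((a + b - e) * fst x powr rho m) = exp ((a - e / 2) * fst x powr rho m) * exp ((b - e / 2) * fst x powr rho m)"
      by (simp only: exp_add)
    also have "\<dots> \<le> norm (f (pol x) * g (pol x))"
      unfolding norm_mult using elim by (intro mult_mono) auto
    finally show ?case .
  qed
qed

lemma grows_inverse:
  assumes "grows m g t b"
  shows "grows m (\<lambda>z. inverse (g z)) t (- b)"
  unfolding grows_def below_def
proof (intro conjI allI impI)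
  fix e :: real assume e: "e > 0"
  show "\<forall>\<^sub>F x in dirf t. norm (inverse (g (pol x))) \<le> exp ((- b + e) * fst x powr rho m)"
    using growsD(1)[OF assms e]
  proof eventually_elim
    case (elim x)
    have "inverse (norm (g (pol x))) \<le> inverse (exp ((b - e) * fst x powr rho m))"
      using elim by (intro le_imp_inverse_le) auto
    also have "\<dots> = exp (- ((b - e) * fst x powr rho m))" by (simp add: exp_minus)
    also have "- ((b - e) * fst x powr rho m) = (- b + e) * fst x powr rho m" by (simp add: algebra_simps)
    finally show ?case by (simp add: norm_inverse)
  qed
  show "\<forall>\<^sub>F x in dirf t. exp ((- b - e) * fst x powr rho m) \<le> norm (inverse (g (pol x)))"
    using growsD(2)[OF assms e] grows_nonzero[OF assms]
  proof eventually_elim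
    case (elim x)
    have "- ((b + e) * fst x powr rho m) = (- b - e) * fst x powr rho m" by (simp add: algebra_simps)
    then have "exp ((- b - e) * fst x powr rho m) = inverse (exp ((b + e) * fst x powr rho m))" by (metis exp_minus)
    also have "\<dots> \<le> inverse (norm (g (pol x)))"
      using elim by (intro le_imp_inverse_le) auto
    finally show ?case by (simp add: norm_inverse)
  qed
qed

lemma below_divide: "below m f t a \<Longrightarrow> grows m g t b \<Longrightarrow> below m (\<lambda>z. f z / g z) t (a - b)"
  using below_mult[OF _ grows_imp_below[OF grows_inverse], of m f t a g b] by (simp add: divide_inverse)

lemma grows_divide: "grows m f t a \<Longrightarrow> grows m g t b \<Longrightarrow> grows m (\<lambda>z. f z / g z) t (a - b)"
  using grows_mult[OF _ grows_inverse, of m f t a g b] by (simp add: divide_inverse)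

lemma below_add:
  assumes "m \<ge> 1" "below m f t a" "below m g t a"
  shows "below m (\<lambda>z. f z + g z) t a"
  unfolding below_def
proof (intro allI impI)
  fix e :: real assume e: "e > 0"
  then have "\<forall>\<^sub>F x in dirf t. norm (f (pol x)) \<le> exp ((a + e / 2) * fst x powr rho m)"
    "\<forall>\<^sub>F x in dirf t. norm (g (pol x)) \<le> exp ((a + e / 2) * fst x powr rho m)"
    using assms unfolding below_def by auto
  moreover have "\<forall>\<^sub>F x in dirf t. ln 2 \<le> e / 2 * fst x powr rho m" using e by (intro dirf_powr_large assms) simp
  ultimately show "\<forall>\<^sub>F x in dirf t. norm (f (pol x) + g (pol x)) \<le> exp ((a + e) * fst x powr rho m)"
  proof eventually_elim
    case (elim x)
    have "norm (f (pol x) + g (pol x)) \<le> exp (ln 2) * exp ((a + e / 2) * fst x powr rho m)"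
      using elim by (intro order.trans[OF norm_triangle_ineq]) simp
    also have "\<dots> \<le> exp (e / 2 * fst x powr rho m) * exp ((a + e / 2) * fst x powr rho m)"
      using elim by (intro mult_right_mono) (auto simp del: exp_ln_iff exp_ln)
    also have "\<dots> = exp (e / 2 * fst x powr rho m + (a + e / 2) * fst x powr rho m)" by (simp only: exp_add)
    also have "e / 2 * fst x powr rho m + (a + e / 2) * fst x powr rho m = (a + e) * fst x powr rho m"
      by (simp add: algebra_simps)
    finally show ?case .
  qed
qed

lemma below_mono: "below m f t a \<Longrightarrow> a \<le> b \<Longrightarrow> below m f t b"
  unfolding below_def
proof (intro allI impI)
  fix e :: real assume *: "\<forall>e>0. \<forall>\<^sub>F x in dirf t. cmod (f (pol x)) \<le> exp ((a + e) * fst x powr rho m)" "a \<le> b" "e > 0"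
  then have "\<forall>\<^sub>F x in dirf t. cmod (f (pol x)) \<le> exp ((a + e) * fst x powr rho m)" by blast
  then show "\<forall>\<^sub>F x in dirf t. cmod (f (pol x)) \<le> exp ((b + e) * fst x powr rho m)"
  proof eventually_elim
    case (elim x)
    have "(a + e) * fst x powr rho m \<le> (b + e) * fst x powr rho m" using * by (intro mult_right_mono) auto
    then show ?case using elim by (meson exp_le_cancel_iff order.trans)
  qed
qed

text \<open>A strictly smaller exponent makes the second summand at most half of the first far out.
  Equal exponents would permit cancellation, so each use has to come with a strict
  inequality.\<close>

lemma grows_add:
  assumes m: "m \<ge> 1" and f: "grows m f t a" and g: "below m g t b" and ba: "b < a"
  shows "grows m (\<lambda>z. f z + g z) t a"
  unfolding grows_def
proof (intro conjI allI impI)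
  show "below m (\<lambda>z. f z + g z) t a"
    using assms by (intro below_add grows_imp_below[OF f] below_mono[OF g]) auto
  fix e :: real assume e: "e > 0"
  define d where "d = min (e / 2) ((a - b) / 4)"
  have d: "d > 0" using e ba by (simp add: d_def)
  have "\<forall>\<^sub>F x in dirf t. norm (g (pol x)) \<le> exp ((b + d) * fst x powr rho m)" using g d unfolding below_def by blast
  moreover have "\<forall>\<^sub>F x in dirf t. ln 2 \<le> d * fst x powr rho m" by (intro dirf_powr_large m d)
  ultimately show "\<forall>\<^sub>F x in dirf t. exp ((a - e) * fst x powr rho m) \<le> norm (f (pol x) + g (pol x))"
    using growsD(1)[OF f d]
  proof eventually_elim
    case (elim x)
    define R where "R = fst x powr rho m"
    have R: "R \<ge> 0" by (simp add: R_def)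
    have "d \<le> (a - b) / 4" unfolding d_def by (rule min.cobounded2)
    then have "4 * d \<le> a - b" by simp
    then have "b + d \<le> a - d - d" using ba by linarith
    then have "(b + d) * R \<le> (a - d - d) * R" using R by (intro mult_right_mono)
    also have "(a - d - d) * R = (a - d) * R - d * R" by (simp add: algebra_simps)
    finally have "(b + d) * R \<le> (a - d) * R - ln 2" using elim(2) by (simp add: R_def)
    then have "exp ((b + d) * R) \<le> exp ((a - d) * R - ln 2)" by simp
    also have "\<dots> = exp ((a - d) * R) / 2" by (simp add: exp_diff)
    finally have "norm (g (pol x)) \<le> exp ((a - d) * R) / 2" using elim(1) by (simp add: R_def)
    then have "exp ((a - d) * R) / 2 \<le> norm (f (pol x) + g (pol x))"
      using elim(3) norm_diff_ineq[of "f (pol x)" "g (pol x)"] by (simp add: R_def)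
    moreover have "exp ((a - e) * R) \<le> exp ((a - d) * R) / 2"
    proof -
      have "(a - e) * R \<le> (a - d - d) * R" using R by (intro mult_right_mono) (auto simp: d_def)
      also have "(a - d - d) * R = (a - d) * R - d * R" by (simp add: algebra_simps)
      finally have "(a - e) * R \<le> (a - d) * R - ln 2" using elim(2) by (simp add: R_def)
      then have "exp ((a - e) * R) \<le> exp ((a - d) * R - ln 2)" by simp
      then show ?thesis by (simp add: exp_diff)
    qed
    ultimately show ?case unfolding R_def by linarith
  qed
qed

text \<open>Powers of \<open>r\<close> are invisible on the scale \<open>exp (r powr rho m)\<close>.
  This covers constants and the difference of logarithmic derivatives of two solutions, which has
  the size of \<open>sqrt r\<close>.\<close>

lemma grows_sqrt_bounded:
  assumes m: "m \<ge> 1" and ev: "\<forall>\<^sub>F x in dirf t. c * fst x powr a \<le> norm (g (pol x)) \<and> norm (g (pol x)) \<le> C * fst x powr a"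
    and c: "c > 0" and a: "a \<ge> 0"
  shows "grows m g t 0"
proof -
  have rho: "rho m > 0" by (simp add: rho_def add_pos_nonneg)
  show ?thesis unfolding grows_def below_def
  proof (intro conjI allI impI)
    fix e :: real assume e: "e > 0"
    define C' where "C' = max C 1"
    have C': "C' > 0" by (simp add: C'_def)
    have "\<forall>\<^sub>F r in at_top. C' * r powr a \<le> exp (e * r powr rho m)"
      using rho e a C' by real_asymp
    note eventually_dirf_fst[OF this, of t]
    then show "\<forall>\<^sub>F x in dirf t. norm (g (pol x)) \<le> exp ((0 + e) * fst x powr rho m)"
      using ev
    proof eventually_elim
      case (elim x)
      have "C * fst x powr a \<le> C' * fst x powr a" by (intro mult_right_mono) (auto simp: C'_def)
      then show ?case using elim by simp
    qed
    have "\<forall>\<^sub>F r in at_top. exp (- e * r powr rho m) \<le> c * r powr a"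
    proof -
      have "((\<lambda>r. exp (- e * r powr rho m)) \<longlongrightarrow> 0) at_top" using rho e by real_asymp
      then have "\<forall>\<^sub>F r in at_top. exp (- e * r powr rho m) < c" using c by (intro order_tendstoD(2)) auto
      then show ?thesis using eventually_ge_at_top[of 1]
      proof eventually_elim
        case (elim r)
        have "c * 1 \<le> c * r powr a" using elim c a by (intro mult_left_mono ge_one_powr_ge_zero) auto
        then show ?case using elim by simp
      qed
    qed
    note eventually_dirf_fst[OF this, of t]
    then show "\<forall>\<^sub>F x in dirf t. exp ((0 - e) * fst x powr rho m) \<le> norm (g (pol x))"
      using ev by eventually_elim simp
  qed
qed

lemma grows_const:
  assumes "m \<ge> 1" "c \<noteq> 0"
  shows "grows m (\<lambda>_. c) t 0"
proof (rule grows_sqrt_bounded[OF assms(1), where c = "norm c" and C = "norm c" and a = 0])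
  show "\<forall>\<^sub>F x in dirf t. norm c * fst x powr 0 \<le> norm c \<and> norm c \<le> norm c * fst x powr 0"
    using dirf_pos[of 0] by eventually_elim simp
qed (use assms in auto)

lemma filterlim_dirf_shift: "filterlim (\<lambda>x. (fst x, snd x + a)) (dirf (t + a)) (dirf t)"
  unfolding dirf_def
proof (rule filterlim_Pair)
  show "filterlim fst at_top (at_top \<times>\<^sub>F nhds t)" by (rule filterlim_fst)
  show "filterlim (\<lambda>x. snd x + a) (nhds (t + a)) (at_top \<times>\<^sub>F nhds t)"
    by (intro tendsto_intros filterlim_snd)
qed

lemma pol_shift: "pol (fst x, snd x + a) = cis a * pol x"
  by (simp add: pol_def cis_mult [symmetric] mult_ac)

lemma eventually_dirf_shift:
  "eventually P (dirf (t + a)) \<Longrightarrow> eventually (\<lambda>x. P (fst x, snd x + a)) (dirf t)"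
  by (rule eventually_compose_filterlim[OF _ filterlim_dirf_shift])

lemma grows_rotate:
  assumes "grows m g (t + a) h"
  shows "grows m (\<lambda>z. g (cis a * z)) t h"
  unfolding grows_def below_def
proof (intro conjI allI impI)
  fix e :: real assume e: "e > 0"
  show "\<forall>\<^sub>F x in dirf t. norm (g (cis a * pol x)) \<le> exp ((h + e) * fst x powr rho m)"
    using eventually_dirf_shift[OF growsD(2)[OF assms e]] by (simp add: pol_shift)
  show "\<forall>\<^sub>F x in dirf t. exp ((h - e) * fst x powr rho m) \<le> norm (g (cis a * pol x))"
    using eventually_dirf_shift[OF growsD(1)[OF assms e]] by (simp add: pol_shift)
qed

lemma grows_uminus: "grows m g t h \<Longrightarrow> grows m (\<lambda>z. - g z) t h"
  unfolding grows_def below_def by simp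

lemma csqrt_pol:
  assumes "fst x > 0" "\<bar>snd x\<bar> < pi"
  shows "csqrt (pol x) = of_real (sqrt (fst x)) * cis (snd x / 2)"
proof (rule csqrt_unique)
  show "(of_real (sqrt (fst x)) * cis (snd x / 2))\<^sup>2 = pol x"
    using assms by (simp add: power_mult_distrib pol_def Complex.DeMoivre flip: of_real_power)
  have "cos (snd x / 2) > 0" using assms by (intro cos_gt_zero_pi) auto
  then show "0 < Re (of_real (sqrt (fst x)) * cis (snd x / 2)) \<or> Re (of_real (sqrt (fst x)) * cis (snd x / 2)) = 0 \<and> 0 \<le> Im (of_real (sqrt (fst x)) * cis (snd x / 2))"
    using assms by simp
qed

section \<open>Wronskians of the rotated subdominant solutions\<close>

lemma csqrt_scale:
  assumes "a \<ge> 0"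
  shows "csqrt (of_real a * z) = of_real (sqrt a) * csqrt z"
proof (cases "a = 0")
  case False
  then have a: "a > 0" using assms by simp
  show ?thesis
  proof (rule csqrt_unique)
    show "(of_real (sqrt a) * csqrt z)\<^sup>2 = of_real a * z"
      using assms by (simp add: power_mult_distrib flip: of_real_power)
    show "0 < Re (of_real (sqrt a) * csqrt z) \<or> Re (of_real (sqrt a) * csqrt z) = 0 \<and> 0 \<le> Im (of_real (sqrt a) * csqrt z)"
      using csqrt_principal[of z] a by (auto simp del: csqrt.simps)
  qed
qed simp

text \<open>The condition on the angle places the limit \<open>cis (m * a)\<close> off the cut,
  where the principal root is continuous.\<close>

lemma csqrt_poly_ray:
  fixes p :: "complex poly"
  assumes p: "lead_coeff p = 1" "degree p = m" "m \<ge> 1" and a: "\<bar>real m * a\<bar> < pi"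
  shows "((\<lambda>t. csqrt (poly p (of_real t * cis a)) / of_real (sqrt (t ^ m))) \<longlongrightarrow> cis (real m * a / 2)) at_top"
proof -
  obtain C where C: "C \<ge> 0" "\<And>z. norm (poly (p - monom 1 m) z) \<le> C * (1 + norm z) ^ (m - 1)"
    using poly_growth_bound[OF monic_diff_degree[OF p]] by auto
  have Z: "((\<lambda>t. poly p (of_real t * cis a) / of_real (t ^ m) - cis a ^ m) \<longlongrightarrow> 0) at_top"
  proof (rule Lim_null_comparison)
    show "((\<lambda>t::real. C * 2 ^ (m - 1) / t) \<longlongrightarrow> 0) at_top" by real_asymp
    show "\<forall>\<^sub>F t in at_top. norm (poly p (of_real t * cis a) / of_real (t ^ m) - cis a ^ m) \<le> C * 2 ^ (m - 1) / t"
      using eventually_ge_at_top[of 1]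
    proof eventually_elim
      case (elim t)
      have "poly p (of_real t * cis a) / of_real (t ^ m) - cis a ^ m = poly (p - monom 1 m) (of_real t * cis a) / of_real (t ^ m)"
        using elim by (simp add: poly_monom power_mult_distrib diff_divide_distrib)
      also have "norm \<dots> \<le> C * (1 + t) ^ (m - 1) / t ^ m"
        using C(2)[of "of_real t * cis a"] elim by (simp add: norm_divide norm_mult norm_power divide_right_mono)
      also have "\<dots> \<le> C * (2 * t) ^ (m - 1) / t ^ m"
        using elim C by (intro divide_right_mono mult_left_mono power_mono) auto
      also have "\<dots> = C * 2 ^ (m - 1) * (t ^ (m - 1) / t ^ m)" by (simp add: power_mult_distrib)
      also have "t ^ (m - 1) / t ^ m = 1 / t"
      proof -
        have "t ^ m = t ^ (m - 1) * t" using p by (subst power_minus_mult) auto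
        then show ?thesis using elim by simp
      qed
      finally show ?case by simp
    qed
  qed
  from LIM_zero_cancel[OF Z]
  have lim: "((\<lambda>t. poly p (of_real t * cis a) / of_real (t ^ m)) \<longlongrightarrow> cis (real m * a)) at_top"
    by (simp only: Complex.DeMoivre)
  have nz: "cis (real m * a) \<notin> \<real>\<^sub>\<le>\<^sub>0"
  proof
    assume "cis (real m * a) \<in> \<real>\<^sub>\<le>\<^sub>0"
    then have s: "cos (real m * a) \<le> 0" "sin (real m * a) = 0" by (auto simp: complex_nonpos_Reals_iff)
    then have "sin \<bar>real m * a\<bar> = 0" by (auto simp: abs_if)
    then have "real m * a = 0" using a sin_gt_zero[of "\<bar>real m * a\<bar>"] by (cases "real m * a = 0") auto
    then show False using s unfolding \<open>real m * a = 0\<close> by simp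
  qed
  have ccis: "csqrt (cis (real m * a)) = cis (real m * a / 2)"
    using csqrt_pol[of "(1, real m * a)"] a by (simp add: pol_def)
  have "isCont csqrt (cis (real m * a))"
    using has_field_derivative_csqrt[OF nz] by (rule DERIV_isCont)
  from isCont_tendsto_compose[OF this lim]
  have "((\<lambda>t. csqrt (poly p (of_real t * cis a) / of_real (t ^ m))) \<longlongrightarrow> cis (real m * a / 2)) at_top"
    unfolding ccis .
  then show ?thesis
  proof (rule Lim_transform_eventually)
    show "\<forall>\<^sub>F t in at_top. csqrt (poly p (of_real t * cis a) / of_real (t ^ m)) = csqrt (poly p (of_real t * cis a)) / of_real (sqrt (t ^ m))"
      using eventually_gt_at_top[of 0]
    proof eventually_elim
      case (elim t)
      have "csqrt (of_real (inverse (t ^ m)) * poly p (of_real t * cis a)) = of_real (sqrt (inverse (t ^ m))) * csqrt (poly p (of_real t * cis a))"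
        using elim by (intro csqrt_scale) auto
      then show ?case by (simp add: divide_inverse mult.commute real_sqrt_inverse del: csqrt.simps)
    qed
  qed
qed

section \<open>Rotated equations, their subdominant solutions and Wronskians\<close>

locale osc =
  fixes p :: "complex poly" and m :: nat
  assumes lead: "lead_coeff p = 1" and deg: "degree p = m" and m3: "m \<ge> 3" and p0: "poly p 0 = 0"
begin

definition "tau = 2 * pi / (real m + 2)"
definition "u = pi / real m"
definition "om k = cis (real k * tau)"
text \<open>If \<open>v\<close> solves the equation for \<open>p\<close> and \<open>lam\<close>,
  then \<open>y \<mapsto> v (om k * y)\<close> solves the one for \<open>P k\<close> and
  \<open>(om k) ^ 2 * lam\<close>. As \<open>om k ^ (m + 2) = 1\<close>, this potential is again
  monic.\<close>

definition "P k = smult ((om k)\<^sup>2) (pcompose p [:0, om k:])"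

lemma rho_tau: "rho m * tau = u" and rho_pi: "rho m * pi = pi / 2 + u"
proof -
  have "real m * (real m + 2) \<noteq> 0" using m3 by simp
  then show "rho m * tau = u" using m3 by (simp add: rho_def tau_def u_def field_simps)
  show "rho m * pi = pi / 2 + u" by (simp add: rho_def u_def algebra_simps)
qed

lemma tau_pos: "0 < tau" by (simp add: tau_def add_nonneg_pos)
lemma u_pos: "0 < u" "u < pi / 2" 
proof -
  show "0 < u" using m3 by (simp add: u_def)
  show "u < pi / 2" unfolding u_def using m3 by (intro divide_strict_left_mono) auto
qed

lemma rho_pos: "0 < rho m" by (simp add: rho_def add_pos_nonneg)

lemma tau_full: "(real m + 2) * tau = 2 * pi"
  by (simp add: tau_def add_nonneg_eq_0_iff field_simps)

lemma tau_lt: "2 * tau < pi"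
proof -
  have "5 * tau \<le> (real m + 2) * tau" using m3 tau_pos by (intro mult_right_mono) auto
  then show ?thesis using tau_pos unfolding tau_full by linarith
qed

lemma om_0 [simp]: "om 0 = 1" by (simp add: om_def)
lemma norm_om [simp]: "norm (om k) = 1" by (simp add: om_def)
lemma om_nz [simp]: "om k \<noteq> 0" by (simp add: om_def)

lemma om_pow: "om k ^ (m + 2) = 1"
proof -
  have "om k ^ (m + 2) = cis (real (m + 2) * (real k * tau))" unfolding om_def by (rule Complex.DeMoivre)
  also have "real (m + 2) * (real k * tau) = real k * ((real m + 2) * tau)" by simp
  also have "\<dots> = 2 * pi * real k" unfolding tau_full by simp
  also have "cis (2 * pi * real k) = 1" by (rule cis_multiple_2pi) simp
  finally show ?thesis .
qed

lemma om_period: "om (k + (m + 2)) = om k"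
proof -
  have "real (k + (m + 2)) * tau = real k * tau + (real m + 2) * tau" by (simp add: algebra_simps)
  then show ?thesis unfolding om_def tau_full by (simp add: complex_eq_iff)
qed

lemma poly_P: "poly (P k) y = (om k)\<^sup>2 * poly p (om k * y)"
  by (simp add: P_def poly_pcompose mult.commute)

lemma P_props: "lead_coeff (P k) = 1" "degree (P k) = m" "poly (P k) 0 = 0"
proof -
  have d: "degree [:0, om k:] = 1" by simp
  then have "degree (pcompose p [:0, om k:]) = m" by (simp add: degree_pcompose deg)
  then show dP: "degree (P k) = m" by (simp add: P_def)
  have "lead_coeff (pcompose p [:0, om k:]) = om k ^ m"
    using lead_coeff_comp[of "[:0, om k:]" p] lead deg by simp
  then have "lead_coeff (P k) = (om k)\<^sup>2 * om k ^ m" unfolding P_def by (simp add: lead_coeff_smult)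
  also have "\<dots> = om k ^ (m + 2)" by (simp add: power_add power2_eq_square)
  finally show "lead_coeff (P k) = 1" by (simp only: om_pow)
  show "poly (P k) 0 = 0" by (simp add: poly_P p0)
qed

text \<open>The choice depends on the polynomial alone and not on the index. Since
  \<open>P k\<close> has period \<open>m + 2\<close> in \<open>k\<close>, the functions
  \<open>F\<close> and \<open>W\<close> become exactly periodic, without factors of
  proportionality.\<close>

definition "sd q = (SOME t. subdominant q m (fst t) (fst (snd t)) (snd (snd t)))"
definition "sdf k = fst (sd (P k))"
definition "sdf1 k = fst (snd (sd (P k)))"
definition "sdPhi k = snd (snd (sd (P k)))"

lemma sd: "subdominant (P k) m (sdf k) (sdf1 k) (sdPhi k)"
proof -
  obtain f f1 \<Phi> where "subdominant (P k) m f f1 \<Phi>" using subdominant_exists[OF P_props m3] by blast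
  then have "subdominant (P k) m (fst (f, f1, \<Phi>)) (fst (snd (f, f1, \<Phi>))) (snd (snd (f, f1, \<Phi>)))" by simp
  then show ?thesis unfolding sdf_def sdf1_def sdPhi_def sd_def by (rule someI)
qed

definition "F k lam z = sdf k ((om k)\<^sup>2 * lam) (z / om k)"
definition "F1 k lam z = sdf1 k ((om k)\<^sup>2 * lam) (z / om k) / om k"
definition "W j k lam = F j lam 0 * F1 k lam 0 - F1 j lam 0 * F k lam 0"

lemma F_period: "F (k + (m + 2)) = F k" "F1 (k + (m + 2)) = F1 k"
  unfolding F_def F1_def sdf_def sdf1_def P_def om_period by (rule refl)+

lemma W_period: "W j (k + (m + 2)) = W j k" "W (j + (m + 2)) k = W j k"
  unfolding W_def F_period by (rule refl)+

lemma W_antisym: "W j k lam = - W k j lam" by (simp add: W_def)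

text \<open>Three vectors \<open>(F, F1)\<close> in a plane are linearly dependent. As Wronskians of
  adjacent indices are constant, this relation becomes a recursion in the distance of the
  indices.\<close>

lemma plucker_eval: "F j lam 0 * W i k lam = F i lam 0 * W j k lam + F k lam 0 * W i j lam"
  by (simp add: W_def algebra_simps)

lemma plucker: "W a b lam * W c d lam - W a c lam * W b d lam + W a d lam * W b c lam = 0"
  by (simp add: W_def algebra_simps)

lemma ode_F: "ode p lam (F k lam) (F1 k lam)"
proof -
  have sdo: "ode (P k) lam' (sdf k lam') (sdf1 k lam')" for lam' using sd[of k] unfolding subdominant_def by blast
  define l where "l = (om k)\<^sup>2 * lam"
  show ?thesis unfolding ode_def
  proof (intro allI conjI)
    fix z
    have dz: "((\<lambda>z. z / om k) has_field_derivative 1 / om k) (at z)" by (auto intro!: derivative_eq_intros)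
    have "(sdf k l has_field_derivative sdf1 k l (z / om k)) (at (z / om k))"
      "(sdf1 k l has_field_derivative (poly (P k) (z / om k) + l) * sdf k l (z / om k)) (at (z / om k))"
      using sdo[of l] unfolding ode_def by auto
    note d = DERIV_chain2[OF this(1) dz] DERIV_cdivide[OF DERIV_chain2[OF this(2) dz], of "om k"]
    show "(F k lam has_field_derivative F1 k lam z) (at z)"
      unfolding F_def[abs_def] F1_def[abs_def] l_def[symmetric] by (rule DERIV_cong[OF d(1)]) simp
    have e: "poly (P k) (z / om k) + l = (om k)\<^sup>2 * (poly p z + lam)" by (simp add: poly_P l_def algebra_simps)
    show "(F1 k lam has_field_derivative (poly p z + lam) * F k lam z) (at z)"
      unfolding F_def[abs_def] F1_def[abs_def] l_def[symmetric]
      by (rule DERIV_cong[OF d(2)]) (simp add: e power2_eq_square)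
  qed
qed

lemma F_holomorphic: "(\<lambda>lam. F k lam 0) holomorphic_on UNIV" "(\<lambda>lam. F1 k lam 0) holomorphic_on UNIV"
proof -
  have "(\<lambda>lam. sdf k lam 0) holomorphic_on UNIV" "(\<lambda>lam. sdf1 k lam 0) holomorphic_on UNIV"
    using sd[of k] unfolding subdominant_def by blast+
  then have "((\<lambda>lam. sdf k lam 0) \<circ> (\<lambda>lam. (om k)\<^sup>2 * lam)) holomorphic_on UNIV"
    "((\<lambda>lam. sdf1 k lam 0) \<circ> (\<lambda>lam. (om k)\<^sup>2 * lam)) holomorphic_on UNIV"
    by (intro holomorphic_on_compose holomorphic_intros; auto intro: holomorphic_on_subset)+
  then show "(\<lambda>lam. F k lam 0) holomorphic_on UNIV" "(\<lambda>lam. F1 k lam 0) holomorphic_on UNIV"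
    unfolding F_def F1_def by (auto simp: o_def intro!: holomorphic_intros)
qed

lemma W_holomorphic: "W j k holomorphic_on UNIV"
  unfolding W_def[abs_def] by (intro holomorphic_intros F_holomorphic)

lemma F_decay: "((\<lambda>t. F k lam (of_real t * om k)) \<longlongrightarrow> 0) at_top" "((\<lambda>t. F1 k lam (of_real t * om k)) \<longlongrightarrow> 0) at_top"
proof -
  have "((\<lambda>t. sdf k l (of_real t)) \<longlongrightarrow> 0) at_top" "((\<lambda>t. sdf1 k l (of_real t)) \<longlongrightarrow> 0) at_top" for l
    using sd[of k] unfolding subdominant_def by blast+
  from this(1) tendsto_divide[OF this(2) tendsto_const[of "om k"]]
  show "((\<lambda>t. F k lam (of_real t * om k)) \<longlongrightarrow> 0) at_top" "((\<lambda>t. F1 k lam (of_real t * om k)) \<longlongrightarrow> 0) at_top"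
    unfolding F_def F1_def by simp_all
qed

text \<open>The integer \<open>N\<close> allows the argument of \<open>(om k) ^ 2 * lam\<close> to
  be brought back to the range of the principal branch.\<close>

lemma om_sq_cis: "(om k)\<^sup>2 = cis (2 * real k * tau - 2 * pi * of_int N)"
proof -
  have "(om k)\<^sup>2 = cis (2 * real k * tau)" unfolding om_def Complex.DeMoivre by (simp add: mult.assoc)
  moreover have "cis (2 * pi * of_int N) = 1" by (rule cis_multiple_2pi) simp
  ultimately show ?thesis by (simp add: cis_divide [symmetric])
qed

lemma F_grows:
  assumes "\<bar>t + 2 * real k * tau - 2 * pi * of_int N\<bar> < pi"
  shows "grows m (\<lambda>lam. F k lam 0) t (actK m * cos (rho m * (t + 2 * real k * tau - 2 * pi * of_int N)))"
proof -
  define a where "a = 2 * real k * tau - 2 * pi * of_int N"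
  have "\<bar>t + a\<bar> < pi" using assms by (simp add: a_def algebra_simps)
  then have "grows m (\<lambda>lam. sdf k lam 0) (t + a) (actK m * cos (rho m * (t + a)))"
    using sd[of k] unfolding subdominant_def by blast
  from grows_rotate[OF this] show ?thesis
    unfolding F_def om_sq_cis[of k N, folded a_def] by (simp add: a_def algebra_simps)
qed

text \<open>The logarithmic derivative of \<open>F k\<close> at the origin is \<open>\<plusminus> sqrt lam\<close>, the sign being the parity of
  the number \<open>N\<close> of windings.\<close>

lemma F_ratio:
  assumes t: "\<bar>t + 2 * real k * tau - 2 * pi * of_int N\<bar> < pi"
  shows "((\<lambda>x. F1 k (pol x) 0 / (F k (pol x) 0 * (of_real (sqrt (fst x)) * cis (snd x / 2)))) \<longlongrightarrow> - cis (- pi * of_int N)) (dirf t)"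
proof -
  define a where "a = 2 * real k * tau - 2 * pi * of_int N"
  have ta: "\<bar>t + a\<bar> < pi" using t by (simp add: a_def algebra_simps)
  have "((\<lambda>x. sdf1 k (pol x) 0 / (sdf k (pol x) 0 * csqrt (pol x))) \<longlongrightarrow> -1) (dirf (t + a))"
    using sd[of k] ta unfolding subdominant_def by blast
  from filterlim_compose[OF this filterlim_dirf_shift]
  have "((\<lambda>x. sdf1 k (cis a * pol x) 0 / (sdf k (cis a * pol x) 0 * csqrt (pol (fst x, snd x + a)))) \<longlongrightarrow> -1) (dirf t)"
    by (simp add: pol_shift)
  from tendsto_mult[OF this tendsto_const[of "cis (- pi * of_int N)"]]
  have lim: "((\<lambda>x. sdf1 k (cis a * pol x) 0 / (sdf k (cis a * pol x) 0 * csqrt (pol (fst x, snd x + a))) * cis (- pi * of_int N)) \<longlongrightarrow> - cis (- pi * of_int N)) (dirf t)"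
    by simp
  have "((\<lambda>s. \<bar>s + a\<bar>) \<longlongrightarrow> \<bar>t + a\<bar>) (nhds t)" by (intro tendsto_intros filterlim_ident)
  then have "eventually (\<lambda>s. \<bar>s + a\<bar> < pi) (nhds t)" using ta by (rule order_tendstoD(2))
  from eventually_dirf_snd[OF this] dirf_pos[of 0 t]
  have ev: "\<forall>\<^sub>F x in dirf t. sdf1 k (cis a * pol x) 0 / (sdf k (cis a * pol x) 0 * csqrt (pol (fst x, snd x + a))) * cis (- pi * of_int N)
     = F1 k (pol x) 0 / (F k (pol x) 0 * (of_real (sqrt (fst x)) * cis (snd x / 2)))"
  proof eventually_elim
    case (elim x)
    have "cis ((snd x + a) / 2) = cis (snd x / 2) * cis (real k * tau) * cis (- pi * of_int N)"
      by (simp add: cis_mult a_def field_simps)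
    then have cs: "csqrt (pol (fst x, snd x + a)) = of_real (sqrt (fst x)) * cis (snd x / 2) * om k * cis (- pi * of_int N)"
      using csqrt_pol[of "(fst x, snd x + a)"] elim by (simp add: om_def mult.assoc)
    define c where "c = cis (- pi * of_int N)"
    have c: "c * c = 1"
    proof -
      have "c * c = cis (2 * pi * of_int (- N))" by (simp add: c_def cis_mult mult.assoc)
      also have "\<dots> = 1" by (rule cis_multiple_2pi) simp
      finally show ?thesis .
    qed
    then have c0: "c \<noteq> 0" by auto
    have "1 / c = c" using c c0 by (simp add: field_simps)
    then show ?case
      unfolding cs F_def F1_def om_sq_cis[of k N, folded a_def] c_def[symmetric]
      using c c0 by (simp add: field_simps)
  qed
  show ?thesis by (rule Lim_transform_eventually[OF lim ev])
qed

text \<open>When the windings differ by one, the logarithmic derivatives of \<open>F j\<close> and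
  \<open>F k\<close> at 0 are asymptotic to opposite roots of \<open>lam\<close>. Their difference
  has the size \<open>2 * sqrt r\<close>, nothing cancels, and the exponents of \<open>F j\<close>
  and \<open>F k\<close> add up.\<close>

lemma W_direct:
  assumes tj: "\<bar>t + 2 * real j * tau - 2 * pi * of_int N\<bar> < pi"
    and tk: "\<bar>t + 2 * real k * tau - 2 * pi * of_int (N + 1)\<bar> < pi"
  shows "grows m (W j k) t (actK m * cos (rho m * (t + 2 * real j * tau - 2 * pi * of_int N))
     + actK m * cos (rho m * (t + 2 * real k * tau - 2 * pi * of_int (N + 1))))"
proof -
  define M where "M = (\<lambda>k lam. F1 k lam 0 / F k lam 0)"
  define q where "q = (\<lambda>x. of_real (sqrt (fst x)) * cis (snd x / 2))"
  have nq: "norm (q x) = sqrt (fst x)" if "fst x > 0" for x using that by (simp add: q_def norm_mult)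
  have "cis (- pi * of_int (N + 1)) = - cis (- pi * of_int N)"
  proof -
    have "- pi * of_int (N + 1) = - pi * of_int N + - pi" by (simp add: algebra_simps)
    then have "cis (- pi * of_int (N + 1)) = cis (- pi * of_int N) * cis (- pi)" by (simp only: cis_mult)
    then show ?thesis by (simp add: complex_eq_iff)
  qed
  then have "((\<lambda>x. F1 k (pol x) 0 / (F k (pol x) 0 * q x) - F1 j (pol x) 0 / (F j (pol x) 0 * q x)) \<longlongrightarrow> 2 * cis (- pi * of_int N)) (dirf t)"
    using tendsto_diff[OF F_ratio[OF tk] F_ratio[OF tj]] by (simp add: q_def)
  from tendsto_norm[OF this]
  have L2: "((\<lambda>x. norm (F1 k (pol x) 0 / (F k (pol x) 0 * q x) - F1 j (pol x) 0 / (F j (pol x) 0 * q x))) \<longlongrightarrow> 2) (dirf t)"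
    by (simp add: norm_mult)
  have "\<forall>\<^sub>F x in dirf t. 1 < norm (F1 k (pol x) 0 / (F k (pol x) 0 * q x) - F1 j (pol x) 0 / (F j (pol x) 0 * q x))"
    "\<forall>\<^sub>F x in dirf t. norm (F1 k (pol x) 0 / (F k (pol x) 0 * q x) - F1 j (pol x) 0 / (F j (pol x) 0 * q x)) < 3"
    by (rule order_tendstoD(1)[OF L2] order_tendstoD(2)[OF L2]; simp)+
  then have "\<forall>\<^sub>F x in dirf t. 1 * fst x powr (1/2) \<le> norm (M k (pol x) - M j (pol x)) \<and> norm (M k (pol x) - M j (pol x)) \<le> 3 * fst x powr (1/2)"
    using dirf_pos[of 0 t]
  proof eventually_elim
    case (elim x)
    have q0: "q x \<noteq> 0" using elim nq[of x] by auto
    have "F1 k (pol x) 0 / (F k (pol x) 0 * q x) - F1 j (pol x) 0 / (F j (pol x) 0 * q x) = (M k (pol x) - M j (pol x)) / q x"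
      by (simp add: M_def diff_divide_distrib)
    then have "1 < norm (M k (pol x) - M j (pol x)) / sqrt (fst x)" "norm (M k (pol x) - M j (pol x)) / sqrt (fst x) < 3"
      using elim nq[of x] by (simp_all add: norm_divide)
    then show ?case using elim by (simp add: powr_half_sqrt field_simps)
  qed
  then have "grows m (\<lambda>lam. M k lam - M j lam) t 0"
    using m3 by (intro grows_sqrt_bounded[where c = 1 and a = "1/2" and C = 3]) auto
  note gr = grows_mult[OF grows_mult[OF F_grows[OF tj] F_grows[OF tk]] this]
  show ?thesis
  proof (rule grows_cong[OF gr[unfolded add_0_right]])
    show "\<forall>\<^sub>F x in dirf t. F j (pol x) 0 * F k (pol x) 0 * (M k (pol x) - M j (pol x)) = W j k (pol x)"
      using grows_nonzero[OF F_grows[OF tj]] grows_nonzero[OF F_grows[OF tk]]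
      by eventually_elim (simp add: M_def W_def field_simps)
  qed
qed

text \<open>On the ray halfway between the sectors \<open>k\<close> and \<open>k + 1\<close> both
  solutions have known asymptotics, and the product \<open>Xi\<close> of their leading terms does
  not involve \<open>lam\<close>. As \<open>W / Xi\<close> tends to 2 for each \<open>lam\<close>,
  any two values of \<open>W\<close> agree.\<close>

lemma W_adjacent: "\<exists>c. c \<noteq> 0 \<and> (\<forall>lam. W k (k + 1) lam = c)"
proof -
  define a where "a = pi / (real m + 2)"
  have a2: "2 * a = tau" by (simp add: a_def tau_def)
  have a0: "a > 0" using a2 tau_pos by linarith
  have ma: "real m * a < pi" using m3 by (simp add: a_def field_simps)
  have mma: "real m * a + 2 * a = pi" by (simp add: a_def field_simps add_nonneg_eq_0_iff)
  define wk where "wk = (\<lambda>k z. csqrt (poly (P k) z))"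
  define y y' where "y = (\<lambda>t. of_real t * cis a)" "y' = (\<lambda>t. of_real t * cis (- a))"
  define Xi where "Xi = (\<lambda>t. sdPhi k (y t) * sdPhi (k + 1) (y' t) * wk k (y t) / om k)"
  have w: "((\<lambda>t. wk k (y t) / of_real (sqrt (t ^ m))) \<longlongrightarrow> cis (real m * a / 2)) at_top"
    "((\<lambda>t. wk (k + 1) (y' t) / of_real (sqrt (t ^ m))) \<longlongrightarrow> cis (- (real m * a / 2))) at_top"
    using csqrt_poly_ray[OF P_props(1,2), of a k] csqrt_poly_ray[OF P_props(1,2), of "- a" "k + 1"] ma a0 m3
    unfolding wk_def y_y'_def by (simp_all add: abs_mult)
  have "((\<lambda>t. (wk (k + 1) (y' t) / of_real (sqrt (t ^ m))) / (wk k (y t) / of_real (sqrt (t ^ m))) * (om k / om (k + 1)))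
     \<longlongrightarrow> cis (- (real m * a / 2)) / cis (real m * a / 2) * (om k / om (k + 1))) at_top"
    by (intro tendsto_intros w) simp
  moreover have "cis (- (real m * a / 2)) / cis (real m * a / 2) * (om k / om (k + 1)) = -1"
  proof -
    have "om k / om (k + 1) = cis (- (2 * a))" unfolding om_def cis_divide a2 by (simp add: algebra_simps)
    then have "cis (- (real m * a / 2)) / cis (real m * a / 2) * (om k / om (k + 1)) = cis (- (real m * a / 2) - real m * a / 2 + - (2 * a))"
      by (simp only: cis_divide cis_mult)
    also have "- (real m * a / 2) - real m * a / 2 + - (2 * a) = - pi" using mma by linarith
    finally show ?thesis by (simp add: complex_eq_iff)
  qed
  ultimately have R0: "((\<lambda>t. (wk (k + 1) (y' t) / of_real (sqrt (t ^ m))) / (wk k (y t) / of_real (sqrt (t ^ m))) * (om k / om (k + 1)))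
     \<longlongrightarrow> -1) at_top" by (simp only:)
  have R: "((\<lambda>t. wk (k + 1) (y' t) / wk k (y t) * (om k / om (k + 1))) \<longlongrightarrow> -1) at_top"
  proof (rule Lim_transform_eventually[OF R0])
    show "\<forall>\<^sub>F t in at_top. (wk (k + 1) (y' t) / of_real (sqrt (t ^ m))) / (wk k (y t) / of_real (sqrt (t ^ m))) * (om k / om (k + 1))
       = wk (k + 1) (y' t) / wk k (y t) * (om k / om (k + 1))"
      using eventually_gt_at_top[of 0] by eventually_elim simp
  qed
  have wnz: "eventually (\<lambda>t. wk k (y t) \<noteq> 0) at_top"
  proof -
    have "eventually (\<lambda>t. wk k (y t) / of_real (sqrt (t ^ m)) \<noteq> 0) at_top"
      by (rule tendsto_imp_eventually_ne[OF w(1)]) simp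
    then show ?thesis by eventually_elim auto
  qed
  have Pnz: "eventually (\<lambda>t. sdPhi k (y t) \<noteq> 0) at_top" "eventually (\<lambda>t. sdPhi (k + 1) (y' t) \<noteq> 0) at_top"
    using sd[of k] sd[of "k + 1"] a0 unfolding subdominant_def y_y'_def a_def by auto
  have lim: "((\<lambda>t. W k (k + 1) lam / Xi t) \<longlongrightarrow> 2) at_top" for lam
  proof -
    define l l' where "l = (om k)\<^sup>2 * lam" "l' = (om (k + 1))\<^sup>2 * lam"
    have A: "((\<lambda>t. sdf k l (y t) / sdPhi k (y t)) \<longlongrightarrow> 1) at_top"
      "((\<lambda>t. sdf1 k l (y t) / (wk k (y t) * sdPhi k (y t))) \<longlongrightarrow> -1) at_top"
      using sd[of k] a0 unfolding subdominant_def y_y'_def a_def wk_def by auto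
    have B: "((\<lambda>t. sdf (k + 1) l' (y' t) / sdPhi (k + 1) (y' t)) \<longlongrightarrow> 1) at_top"
      "((\<lambda>t. sdf1 (k + 1) l' (y' t) / (wk (k + 1) (y' t) * sdPhi (k + 1) (y' t))) \<longlongrightarrow> -1) at_top"
      using sd[of "k + 1"] a0 unfolding subdominant_def y_y'_def a_def wk_def by auto
    have "((\<lambda>t. (sdf k l (y t) / sdPhi k (y t)) * (sdf1 (k + 1) l' (y' t) / (wk (k + 1) (y' t) * sdPhi (k + 1) (y' t)))
        * (wk (k + 1) (y' t) / wk k (y t) * (om k / om (k + 1)))
       - (sdf1 k l (y t) / (wk k (y t) * sdPhi k (y t))) * (sdf (k + 1) l' (y' t) / sdPhi (k + 1) (y' t)))
       \<longlongrightarrow> 1 * -1 * -1 - -1 * 1) at_top"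
      by (intro tendsto_intros A B R)
    then have "((\<lambda>t. (sdf k l (y t) / sdPhi k (y t)) * (sdf1 (k + 1) l' (y' t) / (wk (k + 1) (y' t) * sdPhi (k + 1) (y' t)))
        * (wk (k + 1) (y' t) / wk k (y t) * (om k / om (k + 1)))
       - (sdf1 k l (y t) / (wk k (y t) * sdPhi k (y t))) * (sdf (k + 1) l' (y' t) / sdPhi (k + 1) (y' t)))
       \<longlongrightarrow> 2) at_top" by simp
    then show ?thesis
    proof (rule Lim_transform_eventually)
      have wnz': "eventually (\<lambda>t. wk (k + 1) (y' t) \<noteq> 0) at_top"
      proof -
        have "eventually (\<lambda>t. wk (k + 1) (y' t) / of_real (sqrt (t ^ m)) \<noteq> 0) at_top"
          by (rule tendsto_imp_eventually_ne[OF w(2)]) simp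
        then show ?thesis by eventually_elim auto
      qed
      show "\<forall>\<^sub>F t in at_top. (sdf k l (y t) / sdPhi k (y t)) * (sdf1 (k + 1) l' (y' t) / (wk (k + 1) (y' t) * sdPhi (k + 1) (y' t)))
        * (wk (k + 1) (y' t) / wk k (y t) * (om k / om (k + 1)))
       - (sdf1 k l (y t) / (wk k (y t) * sdPhi k (y t))) * (sdf (k + 1) l' (y' t) / sdPhi (k + 1) (y' t)) = W k (k + 1) lam / Xi t"
        using wnz wnz' Pnz
      proof eventually_elim
        case (elim t)
        \<comment> \<open>The point runs along the bisector of the rays through \<open>om k\<close>
          and \<open>om (k + 1)\<close>; in the two rotated frames it has the arguments
          \<open>a\<close> and \<open>- a\<close>.\<close>
        define z where "z = of_real t * (om k * cis a)"
        have z: "z / om k = y t" by (simp add: z_def y_y'_def)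
        have "om (k + 1) = om k * cis a * cis a"
          unfolding om_def cis_mult by (simp add: a2[symmetric] algebra_simps)
        then have "z / om (k + 1) = (of_real t * (om k * cis a)) / ((om k * cis a) * cis a)" by (simp only: z_def)
        also have "\<dots> = of_real t / cis a" by simp
        finally have z': "z / om (k + 1) = y' t" by (simp add: y_y'_def divide_inverse)
        have "W k (k + 1) lam = F k lam z * F1 (k + 1) lam z - F1 k lam z * F (k + 1) lam z"
          unfolding W_def by (rule wronskian_constant[OF ode_F ode_F, symmetric])
        then have Weq: "W k (k + 1) lam = sdf k l (y t) * (sdf1 (k + 1) l' (y' t) / om (k + 1)) - sdf1 k l (y t) / om k * sdf (k + 1) l' (y' t)"
          unfolding F_def F1_def z z' l_l'_def .
        show ?case unfolding Weq Xi_def using elim by (simp add: field_simps)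
      qed
    qed
  qed
  \<comment> \<open>In this direction the windings of \<open>k\<close> and \<open>k + 1\<close> are
    0 and 1, so the product formula yields a parameter with nonzero Wronskian.\<close>
  define t where "t = pi - tau - 2 * real k * tau"
  have "\<bar>t + 2 * real k * tau - 2 * pi * of_int 0\<bar> < pi" "\<bar>t + 2 * real (k + 1) * tau - 2 * pi * of_int (0 + 1)\<bar> < pi"
    using tau_pos tau_lt by (auto simp: t_def algebra_simps abs_less_iff)
  from grows_nonzero[OF W_direct[OF this]] dirf_neq_bot[of t]
  obtain lam0 where lam0: "W k (k + 1) lam0 \<noteq> 0" using eventually_happens by blast
  have "W k (k + 1) lam = W k (k + 1) lam0" for lam
  proof -
    have "((\<lambda>t. (W k (k + 1) lam / Xi t) / (W k (k + 1) lam0 / Xi t)) \<longlongrightarrow> 2 / 2) at_top"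
      by (intro tendsto_divide lim) simp
    moreover have "eventually (\<lambda>t. (W k (k + 1) lam / Xi t) / (W k (k + 1) lam0 / Xi t) = W k (k + 1) lam / W k (k + 1) lam0) at_top"
      using wnz Pnz by eventually_elim (simp add: Xi_def)
    ultimately have "((\<lambda>t::real. W k (k + 1) lam / W k (k + 1) lam0) \<longlongrightarrow> 2 / 2) at_top"
      by (rule Lim_transform_eventually)
    then have "W k (k + 1) lam / W k (k + 1) lam0 = 1" by (simp add: tendsto_const_iff)
    then show ?thesis using lam0 by simp
  qed
  then show ?thesis using lam0 by blast
qed

end

section \<open>Growth exponents of the Wronskians\<close>

context osc
begin

lemma actK_pos: "0 < actK m" by (rule actK(2)[OF m3])

lemma F_grows':
  assumes "a = t + 2 * real k * tau - 2 * pi * of_int N \<or> - a = t + 2 * real k * tau - 2 * pi * of_int N" "\<bar>a\<bar> < pi"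
  shows "grows m (\<lambda>lam. F k lam 0) t (actK m * cos (rho m * a))"
proof -
  have "\<bar>t + 2 * real k * tau - 2 * pi * of_int N\<bar> < pi" using assms by auto
  from F_grows[OF this] have "grows m (\<lambda>lam. F k lam 0) t (actK m * cos (rho m * (t + 2 * real k * tau - 2 * pi * of_int N)))" .
  moreover have "cos (rho m * (t + 2 * real k * tau - 2 * pi * of_int N)) = cos (rho m * a)"
    using assms(1)
  proof
    assume "- a = t + 2 * real k * tau - 2 * pi * of_int N"
    then have "rho m * (t + 2 * real k * tau - 2 * pi * of_int N) = - (rho m * a)" by (metis mult_minus_right)
    then show ?thesis by (simp only: cos_minus)
  qed simp
  ultimately show ?thesis by simp
qed

text \<open>The WKB estimate excludes the negative axis. There
  \<open>F (k + 1) * W k (k + 2)\<close> is a combination of \<open>F k\<close> and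
  \<open>F (k + 2)\<close> with constant coefficients. Both neighbours have exponent
  \<open>h\<close> and the divisor has \<open>2 * h\<close>, which gives \<open>- h\<close>. The
  numerator might cancel, hence only an upper bound results.\<close>

lemma F_below_pi:
  assumes "pi = t + 2 * real (k + 1) * tau - 2 * pi * of_int N"
  shows "below m (\<lambda>lam. F (k + 1) lam 0) t (actK m * cos (rho m * pi))"
proof -
  define h where "h = actK m * cos (rho m * (pi - 2 * tau))"
  have a: "t + 2 * real k * tau - 2 * pi * of_int N = pi - 2 * tau"
    "t + 2 * real (k + 2) * tau - 2 * pi * of_int (N + 1) = - (pi - 2 * tau)"
    using assms by (simp_all add: algebra_simps)
  have lt: "\<bar>pi - 2 * tau\<bar> < pi" using tau_pos tau_lt by simp
  have gr: "grows m (W k (k + 2)) t (h + h)"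
    using W_direct[of t k N "k + 2", unfolded a mult_minus_right cos_minus abs_minus_cancel, OF lt lt] unfolding h_def .
  obtain c c' where c: "\<And>lam. W (k + 1) (k + 2) lam = c" "c \<noteq> 0" and c': "\<And>lam. W k (k + 1) lam = c'" "c' \<noteq> 0"
    using W_adjacent[of "k + 1"] W_adjacent[of k] by auto
  have g1: "grows m (\<lambda>lam. F k lam 0) t h" unfolding h_def using a(1) lt by (intro F_grows'[of _ _ _ N]) auto
  have g2: "grows m (\<lambda>lam. F (k + 2) lam 0) t h" unfolding h_def using a(2) lt by (intro F_grows'[of _ _ _ "N + 1"]) auto
  have m1: "m \<ge> 1" using m3 by simp
  have "below m (\<lambda>lam. F k lam 0 * c + F (k + 2) lam 0 * c') t (h + 0)"
    by (intro below_add[OF m1] below_mult grows_imp_below[OF g1] grows_imp_below[OF g2] grows_imp_below[OF grows_const[OF m1]] c c')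
  from below_divide[OF this gr]
  have "below m (\<lambda>lam. (F k lam 0 * c + F (k + 2) lam 0 * c') / W k (k + 2) lam) t (h + 0 - (h + h))" .
  then have "below m (\<lambda>lam. F (k + 1) lam 0) t (h + 0 - (h + h))"
  proof (rule below_cong)
    show "\<forall>\<^sub>F x in dirf t. (F k (pol x) 0 * c + F (k + 2) (pol x) 0 * c') / W k (k + 2) (pol x) = F (k + 1) (pol x) 0"
      using grows_nonzero[OF gr]
    proof eventually_elim
      case (elim x)
      have "F (k + 1) (pol x) 0 * W k (k + 2) (pol x) = F k (pol x) 0 * c + F (k + 2) (pol x) 0 * c'"
        using plucker_eval[of "k + 1" "pol x" k "k + 2"] by (simp only: c c')
      then show ?case using elim by (simp add: divide_eq_eq)
    qed
  qed
  moreover have "h + 0 - (h + h) = actK m * cos (rho m * pi)"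
  proof -
    have "rho m * (pi - 2 * tau) = rho m * pi - 2 * (rho m * tau)" by (simp add: algebra_simps)
    also have "\<dots> = pi / 2 - u" unfolding rho_tau rho_pi by simp
    finally have "h = actK m * sin u" by (simp add: h_def cos_diff)
    moreover have "cos (rho m * pi) = - sin u" unfolding rho_pi by (simp add: cos_add)
    ultimately show ?thesis by simp
  qed
  ultimately show ?thesis by simp
qed

lemma F_below:
  assumes "a = t + 2 * real k * tau - 2 * pi * of_int N \<or> - a = t + 2 * real k * tau - 2 * pi * of_int N" "\<bar>a\<bar> \<le> pi"
  shows "below m (\<lambda>lam. F k lam 0) t (actK m * cos (rho m * a))"
proof (cases "\<bar>a\<bar> < pi")
  case True
  then show ?thesis using F_grows'[OF assms(1)] by (intro grows_imp_below)
next
  case False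
  then have "a = pi \<or> a = - pi" using assms(2) by auto
  then obtain N' :: int where N': "pi = t + 2 * real k * tau - 2 * pi * of_int N'" and ca: "cos (rho m * a) = cos (rho m * pi)"
  proof
    assume a: "a = pi"
    from assms(1) show thesis
    proof
      assume "a = t + 2 * real k * tau - 2 * pi * of_int N"
      then show thesis using a by (intro that[of N]) auto
    next
      assume "- a = t + 2 * real k * tau - 2 * pi * of_int N"
      then have "pi = t + 2 * real k * tau - 2 * pi * of_int (N - 1)" using a by (simp add: algebra_simps)
      then show thesis using a by (intro that[of "N - 1"]) auto
    qed
  next
    assume a: "a = - pi"
    from assms(1) show thesis
    proof
      assume "a = t + 2 * real k * tau - 2 * pi * of_int N"
      then have "pi = t + 2 * real k * tau - 2 * pi * of_int (N - 1)" using a by (simp add: algebra_simps)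
      then show thesis using a by (intro that[of "N - 1"]) auto
    next
      assume "- a = t + 2 * real k * tau - 2 * pi * of_int N"
      then show thesis using a by (intro that[of N]) auto
    qed
  qed
  \<comment> \<open>A full period is added so that the index is a successor; it turns the argument
    by \<open>4 * pi\<close>, whence \<open>N' + 2\<close>.\<close>
  have "2 * real (k + (m + 2)) * tau = 2 * real k * tau + 2 * ((real m + 2) * tau)" by (simp add: algebra_simps)
  also have "\<dots> = 2 * real k * tau + 4 * pi" unfolding tau_full by simp
  finally have "pi = t + 2 * real (k + (m + 1) + 1) * tau - 2 * pi * of_int (N' + 2)"
    using N' by (simp add: algebra_simps)
  from F_below_pi[OF this] have "below m (\<lambda>lam. F (k + (m + 2)) lam 0) t (actK m * cos (rho m * pi))" by simp
  then show ?thesis unfolding F_period ca .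
qed

text \<open>With \<open>x = rho m * y\<close>, \<open>p = (l + 1) * u\<close> and
  \<open>q = (l - 1) * u\<close>, the leading product has exponent
  \<open>cos (x - p) + cos (x - q) - cos (x + q)\<close>. The competitor has
  \<open>cos (x + p)\<close> or, once its argument has passed \<open>pi\<close>,
  \<open>- cos (x + q)\<close>. In the latter case the excess is
  \<open>2 * cos (x - l * u) * cos u\<close>, which would vanish for \<open>l = 1\<close> and
  \<open>y = pi\<close>; this case is excluded.\<close>

lemma step_dominance:
  assumes l: "1 \<le> l" "2 * l \<le> m" and y: "0 < y" "y \<le> pi" "l = 1 \<Longrightarrow> y < pi"
    and b: "b = y + (real l + 1) * tau \<and> b \<le> pi \<or> b = 2 * pi - (y + (real l + 1) * tau) \<and> y + (real l + 1) * tau > pi"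
  shows "cos (rho m * b) < cos (rho m * (y - (real l + 1) * tau)) + 2 * sin ((real l - 1) * u) * cos (rho m * (y + tau - pi))"
    and "cos (rho m * (y - (real l + 1) * tau)) + 2 * sin ((real l - 1) * u) * cos (rho m * (y + tau - pi))
      - cos (rho m * (y - (real l - 1) * tau)) = 2 * sin (real l * u) * cos (rho m * (y - pi))"
proof -
  define x where "x = rho m * y"
  define p q where "p = (real l + 1) * u" "q = (real l - 1) * u"
  define lu where "lu = real l * u"
  have pq: "p = lu + u" "q = lu - u" by (simp_all add: p_q_def lu_def algebra_simps)
  have e1: "rho m * (y - (real l + 1) * tau) = x - p"
    unfolding right_diff_distrib x_def p_q_def using rho_tau by (simp add: mult.left_commute)
  have e2: "rho m * (y - (real l - 1) * tau) = x - q"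
    unfolding right_diff_distrib[of _ y] x_def p_q_def using rho_tau by (simp add: mult.left_commute)
  have "rho m * (y + tau - pi) = x + rho m * tau - rho m * pi" by (simp add: x_def algebra_simps)
  then have "rho m * (y + tau - pi) = x - pi / 2" unfolding rho_tau rho_pi by simp
  then have e3: "cos (rho m * (y + tau - pi)) = sin x" by (simp add: cos_diff)
  have "rho m * (y - pi) = x - rho m * pi" by (simp add: x_def algebra_simps)
  then have "rho m * (y - pi) = (x - u) - pi / 2" unfolding rho_pi by simp
  then have e4: "cos (rho m * (y - pi)) = sin (x - u)" by (simp add: cos_diff)
  have lu2: "lu \<le> pi / 2" "0 < lu" "u \<le> lu"
  proof -
    have "2 * real l \<le> real m" using l(2) by (metis of_nat_le_iff of_nat_mult of_nat_numeral)
    then have "2 * real l * pi \<le> real m * pi" by (intro mult_right_mono) auto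
    then show "lu \<le> pi / 2" using m3 by (simp add: lu_def u_def field_simps)
    show "0 < lu" using l u_pos by (simp add: lu_def)
    have "1 * u \<le> real l * u" using l u_pos by (intro mult_right_mono) auto
    then show "u \<le> lu" by (simp add: lu_def)
  qed
  have x: "0 < x" "x \<le> pi / 2 + u" "l = 1 \<Longrightarrow> x < pi / 2 + u"
  proof -
    show "0 < x" using y rho_pos by (simp add: x_def)
    show "x \<le> pi / 2 + u" using mult_left_mono[OF y(2), of "rho m"] rho_pos unfolding x_def rho_pi by simp
    assume "l = 1"
    then show "x < pi / 2 + u" using mult_strict_left_mono[OF y(3), of "rho m"] rho_pos unfolding x_def rho_pi by simp
  qed
  have qsin: "2 * sin q * sin x = cos (x - q) - cos (x + q)" by (simp add: cos_diff cos_add)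
  show "cos (rho m * (y - (real l + 1) * tau)) + 2 * sin ((real l - 1) * u) * cos (rho m * (y + tau - pi))
      - cos (rho m * (y - (real l - 1) * tau)) = 2 * sin (real l * u) * cos (rho m * (y - pi))"
  proof -
    have "cos (x - p) + 2 * sin q * sin x - cos (x - q) = cos (x - p) - cos (x + q)" unfolding qsin by simp
    also have "\<dots> = cos ((x - u) - lu) - cos ((x - u) + lu)"
    proof -
      have "x - p = (x - u) - lu" "x + q = (x - u) + lu" by (simp_all add: pq)
      then show ?thesis by (simp only:)
    qed
    also have "\<dots> = 2 * sin lu * sin (x - u)" by (simp add: cos_diff cos_add)
    finally show ?thesis unfolding e1 e2 e3 e4 p_q_def(2)[symmetric] lu_def[symmetric] .
  qed
  show "cos (rho m * b) < cos (rho m * (y - (real l + 1) * tau)) + 2 * sin ((real l - 1) * u) * cos (rho m * (y + tau - pi))"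
    unfolding e1 e3 p_q_def(2)[symmetric]
    using b
  proof
    assume bb: "b = y + (real l + 1) * tau \<and> b \<le> pi"
    then have "rho m * b = x + p" using rho_tau by (simp add: x_def p_q_def distrib_left mult.left_commute)
    then have "cos (rho m * b) = cos (x + p)" by simp
    moreover have "cos (x - p) - cos (x + p) = 2 * sin x * sin p" by (simp add: cos_diff cos_add)
    moreover have "0 < sin x" using x u_pos by (intro sin_gt_zero) auto
    moreover have "0 < sin p" using lu2 u_pos by (intro sin_gt_zero) (auto simp: pq)
    then have "0 < 2 * sin x * sin p" using \<open>0 < sin x\<close> by simp
    moreover have "0 \<le> sin q" using lu2 u_pos by (intro sin_ge_zero) (auto simp: pq)
    then have "0 \<le> 2 * sin q * sin x" using \<open>0 < sin x\<close> by simp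
    ultimately show "cos (rho m * b) < cos (x - p) + 2 * sin q * sin x" by linarith
  next
    assume bb: "b = 2 * pi - (y + (real l + 1) * tau) \<and> y + (real l + 1) * tau > pi"
    have "rho m * b = 2 * (rho m * pi) - x - (real l + 1) * (rho m * tau)"
      unfolding bb[THEN conjunct1] by (simp add: x_def algebra_simps)
    then have "rho m * b = pi - (x + q)" unfolding rho_tau rho_pi by (simp add: p_q_def algebra_simps)
    then have "cos (rho m * b) = - cos (x + q)" by (simp add: cos_diff)
    moreover have "cos (x - p) + cos (x - q) = 2 * cos (x - lu) * cos u"
    proof -
      have e5: "x - p = (x - lu) - u" "x - q = (x - lu) + u" by (simp_all add: pq)
      show ?thesis unfolding e5 cos_diff[of "x - lu"] cos_add[of "x - lu"] by simp
    qed
    moreover have "0 < cos (x - lu)"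
    proof (rule cos_gt_zero_pi)
      show "- (pi / 2) < x - lu" using x lu2 by linarith
      show "x - lu < pi / 2"
      proof (cases "l = 1")
        case True
        then show ?thesis using x(3) by (simp add: lu_def)
      next
        case False
        then have "1 < real l" using l by simp
        then have "1 * u < real l * u" using u_pos by (intro mult_strict_right_mono)
        then show ?thesis using x(2) by (simp add: lu_def)
      qed
    qed
    moreover have "0 < cos u" using u_pos by (intro cos_gt_zero_pi) auto
    ultimately show "cos (rho m * b) < cos (x - p) + 2 * sin q * sin x"
      unfolding qsin using mult_pos_pos[of "2 * cos (x - lu)" "cos u"] by simp
  qed
qed

text \<open>The induction step is stated for abstract functions because it serves twice, once as it
  stands and once mirrored at \<open>y = pi\<close>, with the two indices exchanged.\<close>

lemma W_step:
  assumes l: "1 \<le> l" "2 * l \<le> m" and y: "0 < y" "y \<le> pi" "l = 1 \<Longrightarrow> y < pi"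
    and id: "\<And>lam. gj lam * w lam = ga lam * v lam + gb lam * c lam"
    and gj: "grows m gj t (actK m * cos (rho m * (y - (real l - 1) * tau)))"
    and ga: "grows m ga t (actK m * cos (rho m * (y - (real l + 1) * tau)))"
    and v: "grows m v t (2 * actK m * sin ((real l - 1) * u) * cos (rho m * (y + tau - pi)))"
    and gb: "below m gb t (actK m * cos (rho m * b))"
    and b: "b = y + (real l + 1) * tau \<and> b \<le> pi \<or> b = 2 * pi - (y + (real l + 1) * tau) \<and> y + (real l + 1) * tau > pi"
    and c: "grows m c t 0"
  shows "grows m w t (2 * actK m * sin (real l * u) * cos (rho m * (y - pi)))"
proof -
  have m1: "m \<ge> 1" using m3 by simp
  define A where "A = cos (rho m * (y - (real l + 1) * tau)) + 2 * sin ((real l - 1) * u) * cos (rho m * (y + tau - pi))"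
  note dom = step_dominance[OF l y b, folded A_def]
  have hA: "actK m * cos (rho m * (y - (real l + 1) * tau)) + 2 * actK m * sin ((real l - 1) * u) * cos (rho m * (y + tau - pi)) = actK m * A"
    by (simp add: A_def algebra_simps)
  have "grows m (\<lambda>lam. ga lam * v lam + gb lam * c lam) t (actK m * A)"
  proof (rule grows_add[OF m1])
    show "grows m (\<lambda>lam. ga lam * v lam) t (actK m * A)" using grows_mult[OF ga v] unfolding hA .
    show "below m (\<lambda>lam. gb lam * c lam) t (actK m * cos (rho m * b) + 0)"
      by (rule below_mult[OF gb grows_imp_below[OF c]])
    show "actK m * cos (rho m * b) + 0 < actK m * A" using dom(1) actK_pos by simp
  qed
  from grows_divide[OF this gj]
  have "grows m (\<lambda>lam. (ga lam * v lam + gb lam * c lam) / gj lam) t (actK m * A - actK m * cos (rho m * (y - (real l - 1) * tau)))" .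
  then have "grows m w t (actK m * A - actK m * cos (rho m * (y - (real l - 1) * tau)))"
  proof (rule grows_cong)
    show "\<forall>\<^sub>F x in dirf t. (ga (pol x) * v (pol x) + gb (pol x) * c (pol x)) / gj (pol x) = w (pol x)"
      using grows_nonzero[OF gj] by eventually_elim (simp add: id[symmetric])
  qed
  moreover have "actK m * A - actK m * cos (rho m * (y - (real l - 1) * tau)) = 2 * actK m * sin (real l * u) * cos (rho m * (y - pi))"
    using dom(2) by (simp flip: right_diff_distrib) 
  ultimately show ?thesis by simp
qed

lemma W_adjacent_grows: "grows m (W k (k + 1)) t 0"
proof -
  obtain c where "c \<noteq> 0" "\<And>lam. W k (k + 1) lam = c" using W_adjacent[of k] by blast
  then have "W k (k + 1) = (\<lambda>_. c)" by auto
  then show ?thesis using grows_const[of m c t] \<open>c \<noteq> 0\<close> m3 by simp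
qed

text \<open>The direction \<open>y\<close> is measured symmetrically with respect to the two
  indices: \<open>y = 0\<close> is the one excluded direction and \<open>y = pi\<close> the axis of
  symmetry. The condition \<open>2 * l \<le> m\<close> amounts to
  \<open>(l + 1) * tau \<le> pi\<close>, so that the arguments of the functions \<open>F\<close>
  wrap around at most once.\<close>

lemma W_grows_small:
  assumes "2 * l \<le> m" "y = t + (2 * real i + real l + 1) * tau - 2 * pi * of_int N" "0 < y" "y < 2 * pi"
  shows "grows m (W i (i + l + 1)) t (2 * actK m * sin (real l * u) * cos (rho m * (y - pi)))"
  using assms
proof (induction l arbitrary: i y N)
  case 0
  then show ?case using W_adjacent_grows[of i t] by simp
next
  case (Suc l')
  define l where "l = Suc l'"
  define k where "k = i + l + 1"
  have l: "1 \<le> l" "2 * l \<le> m" "real l' = real l - 1" using Suc.prems by (auto simp: l_def)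
  have yeq: "y = t + (2 * real i + real l + 1) * tau - 2 * pi * of_int N" using Suc.prems(2) by (simp add: l_def)
  have y: "0 < y" "y < 2 * pi" using Suc.prems by auto
  have ltau: "(real l + 1) * tau \<le> pi" "0 < (real l + 1) * tau" "(real l - 1) * tau < pi" "0 \<le> (real l - 1) * tau"
  proof -
    have "2 * (real l + 1) \<le> real m + 2" using l(2) by simp
    then have "2 * (real l + 1) * tau \<le> (real m + 2) * tau" using tau_pos by (intro mult_right_mono) auto
    then have "2 * ((real l + 1) * tau) \<le> 2 * pi" unfolding tau_full by (simp only: mult.assoc)
    then show 1: "(real l + 1) * tau \<le> pi" by linarith
    show "0 < (real l + 1) * tau" "0 \<le> (real l - 1) * tau" using tau_pos l by (auto intro!: mult_pos_pos)
    have "(real l - 1) * tau < (real l + 1) * tau" using tau_pos by (intro mult_strict_right_mono) auto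
    then show "(real l - 1) * tau < pi" using 1 by linarith
  qed
  have l1: "(real l - 1) * tau = 0" if "l = 1" using that by simp
  have l2: "tau \<le> (real l - 1) * tau" if "l \<noteq> 1"
  proof -
    have "1 \<le> real l - 1" using that l by simp
    then have "1 * tau \<le> (real l - 1) * tau" using tau_pos by (intro mult_right_mono) auto
    then show ?thesis by simp
  qed
  have aj: "\<bar>z - (real l - 1) * tau\<bar> < pi" if "0 < z" "z \<le> pi" "l = 1 \<Longrightarrow> z < pi" for z
  proof (cases "l = 1")
    case True
    then show ?thesis using l1 that by simp
  next
    case False
    then show ?thesis using l2 that ltau tau_pos unfolding abs_less_iff by linarith
  qed
  have ak: "\<bar>z - (real l + 1) * tau\<bar> < pi" if "0 < z" "z \<le> pi" for z
    using that ltau unfolding abs_less_iff by linarith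
  have ai: "t + 2 * real i * tau - 2 * pi * of_int N = y - (real l + 1) * tau"
    "t + 2 * real (i + 1) * tau - 2 * pi * of_int N = y - (real l - 1) * tau"
    "t + 2 * real k * tau - 2 * pi * of_int N = y + (real l + 1) * tau"
    "t + 2 * real (i + l) * tau - 2 * pi * of_int N = y + (real l - 1) * tau"
    unfolding yeq k_def by (simp_all add: algebra_simps)
  have "grows m (W i k) t (2 * actK m * sin (real l * u) * cos (rho m * (y - pi)))"
  proof -
    \<comment> \<open>Up to \<open>pi\<close> the divisor is \<open>F (i + 1)\<close>, from there on
      \<open>F (i + l)\<close>. For \<open>l = 1\<close> and \<open>y = pi\<close> this divisor has
      no lower bound, but there the windings of \<open>i\<close> and \<open>k\<close> differ by
      one.\<close>
    consider (direct) "l = 1" "y = pi" | (left) "y \<le> pi" "l = 1 \<Longrightarrow> y < pi" | (right) "pi \<le> y" "l = 1 \<Longrightarrow> pi < y" by linarith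
    then show ?thesis
    proof cases
      case direct
      have 1: "t + 2 * real i * tau - 2 * pi * of_int N = pi - 2 * tau" unfolding ai(1) using direct by simp
      have 2: "t + 2 * real k * tau - 2 * pi * of_int (N + 1) = - (pi - 2 * tau)"
        using ai(3) direct by (simp add: algebra_simps)
      have lt: "\<bar>pi - 2 * tau\<bar> < pi" using tau_pos tau_lt by simp
      have "grows m (W i k) t (actK m * cos (rho m * (pi - 2 * tau)) + actK m * cos (rho m * (pi - 2 * tau)))"
        by (rule W_direct[of t i N k, unfolded 1 2 mult_minus_right cos_minus abs_minus_cancel, OF lt lt])
      moreover have "cos (rho m * (pi - 2 * tau)) = sin u"
      proof -
        have "rho m * (pi - 2 * tau) = rho m * pi - 2 * (rho m * tau)" by (simp add: algebra_simps)
        also have "\<dots> = pi / 2 - u" unfolding rho_tau rho_pi by simp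
        finally show ?thesis by (simp add: cos_diff)
      qed
      ultimately show ?thesis using direct by (simp add: mult.assoc)
    next
      case left
      define b where "b = (if y + (real l + 1) * tau \<le> pi then y + (real l + 1) * tau else 2 * pi - (y + (real l + 1) * tau))"
      show ?thesis
      proof (rule W_step[OF l(1,2) y(1) left])
        show "F (i + 1) lam 0 * W i k lam = F i lam 0 * W (i + 1) k lam + F k lam 0 * W i (i + 1) lam" for lam
          by (rule plucker_eval)
        show "grows m (\<lambda>lam. F (i + 1) lam 0) t (actK m * cos (rho m * (y - (real l - 1) * tau)))"
          by (rule F_grows'[of _ _ _ N, OF disjI1[OF ai(2)[symmetric]] aj[OF y(1) left]])
        show "grows m (\<lambda>lam. F i lam 0) t (actK m * cos (rho m * (y - (real l + 1) * tau)))"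
          by (rule F_grows'[of _ _ _ N, OF disjI1[OF ai(1)[symmetric]] ak[OF y(1) left(1)]])
        have "grows m (W (i + 1) (i + 1 + l' + 1)) t (2 * actK m * sin (real l' * u) * cos (rho m * (y + tau - pi)))"
        proof (rule Suc.IH)
          show "2 * l' \<le> m" using l by (simp add: l_def)
          show "y + tau = t + (2 * real (i + 1) + real l' + 1) * tau - 2 * pi * of_int N"
            unfolding yeq l(3) by (simp add: algebra_simps)
          show "0 < y + tau" "y + tau < 2 * pi" using y left tau_pos tau_lt by linarith+
        qed
        moreover have "i + 1 + l' + 1 = k" by (simp add: k_def l_def)
        ultimately show "grows m (W (i + 1) k) t (2 * actK m * sin ((real l - 1) * u) * cos (rho m * (y + tau - pi)))"
          by (simp only: l(3))
        show "below m (\<lambda>lam. F k lam 0) t (actK m * cos (rho m * b))"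
        proof (cases "y + (real l + 1) * tau \<le> pi")
          case True
          then show ?thesis using ai(3) y ltau by (intro F_below[of _ _ _ N]) (auto simp: b_def)
        next
          case False
          have "- b = t + 2 * real k * tau - 2 * pi * of_int (N + 1)" using ai(3) False by (simp add: b_def algebra_simps)
          moreover have "\<bar>b\<bar> \<le> pi" using False y left ltau by (auto simp: b_def abs_le_iff)
          ultimately show ?thesis by (intro F_below[of _ _ _ "N + 1"]) auto
        qed
        show "b = y + (real l + 1) * tau \<and> b \<le> pi \<or> b = 2 * pi - (y + (real l + 1) * tau) \<and> y + (real l + 1) * tau > pi"
          by (auto simp: b_def)
        show "grows m (\<lambda>lam. W i (i + 1) lam) t 0" by (rule W_adjacent_grows)
      qed
    next
      case right
      define y' where "y' = 2 * pi - y"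
      have y': "0 < y'" "y' \<le> pi" "l = 1 \<Longrightarrow> y' < pi" using y right by (auto simp: y'_def)
      define b where "b = (if y' + (real l + 1) * tau \<le> pi then y' + (real l + 1) * tau else 2 * pi - (y' + (real l + 1) * tau))"
      have "grows m (W i k) t (2 * actK m * sin (real l * u) * cos (rho m * (y' - pi)))"
      proof (rule W_step[OF l(1,2) y'])
        show "F (i + l) lam 0 * W i k lam = F k lam 0 * W i (i + l) lam + F i lam 0 * W (i + l) k lam" for lam
          using plucker_eval[of "i + l" lam i k] by simp
        have "- (y' - (real l - 1) * tau) = t + 2 * real (i + l) * tau - 2 * pi * of_int (N + 1)"
          using ai(4) by (simp add: y'_def algebra_simps)
        then show "grows m (\<lambda>lam. F (i + l) lam 0) t (actK m * cos (rho m * (y' - (real l - 1) * tau)))"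
          by (intro F_grows'[of _ _ _ "N + 1", OF disjI2 aj[OF y']])
        have "- (y' - (real l + 1) * tau) = t + 2 * real k * tau - 2 * pi * of_int (N + 1)"
          using ai(3) by (simp add: y'_def algebra_simps)
        then show "grows m (\<lambda>lam. F k lam 0) t (actK m * cos (rho m * (y' - (real l + 1) * tau)))"
          by (intro F_grows'[of _ _ _ "N + 1", OF disjI2 ak[OF y'(1,2)]])
        have "grows m (W i (i + l' + 1)) t (2 * actK m * sin (real l' * u) * cos (rho m * ((y - tau) - pi)))"
        proof (rule Suc.IH)
          show "2 * l' \<le> m" using l by (simp add: l_def)
          show "y - tau = t + (2 * real i + real l' + 1) * tau - 2 * pi * of_int N"
            unfolding yeq l(3) by (simp add: algebra_simps)
          show "0 < y - tau" "y - tau < 2 * pi" using y right tau_pos tau_lt by linarith+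
        qed
        moreover have "i + l' + 1 = i + l" by (simp add: l_def)
        moreover have "cos (rho m * ((y - tau) - pi)) = cos (rho m * (y' + tau - pi))"
        proof -
          have "rho m * ((y - tau) - pi) = - (rho m * (y' + tau - pi))" by (simp add: y'_def algebra_simps)
          then show ?thesis by (simp only: cos_minus)
        qed
        ultimately show "grows m (\<lambda>lam. W i (i + l) lam) t (2 * actK m * sin ((real l - 1) * u) * cos (rho m * (y' + tau - pi)))"
          by (simp only: l(3))
        show "below m (\<lambda>lam. F i lam 0) t (actK m * cos (rho m * b))"
        proof (cases "y' + (real l + 1) * tau \<le> pi")
          case True
          have "- b = t + 2 * real i * tau - 2 * pi * of_int (N + 1)" using ai(1) True by (simp add: b_def y'_def algebra_simps)
          moreover have "\<bar>b\<bar> \<le> pi" using True y' ltau by (auto simp: b_def abs_le_iff)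
          ultimately show ?thesis by (intro F_below[of _ _ _ "N + 1"]) auto
        next
          case False
          have "b = t + 2 * real i * tau - 2 * pi * of_int N" using ai(1) False by (simp add: b_def y'_def algebra_simps)
          moreover have "\<bar>b\<bar> \<le> pi" using False y' ltau by (auto simp: b_def abs_le_iff)
          ultimately show ?thesis by (intro F_below[of _ _ _ N]) auto
        qed
        show "b = y' + (real l + 1) * tau \<and> b \<le> pi \<or> b = 2 * pi - (y' + (real l + 1) * tau) \<and> y' + (real l + 1) * tau > pi"
          by (auto simp: b_def)
        have "k = i + l + 1" by (simp add: k_def)
        then show "grows m (\<lambda>lam. W (i + l) k lam) t 0" using W_adjacent_grows[of "i + l" t] by simp
      qed
      moreover have "cos (rho m * (y' - pi)) = cos (rho m * (y - pi))"
      proof -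
        have "rho m * (y' - pi) = - (rho m * (y - pi))" by (simp add: y'_def algebra_simps)
        then show ?thesis by (simp only: cos_minus)
      qed
      ultimately show ?thesis by simp
    qed
  qed
  then show ?case by (simp add: k_def l_def)
qed

text \<open>Larger \<open>l\<close> are reached by going around the other way: up to sign
  \<open>W i (i + l + 1)\<close> is \<open>W (i + l + 1) (i + m + 2)\<close>, for which
  \<open>l\<close> is replaced by \<open>m - l\<close>, and the sines of \<open>l * u\<close> and
  \<open>(m - l) * u\<close> agree.\<close>

theorem W_grows:
  assumes "l \<le> m" "y = t + (2 * real i + real l + 1) * tau - 2 * pi * of_int N" "0 < y" "y < 2 * pi"
  shows "grows m (W i (i + l + 1)) t (2 * actK m * sin (real l * u) * cos (rho m * (y - pi)))"
proof (cases "2 * l \<le> m")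
  case True
  then show ?thesis using assms by (intro W_grows_small)
next
  case False
  define l' where "l' = m - l"
  have l': "2 * l' \<le> m" "real l' = real m - real l" using False assms(1) by (auto simp: l'_def)
  have yy: "y = t + (2 * real (i + l + 1) + real l' + 1) * tau - 2 * pi * of_int (N + 1)"
    using tau_full unfolding assms(2) l'(2) by (simp add: algebra_simps)
  have "grows m (W (i + l + 1) (i + l + 1 + l' + 1)) t (2 * actK m * sin (real l' * u) * cos (rho m * (y - pi)))"
    by (rule W_grows_small[OF l'(1) yy assms(3,4)])
  moreover have "i + l + 1 + l' + 1 = i + (m + 2)" using assms(1) by (simp add: l'_def)
  moreover have "sin (real l' * u) = sin (real l * u)"
  proof -
    have "real l' * u = pi - real l * u" using m3 unfolding l'(2) by (simp add: u_def field_simps)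
    then show ?thesis by (simp add: sin_diff)
  qed
  ultimately have "grows m (W (i + l + 1) i) t (2 * actK m * sin (real l * u) * cos (rho m * (y - pi)))"
    by (simp only: W_period)
  from grows_uminus[OF this] show ?thesis
    by (rule grows_cong) (simp add: W_antisym[of i])
qed

end

section \<open>Zeros near the positive axis\<close>

text \<open>Truth eventually along \<open>dirf t\<close> includes a neighbourhood of
  \<open>t\<close>; finitely many of these cover the interval, and the largest of their radii serves
  all directions.\<close>

lemma dirf_compact:
  assumes "\<And>t. t \<in> {a..b} \<Longrightarrow> eventually P (dirf t)"
  shows "\<exists>R. \<forall>r\<ge>R. \<forall>t\<in>{a..b}. P (r, t)"
proof -
  have "\<exists>U R. open U \<and> t \<in> U \<and> (\<forall>r\<ge>R. \<forall>s\<in>U. P (r, s))" if t: "t \<in> {a..b}" for t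
  proof -
    obtain Pf Pg where e: "eventually Pf at_top" "eventually Pg (nhds t)" and P: "\<And>x y. Pf x \<Longrightarrow> Pg y \<Longrightarrow> P (x, y)"
      using assms[OF t] unfolding dirf_def eventually_prod_filter by blast
    obtain R where "\<And>r. r \<ge> R \<Longrightarrow> Pf r" using e(1) unfolding eventually_at_top_linorder by blast
    moreover obtain U where "open U" "t \<in> U" "\<And>s. s \<in> U \<Longrightarrow> Pg s" using e(2) unfolding eventually_nhds by blast
    ultimately show ?thesis using P by blast
  qed
  then obtain U R where U: "\<And>t. t \<in> {a..b} \<Longrightarrow> open (U t) \<and> t \<in> U t \<and> (\<forall>r\<ge>R t. \<forall>s\<in>U t. P (r, s))" by metis
  have "{a..b} \<subseteq> (\<Union>t\<in>{a..b}. U t)" using U by blast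
  then obtain C where C: "C \<subseteq> {a..b}" "finite C" "{a..b} \<subseteq> (\<Union>t\<in>C. U t)"
    using compactE_image[OF compact_Icc, of "{a..b}" U a b] U by (metis (no_types, lifting))
  show ?thesis
  proof (intro exI allI impI ballI)
    fix r t assume r: "r \<ge> Max (insert 0 (R ` C))" and t: "t \<in> {a..b}"
    then obtain c where c: "c \<in> C" "t \<in> U c" using C by blast
    then have "R c \<le> r" using r C by (intro order_trans[OF Max_ge r]) auto
    then show "P (r, t)" using U c C by blast
  qed
qed

text \<open>A weak form of the Borel-Caratheodory inequality: \<open>exp (H / M)\<close> has modulus
  between \<open>exp (-1)\<close> and \<open>exp 1\<close>, so the Cauchy estimate for it bounds the
  derivative of \<open>H\<close> in terms of the real part alone.\<close>

lemma norm_deriv_le_if_Re_bounded: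
  assumes H: "H holomorphic_on S" "open S" "cball z d \<subseteq> S" and d: "0 < d" and M: "0 < M"
    and b: "\<And>w. w \<in> cball z d \<Longrightarrow> \<bar>Re (H w)\<bar> \<le> M"
  shows "norm (deriv H z) \<le> exp 2 * M / d"
proof -
  define f where "f w = exp (H w / of_real M)" for w
  have hol: "f holomorphic_on S" unfolding f_def using H M by (intro holomorphic_intros) auto
  have zS: "z \<in> S" using H(3) d by auto
  have "norm ((deriv ^^ 1) f z) \<le> fact 1 * exp 1 / d ^ 1"
  proof (rule Cauchy_inequality)
    show "f holomorphic_on ball z d" using hol H(3) by (meson ball_subset_cball holomorphic_on_subset)
    show "continuous_on (cball z d) f"
      using holomorphic_on_imp_continuous_on[OF hol] H(3) continuous_on_subset by blast
    fix w assume "norm (z - w) = d"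
    then have "\<bar>Re (H w)\<bar> \<le> M" by (intro b) (simp add: dist_norm)
    then have "Re (H w) / M \<le> 1" using M by (simp add: divide_le_eq)
    then show "norm (f w) \<le> exp 1" by (simp add: f_def)
  qed fact
  then have 1: "norm (deriv f z) \<le> exp 1 / d" by simp
  have "(H has_field_derivative deriv H z) (at z)" using H zS by (intro holomorphic_derivI)
  then have "(f has_field_derivative exp (H z / of_real M) * (deriv H z / of_real M)) (at z)"
    unfolding f_def using M by (auto intro!: derivative_eq_intros)
  then have "norm (deriv f z) = exp (Re (H z) / M) * (norm (deriv H z) / M)"
    using M by (simp add: DERIV_imp_deriv norm_mult norm_divide)
  moreover have "exp (-1) \<le> exp (Re (H z) / M)"
    using b[of z] d M by (simp add: field_simps abs_le_iff)
  then have "exp (-1) * (norm (deriv H z) / M) \<le> exp (Re (H z) / M) * (norm (deriv H z) / M)"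
    using M by (intro mult_right_mono) auto
  ultimately have "exp (-1) * (norm (deriv H z) / M) \<le> exp 1 / d" using 1 by linarith
  then have "exp 1 * (exp (-1) * (norm (deriv H z) / M)) \<le> exp 1 * (exp 1 / d)" by (intro mult_left_mono) auto
  moreover have "exp 1 * exp (-1) = (1::real)" "exp 1 * exp 1 = exp (2::real)" by (simp_all flip: exp_add)
  ultimately have "norm (deriv H z) / M \<le> exp 2 / d" by (metis mult.assoc mult_1 times_divide_eq_right)
  then show ?thesis using M d by (simp add: field_simps)
qed

lemma pol_exp: "pol (exp (Re z), Im z) = exp z"
  by (simp add: pol_def exp_eq_polar)

text \<open>In the coordinate \<open>z = ln r + \<i> * t\<close> a logarithm \<open>L\<close> of the
  quotient has nearly the real part of \<open>\<i> * S * exp (rho m * z)\<close>. Their difference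
  \<open>H\<close> has small real part, hence by analyticity a small derivative, and the angular
  derivative \<open>- Im (deriv L z)\<close> is close to
  \<open>- S * rho m * cos (rho m * t) * r powr rho m\<close>, which is negative. Growth is assumed
  up to \<open>2 * d\<close> to leave room for the discs of the Cauchy estimate.\<close>

lemma quotient_modulus_decreasing:
  assumes hol: "E holomorphic_on UNIV" "F holomorphic_on UNIV"
    and gr: "\<And>t. \<bar>t\<bar> \<le> 2 * d \<Longrightarrow> grows m E t (hE t)" "\<And>t. \<bar>t\<bar> \<le> 2 * d \<Longrightarrow> grows m F t (hF t)"
    and h: "\<And>t. \<bar>t\<bar> \<le> 2 * d \<Longrightarrow> hE t - hF t = - S * sin (rho m * t)"
    and S: "0 < S" and d: "0 < d" "rho m * d < pi / 2"
  shows "\<exists>R. \<forall>r\<ge>R. \<forall>s. 0 < s \<and> s \<le> d \<longrightarrow>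
      norm (E (pol (r, s)) / F (pol (r, s))) < norm (E (pol (r, - s)) / F (pol (r, - s))) \<and> F (pol (r, s)) \<noteq> 0 \<and> F (pol (r, - s)) \<noteq> 0"
proof -
  have rho: "0 < rho m" by (simp add: rho_def add_pos_nonneg)
  define c0 where "c0 = cos (rho m * d)"
  have c0: "0 < c0" unfolding c0_def using rho d by (intro cos_gt_zero_pi) (auto intro: order.strict_trans[of _ 0])
  define d' where "d' = min d 1 / 2"
  have d': "0 < d'" "d' < d" "d' < 1" using d by (auto simp: d'_def)
  \<comment> \<open>With this value the bound for \<open>deriv H\<close> comes out as half of the
    main term. The factor \<open>exp (rho m)\<close> accounts for the growth of the bound across a
    disc of radius below 1.\<close>
  define e where "e = S * rho m * c0 * d' / (2 * exp 2 * exp (rho m))"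
  have e: "e > 0" using S rho c0 d' by (simp add: e_def)
  define G where "G z = E z / F z" for z
  define Q where "Q x \<longleftrightarrow> E (pol x) \<noteq> 0 \<and> F (pol x) \<noteq> 0 \<and>
      exp ((- S * sin (rho m * snd x) - e) * fst x powr rho m) \<le> norm (G (pol x)) \<and>
      norm (G (pol x)) \<le> exp ((- S * sin (rho m * snd x) + e) * fst x powr rho m)" for x
  have "eventually Q (dirf t)" if "t \<in> {- (2 * d)..2 * d}" for t
  proof -
    have t: "\<bar>t\<bar> \<le> 2 * d" using that by auto
    have g: "grows m G t (- S * sin (rho m * t))"
      using grows_divide[OF gr[OF t]] unfolding h[OF t] G_def .
    have "((\<lambda>s. - S * sin (rho m * s)) \<longlongrightarrow> - S * sin (rho m * t)) (nhds t)"
      by (intro tendsto_intros filterlim_ident)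
    then have "\<forall>\<^sub>F s in nhds t. dist (- S * sin (rho m * s)) (- S * sin (rho m * t)) < e / 2"
      using e by (intro tendstoD) auto
    from eventually_dirf_snd[OF this] growsD[OF g, of "e / 2"] e
    have "\<forall>\<^sub>F x in dirf t. dist (- S * sin (rho m * snd x)) (- S * sin (rho m * t)) < e / 2"
      "\<forall>\<^sub>F x in dirf t. exp ((- S * sin (rho m * t) - e / 2) * fst x powr rho m) \<le> norm (G (pol x))"
      "\<forall>\<^sub>F x in dirf t. norm (G (pol x)) \<le> exp ((- S * sin (rho m * t) + e / 2) * fst x powr rho m)" by auto
    then show ?thesis using grows_nonzero[OF gr(1)[OF t]] grows_nonzero[OF gr(2)[OF t]]
    proof eventually_elim
      case (elim x)
      have "- S * sin (rho m * snd x) - e \<le> - S * sin (rho m * t) - e / 2"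
        "- S * sin (rho m * t) + e / 2 \<le> - S * sin (rho m * snd x) + e"
        using elim(1) unfolding dist_real_def by linarith+
      then have "exp ((- S * sin (rho m * snd x) - e) * fst x powr rho m) \<le> exp ((- S * sin (rho m * t) - e / 2) * fst x powr rho m)"
        "exp ((- S * sin (rho m * t) + e / 2) * fst x powr rho m) \<le> exp ((- S * sin (rho m * snd x) + e) * fst x powr rho m)"
        by (simp_all only: exp_le_cancel_iff mult_right_mono powr_ge_zero)
      then show ?case unfolding Q_def using elim by linarith
    qed
  qed
  from dirf_compact[OF this] obtain R where R: "\<And>r t. r \<ge> R \<Longrightarrow> \<bar>t\<bar> \<le> 2 * d \<Longrightarrow> Q (r, t)"
    by (metis abs_le_iff atLeastAtMost_iff minus_le_iff)
  define R0 where "R0 = max R 1"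
  define A where "A = {z. ln R0 < Re z} \<inter> {z. - (2 * d) < Im z} \<inter> {z. Im z < 2 * d}"
  have A: "open A" "convex A" unfolding A_def
    by (intro open_Int open_halfspace_Re_gt open_halfspace_Im_gt open_halfspace_Im_lt)
      (intro convex_Int convex_halfspace_Re_gt convex_halfspace_Im_gt convex_halfspace_Im_lt)
  have QA: "Q (exp (Re z), Im z)" if "z \<in> A" for z
  proof (rule R)
    have "exp (ln R0) < exp (Re z)" using that by (simp add: A_def)
    moreover have "exp (ln R0) = R0" by (intro exp_ln) (simp add: R0_def)
    ultimately show "R \<le> exp (Re z)" by (simp add: R0_def)
  qed (use that in \<open>auto simp: A_def\<close>)
  define g where "g z = G (exp z)" for z
  have "g holomorphic_on A"
  proof -
    have "(\<lambda>z. E (exp z)) holomorphic_on A" "(\<lambda>z. F (exp z)) holomorphic_on A"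
      using hol by (auto intro!: holomorphic_on_compose_gen[unfolded o_def, where t = UNIV and f = exp] holomorphic_intros)
    moreover have "F (exp z) \<noteq> 0" if "z \<in> A" for z using QA[OF that] by (simp add: Q_def pol_exp)
    ultimately show ?thesis unfolding g_def G_def by (intro holomorphic_intros)
  qed
  moreover have "g z \<noteq> 0" if "z \<in> A" for z using QA[OF that] by (simp add: Q_def pol_exp g_def G_def)
  moreover have "of_real (ln R0 + 1) \<in> A" using d by (simp add: A_def)
  ultimately obtain L where L: "L holomorphic_on A" "\<And>z. z \<in> A \<Longrightarrow> exp (L z) = g z"
    using holomorphic_logarithm_exists[OF A(2,1)] by metis
  define H where "H z = L z - \<i> * of_real S * exp (of_real (rho m) * z)" for z
  have H: "H holomorphic_on A" unfolding H_def by (intro holomorphic_intros L)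
  have ReH: "\<bar>Re (H z)\<bar> \<le> e * exp (rho m * Re z)" if z: "z \<in> A" for z
  proof -
    have pw: "exp (Re z) powr rho m = exp (rho m * Re z)" by (simp add: powr_def)
    have "norm (G (exp z)) = exp (Re (L z))" using L(2)[OF z] by (metis g_def norm_exp_eq_Re)
    then have "(- S * sin (rho m * Im z) - e) * exp (rho m * Re z) \<le> Re (L z)"
      "Re (L z) \<le> (- S * sin (rho m * Im z) + e) * exp (rho m * Re z)"
      using QA[OF z] by (simp_all add: Q_def pol_exp pw)
    moreover have "Re (H z) = Re (L z) + S * sin (rho m * Im z) * exp (rho m * Re z)"
      by (simp add: H_def Re_exp Im_exp)
    ultimately show ?thesis by (simp add: abs_le_iff algebra_simps)
  qed
  have neg: "- Im (deriv L z) < 0" if z: "ln R0 + 1 < Re z" "\<bar>Im z\<bar> \<le> d" for z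
  proof -
    have sub: "cball z d' \<subseteq> A"
    proof
      fix w assume "w \<in> cball z d'"
      then have "norm (z - w) \<le> d'" by (simp add: dist_norm)
      then have "\<bar>Re z - Re w\<bar> \<le> d'" "\<bar>Im z - Im w\<bar> \<le> d'"
        using abs_Re_le_cmod[of "z - w"] abs_Im_le_cmod[of "z - w"] by auto
      then show "w \<in> A" using z d' unfolding A_def by (auto simp: abs_le_iff)
    qed
    then have zA: "z \<in> A" using d' by auto
    define X where "X = exp (rho m * Re z)"
    have X: "X > 0" by (simp add: X_def)
    have "norm (deriv H z) \<le> exp 2 * (e * exp (rho m) * X) / d'"
    proof (rule norm_deriv_le_if_Re_bounded[OF H A(1) sub d'(1)])
      show "0 < e * exp (rho m) * X" using e X by simp
      fix w assume w: "w \<in> cball z d'"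
      then have "norm (z - w) \<le> d'" by (simp add: dist_norm)
      then have "Re w \<le> 1 + Re z" using abs_Re_le_cmod[of "z - w"] d' by auto
      then have "rho m * Re w \<le> rho m * (1 + Re z)" using rho by (intro mult_left_mono) auto
      then have "exp (rho m * Re w) \<le> exp (rho m) * X" by (simp add: X_def distrib_left flip: exp_add)
      then have "e * exp (rho m * Re w) \<le> e * exp (rho m) * X" using e by simp
      then show "\<bar>Re (H w)\<bar> \<le> e * exp (rho m) * X" using ReH[of w] w sub by force
    qed
    also have "\<dots> = S * rho m * c0 / 2 * X" using d' by (simp add: e_def)
    finally have nH: "norm (deriv H z) \<le> S * rho m * c0 / 2 * X" .
    have dL: "(L has_field_derivative deriv L z) (at z)" using L A zA by (intro holomorphic_derivI)
    have "(H has_field_derivative deriv L z - \<i> * of_real S * (exp (of_real (rho m) * z) * of_real (rho m))) (at z)"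
      unfolding H_def by (rule derivative_eq_intros dL refl | simp)+
    then have dH: "deriv L z = deriv H z + \<i> * of_real S * (exp (of_real (rho m) * z) * of_real (rho m))"
      by (simp add: DERIV_imp_deriv)
    have "Im (deriv L z) = Im (deriv H z) + S * rho m * cos (rho m * Im z) * X"
      unfolding dH by (simp add: Re_exp X_def)
    moreover have "c0 \<le> cos (rho m * Im z)"
    proof -
      have "rho m * \<bar>Im z\<bar> \<le> rho m * d" using z rho by (intro mult_left_mono) auto
      moreover have "rho m * d \<le> pi" using d pi_gt_zero by linarith
      ultimately have "cos (rho m * d) \<le> cos (rho m * \<bar>Im z\<bar>)" using rho by (intro cos_monotone_0_pi_le) auto
      then show ?thesis by (simp add: c0_def abs_if split: if_splits)
    qed
    then have "S * rho m * c0 * X \<le> S * rho m * cos (rho m * Im z) * X"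
      using S rho X by (intro mult_right_mono mult_left_mono) auto
    moreover have "- Im (deriv H z) \<le> S * rho m * c0 / 2 * X" using nH abs_Im_le_cmod[of "deriv H z"] by linarith
    moreover have "0 < S * rho m * c0 * X" using S rho c0 X by simp
    ultimately show ?thesis by simp
  qed
  show ?thesis
  proof (intro exI allI impI)
    fix r s assume r: "r \<ge> exp (ln R0 + 2)" and s: "0 < s \<and> s \<le> d"
    have "0 < r" using r by (meson exp_gt_zero less_le_trans)
    define x where "x = ln r"
    have "ln R0 + 2 \<le> x" using r \<open>0 < r\<close> by (simp add: x_def ln_ge_iff)
    then have x: "ln R0 + 1 < x" "exp x = r" using \<open>0 < r\<close> by (auto simp: x_def)
    have mem: "Complex x y \<in> A" if "\<bar>y\<bar> \<le> d" for y using that x d by (auto simp: A_def)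
    have "Re (L (Complex x s)) < Re (L (Complex x (- s)))"
    proof (rule DERIV_neg_imp_decreasing[where f = "\<lambda>y. Re (L (Complex x y))"])
      show "- s < s" using s by simp
      fix y assume "- s \<le> y" "y \<le> s"
      then have y: "\<bar>y\<bar> \<le> d" using s by auto
      have "((\<lambda>y. Complex x y) has_vector_derivative \<i>) (at y)"
        unfolding Complex_eq by (auto intro!: derivative_eq_intros)
      moreover have "(L has_field_derivative deriv L (Complex x y)) (at (Complex x y))"
        using L A mem[OF y] by (intro holomorphic_derivI)
      ultimately have "((\<lambda>y. L (Complex x y)) has_vector_derivative \<i> * deriv L (Complex x y)) (at y)"
        using field_vector_diff_chain_at[unfolded o_def] by blast
      from bounded_linear.has_vector_derivative[OF bounded_linear_Re this]
      have "((\<lambda>y. Re (L (Complex x y))) has_real_derivative - Im (deriv L (Complex x y))) (at y)"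
        by (simp add: has_real_derivative_iff_has_vector_derivative)
      moreover have "- Im (deriv L (Complex x y)) < 0" using x y by (intro neg) auto
      ultimately show "\<exists>D. ((\<lambda>y. Re (L (Complex x y))) has_real_derivative D) (at y) \<and> D < 0" by blast
    qed
    moreover have "norm (E (pol (r, y)) / F (pol (r, y))) = exp (Re (L (Complex x y)))" "F (pol (r, y)) \<noteq> 0" if "\<bar>y\<bar> \<le> d" for y
    proof -
      have "pol (r, y) = exp (Complex x y)" using pol_exp[of "Complex x y"] x by simp
      then show "norm (E (pol (r, y)) / F (pol (r, y))) = exp (Re (L (Complex x y)))"
        using L(2)[OF mem[OF that]] by (metis G_def g_def norm_exp_eq_Re)
      show "F (pol (r, y)) \<noteq> 0" using QA[OF mem[OF that]] x by (simp add: Q_def)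
    qed
    ultimately show "norm (E (pol (r, s)) / F (pol (r, s))) < norm (E (pol (r, - s)) / F (pol (r, - s))) \<and> F (pol (r, s)) \<noteq> 0 \<and> F (pol (r, - s)) \<noteq> 0"
      using s by simp
  qed
qed

lemma exp_decay_times_power:
  fixes c C :: real
  assumes "c > 0"
  shows "\<forall>\<^sub>F r in at_top. C * (1 + r) ^ n * exp (- c * r) \<le> exp (- (c / 2) * r)"
proof -
  have "((\<lambda>r. C * (1 + r) ^ n * exp (- (c / 2) * r)) \<longlongrightarrow> 0) at_top" using assms by real_asymp
  then have "\<forall>\<^sub>F r in at_top. C * (1 + r) ^ n * exp (- (c / 2) * r) < 1" by (rule order_tendstoD) simp
  then show ?thesis
  proof eventually_elim
    case (elim r)
    have "exp (- c * r) = exp (- (c / 2) * r) * exp (- (c / 2) * r)" by (simp flip: exp_add)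
    then have "C * (1 + r) ^ n * exp (- c * r) = (C * (1 + r) ^ n * exp (- (c / 2) * r)) * exp (- (c / 2) * r)" by simp
    also have "\<dots> \<le> 1 * exp (- (c / 2) * r)" using elim by (intro mult_right_mono) auto
    finally show ?case by simp
  qed
qed

section \<open>Decaying solutions, vanishing Wronskians and the location of zeros\<close>

context osc
begin

text \<open>Uniqueness for the initial value problem follows from constant Wronskians: those of
  \<open>V\<close> with \<open>F 0\<close> and \<open>F 1\<close> vanish, and these two solutions
  are independent by \<open>W_adjacent\<close>.\<close>

lemma ode_eq_0:
  assumes V: "ode p lam V V1" "V 0 = 0" "V1 0 = 0"
  shows "V z = 0"
proof -
  obtain c where c: "c \<noteq> 0" "W 0 (0 + 1) lam = c" using W_adjacent[of 0] by metis
  have w: "V z * F1 k lam z = V1 z * F k lam z" for k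
    using wronskian_constant[OF V(1) ode_F[of lam k], of z] V by simp
  have "F 0 lam z * F1 (0 + 1) lam z - F1 0 lam z * F (0 + 1) lam z = c"
    using wronskian_constant[OF ode_F[of lam 0] ode_F[of lam "0 + 1"], of z] c by (simp add: W_def)
  then have "V z * c = F 0 lam z * (V z * F1 (0 + 1) lam z) - (V z * F1 0 lam z) * F (0 + 1) lam z"
    by (simp add: algebra_simps)
  also have "\<dots> = 0" unfolding w by (simp add: algebra_simps)
  finally show ?thesis using c by simp
qed

text \<open>Along the ray \<open>V\<close>, \<open>F k\<close> and \<open>F1 k\<close> tend to 0, so
  the constant Wronskian vanishes as soon as \<open>V1\<close> stays bounded. This comes from
  integrating the equation, in which the exponential decay of \<open>V\<close> beats the
  polynomial.\<close>

lemma wronskian_F_eq_0: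
  assumes V: "ode p lam V V1" and c: "c > 0"
    and decay: "\<And>r. r \<ge> 0 \<Longrightarrow> norm (V (of_real r * om k)) \<le> C * exp (- c * r)"
  shows "V 0 * F1 k lam 0 = V1 0 * F k lam 0"
proof -
  define v where "v r = V (of_real r * om k)" for r :: real
  define v1 where "v1 r = V1 (of_real r * om k)" for r :: real
  have C: "C \<ge> 0" using decay[of 0] by (simp add: order_trans[OF norm_ge_zero])
  obtain Cp where Cp: "\<And>z. norm (poly (p + [:lam:]) z) \<le> Cp * (1 + norm z) ^ m"
  proof -
    have "degree (p + [:lam:]) \<le> m" using deg by (intro degree_add_le) auto
    from poly_growth_bound[OF this] show ?thesis using that by metis
  qed
  obtain R where R: "R \<ge> 0" "\<And>r. r \<ge> R \<Longrightarrow> (Cp * C) * (1 + r) ^ m * exp (- c * r) \<le> exp (- (c / 2) * r)"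
    using exp_decay_times_power[OF c, of "Cp * C" m] unfolding eventually_at_top_linorder
    by (metis (no_types, lifting) max.bounded_iff max.cobounded1 max.cobounded2)
  define B where "B = norm (v1 R) + 2 / c"
  have v1: "norm (v1 b) \<le> B" if b: "b \<ge> R" for b
  proof -
    define f' where "f' r = om k * ((poly p (of_real r * om k) + lam) * v r)" for r
    define G where "G r = - (2 / c) * exp (- (c / 2) * r)" for r
    have "norm (v1 b - v1 R) \<le> G b - G R"
    proof (rule path_bound[OF b])
      fix x assume x: "x \<in> {R..b}"
      have d1: "((\<lambda>r. of_real r * om k) has_vector_derivative om k) (at x within {R..b})"
        by (auto intro!: derivative_eq_intros)
      have d2: "(V1 has_field_derivative (poly p (of_real x * om k) + lam) * V (of_real x * om k)) (at (of_real x * om k))"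
        using V unfolding ode_def by blast
      show "(v1 has_vector_derivative f' x) (at x within {R..b})"
        using field_vector_diff_chain_within[OF d1 has_field_derivative_at_within[OF d2]]
        unfolding v1_def f'_def v_def o_def .
      show "(G has_real_derivative exp (- (c / 2) * x)) (at x within {R..b})"
        unfolding G_def using c by (auto intro!: derivative_eq_intros)
      have "norm (f' x) = norm (poly (p + [:lam:]) (of_real x * om k)) * norm (v x)"
        by (simp add: f'_def norm_mult add.commute)
      also have "\<dots> \<le> (Cp * (1 + x) ^ m) * (C * exp (- c * x))"
      proof (rule mult_mono)
        show "norm (poly (p + [:lam:]) (of_real x * om k)) \<le> Cp * (1 + x) ^ m"
          using Cp[of "of_real x * om k"] x R by (simp add: norm_mult)
        then show "0 \<le> Cp * (1 + x) ^ m" by (rule order_trans[OF norm_ge_zero])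
        show "norm (v x) \<le> C * exp (- c * x)" using decay[of x] x R by (simp add: v_def)
      qed simp
      also have "\<dots> = (Cp * C) * (1 + x) ^ m * exp (- c * x)" by simp
      also have "\<dots> \<le> exp (- (c / 2) * x)" using x by (intro R) auto
      finally show "norm (f' x) \<le> exp (- (c / 2) * x)" .
    qed
    moreover have "G b \<le> 0" "- G R \<le> 2 / c"
    proof -
      show "G b \<le> 0" using c by (simp add: G_def)
      have "exp (- (c / 2) * R) \<le> 1" using c R by simp
      then have "(2 / c) * exp (- (c / 2) * R) \<le> (2 / c) * 1" using c by (intro mult_left_mono) auto
      then show "- G R \<le> 2 / c" by (simp add: G_def)
    qed
    moreover have "norm (v1 b) \<le> norm (v1 b - v1 R) + norm (v1 R)" by (metis norm_triangle_sub add.commute)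
    ultimately show ?thesis unfolding B_def by linarith
  qed
  have v0: "(v \<longlongrightarrow> 0) at_top"
  proof (rule Lim_null_comparison)
    show "((\<lambda>r. C * exp (- c * r)) \<longlongrightarrow> 0) at_top" using c by real_asymp
    show "\<forall>\<^sub>F r in at_top. norm (v r) \<le> C * exp (- c * r)"
      using eventually_ge_at_top[of 0] by eventually_elim (simp only: v_def decay)
  qed
  have "((\<lambda>r. v r * F1 k lam (of_real r * om k)) \<longlongrightarrow> 0 * 0) at_top"
    by (intro tendsto_mult v0 F_decay)
  moreover have "((\<lambda>r. v1 r * F k lam (of_real r * om k)) \<longlongrightarrow> 0) at_top"
  proof (rule Lim_null_comparison)
    show "((\<lambda>r. B * norm (F k lam (of_real r * om k))) \<longlongrightarrow> 0) at_top"
      by (rule tendsto_mult_right_zero) (rule tendsto_norm_zero[OF F_decay(1)])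
    show "\<forall>\<^sub>F r in at_top. norm (v1 r * F k lam (of_real r * om k)) \<le> B * norm (F k lam (of_real r * om k))"
      using eventually_ge_at_top[of R] by eventually_elim (simp add: norm_mult v1 mult_right_mono)
  qed
  ultimately have "((\<lambda>r. v r * F1 k lam (of_real r * om k) - v1 r * F k lam (of_real r * om k)) \<longlongrightarrow> 0 * 0 - 0) at_top"
    by (rule tendsto_diff)
  moreover have "v r * F1 k lam (of_real r * om k) - v1 r * F k lam (of_real r * om k) = V 0 * F1 k lam 0 - V1 0 * F k lam 0" for r
    unfolding v_def v1_def by (rule wronskian_constant[OF V ode_F])
  ultimately have "((\<lambda>r::real. V 0 * F1 k lam 0 - V1 0 * F k lam 0) \<longlongrightarrow> 0) at_top" by simp
  then show ?thesis by (simp add: tendsto_const_iff)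
qed

text \<open>The nonzero vector \<open>(V 0, V1 0)\<close> is parallel to the vectors of
  \<open>F j\<close> and of \<open>F k\<close> at 0, so these are parallel to each other.\<close>

lemma W_eq_0:
  assumes V: "ode p lam V V1" and nz: "V z \<noteq> 0" and c: "c > 0" "c' > 0"
    and decay: "\<And>r. r \<ge> 0 \<Longrightarrow> norm (V (of_real r * om j)) \<le> C * exp (- c * r)"
      "\<And>r. r \<ge> 0 \<Longrightarrow> norm (V (of_real r * om k)) \<le> C' * exp (- c' * r)"
  shows "W j k lam = 0"
proof -
  have j: "V 0 * F1 j lam 0 = V1 0 * F j lam 0" by (rule wronskian_F_eq_0[OF V c(1) decay(1)])
  have k: "V 0 * F1 k lam 0 = V1 0 * F k lam 0" by (rule wronskian_F_eq_0[OF V c(2) decay(2)])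
  have "V 0 * W j k lam = F j lam 0 * (V 0 * F1 k lam 0) - (V 0 * F1 j lam 0) * F k lam 0"
    by (simp add: W_def algebra_simps)
  also have "\<dots> = 0" by (simp only: j k) (simp add: algebra_simps)
  finally have 0: "V 0 * W j k lam = 0" .
  have "V1 0 * W j k lam = (V1 0 * F j lam 0) * F1 k lam 0 - F1 j lam 0 * (V1 0 * F k lam 0)"
    by (simp add: W_def algebra_simps)
  also have "\<dots> = 0" by (simp only: j[symmetric] k[symmetric]) (simp add: algebra_simps)
  finally have 1: "V1 0 * W j k lam = 0" .
  have "V 0 \<noteq> 0 \<or> V1 0 \<noteq> 0" using ode_eq_0[OF V] nz by blast
  then show ?thesis using 0 1 by auto
qed

text \<open>The rotation by \<open>- (l + 1) * tau\<close> carries the excluded direction to the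
  positive axis. Only zeros whose conjugate is a zero are considered, because monotonicity compares
  the directions \<open>s\<close> and \<open>- s\<close> with each other.\<close>

lemma conj_zeros_real:
  assumes l: "1 \<le> l" "l + 1 \<le> m"
  defines "D \<equiv> \<lambda>z. W 0 (l + 1) (cis (- (real l + 1) * tau) * z)"
  shows "finite {z. D z = 0 \<and> D (cnj z) = 0 \<and> \<not> (Im z = 0 \<and> Re z > 0)}"
proof -
  define a where "a = - (real l + 1) * tau"
  have l1: "real (l - 1) = real l - 1" using l by simp
  \<comment> \<open>Since \<open>2 * d < tau\<close>, the shifted directions
    \<open>t - tau + 2 * pi\<close> of \<open>E\<close> and \<open>t + tau\<close> of
    \<open>G\<close> stay strictly between 0 and \<open>2 * pi\<close> for
    \<open>\<bar>t\<bar> \<le> 2 * d\<close>.\<close>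
  define d where "d = tau / 3"
  have d: "0 < d" "2 * d < tau" "d < pi" using tau_pos tau_lt by (auto simp: d_def)
  have rho_d: "rho m * d < pi / 2" using rho_tau u_pos by (simp add: d_def)
  define E where "E z = W 0 l (cis a * z)" for z
  define G where "G z = W 0 (l + 2) (cis a * z)" for z
  have hol: "(\<lambda>z. W i j (cis a * z)) holomorphic_on UNIV" for i j
    by (intro holomorphic_on_compose_gen[unfolded o_def, OF _ W_holomorphic, where f = "\<lambda>z. cis a * z"] holomorphic_intros) auto
  have Dout: "\<forall>\<^sub>F x in dirf t. D (pol x) \<noteq> 0" if t: "t \<in> {d..2 * pi - d}" for t
  proof -
    have "grows m (W 0 (0 + l + 1)) (t + a) (2 * actK m * sin (real l * u) * cos (rho m * (t - pi)))"
      using l t d by (intro W_grows[of _ _ _ _ 0]) (auto simp: a_def algebra_simps)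
    from grows_nonzero[OF grows_rotate[OF this]] show ?thesis by (simp add: D_def a_def)
  qed
  obtain R1 where R1: "\<And>r t. r \<ge> R1 \<Longrightarrow> t \<in> {d..2 * pi - d} \<Longrightarrow> D (pol (r, t)) \<noteq> 0"
    using dirf_compact[OF Dout] by blast
  define hE where "hE t = 2 * actK m * sin (real (l - 1) * u) * cos (rho m * ((t - tau + 2 * pi) - pi))" for t
  define hG where "hG t = 2 * actK m * sin (real (l + 1) * u) * cos (rho m * ((t + tau) - pi))" for t
  define S where "S = 2 * actK m * (sin ((real l - 1) * u) + sin ((real l + 1) * u))"
  \<comment> \<open>For \<open>E\<close> the shifted direction \<open>t - tau\<close> is negative,
    hence the winding \<open>-1\<close>; for \<open>G\<close> it is positive and the winding is 0.
    The two quantities thus lie on opposite sides of the excluded direction.\<close>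
  have gE: "grows m E t (hE t)" if "\<bar>t\<bar> \<le> 2 * d" for t
  proof -
    have "grows m (W 0 (0 + (l - 1) + 1)) (t + a) (hE t)" unfolding hE_def
      using l that d tau_lt by (intro W_grows[of _ _ _ _ "-1"]) (auto simp: a_def algebra_simps)
    from grows_rotate[OF this] show ?thesis using l unfolding E_def by simp
  qed
  have gG: "grows m G t (hG t)" if "\<bar>t\<bar> \<le> 2 * d" for t
  proof -
    have "grows m (W 0 (0 + (l + 1) + 1)) (t + a) (hG t)" unfolding hG_def
      using l that d tau_lt by (intro W_grows[of _ _ _ _ 0]) (auto simp: a_def algebra_simps)
    from grows_rotate[OF this] show ?thesis unfolding G_def by simp
  qed
  have h: "hE t - hG t = - S * sin (rho m * t)" for t
  proof -
    have "rho m * ((t - tau + 2 * pi) - pi) = rho m * t + (rho m * pi - rho m * tau)" by (simp add: algebra_simps)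
    then have c1: "cos (rho m * ((t - tau + 2 * pi) - pi)) = - sin (rho m * t)"
      unfolding rho_tau rho_pi by (simp add: cos_add)
    have "rho m * ((t + tau) - pi) = rho m * t - (rho m * pi - rho m * tau)" by (simp add: algebra_simps)
    then have c2: "cos (rho m * ((t + tau) - pi)) = sin (rho m * t)"
      unfolding rho_tau rho_pi by (simp add: cos_diff)
    have l2: "real (l + 1) = real l + 1" by simp
    show ?thesis unfolding hE_def hG_def c1 c2 S_def l1 l2 by (simp add: algebra_simps)
  qed
  have S: "0 < S"
  proof -
    have "sin ((real l - 1) * u) + sin ((real l + 1) * u) = 2 * sin (real l * u) * cos u"
      by (simp add: left_diff_distrib distrib_right sin_add sin_diff)
    moreover have "0 < real l * u" using l u_pos by simp
    moreover have "real l * u < real m * u" using l u_pos by (intro mult_strict_right_mono) auto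
    then have "real l * u < pi" using m3 by (simp add: u_def)
    ultimately show ?thesis unfolding S_def using actK_pos u_pos by (simp add: sin_gt_zero cos_gt_zero)
  qed
  obtain R2 where R2: "\<And>r s. r \<ge> R2 \<Longrightarrow> 0 < s \<Longrightarrow> s \<le> d \<Longrightarrow>
      norm (E (pol (r, s)) / G (pol (r, s))) < norm (E (pol (r, - s)) / G (pol (r, - s))) \<and> G (pol (r, s)) \<noteq> 0 \<and> G (pol (r, - s)) \<noteq> 0"
    using quotient_modulus_decreasing[OF hol[of 0 l, folded E_def] hol[of 0 "l + 2", folded G_def] gE gG h S d(1) rho_d] by blast
  obtain c1 c2 where c1: "c1 \<noteq> 0" "\<And>z. W (l + 1) (l + 1 + 1) z = c1" and c2: "\<And>z. W l (l + 1) z = c2"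
    using W_adjacent by metis
  have ratio: "E z / G z = - c2 / c1" if "D z = 0" "G z \<noteq> 0" for z
  proof -
    have "l + 1 + 1 = l + 2" by simp
    then have "E z * c1 + G z * c2 = 0"
      using plucker[of 0 l "cis a * z" "l + 1" "l + 2"] that(1) c1(2)[of "cis a * z"] c2[of "cis a * z"]
      by (simp add: E_def G_def D_def a_def)
    then have "E z * c1 = - (G z * c2)" by (simp add: eq_neg_iff_add_eq_0)
    then show ?thesis using that(2) c1(1) by (simp add: field_simps)
  qed
  define R where "R = max 1 (max R1 R2)"
  have large: "Im z = 0 \<and> Re z > 0" if z: "D z = 0" "D (cnj z) = 0" "norm z \<ge> R" for z
  proof -
    define r s where "r = norm z" and "s = Arg z"
    have r: "r > 0" "r \<ge> R1" "r \<ge> R2" using z(3) by (auto simp: R_def r_def)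
    have zp: "z = pol (r, s)"
      unfolding pol_def r_def s_def using Arg_eq[of z] r by (auto simp: r_def cis_conv_exp)
    have zc: "cnj z = pol (r, - s)" unfolding zp pol_def by (simp add: cis_cnj)
    have zq: "z = pol (r, s + 2 * pi)" unfolding zp pol_def by (simp flip: cis_mult)
    have s: "- pi < s" "s \<le> pi" using Arg_bounded[of z] by (auto simp: s_def)
    have "\<bar>s\<bar> < d"
    proof (rule ccontr)
      assume "\<not> \<bar>s\<bar> < d"
      then have "s \<in> {d..2 * pi - d} \<or> s + 2 * pi \<in> {d..2 * pi - d}" using s d by auto
      then show False using R1[OF r(2)] z(1) zp zq by metis
    qed
    have "s = 0"
    proof (rule ccontr)
      assume "s \<noteq> 0"
      define t where "t = \<bar>s\<bar>"
      have t: "0 < t" "t \<le> d" using \<open>s \<noteq> 0\<close> \<open>\<bar>s\<bar> < d\<close> by (auto simp: t_def)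
      have "D (pol (r, t)) = 0" "D (pol (r, - t)) = 0"
        using z(1,2) unfolding zc unfolding zp by (auto simp: t_def abs_if)
      with R2[OF r(3) t] ratio show False by (metis less_irrefl)
    qed
    then show ?thesis using r(1) zp by (simp add: pol_def)
  qed
  have holD: "D holomorphic_on UNIV" using hol[of 0 "l + 1"] by (simp add: D_def a_def)
  \<comment> \<open>A value of \<open>D\<close> outside the wedge is nonzero, so \<open>D\<close>
    does not vanish identically and has finitely many zeros in the disc.\<close>
  have "finite {z \<in> cball 0 R. D z = 0}"
  proof (cases "D constant_on UNIV")
    case True
    then obtain k where k: "\<And>z. D z = k" by (auto simp: constant_on_def)
    have "D (pol (R1, pi)) \<noteq> 0" using d by (intro R1) auto
    then show ?thesis using k by auto
  next
    case False
    then show ?thesis by (intro holomorphic_compact_finite_zeros[OF holD]) auto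
  qed
  moreover have "{z. D z = 0 \<and> D (cnj z) = 0 \<and> \<not> (Im z = 0 \<and> Re z > 0)} \<subseteq> {z \<in> cball 0 R. D z = 0}"
    using large by (auto simp: not_le)  (meson linorder_le_less_linear nle_le)+
  ultimately show ?thesis by (rule rev_finite_subset)
qed

end

section \<open>Eigenvalues\<close>

text \<open>The point \<open>\<i> * (- cnj z)\<close> is the conjugate of \<open>\<i> * z\<close>,
  so conjugating \<open>u\<close> and reflecting at the imaginary axis preserves a potential with
  real coefficients; the two boundary rays are interchanged.\<close>

lemma is_eigenvalue_cnj:
  assumes "is_eigenvalue m l a lam"
  shows "is_eigenvalue m l a (cnj lam)"
proof -
  obtain u where hol: "u holomorphic_on UNIV" and nc: "\<not> (\<exists>c. \<forall>z. u z = c)"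
    and eq: "\<And>z. - deriv (deriv u) z + ((-1) ^ l * (\<i> * z) ^ m - polyP m a (\<i> * z)) * u z = lam * u z"
    and d1: "decays_on_ray u (- pi / 2 + (real l + 1) * pi / (real m + 2))"
    and d2: "decays_on_ray u (- pi / 2 - (real l + 1) * pi / (real m + 2))"
    using assms unfolding is_eigenvalue_def by blast
  define v where "v z = cnj (u (- cnj z))" for z
  have refl: "((\<lambda>z. cnj (f (- cnj z))) has_field_derivative - cnj (deriv f (- cnj z))) (at z)"
    if "f holomorphic_on UNIV" for f z
  proof -
    have "(f has_field_derivative deriv f (- cnj z)) (at (- cnj z))"
      using that by (intro holomorphic_derivI[of _ UNIV]) auto
    then have "((cnj \<circ> f \<circ> cnj) has_field_derivative cnj (deriv f (- cnj z))) (at (- z))"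
      using has_field_derivative_cnj_cnj[of f "deriv f (- cnj z)" "- z"] by simp
    then have "((cnj \<circ> f \<circ> cnj \<circ> uminus) has_field_derivative cnj (deriv f (- cnj z)) * (-1)) (at z)"
      by (intro DERIV_chain) (auto intro!: derivative_eq_intros)
    then show ?thesis by (simp add: o_def)
  qed
  have "deriv v z = - cnj (deriv u (- cnj z))" for z
    unfolding v_def by (rule DERIV_imp_deriv[OF refl[OF hol]])
  then have dv: "deriv v = (\<lambda>z. - cnj (deriv u (- cnj z)))" by blast
  have ddv: "deriv (deriv v) z = cnj (deriv (deriv u) (- cnj z))" for z
    unfolding dv using DERIV_minus[OF refl[of "deriv u" z]] hol
    by (auto intro!: DERIV_imp_deriv holomorphic_deriv)
  have ray: "decays_on_ray v (- pi - t)" if "decays_on_ray u t" for t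
  proof -
    have "- cnj (of_real r * cis (- pi - t)) = of_real r * cis t" for r
      by (simp add: complex_eq_iff cos_diff sin_diff)
    then show ?thesis using that by (simp add: decays_on_ray_def v_def)
  qed
  have "\<not> (\<exists>c. \<forall>z. v z = c)"
  proof
    assume "\<exists>c. \<forall>z. v z = c"
    then obtain c where "\<And>z. v z = c" by blast
    then have "cnj (u z) = c" for z using v_def[of "- cnj z"] by simp
    then have "u z = cnj c" for z by (metis complex_cnj_cnj)
    then show False using nc by blast
  qed
  moreover have "v holomorphic_on UNIV"
    unfolding v_def holomorphic_on_def field_differentiable_def using refl[OF hol] has_field_derivative_at_within by blast
  moreover have "- deriv (deriv v) z + ((-1) ^ l * (\<i> * z) ^ m - polyP m a (\<i> * z)) * v z = cnj lam * v z" for z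
  proof -
    have i: "cnj (\<i> * - cnj z) = \<i> * z" by simp
    have P: "cnj (polyP m a (\<i> * - cnj z)) = polyP m a (\<i> * z)"
      unfolding polyP_def using i by simp
    have "cnj (- deriv (deriv u) (- cnj z) + ((-1) ^ l * (\<i> * - cnj z) ^ m - polyP m a (\<i> * - cnj z)) * u (- cnj z))
        = - deriv (deriv v) z + ((-1) ^ l * (\<i> * z) ^ m - polyP m a (\<i> * z)) * v z"
      unfolding ddv v_def complex_cnj_add complex_cnj_minus complex_cnj_mult[of "_ - _"] complex_cnj_diff P
        complex_cnj_mult[of "_ ^ _"] complex_cnj_power i by simp
    then show ?thesis unfolding eq by (simp add: v_def)
  qed
  moreover have "decays_on_ray v (- pi / 2 - (real l + 1) * pi / (real m + 2))"
    using ray[OF d1] by (simp add: field_simps)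
  moreover have "decays_on_ray v (- pi / 2 + (real l + 1) * pi / (real m + 2))"
    using ray[OF d2] by (simp add: field_simps)
  ultimately show ?thesis unfolding is_eigenvalue_def by blast
qed

text \<open>The leading coefficient is entered as 1 for every \<open>t\<close>. It is the rotated
  one for the angle \<open>t\<close> of the boundary rays, where
  \<open>cis (- 2 * t) * cis (- t) ^ m = - ((-1) ^ l)\<close>.\<close>

definition rotated_potential :: "nat \<Rightarrow> (nat \<Rightarrow> real) \<Rightarrow> real \<Rightarrow> complex poly" where
  "rotated_potential m a t = monom 1 m
     + (\<Sum>i = 1..m-1. monom (cis (- 2 * t) * of_real (a i) * cis (- t) ^ (m - i)) (m - i))"

lemma poly_rotated_potential:
  assumes m: "m \<ge> 1" and t: "t = (real l + 1) * pi / (real m + 2)"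
  shows "poly (rotated_potential m a t) y
    = - (cis (- 2 * t) * ((-1) ^ l * (cis (- t) * y) ^ m - polyP m a (cis (- t) * y)))"
proof -
  have "cis (- 2 * t) * cis (- t) ^ m = cis (- ((real l + 1) * pi))"
  proof -
    have "cis (- 2 * t) * cis (- t) ^ m = cis (- ((real m + 2) * t))"
      by (simp add: Complex.DeMoivre cis_mult algebra_simps)
    also have "(real m + 2) * t = (real l + 1) * pi" unfolding t by simp
    finally show ?thesis .
  qed
  also have "\<dots> = cis (- pi) ^ (l + 1)" by (simp only: Complex.DeMoivre) (simp add: algebra_simps)
  also have "\<dots> = - ((-1) ^ l)" by (simp flip: cis_cnj)
  finally have c: "cis (- 2 * t) * cis (- t) ^ m = - ((-1) ^ l)" .
  have "cis (- 2 * t) * ((-1) ^ l * (cis (- t) * y) ^ m) = (cis (- 2 * t) * cis (- t) ^ m) * (-1) ^ l * y ^ m"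
    by (simp only: power_mult_distrib mult_ac)
  also have "\<dots> = - (y ^ m)" unfolding c by (simp flip: power_mult_distrib)
  finally have 1: "cis (- 2 * t) * ((-1) ^ l * (cis (- t) * y) ^ m) = - (y ^ m)" .
  have "cis (- 2 * t) * polyP m a (cis (- t) * y)
      = (\<Sum>i = 1..m-1. cis (- 2 * t) * of_real (a i) * cis (- t) ^ (m - i) * y ^ (m - i))"
    by (simp add: polyP_def sum_distrib_left power_mult_distrib mult_ac)
  then show ?thesis unfolding right_diff_distrib 1
    by (simp add: rotated_potential_def poly_monom poly_sum)
qed

lemma osc_rotated_potential:
  assumes "m \<ge> 3"
  shows "osc (rotated_potential m a t) m"
proof
  have d: "degree (\<Sum>i = 1..m-1. monom (cis (- 2 * t) * of_real (a i) * cis (- t) ^ (m - i)) (m - i)) < m" (is "degree ?q < m")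
    using assms by (intro degree_sum_less) (auto intro: le_less_trans[OF degree_monom_le])
  show "degree (rotated_potential m a t) = m"
    unfolding rotated_potential_def using d by (subst degree_add_eq_left) (auto simp: degree_monom_eq)
  then show "lead_coeff (rotated_potential m a t) = 1"
    using coeff_eq_0[OF d] by (simp add: rotated_potential_def)
  show "poly (rotated_potential m a t) 0 = 0"
    using assms unfolding rotated_potential_def poly_add poly_sum
    by (subst sum.neutral) (auto simp: poly_monom power_0_left)
qed fact

text \<open>Rotating \<open>z = cis (- pi/2 - t) * y\<close> takes the two boundary rays to the positive axis and to the ray through \<open>om (l + 1)\<close>.\<close>
lemma W_eq_0_if_eigenvalue:
  assumes m: "m \<ge> 3" and ev: "is_eigenvalue m l a lam"
  defines "t \<equiv> (real l + 1) * pi / (real m + 2)"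
  shows "osc.W (rotated_potential m a t) m 0 (l + 1) (cis (- (real l + 1) * osc.tau m) * lam) = 0"
proof -
  interpret osc "rotated_potential m a t" m by (rule osc_rotated_potential[OF m])
  have tt: "(real l + 1) * tau = 2 * t" by (simp add: tau_def t_def)
  obtain u where hol: "u holomorphic_on UNIV" and nc: "\<not> (\<exists>c. \<forall>z. u z = c)"
    and eq: "\<And>z. - deriv (deriv u) z + ((-1) ^ l * (\<i> * z) ^ m - polyP m a (\<i> * z)) * u z = lam * u z"
    and d1: "decays_on_ray u (- pi / 2 + t)" and d2: "decays_on_ray u (- pi / 2 - t)"
    using ev unfolding is_eigenvalue_def t_def by blast
  define c where "c = cis (- pi / 2 - t)"
  have ic: "\<i> * c = cis (- t)" by (simp add: c_def complex_eq_iff cos_diff sin_diff)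
  have "c * c = - cis (- 2 * t)"
  proof -
    have "- cis (- 2 * t) = (\<i> * c) * (\<i> * c) * (-1)" unfolding ic by (simp add: cis_mult)
    then show ?thesis by (simp add: algebra_simps)
  qed
  then have cc: "c * c = - cis (- 2 * t)" .
  have D: "(f has_field_derivative deriv f z) (at z)" if "f holomorphic_on UNIV" for f z
    using that by (intro holomorphic_derivI[of _ UNIV]) auto
  have chain: "((\<lambda>y. f (c * y)) has_field_derivative c * deriv f (c * y)) (at y)" if "f holomorphic_on UNIV" for f y
  proof -
    have "((\<lambda>y. c * y) has_field_derivative c) (at y)" by (auto intro!: derivative_eq_intros)
    from DERIV_chain2[where f = f and g = "\<lambda>y. c * y", OF D[OF that] this]
    show ?thesis by (simp only: mult.commute[of "deriv f (c * y)"])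
  qed
  have ode: "ode (rotated_potential m a t) (cis (- (real l + 1) * tau) * lam) (\<lambda>y. u (c * y)) (\<lambda>y. c * deriv u (c * y))"
    unfolding ode_def
  proof (intro allI conjI)
    fix y
    show "((\<lambda>y. u (c * y)) has_field_derivative c * deriv u (c * y)) (at y)" by (rule chain[OF hol])
    have "deriv u holomorphic_on UNIV" using hol by (intro holomorphic_deriv) auto
    from DERIV_cmult[OF chain[OF this], of c y]
    have "((\<lambda>y. c * deriv u (c * y)) has_field_derivative (c * c) * deriv (deriv u) (c * y)) (at y)"
      by (simp add: mult.assoc)
    moreover have "(c * c) * deriv (deriv u) (c * y)
        = (poly (rotated_potential m a t) y + cis (- (real l + 1) * tau) * lam) * u (c * y)"
    proof -
      have "deriv (deriv u) (c * y) = ((-1) ^ l * (cis (- t) * y) ^ m - polyP m a (cis (- t) * y)) * u (c * y) - lam * u (c * y)"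
        using eq[of "c * y"] unfolding ic[symmetric] mult.assoc by (metis add_diff_cancel_right' minus_add_cancel uminus_add_conv_diff add.commute)
      moreover have "- (real l + 1) * tau = - 2 * t" by (simp only: mult_minus_left tt)
      moreover have "m \<ge> 1" using m by simp
      ultimately show ?thesis
        by (simp only: cc poly_rotated_potential[OF _ t_def[unfolded atomize_eq]]) (simp add: algebra_simps)
    qed
    ultimately show "((\<lambda>y. c * deriv u (c * y)) has_field_derivative
        (poly (rotated_potential m a t) y + cis (- (real l + 1) * tau) * lam) * u (c * y)) (at y)" by simp
  qed
  obtain z where z: "u z \<noteq> 0" using nc by blast
  have "c \<noteq> 0" by (simp add: c_def)
  then have nz: "u (c * (z / c)) \<noteq> 0" using z by simp
  have "c * om (l + 1) = cis (- pi / 2 + t)"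
    using tt by (simp add: c_def om_def cis_mult algebra_simps)
  then have r: "c * (of_real r * om 0) = of_real r * cis (- pi / 2 - t)" "c * (of_real r * om (l + 1)) = of_real r * cis (- pi / 2 + t)" for r
    by (simp_all add: c_def mult_ac)
  obtain k1 C1 k2 C2 where k: "k1 > 0" "k2 > 0"
    "\<And>r. r \<ge> 0 \<Longrightarrow> norm (u (of_real r * cis (- pi / 2 - t))) \<le> C1 * exp (- k1 * r)"
    "\<And>r. r \<ge> 0 \<Longrightarrow> norm (u (of_real r * cis (- pi / 2 + t))) \<le> C2 * exp (- k2 * r)"
    using d1 d2 unfolding decays_on_ray_def by blast
  show ?thesis
    by (rule W_eq_0[OF ode nz k(1,2), of _ C1 _ C2]) (simp_all only: r k(3,4))
qed

text \<open>For real \<open>a\<close> all factors in the formula other than \<open>\<i>\<close> are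
  real, the signs included, in each of its cases.\<close>

lemma d_coef_eq_i_times_real: "\<exists>x. d_coef m l a j = \<i> * complex_of_real x"
proof -
  have "(-1 :: complex) ^ n = of_real ((-1) ^ n)" for n by simp
  then have "d_coef m l a j = \<i> * complex_of_real (if 1 \<le> j \<and> 2 * j \<le> m + 1 then
       - 4 * (\<Sum>k=1..j. (-1) ^ ((l + 1) * k) * K_coef m j k * b_coef m a j k
             * sin ((real j - 1) * real l * pi / real m) * cos ((real j - 1) * pi / real m))
     else if even m \<and> 2 * j = m + 2 \<and> odd l then
       (-1) ^ ((l - 1) div 2) * (4 * pi / real m) * (\<Sum>k=1..(m+2) div 2. b_coef m a ((m+2) div 2) k)
     else 0)"
    unfolding d_coef_def eta_def by simp
  then show ?thesis by blast
qed

theorem theorem8: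
  fixes m l :: nat and a :: "nat \<Rightarrow> real"
  assumes "m \<ge> 3" and "1 \<le> l" and "l \<le> m - 1"
  shows "finite {z. is_eigenvalue m l a z \<and> \<not> (Im z = 0 \<and> Re z > 0)}
         \<and> (\<forall>j. 1 \<le> j \<and> 2 * j \<le> m + 2 \<longrightarrow> Re (d_coef m l a j) = 0)"
proof
  define t where "t = (real l + 1) * pi / (real m + 2)"
  interpret osc "rotated_potential m a t" m by (rule osc_rotated_potential[OF assms(1)])
  have "l + 1 \<le> m" using assms by simp
  note fin = conj_zeros_real[OF assms(2) this]
  note zero = W_eq_0_if_eigenvalue[OF assms(1), of l a, folded t_def]
  \<comment> \<open>An eigenvalue and its conjugate are both zeros of the rotated Wronskian, so the
    exceptional eigenvalues lie in the finite set \<open>fin\<close>.\<close>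
  show "finite {z. is_eigenvalue m l a z \<and> \<not> (Im z = 0 \<and> Re z > 0)}"
    by (rule finite_subset[OF _ fin]) (use zero is_eigenvalue_cnj zero[OF is_eigenvalue_cnj] in blast)
  show "\<forall>j. 1 \<le> j \<and> 2 * j \<le> m + 2 \<longrightarrow> Re (d_coef m l a j) = 0"
  proof (intro allI impI)
    fix j
    obtain x where "d_coef m l a j = \<i> * complex_of_real x" using d_coef_eq_i_times_real by blast
    then show "Re (d_coef m l a j) = 0" by simp
  qed
qed

end
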